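(* Let $X=X(\Delta)$ be a complete complex toric variety associated to a fan $\Delta$ and let $R$ be a commutative ring. The augmented complex of sheaves $$\check{\mathcal C}_*(\Delta,R_X)\to R_X$$ is exact; that is, $\check{\mathcal C}_*(\Delta,R_X)$ is a resolution of the constant sheaf $R_X$.
   Context: Toric notation. $N\cong\mathbb Z^n$, $M=\mathrm{Hom}(N,\mathbb Z)$, $N_{\mathbb R}=N\otimes\mathbb R$, $M_{\mathbb R}=M\otimes\mathbb R$, with pairing $\langle\cdot,\cdot\rangle$. A rational polyhedral cone $\sigma\subset N_{\mathbb R}$ is the set of nonnegative real combinations of finitely many vectors of $N$; it is strictly convex if it contains no linear subspace of positive dimension; $\dim\sigma=\dim\mathbb R\sigma$. $\sigma^\vee=\{v\in M_{\mathbb R}:\langle u,v\rangle\ge0\ \forall u\in\sigma\}$. A face of $\sigma$ is a set $\tau=\sigma\cap u^\perp$ with $u\in\sigma^\vee$; write $\tau\le\sigma$. A fan $\Delta$ in $N$ is a finite set of strictly convex rational polyhedral cones, closed under taking faces, in which any two cones intersect in a common face; it is complete if its cones cover $N_{\mathbb R}$. $\Delta^{(k)}$ is the set of cones of codimension $k$ (dimension $n-k$). $X_\sigma=\mathrm{Spec}\,\mathbb C[\sigma^\vee\cap M]$; $X(\Delta)$ is glued from the $X_\sigma$ along the open embeddings $X_\tau\subset X_\sigma$ for $\tau\le\sigma$; $i_\sigma:X_\sigma\to X(\Delta)$ is the open inclusion. The toric variety is complete when the fan is complete. Orientations. An orientation of each vector space $\mathbb R\sigma$, $\sigma\in\Delta$,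 is fixed. If $\tau\le\sigma$ has codimension 1 in $\sigma$, choose $u\in\sigma\setminus\tau$, so $\mathbb R\sigma=\mathbb Ru\oplus\mathbb R\tau$; the orientation induced by $\sigma$ on $\tau$ is the one such that $u$ followed by an oriented basis of $\mathbb R\tau$ is an oriented basis of $\mathbb R\sigma$. $\epsilon(\tau,\sigma)=+1$ if it agrees with the fixed orientation of $\tau$, and $-1$ otherwise. The complex. For $k\ge0$, $\check{\mathcal C}_k(\Delta,R_X)=\bigoplus_{\sigma\in\Delta^{(k)}}i_{\sigma!}i_\sigma^*R_X$, where $R_X$ is the constant sheaf on $X(\Delta)$ (Zariski topology); the differential $d_k:\check{\mathcal C}_k(\Delta,R_X)\to\check{\mathcal C}_{k-1}(\Delta,R_X)$ is $\sum\epsilon(\tau,\sigma)\iota_{\tau,\sigma}$ over pairs $\tau\in\Delta^{(k)}$, $\sigma\in\Delta^{(k-1)}$, $\tau\le\sigma$, where $\iota_{\tau,\sigma}:i_{\tau!}i_\tau^*R_X\to i_{\sigma!}i_\sigma^*R_X$ is the natural inclusion inducing the identity on nonzero stalks. The augmentation $\check{\mathcal C}_0(\Delta,R_X)\to R_X$ is induced by the natural morphisms $i_{\sigma!}i_\sigma^*R_X\to R_X$, $\sigma\in\Delta^{(0)}$. *)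

theory Defs
  imports
    "HOL-Analysis.Abstract_Topology"
    "HOL-Library.Poly_Mapping"
    "HOL-Library.Function_Algebras"
    "HOL-Algebra.Ideal"
    "HOL-Algebra.Module"
    "Jordan_Normal_Form.Determinant"
begin

section \<open>Lattices, cones and fans\<close>

text \<open>
  The type \<open>'v\<close> plays the role of the real vector space $N_{\mathbf R}$, and the lattice \<open>N\<close> is a
  subset of it: the integral span of a finite real basis.  The real vector space $M_{\mathbf R}$ is
  the set of linear forms on \<open>'v\<close>, and the pairing is evaluation.  The rank 0 is not excluded.
\<close>

definition full_rank_lattice :: "'v::real_vector set \<Rightarrow> bool" where
  "full_rank_lattice N \<longleftrightarrow>
     (\<exists>B. finite B \<and> independent B \<and> span B = UNIV \<and>
          N = {\<Sum>b\<in>B. of_int (c b) *\<^sub>R b | c :: 'v \<Rightarrow> int. True})"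

definition dual_space :: "('v::real_vector \<Rightarrow> real) set" where
  "dual_space = {u. linear u}"

definition dual_lattice :: "'v::real_vector set \<Rightarrow> ('v \<Rightarrow> real) set" where
  "dual_lattice N = {u \<in> dual_space. \<forall>v\<in>N. u v \<in> \<int>}"

definition rational_polyhedral_cone :: "'v::real_vector set \<Rightarrow> 'v set \<Rightarrow> bool" where
  "rational_polyhedral_cone N \<sigma> \<longleftrightarrow>
     (\<exists>S. finite S \<and> S \<subseteq> N \<and> \<sigma> = {\<Sum>v\<in>S. c v *\<^sub>R v | c. \<forall>v\<in>S. 0 \<le> c v})"

definition strictly_convex :: "'v::real_vector set \<Rightarrow> bool" where
  "strictly_convex \<sigma> \<longleftrightarrow> \<not> (\<exists>L. subspace L \<and> L \<noteq> {0} \<and> L \<subseteq> \<sigma>)"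

definition dual_cone :: "'v::real_vector set \<Rightarrow> ('v \<Rightarrow> real) set" where
  "dual_cone \<sigma> = {u \<in> dual_space. \<forall>v\<in>\<sigma>. 0 \<le> u v}"

definition cone_face :: "'v::real_vector set \<Rightarrow> 'v set \<Rightarrow> bool" where
  "cone_face \<tau> \<sigma> \<longleftrightarrow> (\<exists>u \<in> dual_cone \<sigma>. \<tau> = {v \<in> \<sigma>. u v = 0})"

definition fan :: "'v::real_vector set \<Rightarrow> 'v set set \<Rightarrow> bool" where
  "fan N \<Delta> \<longleftrightarrow>
     finite \<Delta> \<and>
     (\<forall>\<sigma>\<in>\<Delta>. rational_polyhedral_cone N \<sigma> \<and> strictly_convex \<sigma>) \<and>
     (\<forall>\<sigma>\<in>\<Delta>. \<forall>\<tau>. cone_face \<tau> \<sigma> \<longrightarrow> \<tau> \<in> \<Delta>) \<and>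
     (\<forall>\<sigma>\<in>\<Delta>. \<forall>\<sigma>'\<in>\<Delta>. cone_face (\<sigma> \<inter> \<sigma>') \<sigma> \<and> cone_face (\<sigma> \<inter> \<sigma>') \<sigma>')"

definition complete_fan :: "'v::real_vector set \<Rightarrow> 'v set set \<Rightarrow> bool" where
  "complete_fan N \<Delta> \<longleftrightarrow> fan N \<Delta> \<and> \<Union>\<Delta> = UNIV"

definition cones_codim :: "'v::real_vector set set \<Rightarrow> nat \<Rightarrow> 'v set set" where
  "cones_codim \<Delta> k = {\<sigma> \<in> \<Delta>. dim (span \<sigma>) + k = dim (UNIV :: 'v set)}"


section \<open>The toric variety of a fan, with its Zariski topology\<close>

definition spec :: "('a, 'm) ring_scheme \<Rightarrow> 'a set set" where
  "spec A = {P. primeideal P A}"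

definition zariski :: "('a, 'm) ring_scheme \<Rightarrow> 'a set topology" where
  "zariski A = topology (\<lambda>U. \<exists>S \<subseteq> carrier A. U = {P \<in> spec A. \<not> S \<subseteq> P})"

lemma istopology_zariski:
  "istopology (\<lambda>U. \<exists>S \<subseteq> carrier A. U = {P \<in> spec A. \<not> S \<subseteq> P})"
proof -
  have inter: "\<exists>T' \<subseteq> carrier A. {P \<in> spec A. \<not> S \<subseteq> P} \<inter> {P \<in> spec A. \<not> T \<subseteq> P} = {P \<in> spec A. \<not> T' \<subseteq> P}"
    if S: "S \<subseteq> carrier A" and T: "T \<subseteq> carrier A" for S T
  proof (cases "spec A = {}")
    case True
    then show ?thesis by auto
  next
    case False
    then obtain P0 where "primeideal P0 A" by (auto simp: spec_def)
    then interpret cring A by (rule primeideal.axioms)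
    let ?T' = "{s \<otimes>\<^bsub>A\<^esub> t | s t. s \<in> S \<and> t \<in> T}"
    have "(\<not> S \<subseteq> P \<and> \<not> T \<subseteq> P) = (\<not> ?T' \<subseteq> P)" if "primeideal P A" for P
    proof -
      interpret P: primeideal P A by fact
      show ?thesis
      proof
        assume "\<not> S \<subseteq> P \<and> \<not> T \<subseteq> P"
        then obtain s t where "s \<in> S" "s \<notin> P" "t \<in> T" "t \<notin> P" by blast
        moreover from this have "s \<otimes>\<^bsub>A\<^esub> t \<notin> P" using S T P.I_prime by (meson subsetD)
        ultimately show "\<not> ?T' \<subseteq> P" by blast
      next
        assume "\<not> ?T' \<subseteq> P"
        then obtain s t where "s \<in> S" "t \<in> T" "s \<otimes>\<^bsub>A\<^esub> t \<notin> P" by blast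
        moreover from this have "s \<notin> P" "t \<notin> P"
          using S T P.I_l_closed P.I_r_closed by (meson subsetD)+
        ultimately show "\<not> S \<subseteq> P \<and> \<not> T \<subseteq> P" by blast
      qed
    qed
    then have "{P \<in> spec A. \<not> S \<subseteq> P} \<inter> {P \<in> spec A. \<not> T \<subseteq> P} = {P \<in> spec A. \<not> ?T' \<subseteq> P}"
      unfolding spec_def by blast
    moreover have "?T' \<subseteq> carrier A"
      using S T by auto
    ultimately show ?thesis by blast
  qed
  have union: "\<exists>T \<subseteq> carrier A. \<Union>\<K> = {P \<in> spec A. \<not> T \<subseteq> P}"
    if "\<forall>K\<in>\<K>. \<exists>S \<subseteq> carrier A. K = {P \<in> spec A. \<not> S \<subseteq> P}" for \<K>
  proof -
    from that obtain S where
      S: "\<forall>K\<in>\<K>. S K \<subseteq> carrier A \<and> K = {P \<in> spec A. \<not> S K \<subseteq> P}"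
      unfolding bchoice_iff by blast
    have "(\<Union>K\<in>\<K>. K) = (\<Union>K\<in>\<K>. {P \<in> spec A. \<not> S K \<subseteq> P})"
      using S by (intro SUP_cong refl) blast
    then have "\<Union>\<K> = (\<Union>K\<in>\<K>. {P \<in> spec A. \<not> S K \<subseteq> P})"
      by simp
    also have "\<dots> = {P \<in> spec A. \<not> (\<Union>K\<in>\<K>. S K) \<subseteq> P}"
      by blast
    finally have "\<Union>\<K> = {P \<in> spec A. \<not> (\<Union>K\<in>\<K>. S K) \<subseteq> P}" .
    moreover have "(\<Union>K\<in>\<K>. S K) \<subseteq> carrier A"
      by (rule UN_least) (use S in blast)
    ultimately show ?thesis by blast
  qed
  show ?thesis
    unfolding istopology_def
  proof (intro conjI allI impI)
    fix U V
    assume "\<exists>S \<subseteq> carrier A. U = {P \<in> spec A. \<not> S \<subseteq> P}" "\<exists>S \<subseteq> carrier A. V = {P \<in> spec A. \<not> S \<subseteq> P}"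
    then show "\<exists>S \<subseteq> carrier A. U \<inter> V = {P \<in> spec A. \<not> S \<subseteq> P}"
      by (elim exE conjE, hypsubst, intro inter)
  qed (rule union)
qed

lemma openin_zariski:
  "openin (zariski A) U \<longleftrightarrow> (\<exists>S \<subseteq> carrier A. U = {P \<in> spec A. \<not> S \<subseteq> P})"
  unfolding zariski_def by (simp add: topology_inverse'[OF istopology_zariski])

text \<open>
  An element of the type \<^typ>\<open>('v \<Rightarrow> real) \<Rightarrow>\<^sub>0 complex\<close> is a finite formal sum of characters, with the
  convolution product.  The affine coordinate ring of a cone consists of those sums whose
  exponents lie in the semigroup cut out by the dual cone.
\<close>

definition cone_ring :: "'v::real_vector set \<Rightarrow> 'v set \<Rightarrow> (('v \<Rightarrow> real) \<Rightarrow>\<^sub>0 complex) ring" where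
  "cone_ring N \<sigma> =
     \<lparr>carrier = {f. Poly_Mapping.keys f \<subseteq> dual_cone \<sigma> \<inter> dual_lattice N},
      monoid.mult = (*), one = 1, zero = 0, add = (+)\<rparr>"

lemma cring_cone_ring: "cring (cone_ring N \<sigma>)"
proof -
  let ?E = "dual_cone \<sigma> \<inter> dual_lattice N"
  have E0: "0 \<in> ?E"
    by (auto simp: dual_cone_def dual_lattice_def dual_space_def zero_fun_def
        intro: linearI)
  have Eadd: "u + w \<in> ?E" if "u \<in> ?E" "w \<in> ?E" for u w
    using that by (auto simp: dual_cone_def dual_lattice_def dual_space_def plus_fun_def
        intro: linear_compose_add)
  have add: "Poly_Mapping.keys (f + g) \<subseteq> ?E"
    if "Poly_Mapping.keys f \<subseteq> ?E" "Poly_Mapping.keys g \<subseteq> ?E" for f g :: "('a \<Rightarrow> real) \<Rightarrow>\<^sub>0 complex"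
    using that Poly_Mapping.keys_add[of f g] by blast
  have mult: "Poly_Mapping.keys (f * g) \<subseteq> ?E"
    if "Poly_Mapping.keys f \<subseteq> ?E" "Poly_Mapping.keys g \<subseteq> ?E" for f g :: "('a \<Rightarrow> real) \<Rightarrow>\<^sub>0 complex"
    using that keys_mult[of f g] Eadd by blast
  show ?thesis
  proof (rule cringI)
    show "abelian_group (cone_ring N \<sigma>)"
    proof (rule abelian_groupI)
      fix f assume "f \<in> carrier (cone_ring N \<sigma>)"
      then show "\<exists>g\<in>carrier (cone_ring N \<sigma>). g \<oplus>\<^bsub>cone_ring N \<sigma>\<^esub> f = \<zero>\<^bsub>cone_ring N \<sigma>\<^esub>"
        by (intro bexI[of _ "- f"]) (auto simp: cone_ring_def)
    qed (use add in \<open>auto simp: cone_ring_def add_ac\<close>)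
    show "comm_monoid (cone_ring N \<sigma>)"
      using mult E0 by (intro comm_monoidI) (auto simp: cone_ring_def mult_ac)
  qed (auto simp: cone_ring_def distrib_right)
qed

type_synonym 'v chart_point = "'v set \<times> (('v \<Rightarrow> real) \<Rightarrow>\<^sub>0 complex) set"

definition toric_charts :: "'v::real_vector set \<Rightarrow> 'v set set \<Rightarrow> 'v chart_point set" where
  "toric_charts N \<Delta> = (SIGMA \<sigma>:\<Delta>. spec (cone_ring N \<sigma>))"

text \<open>
  For a face \<open>\<tau>\<close> of \<open>\<sigma>\<close> the ring of \<open>\<sigma>\<close> is contained in that of \<open>\<tau>\<close>, and the induced map on spectra
  contracts a prime ideal of the larger ring.
\<close>

definition toric_glue :: "'v::real_vector set \<Rightarrow> 'v set set \<Rightarrow> 'v chart_point rel" where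
  "toric_glue N \<Delta> =
     {((\<tau>, P), (\<sigma>, P \<inter> carrier (cone_ring N \<sigma>))) | \<tau> \<sigma> P.
        \<tau> \<in> \<Delta> \<and> \<sigma> \<in> \<Delta> \<and> cone_face \<tau> \<sigma> \<and> P \<in> spec (cone_ring N \<tau>)}"

definition toric_equiv :: "'v::real_vector set \<Rightarrow> 'v set set \<Rightarrow> 'v chart_point rel" where
  "toric_equiv N \<Delta> = (toric_glue N \<Delta> \<union> (toric_glue N \<Delta>)\<inverse>)\<^sup>*"

definition toric_points :: "'v::real_vector set \<Rightarrow> 'v set set \<Rightarrow> 'v chart_point set set" where
  "toric_points N \<Delta> = toric_charts N \<Delta> // toric_equiv N \<Delta>"

definition chart_map ::
  "'v::real_vector set \<Rightarrow> 'v set set \<Rightarrow> 'v set \<Rightarrow> (('v \<Rightarrow> real) \<Rightarrow>\<^sub>0 complex) set \<Rightarrow> 'v chart_point set"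
  where "chart_map N \<Delta> \<sigma> P = toric_equiv N \<Delta> `` {(\<sigma>, P)}"

definition toric_variety ::
  "'v::real_vector set \<Rightarrow> 'v set set \<Rightarrow> 'v chart_point set topology" where
  "toric_variety N \<Delta> = topology (\<lambda>U. U \<subseteq> toric_points N \<Delta> \<and>
     (\<forall>\<sigma>\<in>\<Delta>. openin (zariski (cone_ring N \<sigma>))
                {P \<in> spec (cone_ring N \<sigma>). chart_map N \<Delta> \<sigma> P \<in> U}))"

lemma istopology_toric_variety:
  "istopology (\<lambda>U. U \<subseteq> toric_points N \<Delta> \<and>
     (\<forall>\<sigma>\<in>\<Delta>. openin (zariski (cone_ring N \<sigma>))
                {P \<in> spec (cone_ring N \<sigma>). chart_map N \<Delta> \<sigma> P \<in> U}))"
  (is "istopology (\<lambda>U. _ U \<and> (\<forall>\<sigma>\<in>\<Delta>. openin (?Z \<sigma>) (?pre \<sigma> U)))")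
  unfolding istopology_def
proof (intro conjI allI impI ballI)
  fix S T \<sigma>
  assume "S \<subseteq> toric_points N \<Delta> \<and> (\<forall>\<sigma>\<in>\<Delta>. openin (?Z \<sigma>) (?pre \<sigma> S))"
    and "T \<subseteq> toric_points N \<Delta> \<and> (\<forall>\<sigma>\<in>\<Delta>. openin (?Z \<sigma>) (?pre \<sigma> T))" and "\<sigma> \<in> \<Delta>"
  then have "openin (?Z \<sigma>) (?pre \<sigma> S \<inter> ?pre \<sigma> T)"
    by (intro openin_Int) simp_all
  also have "?pre \<sigma> S \<inter> ?pre \<sigma> T = ?pre \<sigma> (S \<inter> T)"
    by auto
  finally show "openin (?Z \<sigma>) (?pre \<sigma> (S \<inter> T))" .
next
  fix \<K> \<sigma>
  assume "\<forall>K\<in>\<K>. K \<subseteq> toric_points N \<Delta> \<and> (\<forall>\<sigma>\<in>\<Delta>. openin (?Z \<sigma>) (?pre \<sigma> K))" and "\<sigma> \<in> \<Delta>"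
  then have "openin (?Z \<sigma>) (\<Union>K\<in>\<K>. ?pre \<sigma> K)"
    by (intro openin_Union) auto
  also have "(\<Union>K\<in>\<K>. ?pre \<sigma> K) = ?pre \<sigma> (\<Union>\<K>)"
    by auto
  finally show "openin (?Z \<sigma>) (?pre \<sigma> (\<Union>\<K>))" .
qed auto

lemma openin_toric_variety:
  "openin (toric_variety N \<Delta>) U \<longleftrightarrow> U \<subseteq> toric_points N \<Delta> \<and>
     (\<forall>\<sigma>\<in>\<Delta>. openin (zariski (cone_ring N \<sigma>))
                {P \<in> spec (cone_ring N \<sigma>). chart_map N \<Delta> \<sigma> P \<in> U})"
  unfolding toric_variety_def by (simp add: topology_inverse'[OF istopology_toric_variety])

definition chart :: "'v::real_vector set \<Rightarrow> 'v set set \<Rightarrow> 'v set \<Rightarrow> 'v chart_point set set" where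
  "chart N \<Delta> \<sigma> = chart_map N \<Delta> \<sigma> ` spec (cone_ring N \<sigma>)"


section \<open>Sheaves of modules over a commutative ring\<close>

record ('p, 'r, 's) module_sheaf =
  base :: "'p topology"
  sect :: "'p set \<Rightarrow> ('r, 's) module"
  res :: "'p set \<Rightarrow> 'p set \<Rightarrow> 's \<Rightarrow> 's"

definition linear_maps ::
  "('r, 'm) ring_scheme \<Rightarrow> ('r, 's) module \<Rightarrow> ('r, 't) module \<Rightarrow> ('s \<Rightarrow> 't) set" where
  "linear_maps R A B =
     {f \<in> carrier A \<rightarrow> carrier B.
        (\<forall>x\<in>carrier A. \<forall>y\<in>carrier A. f (x \<oplus>\<^bsub>A\<^esub> y) = f x \<oplus>\<^bsub>B\<^esub> f y) \<and>
        (\<forall>a\<in>carrier R. \<forall>x\<in>carrier A. f (a \<odot>\<^bsub>A\<^esub> x) = a \<odot>\<^bsub>B\<^esub> f x)}"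

text \<open>The gluing axiom includes the empty cover, so there is only one section over the empty set.\<close>

definition sheaf :: "('r, 'm) ring_scheme \<Rightarrow> ('p, 'r, 's) module_sheaf \<Rightarrow> bool" where
  "sheaf R F \<longleftrightarrow>
     (\<forall>U. openin (base F) U \<longrightarrow> module R (sect F U)) \<and>
     (\<forall>U V. openin (base F) U \<and> openin (base F) V \<and> V \<subseteq> U \<longrightarrow>
        res F U V \<in> linear_maps R (sect F U) (sect F V)) \<and>
     (\<forall>U. openin (base F) U \<longrightarrow> (\<forall>s\<in>carrier (sect F U). res F U U s = s)) \<and>
     (\<forall>U V W. openin (base F) U \<and> openin (base F) V \<and> openin (base F) W \<and> W \<subseteq> V \<and> V \<subseteq> U \<longrightarrow>
        (\<forall>s\<in>carrier (sect F U). res F V W (res F U V s) = res F U W s)) \<and>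
     (\<forall>\<U> s. (\<forall>U\<in>\<U>. openin (base F) U \<and> s U \<in> carrier (sect F U)) \<and>
        (\<forall>U\<in>\<U>. \<forall>V\<in>\<U>. res F U (U \<inter> V) (s U) = res F V (U \<inter> V) (s V)) \<longrightarrow>
        (\<exists>!t. t \<in> carrier (sect F (\<Union>\<U>)) \<and> (\<forall>U\<in>\<U>. res F (\<Union>\<U>) U t = s U)))"

definition sheaf_morphism ::
  "('r, 'm) ring_scheme \<Rightarrow> ('p, 'r, 's) module_sheaf \<Rightarrow> ('p, 'r, 't) module_sheaf
    \<Rightarrow> ('p set \<Rightarrow> 's \<Rightarrow> 't) \<Rightarrow> bool" where
  "sheaf_morphism R F G \<phi> \<longleftrightarrow>
     base F = base G \<and>
     (\<forall>U. openin (base F) U \<longrightarrow> \<phi> U \<in> linear_maps R (sect F U) (sect G U)) \<and>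
     (\<forall>U V. openin (base F) U \<and> openin (base F) V \<and> V \<subseteq> U \<longrightarrow>
        (\<forall>s\<in>carrier (sect F U). \<phi> V (res F U V s) = res G U V (\<phi> U s)))"

definition kernel_sections ::
  "('p, 'r, 's) module_sheaf \<Rightarrow> ('p, 'r, 't) module_sheaf \<Rightarrow> ('p set \<Rightarrow> 's \<Rightarrow> 't) \<Rightarrow> 'p set \<Rightarrow> 's set"
  where "kernel_sections F G \<phi> U = {s \<in> carrier (sect F U). \<phi> U s = \<zero>\<^bsub>sect G U\<^esub>}"

text \<open>The image as a subsheaf (not subpresheaf): sections that lift locally.\<close>

definition image_sections ::
  "('p, 'r, 's) module_sheaf \<Rightarrow> ('p, 'r, 't) module_sheaf \<Rightarrow> ('p set \<Rightarrow> 's \<Rightarrow> 't) \<Rightarrow> 'p set \<Rightarrow> 't set"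
  where
  "image_sections F G \<phi> U = {t \<in> carrier (sect G U). \<forall>x\<in>U. \<exists>V. openin (base G) V \<and> x \<in> V \<and> V \<subseteq> U \<and>
     res G U V t \<in> \<phi> V ` carrier (sect F V)}"

text \<open>
  \<open>sheaf_resolution R C d G \<eta>\<close>: the sequence
  $\cdots \to C_2 \to C_1 \to C_0 \to G \to 0$ with maps $d_k : C_k \to C_{k-1}$ for $k \ge 1$ and
  $\eta : C_0 \to G$ is an exact sequence of sheaves of modules (the map \<open>d 0\<close> is not used).
\<close>

definition sheaf_resolution ::
  "('r, 'm) ring_scheme \<Rightarrow> (nat \<Rightarrow> ('p, 'r, 's) module_sheaf) \<Rightarrow> (nat \<Rightarrow> 'p set \<Rightarrow> 's \<Rightarrow> 's)
    \<Rightarrow> ('p, 'r, 't) module_sheaf \<Rightarrow> ('p set \<Rightarrow> 's \<Rightarrow> 't) \<Rightarrow> bool" where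
  "sheaf_resolution R C d G \<eta> \<longleftrightarrow>
     sheaf R G \<and> (\<forall>k. sheaf R (C k)) \<and>
     sheaf_morphism R (C 0) G \<eta> \<and>
     (\<forall>k\<ge>1. sheaf_morphism R (C k) (C (k - 1)) (d k)) \<and>
     (\<forall>U. openin (base G) U \<longrightarrow>
        image_sections (C 0) G \<eta> U = carrier (sect G U) \<and>
        image_sections (C 1) (C 0) (d 1) U = kernel_sections (C 0) G \<eta> U \<and>
        (\<forall>k\<ge>1. image_sections (C (k + 1)) (C k) (d (k + 1)) U
                 = kernel_sections (C k) (C (k - 1)) (d k) U))"

text \<open>Sections of the constant sheaf are the locally constant functions.\<close>

definition constant_sheaf ::
  "'p topology \<Rightarrow> ('r, 'm) ring_scheme \<Rightarrow> ('p, 'r, 'p \<Rightarrow> 'r) module_sheaf" where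
  "constant_sheaf X R =
     \<lparr>base = X,
      sect = (\<lambda>U. \<lparr>carrier = {s \<in> extensional U.
                      continuous_map (subtopology X U) (discrete_topology (carrier R)) s},
                    monoid.mult = (\<lambda>s t. \<lambda>x\<in>U. s x \<otimes>\<^bsub>R\<^esub> t x), one = (\<lambda>x\<in>U. \<one>\<^bsub>R\<^esub>),
                    zero = (\<lambda>x\<in>U. \<zero>\<^bsub>R\<^esub>), add = (\<lambda>s t. \<lambda>x\<in>U. s x \<oplus>\<^bsub>R\<^esub> t x),
                    module.smult = (\<lambda>a s. \<lambda>x\<in>U. a \<otimes>\<^bsub>R\<^esub> s x)\<rparr>),
      res = (\<lambda>U V s. restrict s V)\<rparr>"

text \<open>For a finite index set the direct sum of sheaves is computed on sections.\<close>

definition finite_direct_sum ::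
  "'p topology \<Rightarrow> 'i set \<Rightarrow> ('i \<Rightarrow> ('p, 'r, 's) module_sheaf) \<Rightarrow> ('p, 'r, 'i \<Rightarrow> 's) module_sheaf" where
  "finite_direct_sum X I F =
     \<lparr>base = X,
      sect = (\<lambda>U. \<lparr>carrier = (\<Pi>\<^sub>E i\<in>I. carrier (sect (F i) U)),
                    monoid.mult = (\<lambda>s t. \<lambda>i\<in>I. s i \<otimes>\<^bsub>sect (F i) U\<^esub> t i),
                    one = (\<lambda>i\<in>I. \<one>\<^bsub>sect (F i) U\<^esub>),
                    zero = (\<lambda>i\<in>I. \<zero>\<^bsub>sect (F i) U\<^esub>),
                    add = (\<lambda>s t. \<lambda>i\<in>I. s i \<oplus>\<^bsub>sect (F i) U\<^esub> t i),
                    module.smult = (\<lambda>a s. \<lambda>i\<in>I. a \<odot>\<^bsub>sect (F i) U\<^esub> s i)\<rparr>),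
      res = (\<lambda>U V s. \<lambda>i\<in>I. res (F i) U V (s i))\<rparr>"

text \<open>
  For the inclusion $i$ of an open subset \<open>U\<close>, \<open>open_restriction F U\<close> is $i^*F$.
  For a sheaf \<open>G\<close> on an open subspace of \<open>X\<close>, \<open>extension_by_zero X G\<close> is $i_!G$: its
  sections over \<open>V\<close> are the sections of $i_*G$ over \<open>V\<close> whose support is closed in \<open>V\<close>.
\<close>

definition open_restriction ::
  "('p, 'r, 's) module_sheaf \<Rightarrow> 'p set \<Rightarrow> ('p, 'r, 's) module_sheaf" where
  "open_restriction F U = F\<lparr>base := subtopology (base F) U\<rparr>"

definition section_support :: "('p, 'r, 's) module_sheaf \<Rightarrow> 'p set \<Rightarrow> 's \<Rightarrow> 'p set" where
  "section_support F U s =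
     {x \<in> U. \<forall>V. openin (base F) V \<and> x \<in> V \<and> V \<subseteq> U \<longrightarrow> res F U V s \<noteq> \<zero>\<^bsub>sect F V\<^esub>}"

definition extension_by_zero ::
  "'p topology \<Rightarrow> ('p, 'r, 's) module_sheaf \<Rightarrow> ('p, 'r, 's) module_sheaf" where
  "extension_by_zero X G =
     (let U = topspace (base G) in
      \<lparr>base = X,
       sect = (\<lambda>V. (sect G (U \<inter> V))\<lparr>carrier := {s \<in> carrier (sect G (U \<inter> V)).
                      closedin (subtopology X V) (section_support G (U \<inter> V) s)}\<rparr>),
       res = (\<lambda>V W. res G (U \<inter> V) (U \<inter> W))\<rparr>)"

text \<open>\<open>extend_section F W W' s\<close> extends a section \<open>s\<close> over \<open>W\<close> to \<open>W'\<close> by zero off its support.\<close>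

definition extend_section ::
  "('p, 'r, 's) module_sheaf \<Rightarrow> 'p set \<Rightarrow> 'p set \<Rightarrow> 's \<Rightarrow> 's" where
  "extend_section F W W' s =
     (let W0 = W' - section_support F W s in
      THE t. t \<in> carrier (sect F W') \<and> res F W' W t = s \<and> res F W' W0 t = \<zero>\<^bsub>sect F W0\<^esub>)"

text \<open>
  With $i$, $j$ the inclusions of open subsets $U \subseteq U'$, the natural morphisms
  $i_! i^* F \to j_! j^* F$ and $i_! i^* F \to F$.
\<close>

definition extension_inclusion ::
  "('p, 'r, 's) module_sheaf \<Rightarrow> 'p set \<Rightarrow> 'p set \<Rightarrow> 'p set \<Rightarrow> 's \<Rightarrow> 's" where
  "extension_inclusion F U U' V = extend_section F (U \<inter> V) (U' \<inter> V)"

definition extension_counit ::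
  "('p, 'r, 's) module_sheaf \<Rightarrow> 'p set \<Rightarrow> 'p set \<Rightarrow> 's \<Rightarrow> 's" where
  "extension_counit F U V = extend_section F (U \<inter> V) V"


section \<open>Orientations and the complex\<close>

definition ordered_basis :: "'v::real_vector set \<Rightarrow> 'v list \<Rightarrow> bool" where
  "ordered_basis V bs \<longleftrightarrow> distinct bs \<and> independent (set bs) \<and> span (set bs) = V"

definition basis_change_matrix :: "'v::real_vector list \<Rightarrow> 'v list \<Rightarrow> real mat" where
  "basis_change_matrix bs cs =
     mat (length bs) (length bs) (\<lambda>(i, j). representation (set bs) (cs ! j) (bs ! i))"

text \<open>
  An orientation is given by its set of oriented bases.  The zero space has
  the two orientations \<open>{[]}\<close> and \<open>{}\<close>, that is, the signs $+1$ and $-1$; for a space of positive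
  finite dimension the condition forces a (nonempty) class of equally oriented bases.
\<close>

definition orientation_of :: "'v::real_vector set \<Rightarrow> 'v list set \<Rightarrow> bool" where
  "orientation_of V Or \<longleftrightarrow>
     Or \<subseteq> {bs. ordered_basis V bs} \<and>
     (\<forall>bs cs. ordered_basis V bs \<and> ordered_basis V cs \<longrightarrow>
        (bs \<in> Or \<longleftrightarrow> cs \<in> Or) = (0 < det (basis_change_matrix bs cs)))"

definition induced_orientation ::
  "'v::real_vector set \<Rightarrow> 'v list set \<Rightarrow> 'v set \<Rightarrow> 'v list set" where
  "induced_orientation \<sigma> Or \<tau> =
     (let u = (SOME u. u \<in> \<sigma> - \<tau>) in {bs. ordered_basis (span \<tau>) bs \<and> u # bs \<in> Or})"

definition incidence_sign ::
  "('v::real_vector set \<Rightarrow> 'v list set) \<Rightarrow> 'v set \<Rightarrow> 'v set \<Rightarrow> int" where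
  "incidence_sign ori \<tau> \<sigma> = (if induced_orientation \<sigma> (ori \<sigma>) \<tau> = ori \<tau> then 1 else -1)"

text \<open>
  One orientation for each vector space spanned by a cone.  The full-dimensional cones all span
  the same vector space, hence carry the same orientation; for lower-dimensional cones with the
  same span no agreement is needed, and none is imposed.
\<close>

definition fan_orientation ::
  "'v::real_vector set set \<Rightarrow> ('v set \<Rightarrow> 'v list set) \<Rightarrow> bool" where
  "fan_orientation \<Delta> ori \<longleftrightarrow>
     (\<forall>\<sigma>\<in>\<Delta>. orientation_of (span \<sigma>) (ori \<sigma>)) \<and>
     (\<forall>\<sigma>\<in>cones_codim \<Delta> 0. \<forall>\<sigma>'\<in>cones_codim \<Delta> 0. ori \<sigma> = ori \<sigma>')"

definition cech_summand ::
  "'v::real_vector set \<Rightarrow> 'v set set \<Rightarrow> ('v chart_point set, 'r, 's) module_sheaf \<Rightarrow> 'v set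
    \<Rightarrow> ('v chart_point set, 'r, 's) module_sheaf" where
  "cech_summand N \<Delta> F \<sigma> =
     extension_by_zero (toric_variety N \<Delta>) (open_restriction F (chart N \<Delta> \<sigma>))"

definition cech_sheaf ::
  "'v::real_vector set \<Rightarrow> 'v set set \<Rightarrow> ('v chart_point set, 'r, 's) module_sheaf \<Rightarrow> nat
    \<Rightarrow> ('v chart_point set, 'r, 'v set \<Rightarrow> 's) module_sheaf" where
  "cech_sheaf N \<Delta> F k =
     finite_direct_sum (toric_variety N \<Delta>) (cones_codim \<Delta> k) (cech_summand N \<Delta> F)"

text \<open>The differential from degree \<open>k\<close> to degree \<open>k - 1\<close>, for \<open>k \<ge> 1\<close>.\<close>

definition cech_differential ::
  "'v::real_vector set \<Rightarrow> 'v set set \<Rightarrow> ('v set \<Rightarrow> 'v list set)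
    \<Rightarrow> ('v chart_point set, 'r, 's) module_sheaf \<Rightarrow> nat
    \<Rightarrow> 'v chart_point set set \<Rightarrow> ('v set \<Rightarrow> 's) \<Rightarrow> ('v set \<Rightarrow> 's)" where
  "cech_differential N \<Delta> ori F k V s =
     (\<lambda>\<sigma>\<in>cones_codim \<Delta> (k - 1).
        \<Oplus>\<^bsub>sect (cech_summand N \<Delta> F \<sigma>) V\<^esub>\<tau>\<in>{\<tau> \<in> cones_codim \<Delta> k. cone_face \<tau> \<sigma>}.
          [incidence_sign ori \<tau> \<sigma>] \<cdot>\<^bsub>sect (cech_summand N \<Delta> F \<sigma>) V\<^esub>
            extension_inclusion F (chart N \<Delta> \<tau>) (chart N \<Delta> \<sigma>) V (s \<tau>))"

definition cech_augmentation ::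
  "'v::real_vector set \<Rightarrow> 'v set set \<Rightarrow> ('v chart_point set, 'r, 's) module_sheaf
    \<Rightarrow> 'v chart_point set set \<Rightarrow> ('v set \<Rightarrow> 's) \<Rightarrow> 's" where
  "cech_augmentation N \<Delta> F V s =
     (\<Oplus>\<^bsub>sect F V\<^esub>\<sigma>\<in>cones_codim \<Delta> 0. extension_counit F (chart N \<Delta> \<sigma>) V (s \<sigma>))"

end

theory Submission
  imports
    Defs
begin

text \<open>
  Exactness is checked on stalks.  The chart of \<open>\<sigma>\<close> contains the point \<open>x\<close> iff the smallest cone
  \<open>\<tau>\<close> whose chart contains \<open>x\<close> is a face of \<open>\<sigma>\<close>, so the stalk of the augmented complex at \<open>x\<close> is
  the augmented cellular complex of the star of \<open>\<tau>\<close> in the fan, with coefficients in \<open>R\<close>.  Over the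
  integers it is acyclic: cutting a decomposition of the space into relatively open cones by a
  hyperplane induces a surjective chain map with acyclic kernel, and a hyperplane arrangement that
  contains the separating hyperplanes of the fan (Farkas) refines both the fan and the trivial
  decomposition into a single cell.  An integral contracting homotopy then carries the acyclicity
  over to \<open>R\<close>, and its values, being constant on the chart of \<open>\<tau>\<close>, provide the local lifts.
\<close>

section \<open>Finitely generated cones\<close>

text \<open>The induction passes through decompositions that are not fans, beginning with the single
  cell \<open>UNIV\<close>. Cells are therefore relatively open convex cones subject only to a
  frontier condition, and strict convexity is left behind. Two devices keep the bookkeeping small.
  The star is taken at a point \<open>p\<close> and not at a cell, so that one \<open>p\<close>
  serves a decomposition and all its refinements. Each cell is oriented by a basis chosen for its
  span, so that a piece with the span of its parent inherits its orientation; the given orientations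
  enter once, as a diagonal change of signs. That boundaries square to zero is verified directly
  only for arrangements, whose cells are sign vectors, and descends to the fan by surjectivity of
  the chain maps. Incidence numbers of walls are units of the integers, which is what makes the
  kernels acyclic without division. On the algebraic side the obstacle is rationality: faces are
  given by real forms, but charts are cut out by characters, so a lattice form with the same zeros
  on the cone has to be produced.\<close>

lemma linear_functional_nonzero:
  fixes b :: "'v::real_vector"
  assumes "b \<noteq> 0"
  obtains f :: "'v \<Rightarrow> real" where "linear f" "f b = 1"
proof -
  have "independent {b}" using assms by simp
  then obtain f :: "'v \<Rightarrow> real" where "linear f" "\<forall>x\<in>{b}. f x = 1"
    using linear_independent_extend[of "{b}" "\<lambda>_. 1"] by auto
  then show ?thesis using that by auto
qed

text \<open>A violated inequality at \<open>a k\<close> is removed by projecting along \<open>a k\<close> onto the kernel of the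
  current functional (Fourier-Motzkin elimination).\<close>

lemma farkas_family:
  fixes a :: "'i \<Rightarrow> 'v::real_vector" and b :: 'v
  assumes "finite I"
    and "\<And>c. \<forall>i\<in>I. 0 \<le> c i \<Longrightarrow> b \<noteq> (\<Sum>i\<in>I. c i *\<^sub>R a i)"
  shows "\<exists>f::'v \<Rightarrow> real. linear f \<and> (\<forall>i\<in>I. 0 \<le> f (a i)) \<and> f b < 0"
  using assms
proof (induction I arbitrary: a b rule: finite_induct)
  case empty
  then have "- b \<noteq> 0" by simp
  then obtain f :: "'v \<Rightarrow> real" where "linear f" "f (- b) = 1"
    by (rule linear_functional_nonzero)
  then show ?case by (auto intro!: exI[of _ f] simp: linear_neg)
next
  case (insert k I)
  have nb: "b \<noteq> (\<Sum>i\<in>I. c i *\<^sub>R a i)" if "\<forall>i\<in>I. 0 \<le> c i" for c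
  proof -
    have "b \<noteq> (\<Sum>i\<in>insert k I. (c(k := 0)) i *\<^sub>R a i)"
      using that by (intro insert.prems) auto
    moreover have "(\<Sum>i\<in>I. (c(k := 0)) i *\<^sub>R a i) = (\<Sum>i\<in>I. c i *\<^sub>R a i)"
      using insert.hyps by (intro sum.cong) auto
    ultimately show ?thesis using insert.hyps by auto
  qed
  obtain f :: "'v \<Rightarrow> real" where f: "linear f" "\<forall>i\<in>I. 0 \<le> f (a i)" "f b < 0"
    using insert.IH[OF nb] by blast
  show ?case
  proof (cases "0 \<le> f (a k)")
    case True
    then show ?thesis using f by blast
  next
    case False
    define \<pi> where "\<pi> = (\<lambda>x. x - (f x / f (a k)) *\<^sub>R a k)"
    have lin: "linear \<pi>"
      unfolding \<pi>_def using f(1)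
      by (intro linearI) (simp_all add: linear_add linear_scale algebra_simps add_divide_distrib)
    have "\<pi> b \<noteq> (\<Sum>i\<in>I. c i *\<^sub>R \<pi> (a i))" if c: "\<forall>i\<in>I. 0 \<le> c i" for c
    proof
      assume eq: "\<pi> b = (\<Sum>i\<in>I. c i *\<^sub>R \<pi> (a i))"
      \<comment> \<open>The coefficient that \<open>a k\<close> receives when \<open>\<pi>\<close>
        is undone. It is nonnegative: \<open>f b\<close> and \<open>f (a k)\<close> are negative,
        whereas \<open>f (a i)\<close> is nonnegative for \<open>i \<in> I\<close>.\<close>
      define d where "d = f b / f (a k) - (\<Sum>i\<in>I. c i * (f (a i) / f (a k)))"
      have "0 \<le> d"
        using False f c unfolding d_def
        by (simp add: divide_nonpos_neg divide_nonneg_neg sum_nonpos mult_nonneg_nonpos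
            less_imp_le divide_nonpos_nonpos order_trans[of _ 0])
      have "b = (\<Sum>i\<in>I. c i *\<^sub>R a i) + d *\<^sub>R a k"
        using eq unfolding \<pi>_def d_def
        by (simp add: algebra_simps sum_subtractf scaleR_sum_left)
      also have "\<dots> = (\<Sum>i\<in>insert k I. (c(k := d)) i *\<^sub>R a i)"
      proof -
        have "(\<Sum>i\<in>I. (c(k := d)) i *\<^sub>R a i) = (\<Sum>i\<in>I. c i *\<^sub>R a i)"
          using insert.hyps by (intro sum.cong) auto
        then show ?thesis using insert.hyps by (simp add: add.commute)
      qed
      finally have "b = (\<Sum>i\<in>insert k I. (c(k := d)) i *\<^sub>R a i)" .
      moreover have "\<forall>i\<in>insert k I. 0 \<le> (c(k := d)) i" using c \<open>0 \<le> d\<close> by simp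
      ultimately show False using insert.prems by blast
    qed
    from insert.IH[OF this] obtain g :: "'v \<Rightarrow> real" where
      g: "linear g" "\<forall>i\<in>I. 0 \<le> g (\<pi> (a i))" "g (\<pi> b) < 0" by blast
    have "\<pi> (a k) = 0" using False by (simp add: \<pi>_def)
    then have "linear (g \<circ> \<pi>) \<and> (\<forall>i\<in>insert k I. 0 \<le> (g \<circ> \<pi>) (a i)) \<and> (g \<circ> \<pi>) b < 0"
      using g lin linear_compose[OF lin g(1)] by (auto simp: linear_0)
    then show ?thesis by blast
  qed
qed

text \<open>If every \<open>- a k\<close> were a nonnegative combination of the \<open>a i\<close>
  and of \<open>- v\<close>, adding these relations to the given one for \<open>v\<close> would
  write \<open>v\<close> with strictly positive coefficients. So some \<open>- a k\<close> lies
  outside that cone and Farkas separates it: \<open>f (- v) \<ge> 0\<close> and \<open>v\<close> in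
  the cone force \<open>f v = 0\<close>, while \<open>f (a k) > 0\<close>.\<close>

lemma relint_alternative_family:
  fixes a :: "'i \<Rightarrow> 'v::real_vector"
  assumes fin: "finite I" and v: "v = (\<Sum>i\<in>I. c0 i *\<^sub>R a i)" "\<forall>i\<in>I. 0 \<le> c0 i"
    and no: "\<And>c. \<forall>i\<in>I. 0 < c i \<Longrightarrow> v \<noteq> (\<Sum>i\<in>I. c i *\<^sub>R a i)"
  shows "\<exists>f::'v \<Rightarrow> real. linear f \<and> (\<forall>i\<in>I. 0 \<le> f (a i)) \<and> f v = 0 \<and> (\<exists>i\<in>I. 0 < f (a i))"
proof -
  have "\<exists>k\<in>I. \<forall>c e. (\<forall>i\<in>I. 0 \<le> c i) \<and> 0 \<le> e \<longrightarrow> - a k \<noteq> (\<Sum>i\<in>I. c i *\<^sub>R a i) + e *\<^sub>R (- v)"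
  proof (rule ccontr)
    assume "\<not> ?thesis"
    then have "\<forall>k\<in>I. \<exists>c e. (\<forall>i\<in>I. 0 \<le> c i) \<and> 0 \<le> e \<and>
        - a k = (\<Sum>i\<in>I. c i *\<^sub>R a i) + e *\<^sub>R (- v)" by blast
    then obtain C E where CE: "\<And>k. k \<in> I \<Longrightarrow> (\<forall>i\<in>I. 0 \<le> C k i) \<and> 0 \<le> E k \<and>
        - a k = (\<Sum>i\<in>I. C k i *\<^sub>R a i) + E k *\<^sub>R (- v)"
      by metis
    \<comment> \<open>Summed over \<open>k\<close>, the relations express the multiple of
      \<open>v\<close> by the sum of the \<open>E k\<close> through the \<open>a i\<close>; one more
      copy of \<open>v\<close>, written with \<open>c0\<close>, makes the multiple \<open>s\<close>.
      The summand 1 in \<open>c\<close> stems from the vectors \<open>a k\<close> themselves and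
      makes the coefficients positive.\<close>
    define s where "s = 1 + (\<Sum>k\<in>I. E k)"
    have spos: "0 < s" using CE by (simp add: s_def sum_nonneg add_pos_nonneg)
    define c where "c = (\<lambda>i. (c0 i + 1 + (\<Sum>k\<in>I. C k i)) / s)"
    have "0 < c i" if "i \<in> I" for i
      using that v CE spos unfolding c_def
      by (intro divide_pos_pos add_pos_nonneg sum_nonneg add_nonneg_pos) auto
    moreover have "v = (\<Sum>i\<in>I. c i *\<^sub>R a i)"
    proof -
      have "(\<Sum>k\<in>I. a k + (\<Sum>i\<in>I. C k i *\<^sub>R a i)) = (\<Sum>k\<in>I. E k *\<^sub>R v)"
        using CE by (intro sum.cong refl) (simp add: minus_equation_iff algebra_simps)
      then have "(\<Sum>k\<in>I. a k) + (\<Sum>k\<in>I. \<Sum>i\<in>I. C k i *\<^sub>R a i) = (\<Sum>k\<in>I. E k) *\<^sub>R v"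
        by (simp add: sum.distrib scaleR_sum_left)
      moreover have "(\<Sum>k\<in>I. \<Sum>i\<in>I. C k i *\<^sub>R a i) = (\<Sum>i\<in>I. (\<Sum>k\<in>I. C k i) *\<^sub>R a i)"
        by (subst sum.swap) (simp add: scaleR_sum_left)
      ultimately have "s *\<^sub>R v = (\<Sum>i\<in>I. (c0 i + 1 + (\<Sum>k\<in>I. C k i)) *\<^sub>R a i)"
        by (simp add: s_def scaleR_add_left sum.distrib v(1)[symmetric] add.assoc)
      then have "(1 / s) *\<^sub>R (s *\<^sub>R v) = (1 / s) *\<^sub>R (\<Sum>i\<in>I. (c0 i + 1 + (\<Sum>k\<in>I. C k i)) *\<^sub>R a i)"
        by simp
      then show ?thesis
        using spos by (simp add: c_def scaleR_sum_right)
    qed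
    ultimately show False using no by blast
  qed
  then obtain k where k: "k \<in> I" and nk: "\<And>c e. \<forall>i\<in>I. 0 \<le> c i \<Longrightarrow> 0 \<le> e \<Longrightarrow>
      - a k \<noteq> (\<Sum>i\<in>I. c i *\<^sub>R a i) + e *\<^sub>R (- v)" by blast
  \<comment> \<open>The index \<open>None\<close> carries the extra generator
    \<open>- v\<close>.\<close>
  define J where "J = insert None (Some ` I)"
  define a' where "a' = (\<lambda>j. case j of None \<Rightarrow> - v | Some i \<Rightarrow> a i)"
  have "- a k \<noteq> (\<Sum>j\<in>J. c j *\<^sub>R a' j)" if "\<forall>j\<in>J. 0 \<le> c j" for c
  proof -
    have "(\<Sum>j\<in>J. c j *\<^sub>R a' j) = c None *\<^sub>R (- v) + (\<Sum>i\<in>I. c (Some i) *\<^sub>R a i)"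
      using fin by (simp add: J_def a'_def sum.insert sum.reindex)
    then show ?thesis using nk[of "\<lambda>i. c (Some i)" "c None"] that by (simp add: J_def)
  qed
  then obtain f :: "'v \<Rightarrow> real" where f: "linear f" "\<forall>j\<in>J. 0 \<le> f (a' j)" "f (- a k) < 0"
    using farkas_family[of J "- a k" a'] fin by (auto simp: J_def)
  have "0 \<le> f (- v)" using f(2) by (simp add: J_def a'_def)
  then have "f v \<le> 0" using f(1) by (simp add: linear_neg)
  moreover have pos: "\<forall>i\<in>I. 0 \<le> f (a i)" using f(2) by (simp add: J_def a'_def)
  moreover have "f v = (\<Sum>i\<in>I. c0 i * f (a i))"
    using f(1) by (simp add: v(1) linear_sum linear_scale)
  ultimately have "f v = 0" using v(2) by (simp add: order_antisym sum_nonneg)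
  then show ?thesis using f(1,3) pos k by (auto simp: linear_neg)
qed

definition gen_cone :: "'v::real_vector set \<Rightarrow> 'v set" where
  "gen_cone S = {\<Sum>v\<in>S. c v *\<^sub>R v | c. \<forall>v\<in>S. 0 \<le> c v}"

text \<open>The relative interior of \<open>gen_cone S\<close>, read off from the generators without
  a topology; for empty \<open>S\<close> it is \<open>{0}\<close>.\<close>

definition open_gen_cone :: "'v::real_vector set \<Rightarrow> 'v set" where
  "open_gen_cone S = {\<Sum>v\<in>S. c v *\<^sub>R v | c. \<forall>v\<in>S. 0 < c v}"

lemma gen_coneE:
  assumes "x \<in> gen_cone S"
  obtains c where "x = (\<Sum>v\<in>S. c v *\<^sub>R v)" "\<And>v. v \<in> S \<Longrightarrow> 0 \<le> c v"
  using assms unfolding gen_cone_def by blast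

lemma open_gen_coneE:
  assumes "x \<in> open_gen_cone S"
  obtains c where "x = (\<Sum>v\<in>S. c v *\<^sub>R v)" "\<And>v. v \<in> S \<Longrightarrow> 0 < c v"
  using assms unfolding open_gen_cone_def by blast

lemma gen_coneI: "(\<And>v. v \<in> S \<Longrightarrow> 0 \<le> c v) \<Longrightarrow> (\<Sum>v\<in>S. c v *\<^sub>R v) \<in> gen_cone S"
  unfolding gen_cone_def by blast

lemma open_gen_coneI: "(\<And>v. v \<in> S \<Longrightarrow> 0 < c v) \<Longrightarrow> (\<Sum>v\<in>S. c v *\<^sub>R v) \<in> open_gen_cone S"
  unfolding open_gen_cone_def by blast

lemma open_gen_cone_subset: "open_gen_cone S \<subseteq> gen_cone S"
  unfolding gen_cone_def open_gen_cone_def by (blast intro: less_imp_le)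

lemma gen_cone_superset: "finite S \<Longrightarrow> S \<subseteq> gen_cone S"
proof
  fix s assume "finite S" "s \<in> S"
  have "(\<Sum>v\<in>S. (if v = s then 1 else 0) *\<^sub>R v) \<in> gen_cone S"
    by (intro gen_coneI) auto
  also have "(\<Sum>v\<in>S. (if v = s then 1 else 0) *\<^sub>R v) = (\<Sum>v\<in>S. if s = v then v else 0)"
    by (intro sum.cong) auto
  finally show "s \<in> gen_cone S"
    using \<open>finite S\<close> \<open>s \<in> S\<close> by simp
qed

lemma gen_cone_functional_nonneg:
  fixes f :: "'v::real_vector \<Rightarrow> real"
  assumes "linear f" "\<forall>s\<in>S. 0 \<le> f s" "x \<in> gen_cone S"
  shows "0 \<le> f x"
  using assms(3) by (rule gen_coneE) (use assms in \<open>auto simp: linear_sum linear_scale intro!: sum_nonneg\<close>)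

lemma open_gen_cone_functional_pos:
  fixes f :: "'v::real_vector \<Rightarrow> real"
  assumes "linear f" "\<forall>s\<in>S. 0 \<le> f s" "x \<in> open_gen_cone S" "finite S" "s \<in> S" "0 < f s"
  shows "0 < f x"
  using assms(3)
proof (rule open_gen_coneE)
  fix c assume c: "x = (\<Sum>v\<in>S. c v *\<^sub>R v)" "\<And>v. v \<in> S \<Longrightarrow> 0 < c v"
  have "0 < (\<Sum>v\<in>S. c v * f v)"
    using assms c(2) by (intro sum_pos2[OF _ \<open>s \<in> S\<close>]) (auto simp: less_imp_le)
  then show ?thesis using assms(1) by (simp add: c(1) linear_sum linear_scale)
qed

lemma farkas:
  fixes S :: "'v::real_vector set"
  assumes "finite S" "b \<notin> gen_cone S"
  obtains f :: "'v \<Rightarrow> real" where "linear f" "\<forall>s\<in>S. 0 \<le> f s" "f b < 0"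
proof -
  have "b \<noteq> (\<Sum>i\<in>S. c i *\<^sub>R id i)" if "\<forall>i\<in>S. 0 \<le> c i" for c
    using assms(2) that gen_coneI[of S c] by auto
  from farkas_family[OF assms(1) this] show ?thesis using that by auto
qed

lemma relint_alternative:
  fixes S :: "'v::real_vector set"
  assumes "finite S" "v \<in> gen_cone S" "v \<notin> open_gen_cone S"
  obtains f :: "'v \<Rightarrow> real" where "linear f" "\<forall>s\<in>S. 0 \<le> f s" "f v = 0" "\<exists>s\<in>S. 0 < f s"
proof -
  obtain c0 where c0: "v = (\<Sum>i\<in>S. c0 i *\<^sub>R id i)" "\<forall>i\<in>S. 0 \<le> c0 i"
    using assms(2) by (auto elim: gen_coneE)
  have "v \<noteq> (\<Sum>i\<in>S. c i *\<^sub>R id i)" if "\<forall>i\<in>S. 0 < c i" for c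
    using assms(3) that open_gen_coneI[of S c] by auto
  from relint_alternative_family[OF assms(1) c0 this] show ?thesis using that by auto
qed

section \<open>Orientations\<close>

text \<open>The ambient type is an arbitrary real vector space, so finite dimension enters through
  an explicit basis. The rewrites let the facts of the finite-dimensional locale speak about the
  global \<open>span\<close>, \<open>dim\<close> and \<open>dependent\<close>.\<close>

locale finite_dim =
  fixes B :: "'v::real_vector set"
  assumes finite_B: "finite B" and independent_B: "independent B" and span_B: "span B = UNIV"
begin

sublocale fd: finite_dimensional_vector_space "scaleR :: real \<Rightarrow> 'v \<Rightarrow> 'v" B
  rewrites "module.dependent ((*\<^sub>R) :: real \<Rightarrow> 'v \<Rightarrow> 'v) = dependent"
    and "module.representation ((*\<^sub>R) :: real \<Rightarrow> 'v \<Rightarrow> 'v) = representation"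
    and "module.subspace ((*\<^sub>R) :: real \<Rightarrow> 'v \<Rightarrow> 'v) = subspace"
    and "module.span ((*\<^sub>R) :: real \<Rightarrow> 'v \<Rightarrow> 'v) = span"
    and "vector_space.dim ((*\<^sub>R) :: real \<Rightarrow> 'v \<Rightarrow> 'v) = dim"
proof -
  show "finite_dimensional_vector_space ((*\<^sub>R) :: real \<Rightarrow> 'v \<Rightarrow> 'v) B"
    by unfold_locales
      (use finite_B independent_B span_B in \<open>auto simp: dependent_raw_def[symmetric] span_raw_def[symmetric]\<close>)
qed (simp_all add: dependent_raw_def representation_raw_def subspace_raw_def span_raw_def dim_raw_def)

lemma ordered_basis_exists:
  fixes L :: "'v set"
  assumes "subspace L"
  shows "\<exists>bs. ordered_basis L bs"
proof -
  obtain C where C: "C \<subseteq> L" "independent C" "L \<subseteq> span C"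
    using basis_exists[of L] by metis
  have "finite C" using C(2) by (rule fd.finiteI_independent)
  then obtain bs where bs: "set bs = C" "distinct bs" using finite_distinct_list by blast
  moreover have "span C = L" using C assms by (metis span_minimal subset_antisym)
  ultimately show ?thesis using C by (auto simp: ordered_basis_def)
qed

end

lemma ordered_basis_length:
  assumes "ordered_basis L bs"
  shows "length bs = dim L"
  using assms unfolding ordered_basis_def
  by (metis dim_span_eq_card_independent distinct_card)

lemma span_insert_span: "span (insert u (span S)) = span (insert u S)"
proof (rule subset_antisym; rule span_minimal)
  show "insert u (span S) \<subseteq> span (insert u S)"
    using span_mono[of S "insert u S"] by (auto simp: span_base)
  show "insert u S \<subseteq> span (insert u (span S))"
    by (auto simp: span_base)
qed auto

lemma ordered_basis_Cons:
  assumes "ordered_basis L bs" "u \<notin> L"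
  shows "ordered_basis (span (insert u L)) (u # bs)"
proof -
  have bs: "distinct bs" "independent (set bs)" "L = span (set bs)"
    using assms(1) by (auto simp: ordered_basis_def)
  have "u \<notin> set bs" using assms(2) span_base[of u "set bs"] bs(3) by blast
  moreover have "independent (insert u (set bs))"
    using assms(2) bs by (intro independent_insertI) auto
  ultimately show ?thesis
    using bs unfolding ordered_basis_def by (simp add: span_insert_span)
qed

lemma basis_change_matrix_carrier [simp]:
  "basis_change_matrix bs cs \<in> carrier_mat (length bs) (length bs)"
  by (simp add: basis_change_matrix_def)

lemma basis_change_matrix_self:
  assumes "ordered_basis L bs"
  shows "basis_change_matrix bs bs = 1\<^sub>m (length bs)"
  using assms unfolding ordered_basis_def basis_change_matrix_def
  by (intro eq_matI) (auto simp: representation_basis nth_eq_iff_index_eq)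

lemma sum_representation_nth:
  assumes "ordered_basis L bs" "v \<in> L"
  shows "v = (\<Sum>i<length bs. representation (set bs) v (bs ! i) *\<^sub>R bs ! i)"
proof -
  have "v = (\<Sum>b\<in>set bs. representation (set bs) v b *\<^sub>R b)"
    using assms unfolding ordered_basis_def
    by (simp add: sum_representation_eq)
  also have "\<dots> = (\<Sum>i<length bs. representation (set bs) v (bs ! i) *\<^sub>R bs ! i)"
    using assms unfolding ordered_basis_def
    by (intro sum.reindex_bij_betw[symmetric] bij_betw_nth) auto
  finally show ?thesis .
qed

lemma basis_change_matrix_mult:
  assumes bs: "ordered_basis L bs" and cs: "ordered_basis L cs" and ds: "ordered_basis L ds"
  shows "basis_change_matrix bs ds = basis_change_matrix bs cs * basis_change_matrix cs ds"
proof (rule eq_matI)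
  have len: "length cs = length bs" "length ds = length bs"
    using assms by (simp_all add: ordered_basis_length)
  fix i j
  assume "i < dim_row (basis_change_matrix bs cs * basis_change_matrix cs ds)"
    "j < dim_col (basis_change_matrix bs cs * basis_change_matrix cs ds)"
  then have ij: "i < length bs" "j < length bs"
    by (simp_all add: basis_change_matrix_def len)
  have ind: "independent (set bs)" and sp: "span (set bs) = L"
    using bs by (simp_all add: ordered_basis_def)
  have csL: "cs ! k \<in> L" if "k < length bs" for k
    using that cs len unfolding ordered_basis_def by (metis nth_mem span_base)
  have "ds ! j \<in> L"
    using ij ds len unfolding ordered_basis_def by (metis nth_mem span_base)
  then have "representation (set bs) (ds ! j) (bs ! i)
      = representation (set bs) (\<Sum>k<length cs. representation (set cs) (ds ! j) (cs ! k) *\<^sub>R cs ! k) (bs ! i)"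
    using sum_representation_nth[OF cs] by simp
  also have "\<dots> = (\<Sum>k<length bs. representation (set cs) (ds ! j) (cs ! k) * representation (set bs) (cs ! k) (bs ! i))"
    using ind csL unfolding sp[symmetric] len
    by (subst representation_sum) (auto simp: span_scale representation_scale)
  finally show "basis_change_matrix bs ds $$ (i, j) = (basis_change_matrix bs cs * basis_change_matrix cs ds) $$ (i, j)"
    using ij by (simp add: basis_change_matrix_def len scalar_prod_def lessThan_atLeast0 mult.commute)
qed (auto simp: basis_change_matrix_def ordered_basis_length[OF bs] ordered_basis_length[OF cs] ordered_basis_length[OF ds])

text \<open>In the coordinates of \<open>u # bs\<close> only the first new vector has a
  \<open>u\<close>-component. The top row of the matrix is therefore \<open>a\<close> followed by
  zeros, and Laplace expansion along it leaves the change of basis inside \<open>L\<close>.\<close>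

lemma det_basis_change_Cons:
  assumes bs: "ordered_basis L bs" and cs: "ordered_basis L cs" and u: "u \<notin> L" and l: "l \<in> L"
  shows "det (basis_change_matrix (u # bs) ((a *\<^sub>R u + l) # cs)) = a * det (basis_change_matrix bs cs)"
proof -
  let ?A = "basis_change_matrix (u # bs) ((a *\<^sub>R u + l) # cs)"
  have len: "length cs = length bs"
    using assms by (simp add: ordered_basis_length)
  have ind: "independent (set bs)" and sp: "span (set bs) = L"
    using bs by (simp_all add: ordered_basis_def)
  have ind': "independent (set (u # bs))"
    using ordered_basis_Cons[OF bs u] by (simp add: ordered_basis_def)
  have repL: "representation (set (u # bs)) x = representation (set bs) x" if "x \<in> L" for x
    using that ind' sp by (intro representation_extend) auto
  have u0: "representation (set bs) x u = 0" for x
    using u sp span_base representation_ne_zero by metis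
  have csL: "cs ! k \<in> L" if "k < length bs" for k
    using that cs len unfolding ordered_basis_def by (metis nth_mem span_base)
  have usp: "u \<in> span (set (u # bs))" and lsp: "l \<in> span (set (u # bs))"
    using l sp span_mono[of "set bs" "set (u # bs)"] by (auto simp: span_base)
  have row0: "?A $$ (0, j) = (if j = 0 then a else 0)" if j: "j < Suc (length bs)" for j
  proof (cases j)
    case 0
    have "representation (set (u # bs)) (a *\<^sub>R u + l) u = a"
      using usp lsp ind' repL[OF l] u0 representation_basis[OF ind', of u]
      by (simp add: representation_add representation_scale span_scale del: set_simps) simp
    then show ?thesis using 0 by (simp add: basis_change_matrix_def)
  next
    case (Suc k)
    then show ?thesis using j repL[OF csL, of k] u0 by (simp add: basis_change_matrix_def)
  qed
  have del: "mat_delete ?A 0 0 = basis_change_matrix bs cs"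
    using repL[OF csL] by (intro eq_matI) (auto simp: mat_delete_def basis_change_matrix_def)
  have "det ?A = (\<Sum>j<Suc (length bs). ?A $$ (0, j) * cofactor ?A 0 j)"
    using laplace_expansion_row[of ?A "Suc (length bs)" 0] basis_change_matrix_carrier[of "u # bs"]
    by simp
  also have "\<dots> = (\<Sum>j<Suc (length bs). if j = 0 then a * cofactor ?A 0 0 else 0)"
    by (intro sum.cong) (auto simp: row0)
  also have "\<dots> = a * cofactor ?A 0 0"
    by simp
  finally show ?thesis by (simp add: cofactor_def del)
qed

text \<open>Both lists have the same set of vectors, so the change of basis is the identity matrix
  with its first two rows exchanged.\<close>

lemma det_basis_change_swap:
  assumes "ordered_basis L (u # v # bs)"
  shows "det (basis_change_matrix (u # v # bs) (v # u # bs)) = - 1"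
proof -
  let ?n = "length (u # v # bs)"
  have swap: "ordered_basis L (v # u # bs)"
    using assms unfolding ordered_basis_def by (auto simp: insert_commute)
  have "basis_change_matrix (u # v # bs) (v # u # bs) = swaprows 0 1 (1\<^sub>m ?n)"
  proof (rule eq_matI)
    fix i j assume "i < dim_row (swaprows 0 1 (1\<^sub>m ?n))" "j < dim_col (swaprows 0 1 (1\<^sub>m ?n))"
    then have ij: "i < ?n" "j < ?n" by simp_all
    have "representation (set (u # v # bs)) ((v # u # bs) ! j) ((u # v # bs) ! i)
        = representation (set (v # u # bs)) ((v # u # bs) ! j) ((u # v # bs) ! i)"
      by (simp add: insert_commute)
    also have "\<dots> = (if (v # u # bs) ! j = (u # v # bs) ! i then 1 else 0)"
      using swap ij nth_mem[of j "v # u # bs"] unfolding ordered_basis_def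
      by (subst representation_basis) simp_all
    also have "(u # v # bs) ! i = (v # u # bs) ! (if i = 0 then 1 else if i = 1 then 0 else i)"
      by (auto simp: nth_Cons split: nat.splits)
    also have "((v # u # bs) ! j = (v # u # bs) ! (if i = 0 then 1 else if i = 1 then 0 else i))
        \<longleftrightarrow> j = (if i = 0 then 1 else if i = 1 then 0 else i)"
      using swap ij unfolding ordered_basis_def
      by (subst nth_eq_iff_index_eq) auto
    finally show "basis_change_matrix (u # v # bs) (v # u # bs) $$ (i, j) = swaprows 0 1 (1\<^sub>m ?n) $$ (i, j)"
      using ij by (auto simp: basis_change_matrix_def)
  qed (auto simp: basis_change_matrix_def)
  then show ?thesis
    using det_swaprows[of 0 ?n 1 "1\<^sub>m ?n"] by (simp del: One_nat_def)
qed

definition relative_sign :: "'v::real_vector list \<Rightarrow> 'v list \<Rightarrow> int" where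
  "relative_sign bs cs = (if 0 < det (basis_change_matrix bs cs) then 1 else -1)"

lemma det_basis_change_nonzero:
  assumes "ordered_basis L bs" "ordered_basis L cs"
  shows "det (basis_change_matrix bs cs) \<noteq> 0"
proof -
  have len: "length cs = length bs" using assms by (simp add: ordered_basis_length)
  have "det (basis_change_matrix bs cs) * det (basis_change_matrix cs bs) = det (basis_change_matrix bs bs)"
    using basis_change_matrix_mult[OF assms assms(1)] basis_change_matrix_carrier[of cs bs]
    by (subst det_mult[symmetric]) (auto simp: len)
  also have "\<dots> = 1" using basis_change_matrix_self[OF assms(1)] by simp
  finally show ?thesis by auto
qed

lemma relative_sign_trans:
  assumes "ordered_basis L bs" "ordered_basis L cs" "ordered_basis L ds"
  shows "relative_sign bs ds = relative_sign bs cs * relative_sign cs ds"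
proof -
  have len: "length cs = length bs" using assms by (simp add: ordered_basis_length)
  have "det (basis_change_matrix bs ds) = det (basis_change_matrix bs cs) * det (basis_change_matrix cs ds)"
    using basis_change_matrix_mult[OF assms] basis_change_matrix_carrier[of cs ds]
    by (subst det_mult[symmetric]) (auto simp: len)
  then show ?thesis
    using det_basis_change_nonzero[OF assms(1,2)] det_basis_change_nonzero[OF assms(2,3)]
    by (auto simp: relative_sign_def zero_less_mult_iff)
qed

lemma relative_sign_Cons:
  assumes "ordered_basis L bs" "ordered_basis L cs" "u \<notin> L" "l \<in> L" "a \<noteq> 0"
  shows "relative_sign (u # bs) ((a *\<^sub>R u + l) # cs) = (if 0 < a then 1 else -1) * relative_sign bs cs"
  using det_basis_change_Cons[OF assms(1-4), of a] det_basis_change_nonzero[OF assms(1,2)] assms(5)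
  by (auto simp: relative_sign_def zero_less_mult_iff)

text \<open>The reference orientation depends on the subspace alone. Cells of different
  decompositions with the same span are thus oriented alike, and no orientation has to be
  transported under subdivision.\<close>

definition canonical_basis :: "'v::real_vector set \<Rightarrow> 'v list" where
  "canonical_basis L = (SOME bs. ordered_basis L bs)"

text \<open>The sign of the exterior product of \<open>w\<close> with the canonical volume form of \<open>L\<close>, compared
  with the canonical volume form of the sum of \<open>L\<close> and the line through \<open>w\<close>.\<close>

definition side_sign :: "'v::real_vector set \<Rightarrow> 'v \<Rightarrow> int" where
  "side_sign L w = relative_sign (canonical_basis (span (insert w L))) (w # canonical_basis L)"

lemma side_sign_cases: "side_sign L w = 1 \<or> side_sign L w = -1"
  by (simp add: side_sign_def relative_sign_def)

lemma span_insert_scale_add: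
  assumes "subspace L" "l \<in> L" "a \<noteq> 0"
  shows "span (insert (a *\<^sub>R w + l) L) = span (insert w L)"
proof (rule subset_antisym; rule span_minimal)
  have lw: "l \<in> span (insert w L)" "w \<in> span (insert w L)" using assms by (auto simp: span_base)
  then show "insert (a *\<^sub>R w + l) L \<subseteq> span (insert w L)"
    using span_add[OF span_scale[OF lw(2), of a] lw(1)] by (auto simp: span_base)
  let ?W = "span (insert (a *\<^sub>R w + l) L)"
  have "a *\<^sub>R w + l \<in> ?W" "l \<in> ?W" using assms by (auto simp: span_base)
  then have "(1 / a) *\<^sub>R ((a *\<^sub>R w + l) - l) \<in> ?W" by (intro span_scale span_diff)
  then show "insert w L \<subseteq> ?W" using assms(3) by (auto simp: span_base)
qed auto

context finite_dim
begin

lemma canonical_basis: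
  fixes L :: "'v set"
  shows "subspace L \<Longrightarrow> ordered_basis L (canonical_basis L)"
  unfolding canonical_basis_def by (rule someI_ex[OF ordered_basis_exists])

text \<open>Modulo \<open>L\<close> the new vector is \<open>a\<close> times \<open>w\<close>, and
  it spans the same space together with \<open>L\<close>. Hence \<open>side_sign\<close> sees only
  the side of \<open>L\<close> on which a vector lies.\<close>

lemma side_sign_scale_add:
  fixes L :: "'v set"
  assumes L: "subspace L" and w: "w \<notin> L" and l: "l \<in> L" and a: "a \<noteq> 0"
  shows "side_sign L (a *\<^sub>R w + l) = (if 0 < a then 1 else -1) * side_sign L w"
proof -
  let ?b = "canonical_basis L" and ?W = "span (insert w L)"
  have nin: "a *\<^sub>R w + l \<notin> L"
  proof
    assume "a *\<^sub>R w + l \<in> L"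
    then have "(1 / a) *\<^sub>R ((a *\<^sub>R w + l) - l) \<in> L"
      using L l by (intro subspace_scale subspace_diff)
    then show False using a w by simp
  qed
  have W: "span (insert (a *\<^sub>R w + l) L) = ?W"
    by (rule span_insert_scale_add[OF L l a])
  have b: "ordered_basis L ?b" by (rule canonical_basis[OF L])
  have b1: "ordered_basis ?W (w # ?b)" by (rule ordered_basis_Cons[OF b w])
  have b2: "ordered_basis ?W ((a *\<^sub>R w + l) # ?b)" using ordered_basis_Cons[OF b nin] W by simp
  have "relative_sign ?b ?b = 1"
    using basis_change_matrix_self[OF b] by (simp add: relative_sign_def)
  then have "relative_sign (w # ?b) ((a *\<^sub>R w + l) # ?b) = (if 0 < a then 1 else -1)"
    using relative_sign_Cons[OF b b w l a] by simp
  moreover have "side_sign L (a *\<^sub>R w + l) = side_sign L w * relative_sign (w # ?b) ((a *\<^sub>R w + l) # ?b)"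
    unfolding side_sign_def W by (rule relative_sign_trans[OF canonical_basis b1 b2]) simp
  ultimately show ?thesis by simp
qed

text \<open>The source of every cancellation in the square of the boundary. Each product compares
  the canonical basis of the big space with \<open>w2\<close>, \<open>w1\<close> and a basis of
  \<open>L\<close>, or with \<open>w1\<close>, \<open>w2\<close> and that basis; these two lists
  differ by a transposition.\<close>

lemma side_sign_swap:
  fixes L :: "'v set"
  assumes L: "subspace L" and w1: "w1 \<notin> L" and w2: "w2 \<notin> span (insert w1 L)"
  shows "side_sign L w1 * side_sign (span (insert w1 L)) w2
       = - (side_sign L w2 * side_sign (span (insert w2 L)) w1)"
proof -
  let ?b = "canonical_basis L"
  have b: "ordered_basis L ?b" by (rule canonical_basis[OF L])
  have w2': "w2 \<notin> L" using w2 by (auto simp: span_base)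
  have spL: "span L = L" using L by (simp add: span_eq_iff)
  have w1': "w1 \<notin> span (insert w2 L)"
    using in_span_insert[of w1 w2 L] w1 w2 spL by auto
  \<comment> \<open>The canonical basis of the middle space occurs in both factors and cancels by
    transitivity of relative signs.\<close>
  have key: "side_sign L x * side_sign (span (insert x L)) y
      = relative_sign (canonical_basis (span (insert y (span (insert x L))))) (y # x # ?b)"
    if x: "x \<notin> L" and y: "y \<notin> span (insert x L)" for x y
  proof -
    let ?X = "span (insert x L)" and ?Y = "span (insert y (span (insert x L)))"
    have bX: "ordered_basis ?X (x # ?b)" by (rule ordered_basis_Cons[OF b x])
    have cX: "ordered_basis ?X (canonical_basis ?X)" by (rule canonical_basis) simp
    have "relative_sign (y # canonical_basis ?X) ((1 *\<^sub>R y + 0) # x # ?b)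
        = relative_sign (canonical_basis ?X) (x # ?b)"
      by (subst relative_sign_Cons[OF cX bX y]) (auto simp: span_zero)
    then have "relative_sign (canonical_basis ?Y) (y # x # ?b)
        = relative_sign (canonical_basis ?Y) (y # canonical_basis ?X) * relative_sign (canonical_basis ?X) (x # ?b)"
      using relative_sign_trans[OF canonical_basis[of ?Y] ordered_basis_Cons[OF cX y] ordered_basis_Cons[OF bX y]]
      by simp
    then show ?thesis by (simp add: side_sign_def)
  qed
  let ?W = "span (insert w2 (span (insert w1 L)))"
  have W: "?W = span (insert w1 (span (insert w2 L)))"
    by (simp add: span_insert_span insert_commute)
  have B21: "ordered_basis ?W (w2 # w1 # ?b)"
    by (intro ordered_basis_Cons b w1 w2)
  have B12: "ordered_basis ?W (w1 # w2 # ?b)"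
    unfolding W by (intro ordered_basis_Cons b w1' w2')
  have "relative_sign (w2 # w1 # ?b) (w1 # w2 # ?b) = -1"
    using det_basis_change_swap[OF B21] by (simp add: relative_sign_def)
  moreover have "relative_sign (canonical_basis ?W) (w1 # w2 # ?b)
      = relative_sign (canonical_basis ?W) (w2 # w1 # ?b) * relative_sign (w2 # w1 # ?b) (w1 # w2 # ?b)"
    by (rule relative_sign_trans[OF canonical_basis B21 B12]) simp
  ultimately show ?thesis
    using key[OF w1 w2] key[OF w2' w1'] W by simp
qed

text \<open>Replacing \<open>bs\<close> by the canonical basis changes membership of
  \<open>bs\<close> in \<open>ori \<tau>\<close> and of \<open>u # bs\<close> in
  \<open>ori \<sigma>\<close> simultaneously, the two determinants being equal. So the induced and
  the fixed orientation need only be compared on the canonical basis; this covers the zero space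
  with its two conventional orientations as well.\<close>

lemma incidence_sign_eq_side_sign:
  fixes \<tau> \<sigma> :: "'v set"
  assumes ot: "orientation_of (span \<tau>) (ori \<tau>)" and os: "orientation_of (span \<sigma>) (ori \<sigma>)"
    and u: "u = (SOME u. u \<in> \<sigma> - \<tau>)" and uL: "u \<notin> span \<tau>" and W: "span (insert u (span \<tau>)) = span \<sigma>"
  shows "incidence_sign ori \<tau> \<sigma> =
    (if canonical_basis (span \<tau>) \<in> ori \<tau> then 1 else -1) *
    (if canonical_basis (span \<sigma>) \<in> ori \<sigma> then 1 else -1) * side_sign (span \<tau>) u"
proof -
  let ?L = "span \<tau>" and ?b = "canonical_basis (span \<tau>)"
  have b: "ordered_basis ?L ?b" by (rule canonical_basis) simp
  have B: "ordered_basis (span \<sigma>) (u # bs)" if "ordered_basis ?L bs" for bs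
    using ordered_basis_Cons[OF that uL] W by simp
  have iff: "((u # bs \<in> ori \<sigma>) = (bs \<in> ori \<tau>)) = ((u # ?b \<in> ori \<sigma>) = (?b \<in> ori \<tau>))"
    if bs: "ordered_basis ?L bs" for bs
  proof -
    have "det (basis_change_matrix (u # bs) ((1 *\<^sub>R u + 0) # ?b)) = 1 * det (basis_change_matrix bs ?b)"
      by (rule det_basis_change_Cons[OF bs b uL]) (simp add: span_zero)
    then have "((u # bs \<in> ori \<sigma>) = (u # ?b \<in> ori \<sigma>)) = ((bs \<in> ori \<tau>) = (?b \<in> ori \<tau>))"
      using os ot B[OF bs] B[OF b] bs b unfolding orientation_of_def by simp
    then show ?thesis by blast
  qed
  have "ori \<tau> \<subseteq> {bs. ordered_basis ?L bs}" using ot by (simp add: orientation_of_def)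
  then have "induced_orientation \<sigma> (ori \<sigma>) \<tau> = ori \<tau> \<longleftrightarrow> ((u # ?b \<in> ori \<sigma>) = (?b \<in> ori \<tau>))"
    unfolding induced_orientation_def Let_def u[symmetric] using iff b by blast
  moreover have "((u # ?b \<in> ori \<sigma>) = (canonical_basis (span \<sigma>) \<in> ori \<sigma>)) = (side_sign ?L u = 1)"
  proof -
    have "((canonical_basis (span \<sigma>) \<in> ori \<sigma>) = (u # ?b \<in> ori \<sigma>))
        = (0 < det (basis_change_matrix (canonical_basis (span \<sigma>)) (u # ?b)))"
      using os B[OF b] canonical_basis[of "span \<sigma>"] unfolding orientation_of_def by simp
    then show ?thesis unfolding side_sign_def W relative_sign_def by auto
  qed
  ultimately show ?thesis
    using side_sign_cases[of ?L u] by (auto simp: incidence_sign_def)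
qed

end

section \<open>Integral complexes\<close>

text \<open>All degrees share one index set: \<open>m i j\<close> is the coefficient of
  \<open>j\<close> in the boundary of \<open>i\<close>. The grading reappears only as the rank
  function in \<open>contracting_homotopy\<close>.\<close>

definition boundary :: "('i \<Rightarrow> 'i \<Rightarrow> int) \<Rightarrow> 'i set \<Rightarrow> ('i \<Rightarrow> int) \<Rightarrow> 'i \<Rightarrow> int" where
  "boundary m J x j = (\<Sum>i\<in>J. m i j * x i)"

definition square_zero :: "('i \<Rightarrow> 'i \<Rightarrow> int) \<Rightarrow> 'i set \<Rightarrow> bool" where
  "square_zero m J \<longleftrightarrow> (\<forall>x. \<forall>k\<in>J. boundary m J (boundary m J x) k = 0)"

definition acyclic_complex :: "('i \<Rightarrow> 'i \<Rightarrow> int) \<Rightarrow> 'i set \<Rightarrow> bool" where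
  "acyclic_complex m J \<longleftrightarrow>
     (\<forall>x. (\<forall>j\<in>J. boundary m J x j = 0) \<longrightarrow> (\<exists>y. \<forall>j\<in>J. boundary m J y j = x j))"

lemma boundary_cong: "(\<And>i. i \<in> J \<Longrightarrow> x i = y i) \<Longrightarrow> boundary m J x j = boundary m J y j"
  unfolding boundary_def by (intro sum.cong) auto

lemma boundary_diff: "boundary m J (\<lambda>i. x i - y i) j = boundary m J x j - boundary m J y j"
  unfolding boundary_def by (simp add: right_diff_distrib sum_subtractf)

lemma boundary_add: "boundary m J (\<lambda>i. x i + y i) j = boundary m J x j + boundary m J y j"
  unfolding boundary_def by (simp add: distrib_left sum.distrib)

lemma boundary_boundary:
  "boundary m J (boundary m J x) k = (\<Sum>i\<in>J. (\<Sum>j\<in>J. m i j * m j k) * x i)"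
proof -
  have "boundary m J (boundary m J x) k = (\<Sum>j\<in>J. \<Sum>i\<in>J. m i j * m j k * x i)"
    unfolding boundary_def by (simp add: sum_distrib_left mult_ac)
  also have "\<dots> = (\<Sum>i\<in>J. \<Sum>j\<in>J. m i j * m j k * x i)"
    by (rule sum.swap)
  finally show ?thesis by (simp add: sum_distrib_right)
qed

lemma square_zeroI:
  "(\<And>i k. i \<in> J \<Longrightarrow> k \<in> J \<Longrightarrow> (\<Sum>j\<in>J. m i j * m j k) = 0) \<Longrightarrow> square_zero m J"
  by (simp add: square_zero_def boundary_boundary)

lemma square_zeroD:
  assumes "finite J" "square_zero m J" "i \<in> J" "k \<in> J"
  shows "(\<Sum>j\<in>J. m i j * m j k) = 0"
proof -
  have "0 = boundary m J (boundary m J (\<lambda>l. if l = i then 1 else 0)) k"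
    using assms by (simp add: square_zero_def)
  also have "\<dots> = (\<Sum>l\<in>J. if i = l then (\<Sum>j\<in>J. m l j * m j k) else 0)"
    unfolding boundary_boundary by (intro sum.cong) auto
  also have "\<dots> = (\<Sum>j\<in>J. m i j * m j k)"
    using assms by simp
  finally show ?thesis by simp
qed

text \<open>The comparison of a cell complex \<open>J\<close> with its subdivision \<open>J'\<close> by a hyperplane.  The cells in
  \<open>F\<close> have the dimension of the cell \<open>\<pi>\<close> that contains them; the cells in \<open>J' - F\<close> are the new walls,
  each separating \<open>plus\<close> from \<open>minus\<close>.  The kernel of the surjective chain map induced by \<open>\<pi>\<close> is
  acyclic.\<close>

locale subdivision =
  fixes m' :: "'j \<Rightarrow> 'j \<Rightarrow> int" and J' :: "'j set" and m :: "'i \<Rightarrow> 'i \<Rightarrow> int" and J :: "'i set"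
    and F :: "'j set" and \<pi> :: "'j \<Rightarrow> 'i" and plus minus :: "'j \<Rightarrow> 'j"
  assumes fin': "finite J'" and fin: "finite J" and FJ: "F \<subseteq> J'" and surj: "\<pi> ` F = J"
    and chain: "\<And>i j. i \<in> F \<Longrightarrow> j \<in> J \<Longrightarrow> (\<Sum>j'\<in>{j'\<in>F. \<pi> j' = j}. m' i j') = m (\<pi> i) j"
    and wall_chain: "\<And>i j. i \<in> J' - F \<Longrightarrow> j \<in> J \<Longrightarrow> (\<Sum>j'\<in>{j'\<in>F. \<pi> j' = j}. m' i j') = 0"
    and fibre: "\<And>j. j \<in> J \<Longrightarrow> (\<exists>i. {j'\<in>F. \<pi> j' = j} = {i}) \<or>
        (\<exists>n\<in>J' - F. {j'\<in>F. \<pi> j' = j} = {plus n, minus n} \<and> plus n \<noteq> minus n)"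
    and plus: "\<And>n. n \<in> J' - F \<Longrightarrow> plus n \<in> F"
    and wall: "\<And>n n'. n \<in> J' - F \<Longrightarrow> n' \<in> J' - F \<Longrightarrow> n' \<noteq> n \<Longrightarrow> m' n' (plus n) = 0"
    and wall_self: "\<And>n. n \<in> J' - F \<Longrightarrow> m' n (plus n) * m' n (plus n) = 1"
begin

text \<open>The chain map of the subdivision. Walls are sent to zero because the cell around them
  has larger dimension.\<close>

definition push :: "('j \<Rightarrow> int) \<Rightarrow> 'i \<Rightarrow> int" where
  "push x j = (\<Sum>j'\<in>{j'\<in>F. \<pi> j' = j}. x j')"

lemma finF: "finite F" using FJ fin' by (rule finite_subset)

lemma push_diff: "push (\<lambda>i. x i - y i) j = push x j - push y j"
  unfolding push_def by (simp add: sum_subtractf)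

lemma push_boundary:
  assumes "j \<in> J"
  shows "push (boundary m' J' x) j = boundary m J (push x) j"
proof -
  let ?f = "\<lambda>j. {j'\<in>F. \<pi> j' = j}"
  have "push (boundary m' J' x) j = (\<Sum>i\<in>J'. (\<Sum>j'\<in>?f j. m' i j') * x i)"
    unfolding push_def boundary_def by (subst sum.swap) (simp add: sum_distrib_right)
  also have "\<dots> = (\<Sum>i\<in>F. (\<Sum>j'\<in>?f j. m' i j') * x i)"
    by (rule sum.mono_neutral_right) (use fin' FJ wall_chain[OF _ assms] in auto)
  also have "\<dots> = (\<Sum>i\<in>F. m (\<pi> i) j * x i)"
    by (intro sum.cong) (auto simp: chain[OF _ assms])
  also have "\<dots> = (\<Sum>k\<in>J. \<Sum>i\<in>?f k. m (\<pi> i) j * x i)"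
    by (rule sum.group[symmetric]) (use finF fin surj in auto)
  also have "\<dots> = boundary m J (push x) j"
    unfolding push_def boundary_def sum_distrib_left by (intro sum.cong) auto
  finally show ?thesis .
qed

text \<open>One piece of every cell is chosen, and it receives the whole coefficient of that
  cell.\<close>

lemma push_surjective:
  obtains x' where "\<And>j. j \<in> J \<Longrightarrow> push x' j = x j"
proof -
  have "\<forall>j\<in>J. \<exists>i. i \<in> F \<and> \<pi> i = j" using surj by auto
  from bchoice[OF this] obtain s where s: "\<And>j. j \<in> J \<Longrightarrow> s j \<in> F \<and> \<pi> (s j) = j"
    by blast
  show ?thesis
  proof
    fix j assume j: "j \<in> J"
    have "push (\<lambda>i. if i = s (\<pi> i) then x (\<pi> i) else 0) j = (\<Sum>i\<in>{j'\<in>F. \<pi> j' = j}. if s j = i then x j else 0)"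
      unfolding push_def
    proof (intro sum.cong refl)
      fix i assume "i \<in> {j'\<in>F. \<pi> j' = j}"
      then have "\<pi> i = j" by simp
      then show "(if i = s (\<pi> i) then x (\<pi> i) else 0) = (if s j = i then x j else 0)"
        by (simp only: eq_commute[of i])
    qed
    then show "push (\<lambda>i. if i = s (\<pi> i) then x (\<pi> i) else 0) j = x j"
      using s[OF j] finF by simp
  qed
qed

text \<open>A chain on \<open>J\<close> lifts to \<open>J'\<close>, where the identity holds, and
  \<open>push\<close> commutes with the boundaries.\<close>

lemma square_zero_push:
  assumes "square_zero m' J'"
  shows "square_zero m J"
  unfolding square_zero_def
proof (intro allI ballI)
  fix x k assume k: "k \<in> J"
  obtain x' where x': "\<And>j. j \<in> J \<Longrightarrow> push x' j = x j" using push_surjective[of x] by blast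
  have "boundary m J (boundary m J x) k = boundary m J (push (boundary m' J' x')) k"
    by (intro boundary_cong) (simp add: push_boundary boundary_cong[OF x'])
  also have "\<dots> = push (boundary m' J' (boundary m' J' x')) k"
    by (simp add: push_boundary k)
  also have "\<dots> = 0"
    using assms FJ unfolding push_def square_zero_def by (intro sum.neutral) auto
  finally show "boundary m J (boundary m J x) k = 0" .
qed

text \<open>The bounding chain can be taken among the walls: its coefficient at \<open>n\<close> is
  forced by the value of \<open>x\<close> at \<open>plus n\<close>. The difference \<open>z\<close>
  then vanishes at every \<open>plus n\<close>, and \<open>push z = 0\<close> makes it vanish at
  \<open>minus n\<close> and at the cells that are not split. What remains lives on walls, and being
  a cycle it vanishes there too, since its boundary at \<open>plus n\<close> is a unit times
  \<open>z n\<close>.\<close>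

lemma kernel_acyclic:
  assumes sq: "square_zero m' J'" and x0: "\<And>j. j \<in> J \<Longrightarrow> push x j = 0"
    and cyc: "\<And>j. j \<in> J' \<Longrightarrow> boundary m' J' x j = 0"
  shows "\<exists>y. (\<forall>i\<in>F. y i = 0) \<and> (\<forall>j\<in>J'. boundary m' J' y j = x j)"
proof -
  \<comment> \<open>The incidence number \<open>m' n (plus n)\<close> is its own inverse, so
    multiplying by it solves the equation at \<open>plus n\<close>.\<close>
  define y where "y = (\<lambda>i. if i \<in> F then 0 else m' i (plus i) * x (plus i))"
  define z where "z = (\<lambda>i. x i - boundary m' J' y i)"
  have only: "boundary m' J' v (plus n) = m' n (plus n) * v n"
    if n: "n \<in> J' - F" and v: "\<And>i. i \<in> F \<Longrightarrow> v i = 0" for n v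
  proof -
    have "boundary m' J' v (plus n) = (\<Sum>i\<in>J'. if n = i then m' n (plus n) * v n else 0)"
      unfolding boundary_def
      by (intro sum.cong refl) (use v wall[OF n] in auto)
    then show ?thesis using n fin' by simp
  qed
  have y0: "y i = 0" if "i \<in> F" for i using that by (simp add: y_def)
  have "push (boundary m' J' y) j = 0" if "j \<in> J" for j
  proof -
    have "push y k = 0" for k unfolding push_def using y0 by (intro sum.neutral) auto
    then show ?thesis using that by (simp add: push_boundary boundary_def)
  qed
  then have pz: "push z j = 0" if "j \<in> J" for j
    using that x0 by (simp add: z_def push_diff)
  have zp: "z (plus n) = 0" if "n \<in> J' - F" for n
  proof -
    have "boundary m' J' y (plus n) = (m' n (plus n) * m' n (plus n)) * x (plus n)"
      using only[OF that y0] that by (simp add: y_def)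
    then show ?thesis using wall_self[OF that] by (simp add: z_def)
  qed
  have zF: "z i = 0" if i: "i \<in> F" for i
  proof -
    have j: "\<pi> i \<in> J" using i surj by auto
    have ii: "i \<in> {j'\<in>F. \<pi> j' = \<pi> i}" using i by simp
    from fibre[OF j] show ?thesis
    proof (elim disjE exE bexE conjE)
      fix k assume "{j'\<in>F. \<pi> j' = \<pi> i} = {k}"
      then have "push z (\<pi> i) = z i" using ii unfolding push_def by auto
      then show ?thesis using pz[OF j] by simp
    next
      fix n assume n: "n \<in> J' - F" and fib: "{j'\<in>F. \<pi> j' = \<pi> i} = {plus n, minus n}" "plus n \<noteq> minus n"
      then have "push z (\<pi> i) = z (plus n) + z (minus n)" unfolding push_def by simp
      then have "z (minus n) = 0" using pz[OF j] zp[OF n] by simp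
      then show ?thesis using ii zp[OF n] unfolding fib by auto
    qed
  qed
  have "boundary m' J' z j = 0" if "j \<in> J'" for j
    using that cyc sq unfolding z_def boundary_diff square_zero_def by simp
  then have "m' n (plus n) * z n = 0" if "n \<in> J' - F" for n
    using that only[of n z, OF that zF] plus[OF that] FJ by auto
  then have "z n = 0" if "n \<in> J' - F" for n
    using wall_self[OF that] that by fastforce
  then have "z j = 0" if "j \<in> J'" for j
    using zF that by blast
  then have "\<forall>j\<in>J'. boundary m' J' y j = x j"
    by (simp add: z_def)
  then show ?thesis using y0 by blast
qed

text \<open>A cycle \<open>x\<close> lifts to a chain \<open>x'\<close> whose boundary lies in the
  kernel of \<open>push\<close>. The chain \<open>k\<close> with the same boundary consists of
  walls, so \<open>x' - k\<close> is a cycle still lying over \<open>x\<close>, and a chain that it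
  bounds is pushed forward.\<close>

lemma acyclic_push:
  assumes sq: "square_zero m' J'" and ac: "acyclic_complex m' J'"
  shows "acyclic_complex m J"
  unfolding acyclic_complex_def
proof (intro allI impI)
  fix x assume x: "\<forall>j\<in>J. boundary m J x j = 0"
  obtain x' where x': "\<And>j. j \<in> J \<Longrightarrow> push x' j = x j" using push_surjective[of x] by blast
  have "\<exists>y. (\<forall>i\<in>F. y i = 0) \<and> (\<forall>j\<in>J'. boundary m' J' y j = boundary m' J' x' j)"
  proof (rule kernel_acyclic[OF sq])
    fix j assume "j \<in> J"
    then show "push (boundary m' J' x') j = 0"
      using x by (simp add: push_boundary boundary_cong[OF x'])
  qed (use sq in \<open>simp add: square_zero_def\<close>)
  then obtain k where k: "\<And>i. i \<in> F \<Longrightarrow> k i = 0"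
    "\<And>j. j \<in> J' \<Longrightarrow> boundary m' J' k j = boundary m' J' x' j" by blast
  have "\<forall>j\<in>J'. boundary m' J' (\<lambda>i. x' i - k i) j = 0"
    using k by (simp add: boundary_diff)
  then obtain y where y: "\<And>j. j \<in> J' \<Longrightarrow> boundary m' J' y j = x' j - k j"
    using ac unfolding acyclic_complex_def by blast
  have "boundary m J (push y) j = x j" if "j \<in> J" for j
  proof -
    have "boundary m J (push y) j = push (boundary m' J' y) j" using that by (simp add: push_boundary)
    also have "\<dots> = push x' j" unfolding push_def using FJ y k by (intro sum.cong) auto
    finally show ?thesis using x' that by simp
  qed
  then show "\<exists>y. \<forall>j\<in>J. boundary m J y j = x j" by blast
qed

text \<open>The image of a cycle is the boundary of some \<open>y\<close>. Subtracting the boundary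
  of a lift of \<open>y\<close> moves the cycle into the kernel of \<open>push\<close>, which is
  acyclic.\<close>

lemma acyclic_pull:
  assumes sq: "square_zero m' J'" and ac: "acyclic_complex m J"
  shows "acyclic_complex m' J'"
  unfolding acyclic_complex_def
proof (intro allI impI)
  fix x assume x: "\<forall>j\<in>J'. boundary m' J' x j = 0"
  have "boundary m J (push x) j = 0" if "j \<in> J" for j
    using that x FJ unfolding push_boundary[OF that, symmetric] push_def by (intro sum.neutral) auto
  then obtain y where y: "\<And>j. j \<in> J \<Longrightarrow> boundary m J y j = push x j"
    using ac unfolding acyclic_complex_def by blast
  obtain y' where y': "\<And>j. j \<in> J \<Longrightarrow> push y' j = y j" using push_surjective[of y] by blast
  have "\<exists>k. (\<forall>i\<in>F. k i = 0) \<and> (\<forall>j\<in>J'. boundary m' J' k j = x j - boundary m' J' y' j)"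
  proof (rule kernel_acyclic[OF sq])
    fix j assume "j \<in> J"
    then show "push (\<lambda>j. x j - boundary m' J' y' j) j = 0"
      by (simp add: push_diff push_boundary boundary_cong[OF y'] y)
  qed (use sq x in \<open>simp add: boundary_diff square_zero_def\<close>)
  then obtain k where "\<And>j. j \<in> J' \<Longrightarrow> boundary m' J' k j = x j - boundary m' J' y' j" by blast
  then have "\<forall>j\<in>J'. boundary m' J' (\<lambda>i. k i + y' i) j = x j" by (simp add: boundary_add)
  then show "\<exists>y. \<forall>j\<in>J'. boundary m' J' y j = x j" by blast
qed

end

text \<open>Acyclicity over the integers yields a contracting homotopy \<open>h\<close>, because the basis elements can be
  lifted one degree at a time; unlike acyclicity, the homotopy survives a change of coefficients.\<close>

lemma contracting_homotopy:
  fixes m :: "'i \<Rightarrow> 'i \<Rightarrow> int" and rk :: "'i \<Rightarrow> nat"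
  assumes fin: "finite J" and sq: "square_zero m J" and ac: "acyclic_complex m J"
    and rk: "\<And>i j. i \<in> J \<Longrightarrow> j \<in> J \<Longrightarrow> m i j \<noteq> 0 \<Longrightarrow> rk i = Suc (rk j)"
  shows "\<exists>h. \<forall>i\<in>J. \<forall>j\<in>J.
    (\<Sum>k\<in>J. h i k * m k j) + (\<Sum>k\<in>J. m i k * h k j) = (if i = j then 1 else 0)"
proof -
  have "\<exists>h. \<forall>i\<in>J. rk i < r \<longrightarrow> (\<forall>j\<in>J.
    (\<Sum>k\<in>J. h i k * m k j) + (\<Sum>k\<in>J. m i k * h k j) = (if i = j then 1 else 0))" for r
  proof (induction r)
    case (Suc r)
    then obtain h where h: "\<And>i j. i \<in> J \<Longrightarrow> rk i < r \<Longrightarrow> j \<in> J \<Longrightarrow>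
      (\<Sum>k\<in>J. h i k * m k j) + (\<Sum>k\<in>J. m i k * h k j) = (if i = j then 1 else 0)"
      by blast
    \<comment> \<open>The right-hand side is the basis element \<open>i\<close> minus
      \<open>h\<close> applied to its boundary. It is a cycle because that boundary has rank below
      \<open>r\<close>, where \<open>h\<close> already satisfies the relation. A chain with this
      boundary becomes the new row of \<open>h\<close>.\<close>
    have "\<exists>y. \<forall>j\<in>J. boundary m J y j = (if i = j then 1 else 0) - (\<Sum>k\<in>J. m i k * h k j)"
      if i: "i \<in> J" "rk i = r" for i
    proof -
      let ?c = "\<lambda>j. (if i = j then 1 else 0) - (\<Sum>k\<in>J. m i k * h k j)"
      have "boundary m J ?c j = 0" if j: "j \<in> J" for j
      proof -
        have "boundary m J (\<lambda>l. \<Sum>k\<in>J. m i k * h k l) j = (\<Sum>l\<in>J. \<Sum>k\<in>J. m i k * (h k l * m l j))"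
          unfolding boundary_def by (simp add: sum_distrib_left mult_ac)
        also have "\<dots> = (\<Sum>k\<in>J. m i k * (\<Sum>l\<in>J. h k l * m l j))"
          by (subst sum.swap) (simp add: sum_distrib_left)
        also have "\<dots> = (\<Sum>k\<in>J. m i k * ((if k = j then 1 else 0) - (\<Sum>l\<in>J. m k l * h l j)))"
        proof (intro sum.cong refl)
          fix k assume k: "k \<in> J"
          show "m i k * (\<Sum>l\<in>J. h k l * m l j) = m i k * ((if k = j then 1 else 0) - (\<Sum>l\<in>J. m k l * h l j))"
          proof (cases "m i k = 0")
            case False
            then have "rk k < r" using rk[OF i(1) k] i by simp
            then have "(\<Sum>l\<in>J. h k l * m l j) = (if k = j then 1 else 0) - (\<Sum>l\<in>J. m k l * h l j)"
              using h[OF k _ j] by (simp add: eq_diff_eq)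
            then show ?thesis by simp
          qed simp
        qed
        also have "\<dots> = (\<Sum>k\<in>J. if j = k then m i j else 0) - (\<Sum>k\<in>J. \<Sum>l\<in>J. m i k * m k l * h l j)"
          unfolding sum_subtractf[symmetric]
          by (intro sum.cong refl) (simp add: right_diff_distrib sum_distrib_left mult.assoc)
        also have "(\<Sum>k\<in>J. \<Sum>l\<in>J. m i k * m k l * h l j) = (\<Sum>l\<in>J. (\<Sum>k\<in>J. m i k * m k l) * h l j)"
          by (subst sum.swap) (simp add: sum_distrib_right)
        also have "\<dots> = 0"
          using square_zeroD[OF fin sq i(1)] by (intro sum.neutral) auto
        finally have "boundary m J (\<lambda>l. \<Sum>k\<in>J. m i k * h k l) j = m i j"
          using fin j by simp
        moreover have "boundary m J (\<lambda>j. if i = j then 1 else 0) j = m i j"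
        proof -
          have "boundary m J (\<lambda>j. if i = j then 1 else 0) j = (\<Sum>l\<in>J. if i = l then m i j else 0)"
            unfolding boundary_def by (intro sum.cong) auto
          then show ?thesis using fin i by simp
        qed
        ultimately show ?thesis by (simp add: boundary_diff)
      qed
      then show ?thesis using ac unfolding acyclic_complex_def by blast
    qed
    then obtain Y where Y: "\<And>i j. i \<in> J \<Longrightarrow> rk i = r \<Longrightarrow> j \<in> J \<Longrightarrow>
      boundary m J (Y i) j = (if i = j then 1 else 0) - (\<Sum>k\<in>J. m i k * h k j)"
      by metis
    define h' where "h' = (\<lambda>i. if rk i = r then Y i else h i)"
    \<comment> \<open>Only rows of rank below \<open>r\<close> contribute, and there
      \<open>h'\<close> agrees with \<open>h\<close>.\<close>
    have eq: "(\<Sum>k\<in>J. m i k * h' k j) = (\<Sum>k\<in>J. m i k * h k j)" if "i \<in> J" "rk i \<le> r" for i j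
    proof (intro sum.cong refl)
      fix k assume k: "k \<in> J"
      show "m i k * h' k j = m i k * h k j"
        using rk[OF that(1) k] that(2) by (cases "m i k = 0") (auto simp: h'_def)
    qed
    have "(\<Sum>k\<in>J. h' i k * m k j) + (\<Sum>k\<in>J. m i k * h' k j) = (if i = j then 1 else 0)"
      if "i \<in> J" "rk i < Suc r" "j \<in> J" for i j
    proof (cases "rk i = r")
      case True
      have "(\<Sum>k\<in>J. h' i k * m k j) = boundary m J (Y i) j"
        using True by (simp add: h'_def boundary_def mult.commute)
      then show ?thesis using Y[OF that(1) True that(3)] eq[of i j] that True by simp
    next
      case False
      then show ?thesis using h[of i j] eq[of i j] that by (simp add: h'_def)
    qed
    then show ?case by blast
  qed simp
  from this[of "Suc (Max (rk ` J))"] obtain h where h: "\<And>i j. i \<in> J \<Longrightarrow> rk i < Suc (Max (rk ` J)) \<Longrightarrow> j \<in> J \<Longrightarrow>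
    (\<Sum>k\<in>J. h i k * m k j) + (\<Sum>k\<in>J. m i k * h k j) = (if i = j then 1 else 0)"
    by blast
  have "rk i < Suc (Max (rk ` J))" if "i \<in> J" for i using that fin by (simp add: less_Suc_eq_le)
  then show ?thesis using h by blast
qed

section \<open>Decompositions into open cones\<close>

text \<open>For a relatively open convex cone \<open>D\<close> this is the topological closure, expressed without a
  topology.\<close>

definition cone_closure :: "'v::real_vector set \<Rightarrow> 'v set" where
  "cone_closure D = {v. \<forall>w\<in>D. v + w \<in> D}"

text \<open>Relative openness is algebraic: from each point one may move a little in every direction
  of the span. Only positive multiples are required, so \<open>0\<close> need not belong to the
  cone, while \<open>{0}\<close> is itself a cell.\<close>

definition open_cone :: "'v::real_vector set \<Rightarrow> bool" where
  "open_cone D \<longleftrightarrow> D \<noteq> {} \<and> (\<forall>x\<in>D. \<forall>y\<in>D. x + y \<in> D) \<and> (\<forall>x\<in>D. \<forall>a>0. a *\<^sub>R x \<in> D) \<and>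
     (\<forall>x\<in>D. \<forall>v\<in>span D. \<exists>e>0. x + e *\<^sub>R v \<in> D)"

lemma open_cone_add: "open_cone D \<Longrightarrow> x \<in> D \<Longrightarrow> y \<in> D \<Longrightarrow> x + y \<in> D"
  by (simp add: open_cone_def)

lemma open_cone_scale: "open_cone D \<Longrightarrow> x \<in> D \<Longrightarrow> 0 < a \<Longrightarrow> a *\<^sub>R x \<in> D"
  by (simp add: open_cone_def)

lemma open_cone_nonempty: "open_cone D \<Longrightarrow> \<exists>x. x \<in> D"
  by (auto simp: open_cone_def)

lemma open_cone_perturb:
  assumes D: "open_cone D" and x: "x \<in> D" and v: "v \<in> span D"
  shows "\<exists>e>0. \<forall>e'. 0 \<le> e' \<and> e' \<le> e \<longrightarrow> x + e' *\<^sub>R v \<in> D"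
proof -
  obtain e where e: "0 < e" "x + e *\<^sub>R v \<in> D" using assms unfolding open_cone_def by blast
  have "x + e' *\<^sub>R v \<in> D" if e': "0 \<le> e'" "e' \<le> e" for e'
  proof -
    consider "e' = 0" | "e' = e" | "0 < e'" "e' < e" using e' by linarith
    then show ?thesis
    proof cases
      case 3
      have "(1 - e' / e) *\<^sub>R x \<in> D" "(e' / e) *\<^sub>R (x + e *\<^sub>R v) \<in> D"
        using 3 e(1) by (auto intro!: open_cone_scale[OF D x] open_cone_scale[OF D e(2)])
      then have "(1 - e' / e) *\<^sub>R x + (e' / e) *\<^sub>R (x + e *\<^sub>R v) \<in> D"
        by (rule open_cone_add[OF D])
      also have "(1 - e' / e) *\<^sub>R x + (e' / e) *\<^sub>R (x + e *\<^sub>R v) = x + e' *\<^sub>R v"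
        using e by (simp add: algebra_simps)
      finally show ?thesis .
    qed (use x e in auto)
  qed
  then show ?thesis using e(1) by blast
qed

lemma subset_cone_closure: "open_cone D \<Longrightarrow> D \<subseteq> cone_closure D"
  by (auto simp: cone_closure_def open_cone_def)

lemma cone_closure_subset_span:
  assumes "open_cone D"
  shows "cone_closure D \<subseteq> span D"
proof
  fix v assume v: "v \<in> cone_closure D"
  obtain w where w: "w \<in> D" using open_cone_nonempty[OF assms] by blast
  then have "(v + w) - w \<in> span D" using v by (intro span_diff span_base) (auto simp: cone_closure_def)
  then show "v \<in> span D" by simp
qed

text \<open>One direction suffices: any other point \<open>w'\<close> of the cone splits into
  \<open>e *\<^sub>R w\<close> and a remainder that stays in the cone for small
  \<open>e\<close>.\<close>

lemma cone_closureI: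
  assumes D: "open_cone D" and w: "w \<in> D" and v: "\<And>e. 0 < e \<Longrightarrow> v + e *\<^sub>R w \<in> D"
  shows "v \<in> cone_closure D"
  unfolding cone_closure_def
proof (intro CollectI ballI)
  fix w' assume w': "w' \<in> D"
  have "- w \<in> span D" using w by (simp add: span_neg span_base)
  then obtain e where e: "0 < e" "w' + e *\<^sub>R (- w) \<in> D" using D w' unfolding open_cone_def by blast
  have "(v + e *\<^sub>R w) + (w' + e *\<^sub>R (- w)) \<in> D"
    using v[OF e(1)] e(2) by (rule open_cone_add[OF D])
  then show "v + w' \<in> D" by simp
qed

text \<open>Idempotence of the closure. With \<open>d\<close> in \<open>D\<close>, a point of
  \<open>E\<close> splits into a small multiple of \<open>d\<close>, which is absorbed by
  \<open>c\<close>, and a remainder that is still in \<open>E\<close>.\<close>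

lemma cone_closure_mono:
  assumes D: "open_cone D" and E: "open_cone E" and sub: "D \<subseteq> cone_closure E"
  shows "cone_closure D \<subseteq> cone_closure E"
proof
  fix c assume c: "c \<in> cone_closure D"
  obtain d where d: "d \<in> D" using open_cone_nonempty[OF D] by blast
  show "c \<in> cone_closure E"
    unfolding cone_closure_def
  proof (intro CollectI ballI)
    fix e assume e: "e \<in> E"
    have "- d \<in> span E" using d sub cone_closure_subset_span[OF E] by (auto simp: span_neg)
    then obtain t where t: "0 < t" "e + t *\<^sub>R (- d) \<in> E" using E e unfolding open_cone_def by blast
    have "c + t *\<^sub>R d \<in> cone_closure E"
      using c open_cone_scale[OF D d t(1)] sub by (auto simp: cone_closure_def)
    then have "(c + t *\<^sub>R d) + (e + t *\<^sub>R (- d)) \<in> E" using t(2) unfolding cone_closure_def by blast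
    then show "c + e \<in> E" by simp
  qed
qed

text \<open>A small step from a point of \<open>C\<close> towards \<open>w\<close> stays in
  \<open>C\<close>, because \<open>w\<close> lies in its span, and enters \<open>D\<close>, because
  \<open>C\<close> lies in the closure of \<open>D\<close>. In a decomposition this turns equality
  of spans into equality of cells.\<close>

lemma open_cone_meets:
  assumes C: "open_cone C" and D: "open_cone D" and sub: "C \<subseteq> cone_closure D"
    and w: "w \<in> D" "w \<in> span C"
  shows "C \<inter> D \<noteq> {}"
proof -
  obtain c where c: "c \<in> C" using open_cone_nonempty[OF C] by blast
  obtain e where e: "0 < e" "c + e *\<^sub>R w \<in> C" using C c w(2) unfolding open_cone_def by blast
  have "c + e *\<^sub>R w \<in> D"
    using c sub open_cone_scale[OF D w(1) e(1)] by (auto simp: cone_closure_def)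
  then show ?thesis using e by blast
qed

definition decomposition :: "'v::real_vector set set \<Rightarrow> bool" where
  "decomposition \<D> \<longleftrightarrow> finite \<D> \<and> \<Union>\<D> = UNIV \<and> (\<forall>C\<in>\<D>. open_cone C) \<and>
     (\<forall>C\<in>\<D>. \<forall>D\<in>\<D>. C \<inter> D \<noteq> {} \<longrightarrow> C = D) \<and>
     (\<forall>C\<in>\<D>. \<forall>D\<in>\<D>. C \<inter> cone_closure D \<noteq> {} \<longrightarrow> C \<subseteq> cone_closure D)"

lemma decompositionD:
  assumes "decomposition \<D>"
  shows "finite \<D>" "C \<in> \<D> \<Longrightarrow> open_cone C"
    "C \<in> \<D> \<Longrightarrow> D \<in> \<D> \<Longrightarrow> x \<in> C \<Longrightarrow> x \<in> D \<Longrightarrow> C = D"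
    "C \<in> \<D> \<Longrightarrow> D \<in> \<D> \<Longrightarrow> x \<in> C \<Longrightarrow> x \<in> cone_closure D \<Longrightarrow> C \<subseteq> cone_closure D"
proof -
  show "finite \<D>" "C \<in> \<D> \<Longrightarrow> open_cone C"
    using assms by (simp_all add: decomposition_def)
  show "C \<in> \<D> \<Longrightarrow> D \<in> \<D> \<Longrightarrow> x \<in> C \<Longrightarrow> x \<in> D \<Longrightarrow> C = D"
  proof -
    assume *: "C \<in> \<D>" "D \<in> \<D>" "x \<in> C" "x \<in> D"
    then have "C \<inter> D \<noteq> {}" by blast
    with * show "C = D" using assms unfolding decomposition_def by simp
  qed
  show "C \<in> \<D> \<Longrightarrow> D \<in> \<D> \<Longrightarrow> x \<in> C \<Longrightarrow> x \<in> cone_closure D \<Longrightarrow> C \<subseteq> cone_closure D"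
  proof -
    assume *: "C \<in> \<D>" "D \<in> \<D>" "x \<in> C" "x \<in> cone_closure D"
    then have "C \<inter> cone_closure D \<noteq> {}" by blast
    with * show "C \<subseteq> cone_closure D" using assms unfolding decomposition_def by simp
  qed
qed

lemma decomposition_cover:
  assumes "decomposition \<D>"
  obtains C where "C \<in> \<D>" "x \<in> C"
proof -
  have "x \<in> \<Union>\<D>" using assms by (simp add: decomposition_def)
  then show ?thesis using that by blast
qed

definition facet :: "'v::real_vector set \<Rightarrow> 'v set \<Rightarrow> bool" where
  "facet C D \<longleftrightarrow> C \<subseteq> cone_closure D \<and> dim D = Suc (dim C)"

text \<open>The augmented complex of a decomposition: \<open>None\<close> is the target of the augmentation.\<close>

fun incidence :: "'v::real_vector set option \<Rightarrow> 'v set option \<Rightarrow> int" where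
  "incidence (Some C) (Some D) = (if facet C D then side_sign (span C) (SOME w. w \<in> D) else 0)"
| "incidence (Some C) None = (if dim C = dim (UNIV :: 'v set) then 1 else 0)"
| "incidence None j = 0"

text \<open>For \<open>p\<close> in the cell of a cone this is the star of that cone. Fixing a point
  instead of a cell makes sense before and after a cut, even when the cell of \<open>p\<close> is
  itself cut.\<close>

definition star :: "'v::real_vector set set \<Rightarrow> 'v \<Rightarrow> 'v set set" where
  "star \<D> p = {C \<in> \<D>. p \<in> cone_closure C}"

definition star_index :: "'v::real_vector set set \<Rightarrow> 'v \<Rightarrow> 'v set option set" where
  "star_index \<D> p = insert None (Some ` star \<D> p)"

definition cone_piece :: "('v::real_vector \<Rightarrow> real) \<Rightarrow> 'v set \<Rightarrow> real \<Rightarrow> 'v set" where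
  "cone_piece u C s = {x \<in> C. sgn (u x) = s}"

text \<open>The sign is taken from a point \<open>y\<close> of \<open>C\<close>, which excludes
  empty pieces.\<close>

definition cut :: "('v::real_vector \<Rightarrow> real) \<Rightarrow> 'v set set \<Rightarrow> 'v set set" where
  "cut u \<D> = {cone_piece u C (sgn (u y)) | C y. C \<in> \<D> \<and> y \<in> C}"

lemma small_perturb_sgn:
  fixes a b :: real
  assumes "a \<noteq> 0" "0 < e0"
  shows "\<exists>e>0. e \<le> e0 \<and> sgn (a + e * b) = sgn a"
proof (cases "b = 0")
  case False
  define e where "e = min e0 (\<bar>a\<bar> / (2 * \<bar>b\<bar>))"
  have "0 < e" "e \<le> e0" using assms False by (simp_all add: e_def)
  have "e * \<bar>b\<bar> \<le> (\<bar>a\<bar> / (2 * \<bar>b\<bar>)) * \<bar>b\<bar>" by (intro mult_right_mono) (simp_all add: e_def)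
  also have "\<dots> < \<bar>a\<bar>" using assms False by simp
  finally have "\<bar>e * b\<bar> < \<bar>a\<bar>" using \<open>0 < e\<close> by (simp add: abs_mult)
  then have "sgn (a + e * b) = sgn a" by (auto simp: sgn_if abs_if split: if_splits)
  then show ?thesis using \<open>0 < e\<close> \<open>e \<le> e0\<close> by blast
qed (use assms in auto)

lemma cone_piece_perturb:
  fixes u :: "'v::real_vector \<Rightarrow> real"
  assumes u: "linear u" and C: "open_cone C" and x: "x \<in> cone_piece u C s" and v: "v \<in> span C"
    and ok: "s = 0 \<Longrightarrow> u v = 0"
  shows "\<exists>e>0. x + e *\<^sub>R v \<in> cone_piece u C s"
proof -
  have xC: "x \<in> C" and s: "sgn (u x) = s" using x by (auto simp: cone_piece_def)
  obtain e0 where e0: "0 < e0" "\<And>e'. 0 \<le> e' \<Longrightarrow> e' \<le> e0 \<Longrightarrow> x + e' *\<^sub>R v \<in> C"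
    using open_cone_perturb[OF C xC v] by blast
  have ux: "u (x + e *\<^sub>R v) = u x + e * u v" for e using u by (simp add: linear_add linear_scale)
  show ?thesis
  proof (cases "s = 0")
    case True
    then have "x + e0 *\<^sub>R v \<in> cone_piece u C s"
      using e0 ux ok s by (simp add: cone_piece_def sgn_0_0)
    then show ?thesis using e0(1) by blast
  next
    case False
    then have "u x \<noteq> 0" using s by auto
    from small_perturb_sgn[OF this e0(1), of "u v"] obtain e where
      "0 < e" "e \<le> e0" "sgn (u x + e * u v) = sgn (u x)" by blast
    then have "x + e *\<^sub>R v \<in> cone_piece u C s" using e0(2)[of e] ux s by (simp add: cone_piece_def)
    then show ?thesis using \<open>0 < e\<close> by blast
  qed
qed

lemma span_of_perturb:
  assumes "x \<in> D" "x + e *\<^sub>R v \<in> D" "0 < e"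
  shows "v \<in> span D"
proof -
  have "(1 / e) *\<^sub>R ((x + e *\<^sub>R v) - x) \<in> span D"
    using assms by (intro span_scale span_diff span_base)
  then show ?thesis using assms(3) by simp
qed

lemma span_cone_piece:
  assumes u: "linear u" and C: "open_cone C" and ne: "cone_piece u C s \<noteq> {}"
  shows "span (cone_piece u C s) = {v \<in> span C. s = 0 \<longrightarrow> u v = 0}"
proof
  have "subspace {v \<in> span C. s = 0 \<longrightarrow> u v = 0}"
    using u by (auto simp: subspace_def linear_0 linear_add linear_scale span_zero span_add span_scale)
  moreover have "cone_piece u C s \<subseteq> {v \<in> span C. s = 0 \<longrightarrow> u v = 0}"
    by (auto simp: cone_piece_def span_base sgn_0_0)
  ultimately show "span (cone_piece u C s) \<subseteq> {v \<in> span C. s = 0 \<longrightarrow> u v = 0}"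
    by (rule span_minimal[rotated])
next
  show "{v \<in> span C. s = 0 \<longrightarrow> u v = 0} \<subseteq> span (cone_piece u C s)"
    using cone_piece_perturb[OF u C] ne span_of_perturb by blast
qed

lemma open_cone_piece:
  assumes u: "linear u" and C: "open_cone C" and ne: "cone_piece u C s \<noteq> {}"
  shows "open_cone (cone_piece u C s)"
  unfolding open_cone_def
proof (intro conjI ballI allI impI ne)
  fix x y assume xy: "x \<in> cone_piece u C s" "y \<in> cone_piece u C s"
  then show "x + y \<in> cone_piece u C s"
    using u open_cone_add[OF C] by (auto simp: cone_piece_def linear_add sgn_if split: if_splits)
next
  fix x and a :: real assume "x \<in> cone_piece u C s" "0 < a"
  then show "a *\<^sub>R x \<in> cone_piece u C s"
    using u open_cone_scale[OF C] by (auto simp: cone_piece_def linear_scale sgn_mult)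
next
  fix x v assume "x \<in> cone_piece u C s" "v \<in> span (cone_piece u C s)"
  then show "\<exists>e>0. x + e *\<^sub>R v \<in> cone_piece u C s"
    using cone_piece_perturb[OF u C] span_cone_piece[OF u C ne] by blast
qed

text \<open>A nonzero value of \<open>u\<close> keeps its sign under a small step in the direction
  of the piece, so the closure stays in the closed side. Conversely, adding a point of the piece to
  a point of the closed side gives the sign \<open>s\<close>.\<close>

lemma cone_closure_piece:
  assumes u: "linear u" and C: "open_cone C" and ne: "cone_piece u C s \<noteq> {}"
  shows "cone_closure (cone_piece u C s) = {v \<in> cone_closure C. u v = 0 \<or> sgn (u v) = s}"
proof (intro subset_antisym subsetI)
  fix v assume v: "v \<in> {v \<in> cone_closure C. u v = 0 \<or> sgn (u v) = s}"
  show "v \<in> cone_closure (cone_piece u C s)"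
    unfolding cone_closure_def
  proof (intro CollectI ballI)
    fix w assume w: "w \<in> cone_piece u C s"
    then have "v + w \<in> C" using v by (auto simp: cone_closure_def cone_piece_def)
    moreover have "sgn (u (v + w)) = s"
      using v w u by (auto simp: cone_piece_def linear_add sgn_if split: if_splits)
    ultimately show "v + w \<in> cone_piece u C s" by (simp add: cone_piece_def)
  qed
next
  fix v assume v: "v \<in> cone_closure (cone_piece u C s)"
  obtain w where w: "w \<in> cone_piece u C s" using ne by blast
  have ew: "v + e *\<^sub>R w \<in> cone_piece u C s" if "0 < e" for e
    using v open_cone_scale[OF open_cone_piece[OF u C ne] w that] by (simp add: cone_closure_def)
  have "v \<in> cone_closure C"
    by (rule cone_closureI[OF C, of w]) (use w ew in \<open>auto simp: cone_piece_def\<close>)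
  moreover have "u v = 0 \<or> sgn (u v) = s"
  proof (rule disjCI)
    assume "sgn (u v) \<noteq> s"
    show "u v = 0"
    proof (rule ccontr)
      assume "u v \<noteq> 0"
      from small_perturb_sgn[OF this, of 1 "u w"] obtain e where
        "0 < e" "sgn (u v + e * u w) = sgn (u v)" by auto
      then show False using ew[of e] \<open>sgn (u v) \<noteq> s\<close> u
        by (simp add: cone_piece_def linear_add linear_scale)
    qed
  qed
  ultimately show "v \<in> {v \<in> cone_closure C. u v = 0 \<or> sgn (u v) = s}" by blast
qed

lemma cone_piece_split:
  assumes u: "linear u" and C: "open_cone C" and z: "z \<in> C" "u z = 0" and v: "v \<in> span C" "u v \<noteq> 0"
    and s: "s = 1 \<or> s = -1"
  shows "cone_piece u C s \<noteq> {}"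
proof -
  have "(s * sgn (u v)) *\<^sub>R v \<in> span C" using v by (simp add: span_scale)
  then obtain e where e: "0 < e" "z + e *\<^sub>R ((s * sgn (u v)) *\<^sub>R v) \<in> C"
    using C z(1) unfolding open_cone_def by blast
  moreover have "sgn (u (z + e *\<^sub>R ((s * sgn (u v)) *\<^sub>R v))) = s"
    using u e v s z by (auto simp: linear_add linear_scale sgn_mult)
  ultimately show ?thesis by (auto simp: cone_piece_def)
qed

lemma decomposition_cut:
  assumes u: "linear u" and D: "decomposition \<D>"
  shows "decomposition (cut u \<D>)"
  unfolding decomposition_def
proof (intro conjI ballI impI)
  have "cut u \<D> \<subseteq> (\<lambda>(C, s). cone_piece u C s) ` (\<D> \<times> {-1, 0, 1})"
  proof
    fix C' assume "C' \<in> cut u \<D>"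
    then obtain C y where "C' = cone_piece u C (sgn (u y))" "C \<in> \<D>" by (auto simp: cut_def)
    moreover have "sgn (u y) \<in> {-1, 0, 1}" by (auto simp: sgn_if)
    ultimately show "C' \<in> (\<lambda>(C, s). cone_piece u C s) ` (\<D> \<times> {-1, 0, 1})" by blast
  qed
  then show "finite (cut u \<D>)" by (rule finite_subset) (use decompositionD(1)[OF D] in auto)
  show "\<Union> (cut u \<D>) = UNIV"
  proof (intro equalityI subsetI UNIV_I)
    fix x
    obtain C where "C \<in> \<D>" "x \<in> C" by (rule decomposition_cover[OF D])
    then have "x \<in> cone_piece u C (sgn (u x))" "cone_piece u C (sgn (u x)) \<in> cut u \<D>"
      by (auto simp: cone_piece_def cut_def)
    then show "x \<in> \<Union> (cut u \<D>)" by blast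
  qed
next
  fix C' assume "C' \<in> cut u \<D>"
  then obtain C y where C: "C' = cone_piece u C (sgn (u y))" "C \<in> \<D>" "y \<in> C" by (auto simp: cut_def)
  then have "y \<in> C'" by (simp add: cone_piece_def)
  then show "open_cone C'" using open_cone_piece[OF u decompositionD(2)[OF D C(2)]] C(1) by blast
next
  fix C' E' assume "C' \<in> cut u \<D>" "E' \<in> cut u \<D>" and ne: "C' \<inter> E' \<noteq> {}"
  then obtain C y E z where C: "C' = cone_piece u C (sgn (u y))" "C \<in> \<D>" "y \<in> C"
    and E: "E' = cone_piece u E (sgn (u z))" "E \<in> \<D>" "z \<in> E" by (auto simp: cut_def)
  from ne obtain x where x: "x \<in> C'" "x \<in> E'" by blast
  then have "C = E" using decompositionD(3)[OF D C(2) E(2), of x] C E by (auto simp: cone_piece_def)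
  then show "C' = E'" using x C E by (auto simp: cone_piece_def)
next
  fix C' E' assume "C' \<in> cut u \<D>" "E' \<in> cut u \<D>" and ne: "C' \<inter> cone_closure E' \<noteq> {}"
  then obtain C y E z where C: "C' = cone_piece u C (sgn (u y))" "C \<in> \<D>" "y \<in> C"
    and E: "E' = cone_piece u E (sgn (u z))" "E \<in> \<D>" "z \<in> E" by (auto simp: cut_def)
  have zE: "z \<in> E'" using E by (simp add: cone_piece_def)
  have cl: "cone_closure E' = {v \<in> cone_closure E. u v = 0 \<or> sgn (u v) = sgn (u z)}"
    using cone_closure_piece[OF u decompositionD(2)[OF D E(2)]] zE E(1) by blast
  from ne obtain x where x: "x \<in> C'" "x \<in> cone_closure E'" by blast
  then have "C \<subseteq> cone_closure E"
    using decompositionD(4)[OF D C(2) E(2), of x] C cl by (auto simp: cone_piece_def)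
  moreover have "u v = 0 \<or> sgn (u v) = sgn (u z)" if "v \<in> C'" for v
  proof -
    have "sgn (u v) = sgn (u x)" using x(1) that C(1) by (simp add: cone_piece_def)
    then show ?thesis using x(2) cl by (auto simp: sgn_zero_iff)
  qed
  ultimately show "C' \<subseteq> cone_closure E'" using C(1) cl by (auto simp: cone_piece_def)
qed

context finite_dim
begin

text \<open>A point of \<open>D\<close> in the span of \<open>C\<close> would make the cells meet
  and hence coincide. So any point of \<open>D\<close> supplies the one missing dimension.\<close>

lemma facet_span:
  fixes C D :: "'v set"
  assumes dec: "decomposition \<D>" and C: "C \<in> \<D>" and D: "D \<in> \<D>" and f: "facet C D" and w: "w \<in> D"
  shows "w \<notin> span C" "span D = span (insert w (span C))"
proof -
  have oC: "open_cone C" and oD: "open_cone D" using decompositionD(2)[OF dec] C D by auto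
  have sub: "C \<subseteq> cone_closure D" and dm: "dim D = Suc (dim C)" using f by (auto simp: facet_def)
  show w': "w \<notin> span C"
  proof
    assume "w \<in> span C"
    then obtain x where "x \<in> C" "x \<in> D" using open_cone_meets[OF oC oD sub w] by blast
    then have "C = D" by (rule decompositionD(3)[OF dec C D])
    then show False using dm by simp
  qed
  have "span (insert w (span C)) \<subseteq> span D"
    using w sub cone_closure_subset_span[OF oD]
    by (intro span_minimal) (auto simp: span_base intro: span_minimal[THEN subsetD])
  moreover have "dim (span (insert w (span C))) = dim (span D)"
    using w' dm by (simp add: fd.dim_insert span_span)
  ultimately show "span D = span (insert w (span C))"
    using fd.subspace_dim_equal[of "span (insert w (span C))" "span D"] by simp
qed

lemma closure_eq_dim:
  fixes C D :: "'v set"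
  assumes dec: "decomposition \<D>" and C: "C \<in> \<D>" and D: "D \<in> \<D>"
    and sub: "C \<subseteq> cone_closure D" and dm: "dim D \<le> dim C"
  shows "C = D"
proof -
  have oC: "open_cone C" and oD: "open_cone D" using decompositionD(2)[OF dec] C D by auto
  have "span C \<subseteq> span D" using sub cone_closure_subset_span[OF oD] by (intro span_minimal) auto
  then have "span C = span D" using dm by (intro fd.subspace_dim_equal) auto
  moreover obtain w where w: "w \<in> D" using open_cone_nonempty[OF oD] by blast
  ultimately have "w \<in> span C" by (simp add: span_base)
  then obtain x where "x \<in> C" "x \<in> D" using open_cone_meets[OF oC oD sub w] by blast
  then show ?thesis by (rule decompositionD(3)[OF dec C D])
qed

text \<open>The cone \<open>D\<close> is convex and avoids \<open>L\<close>, hence lies on one side: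
  were the coefficient \<open>a\<close> of \<open>w\<close> not positive,
  \<open>w' - a *\<^sub>R w\<close> would be a point of \<open>D\<close> in \<open>L\<close>. This
  makes the incidence number independent of the chosen point.\<close>

lemma side_sign_same_cone:
  fixes D L :: "'v set"
  assumes D: "open_cone D" and L: "subspace L" and disj: "D \<inter> L = {}"
    and w: "w \<in> D" "w' \<in> D" "w' \<in> span (insert w L)"
  shows "side_sign L w' = side_sign L w"
proof -
  obtain a where "w' - a *\<^sub>R w \<in> span L" using w(3) by (auto simp: span_breakdown_eq)
  then have l: "w' - a *\<^sub>R w \<in> L" using L by (simp add: span_eq_iff[THEN iffD2])
  have "0 < a"
  proof (rule ccontr)
    assume "\<not> 0 < a"
    have "w' - a *\<^sub>R w \<in> D"
    proof (cases "a = 0")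
      case False
      then have "w' + (- a) *\<^sub>R w \<in> D"
        using w \<open>\<not> 0 < a\<close> by (intro open_cone_add[OF D] open_cone_scale[OF D]) auto
      then show ?thesis by simp
    qed (use w in simp)
    then show False using l disj by blast
  qed
  then show ?thesis
    using side_sign_scale_add[OF L _ l, of w a] disj w(1) by auto
qed

lemma incidence_facet:
  fixes C D :: "'v set"
  assumes dec: "decomposition \<D>" and C: "C \<in> \<D>" and D: "D \<in> \<D>" and f: "facet C D" and w: "w \<in> D"
  shows "incidence (Some C) (Some D) = side_sign (span C) w"
proof -
  have ex: "(SOME w. w \<in> D) \<in> D" using w by (rule someI)
  have "D \<inter> span C = {}" using facet_span(1)[OF dec C D f] by blast
  moreover have "(SOME w. w \<in> D) \<in> span (insert w (span C))"
    using facet_span(2)[OF dec C D f w] span_base[OF ex] by simp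
  ultimately have "side_sign (span C) (SOME w. w \<in> D) = side_sign (span C) w"
    using side_sign_same_cone[OF decompositionD(2)[OF dec D] _ _ w ex] by simp
  then show ?thesis using f by simp
qed

end

section \<open>Subdivision of a star by one hyperplane\<close>

locale hyperplane_cut = finite_dim B for B :: "'v::real_vector set" +
  fixes u :: "'v \<Rightarrow> real" and \<D> :: "'v set set" and p :: 'v
  assumes lin: "linear u" and dec: "decomposition \<D>"
begin

abbreviation "\<D>' \<equiv> cut u \<D>"

lemma dec': "decomposition \<D>'" by (rule decomposition_cut[OF lin dec])

lemma pieceI: "C \<in> \<D> \<Longrightarrow> cone_piece u C s \<noteq> {} \<Longrightarrow> cone_piece u C s \<in> \<D>'"
  by (auto simp: cut_def cone_piece_def)

text \<open>Besides the star of the parent, only the side of \<open>p\<close> matters. If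
  \<open>p\<close> is off the hyperplane, just the pieces on its side survive and no walls occur; if
  \<open>p\<close> is on the hyperplane, all pieces survive.\<close>

lemma star_cut_iff:
  "C' \<in> star \<D>' p \<longleftrightarrow> (\<exists>C\<in>star \<D> p. \<exists>s. C' = cone_piece u C s \<and> C' \<noteq> {} \<and> (u p = 0 \<or> sgn (u p) = s))"
proof
  assume C': "C' \<in> star \<D>' p"
  then obtain C y where C: "C' = cone_piece u C (sgn (u y))" "C \<in> \<D>" "y \<in> C" by (auto simp: cut_def star_def)
  then have ne: "C' \<noteq> {}" by (auto simp: cone_piece_def)
  then show "\<exists>C\<in>star \<D> p. \<exists>s. C' = cone_piece u C s \<and> C' \<noteq> {} \<and> (u p = 0 \<or> sgn (u p) = s)"
    using cone_closure_piece[OF lin decompositionD(2)[OF dec C(2)]] C C' by (auto simp: star_def)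
next
  assume "\<exists>C\<in>star \<D> p. \<exists>s. C' = cone_piece u C s \<and> C' \<noteq> {} \<and> (u p = 0 \<or> sgn (u p) = s)"
  then obtain C s where "C \<in> star \<D> p" "C' = cone_piece u C s" "C' \<noteq> {}" "u p = 0 \<or> sgn (u p) = s" by blast
  then show "C' \<in> star \<D>' p"
    using cone_closure_piece[OF lin decompositionD(2)[OF dec]] pieceI by (auto simp: star_def)
qed

definition parent :: "'v set \<Rightarrow> 'v set" where
  "parent C' = (THE C. C \<in> \<D> \<and> C' \<subseteq> C)"

lemma parent_piece:
  assumes "C \<in> \<D>" "cone_piece u C s \<noteq> {}"
  shows "parent (cone_piece u C s) = C"
  unfolding parent_def
proof (rule the_equality)
  show "C \<in> \<D> \<and> cone_piece u C s \<subseteq> C" using assms by (auto simp: cone_piece_def)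
next
  fix E assume E: "E \<in> \<D> \<and> cone_piece u C s \<subseteq> E"
  obtain x where "x \<in> cone_piece u C s" using assms by blast
  then have "x \<in> C" "x \<in> E" using E by (auto simp: cone_piece_def)
  then show "E = C" using decompositionD(3)[OF dec] E assms by blast
qed

lemma dim_piece:
  assumes C: "C \<in> \<D>" and ne: "cone_piece u C s \<noteq> {}"
  shows "s \<noteq> 0 \<or> (\<forall>x\<in>C. u x = 0) \<Longrightarrow> span (cone_piece u C s) = span C"
    and "s \<noteq> 0 \<or> (\<forall>x\<in>C. u x = 0) \<Longrightarrow> dim (cone_piece u C s) = dim C"
    and "s = 0 \<Longrightarrow> v \<in> C \<Longrightarrow> u v \<noteq> 0 \<Longrightarrow> dim C = Suc (dim (cone_piece u C s))"
proof -
  have oC: "open_cone C" by (rule decompositionD(2)[OF dec C])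
  note sp = span_cone_piece[OF lin oC ne]
  show eq: "span (cone_piece u C s) = span C" if "s \<noteq> 0 \<or> (\<forall>x\<in>C. u x = 0)"
  proof -
    have "u v = 0" if "v \<in> span C" "\<forall>x\<in>C. u x = 0" for v
      using that lin linear_eq_0_on_span by blast
    then show ?thesis using sp that by auto
  qed
  show "dim (cone_piece u C s) = dim C" if "s \<noteq> 0 \<or> (\<forall>x\<in>C. u x = 0)"
    using span_eq_dim[OF eq[OF that]] .
  show "dim C = Suc (dim (cone_piece u C s))" if s: "s = 0" and v: "v \<in> C" "u v \<noteq> 0"
  proof -
    have "v \<notin> span (cone_piece u C s)" using sp s v by simp
    moreover have "span (insert v (cone_piece u C s)) = span C"
    proof (rule subset_antisym)
      show "span (insert v (cone_piece u C s)) \<subseteq> span C"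
        using v by (intro span_mono) (auto simp: cone_piece_def)
      show "span C \<subseteq> span (insert v (cone_piece u C s))"
      proof
        fix x assume x: "x \<in> span C"
        have "u (x - (u x / u v) *\<^sub>R v) = 0" using v lin by (simp add: linear_diff linear_scale)
        moreover have "x - (u x / u v) *\<^sub>R v \<in> span C" using x v(1)
          by (intro span_diff span_scale) (auto simp: span_base)
        ultimately show "x \<in> span (insert v (cone_piece u C s))"
          using sp by (auto simp: span_breakdown_eq)
      qed
    qed
    ultimately show ?thesis
      using fd.dim_insert[of v "cone_piece u C s"] span_eq_dim[of "insert v (cone_piece u C s)" C] by simp
  qed
qed

lemma full_iff:
  assumes "C \<in> \<D>" "cone_piece u C s \<noteq> {}"
  shows "dim (cone_piece u C s) = dim C \<longleftrightarrow> s \<noteq> 0 \<or> (\<forall>x\<in>C. u x = 0)"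
proof
  assume "dim (cone_piece u C s) = dim C"
  then show "s \<noteq> 0 \<or> (\<forall>x\<in>C. u x = 0)" using dim_piece(3)[OF assms] by fastforce
qed (use dim_piece(2)[OF assms] in blast)

definition full_pieces :: "'v set \<Rightarrow> 'v set set" where
  "full_pieces C = {C' \<in> star \<D>' p. dim C' = dim (parent C') \<and> parent C' = C}"

lemma full_pieces_eq:
  assumes C: "C \<in> star \<D> p"
  shows "full_pieces C = {cone_piece u C s | s. cone_piece u C s \<noteq> {} \<and>
    (s \<noteq> 0 \<or> (\<forall>x\<in>C. u x = 0)) \<and> (u p = 0 \<or> sgn (u p) = s)}"
proof -
  have CD: "C \<in> \<D>" using C by (simp add: star_def)
  show ?thesis
  proof (intro subset_antisym subsetI)
    fix C' assume C': "C' \<in> full_pieces C"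
    then obtain E s where E: "E \<in> star \<D> p" "C' = cone_piece u E s" "C' \<noteq> {}" "u p = 0 \<or> sgn (u p) = s"
      by (auto simp: full_pieces_def star_cut_iff)
    moreover have "E = C" using parent_piece[of E s] E C' by (auto simp: full_pieces_def star_def)
    ultimately show "C' \<in> {cone_piece u C s | s. cone_piece u C s \<noteq> {} \<and>
      (s \<noteq> 0 \<or> (\<forall>x\<in>C. u x = 0)) \<and> (u p = 0 \<or> sgn (u p) = s)}"
      using C' full_iff[OF CD, of s] by (auto simp: full_pieces_def)
  next
    fix C' assume "C' \<in> {cone_piece u C s | s. cone_piece u C s \<noteq> {} \<and>
      (s \<noteq> 0 \<or> (\<forall>x\<in>C. u x = 0)) \<and> (u p = 0 \<or> sgn (u p) = s)}"
    then obtain s where s: "C' = cone_piece u C s" "cone_piece u C s \<noteq> {}"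
      "s \<noteq> 0 \<or> (\<forall>x\<in>C. u x = 0)" "u p = 0 \<or> sgn (u p) = s" by blast
    then show "C' \<in> full_pieces C"
      using parent_piece[OF CD s(2)] full_iff[OF CD s(2)] C star_cut_iff by (auto simp: full_pieces_def)
  qed
qed

lemma sign_const:
  assumes C: "C \<in> \<D>" and nz: "\<forall>x\<in>C. u x \<noteq> 0" and xy: "x \<in> C" "y \<in> C"
  shows "sgn (u x) = sgn (u y)"
proof (rule ccontr)
  assume ne: "sgn (u x) \<noteq> sgn (u y)"
  have oC: "open_cone C" by (rule decompositionD(2)[OF dec C])
  \<comment> \<open>The values at \<open>x\<close> and \<open>y\<close> have opposite signs, and
    these weights make them cancel.\<close>
  have "\<bar>u y\<bar> *\<^sub>R x + \<bar>u x\<bar> *\<^sub>R y \<in> C"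
    using nz xy by (intro open_cone_add[OF oC] open_cone_scale[OF oC]) auto
  moreover have "u (\<bar>u y\<bar> *\<^sub>R x + \<bar>u x\<bar> *\<^sub>R y) = 0"
    using lin ne nz xy by (auto simp: linear_add linear_scale sgn_if abs_if split: if_splits)
  ultimately show False using nz by blast
qed

lemma unsplit_piece:
  assumes C: "C \<in> \<D>" and un: "(\<forall>x\<in>C. u x = 0) \<or> (\<forall>x\<in>C. u x \<noteq> 0)" and y: "y \<in> C"
  shows "cone_piece u C (sgn (u y)) = C"
proof -
  have "sgn (u x) = sgn (u y)" if "x \<in> C" for x
    using un
  proof
    assume "\<forall>x\<in>C. u x = 0" then show ?thesis using that y by simp
  next
    assume "\<forall>x\<in>C. u x \<noteq> 0" then show ?thesis using sign_const[OF C _ that y] by blast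
  qed
  then show ?thesis by (auto simp: cone_piece_def)
qed

lemma full_pieces_unsplit:
  assumes C: "C \<in> star \<D> p" and un: "(\<forall>x\<in>C. u x = 0) \<or> (\<forall>x\<in>C. u x \<noteq> 0)"
  shows "full_pieces C = {C}"
proof -
  have CD: "C \<in> \<D>" and pC: "p \<in> cone_closure C" using C by (auto simp: star_def)
  have oC: "open_cone C" by (rule decompositionD(2)[OF dec CD])
  obtain y where y: "y \<in> C" using open_cone_nonempty[OF oC] by blast
  note pc = unsplit_piece[OF CD un]
  have s: "s = sgn (u y)" if "cone_piece u C s \<noteq> {}" for s
    using that pc[OF y] by (auto simp: cone_piece_def)
  have "cone_piece u C (sgn (u y)) \<noteq> {}" using pc[OF y] y by auto
  from cone_closure_piece[OF lin oC this] pC have "u p = 0 \<or> sgn (u p) = sgn (u y)"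
    unfolding pc[OF y] by blast
  moreover have "sgn (u y) \<noteq> 0 \<or> (\<forall>x\<in>C. u x = 0)" using un y by (auto simp: sgn_zero_iff)
  ultimately have "cone_piece u C (sgn (u y)) \<in> full_pieces C"
    unfolding full_pieces_eq[OF C] using \<open>cone_piece u C (sgn (u y)) \<noteq> {}\<close> by blast
  moreover have "C' = C" if C': "C' \<in> full_pieces C" for C'
  proof -
    obtain t where "C' = cone_piece u C t" "cone_piece u C t \<noteq> {}"
      using C' unfolding full_pieces_eq[OF C] by blast
    then show ?thesis using s[of t] pc[OF y] by simp
  qed
  ultimately show ?thesis using pc[OF y] by auto
qed

lemma full_pieces_split:
  assumes C: "C \<in> star \<D> p" and z: "z \<in> C" "u z = 0" and v: "v \<in> C" "u v \<noteq> 0"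
  shows "u p \<noteq> 0 \<Longrightarrow> full_pieces C = {cone_piece u C (sgn (u p))}"
    and "u p = 0 \<Longrightarrow> full_pieces C = {cone_piece u C 1, cone_piece u C (-1)}"
proof -
  have CD: "C \<in> \<D>" using C by (simp add: star_def)
  have ne: "cone_piece u C s \<noteq> {}" if "s = 1 \<or> s = -1" for s
    using cone_piece_split[OF lin decompositionD(2)[OF dec CD] z span_base[OF v(1)] v(2) that] .
  have sv: "s = 1 \<or> s = -1" if "cone_piece u C s \<noteq> {}" "s \<noteq> 0" for s
    using that by (auto simp: cone_piece_def sgn_if split: if_splits)
  have nk: "\<not> (\<forall>x\<in>C. u x = 0)" using v by blast
  show "full_pieces C = {cone_piece u C (sgn (u p))}" if "u p \<noteq> 0"
  proof -
    have "sgn (u p) = 1 \<or> sgn (u p) = -1" using that by (auto simp: sgn_if)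
    then show ?thesis unfolding full_pieces_eq[OF C] using ne that nk by (auto simp: sgn_zero_iff)
  qed
  show "full_pieces C = {cone_piece u C 1, cone_piece u C (-1)}" if "u p = 0"
  proof (intro subset_antisym subsetI)
    fix C' assume "C' \<in> full_pieces C"
    then obtain s where s: "C' = cone_piece u C s" "cone_piece u C s \<noteq> {}" "s \<noteq> 0"
      unfolding full_pieces_eq[OF C] using nk by blast
    from sv[OF this(2,3)] s(1) show "C' \<in> {cone_piece u C 1, cone_piece u C (-1)}" by blast
  next
    have "cone_piece u C s \<in> full_pieces C" if "s = 1 \<or> s = -1" for s
    proof -
      have "s \<noteq> 0" using that by auto
      then show ?thesis unfolding full_pieces_eq[OF C] using ne[OF that] \<open>u p = 0\<close> by blast
    qed
    then show "C' \<in> full_pieces C" if "C' \<in> {cone_piece u C 1, cone_piece u C (-1)}" for C'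
      using that by blast
  qed
qed

text \<open>Suppose \<open>D\<close> contained a zero \<open>z\<close> of \<open>u\<close> and a
  point \<open>v\<close> where \<open>u\<close> does not vanish. Since \<open>C\<close> and
  \<open>v\<close> span \<open>D\<close>, the point \<open>z\<close> is a multiple of
  \<open>v\<close> modulo the span of \<open>C\<close>; that multiple would be zero, putting
  \<open>z\<close> into the span of its facet.\<close>

lemma facet_not_split:
  assumes C: "C \<in> \<D>" and D: "D \<in> \<D>" and f: "facet C D" and k: "\<forall>x\<in>C. u x = 0"
  shows "(\<forall>x\<in>D. u x = 0) \<or> (\<forall>x\<in>D. u x \<noteq> 0)"
proof (rule ccontr)
  assume "\<not> ?thesis"
  then obtain z v where z: "z \<in> D" "u z = 0" and v: "v \<in> D" "u v \<noteq> 0" by blast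
  have "v \<notin> span C" "span D = span (insert v (span C))" using facet_span[OF dec C D f v(1)] by auto
  moreover have "z \<in> span D" using z by (simp add: span_base)
  ultimately obtain a where a: "z - a *\<^sub>R v \<in> span C" by (auto simp: span_breakdown_eq span_span)
  have "u x = 0" if "x \<in> span C" for x using that k lin linear_eq_0_on_span by blast
  from this[OF a] have "a = 0" using lin z v by (simp add: linear_diff linear_scale)
  then show False using a facet_span(1)[OF dec C D f z(1)] by simp
qed

text \<open>If \<open>D\<close> is not split it is its own only piece. If it is split,
  \<open>u\<close> does not vanish on the facet \<open>C\<close>, so \<open>C'\<close> has a nonzero
  sign, and exactly the piece of \<open>D\<close> with this sign has \<open>C'\<close> in its
  closure.\<close>

lemma piece_of_facet:
  assumes C: "C \<in> star \<D> p" and C': "C' \<in> full_pieces C" and D: "D \<in> star \<D> p" and f: "facet C D"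
  shows "\<exists>!D'. D' \<in> full_pieces D \<and> C' \<subseteq> cone_closure D'"
proof -
  obtain s where s: "C' = cone_piece u C s" "C' \<noteq> {}" "s \<noteq> 0 \<or> (\<forall>x\<in>C. u x = 0)" "u p = 0 \<or> sgn (u p) = s"
    using C' unfolding full_pieces_eq[OF C] by blast
  have CD: "C \<in> \<D>" and DD: "D \<in> \<D>" using C D by (auto simp: star_def)
  have oD: "open_cone D" by (rule decompositionD(2)[OF dec DD])
  have CcD: "C \<subseteq> cone_closure D" using f by (simp add: facet_def)
  show ?thesis
  proof (cases "(\<forall>x\<in>D. u x = 0) \<or> (\<forall>x\<in>D. u x \<noteq> 0)")
    case True
    moreover have "C' \<subseteq> cone_closure D" using s CcD by (auto simp: cone_piece_def)
    ultimately show ?thesis using full_pieces_unsplit[OF D] by auto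
  next
    case False
    then have s0: "s \<noteq> 0" using facet_not_split[OF CD DD f] s(3) by blast
    obtain c where c: "c \<in> C" "sgn (u c) = s" using s(1,2) by (auto simp: cone_piece_def)
    obtain d where d: "d \<in> D" using open_cone_nonempty[OF oD] by blast
    have "u c \<noteq> 0" using c s0 by auto
    from small_perturb_sgn[OF this, of 1 "u d"] obtain e where e: "0 < e" "sgn (u c + e * u d) = sgn (u c)" by auto
    have "c + e *\<^sub>R d \<in> D" using c CcD open_cone_scale[OF oD d e(1)] unfolding cone_closure_def by blast
    then have ne: "cone_piece u D s \<noteq> {}"
      using e c lin by (auto simp: cone_piece_def linear_add linear_scale)
    have mem: "cone_piece u D s \<in> full_pieces D"
      unfolding full_pieces_eq[OF D] using ne s0 s(4) by blast
    have cl: "cone_closure (cone_piece u D t) = {v \<in> cone_closure D. u v = 0 \<or> sgn (u v) = t}"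
      if "cone_piece u D t \<noteq> {}" for t
      using cone_closure_piece[OF lin oD that] .
    show ?thesis
    proof (rule ex1I[of _ "cone_piece u D s"], intro conjI mem)
      show "C' \<subseteq> cone_closure (cone_piece u D s)"
        unfolding cl[OF ne] using s(1) CcD by (auto simp: cone_piece_def)
      fix D' assume D': "D' \<in> full_pieces D \<and> C' \<subseteq> cone_closure D'"
      then obtain t where t: "D' = cone_piece u D t" "cone_piece u D t \<noteq> {}"
        unfolding full_pieces_eq[OF D] by blast
      have "c \<in> C'" using c s(1) by (simp add: cone_piece_def)
      then have "u c = 0 \<or> sgn (u c) = t" using D' cl[OF t(2)] t(1) by blast
      then show "D' = cone_piece u D s" using t(1) c s0 by auto
    qed
  qed
qed

lemma facet_parent:
  assumes C: "C \<in> \<D>" and D: "D \<in> \<D>" and s: "cone_piece u C s \<noteq> {}" and t: "cone_piece u D t \<noteq> {}"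
    and sub: "cone_piece u C s \<subseteq> cone_closure (cone_piece u D t)"
  shows "C \<subseteq> cone_closure D"
proof -
  obtain x where "x \<in> cone_piece u C s" using s by blast
  then have "x \<in> C" "x \<in> cone_closure D"
    using sub cone_closure_piece[OF lin decompositionD(2)[OF dec D] t] by (auto simp: cone_piece_def)
  then show ?thesis by (rule decompositionD(4)[OF dec C D])
qed

text \<open>Full pieces have the spans of their parents, hence the same canonical orientations. The
  single piece given by \<open>piece_of_facet\<close> therefore contributes the old incidence
  number, tested at a point of that piece.\<close>

lemma incidence_full:
  assumes C: "C \<in> star \<D> p" and C': "C' \<in> full_pieces C" and D: "D \<in> star \<D> p"
  shows "(\<Sum>D'\<in>full_pieces D. incidence (Some C') (Some D')) = incidence (Some C) (Some D)"
proof -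
  have fin: "finite (full_pieces D)"
    using decompositionD(1)[OF dec'] by (auto simp: full_pieces_def star_def)
  have CD: "C \<in> \<D>" and DD: "D \<in> \<D>" using C D by (auto simp: star_def)
  obtain s where s: "C' = cone_piece u C s" "cone_piece u C s \<noteq> {}" "s \<noteq> 0 \<or> (\<forall>x\<in>C. u x = 0)"
    using C' unfolding full_pieces_eq[OF C] by blast
  have spC: "span C' = span C" and dimC: "dim C' = dim C"
    using dim_piece(1,2)[OF CD s(2,3)] s(1) by auto
  have C'D: "C' \<in> \<D>'" using C' by (simp add: full_pieces_def star_def)
  have D': "\<exists>t. D' = cone_piece u D t \<and> cone_piece u D t \<noteq> {} \<and> dim D' = dim D \<and> D' \<in> \<D>'"
    if D': "D' \<in> full_pieces D" for D'
  proof -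
    obtain t where t: "D' = cone_piece u D t" "cone_piece u D t \<noteq> {}" "t \<noteq> 0 \<or> (\<forall>x\<in>D. u x = 0)"
      using D' unfolding full_pieces_eq[OF D] by blast
    then show ?thesis using dim_piece(2)[OF DD t(2,3)] pieceI[OF DD t(2)] by blast
  qed
  show ?thesis
  proof (cases "facet C D")
    case True
    from piece_of_facet[OF C C' D this] obtain E where E: "E \<in> full_pieces D" "C' \<subseteq> cone_closure E"
      and uniq: "\<And>D'. D' \<in> full_pieces D \<Longrightarrow> C' \<subseteq> cone_closure D' \<Longrightarrow> D' = E"
      by (elim ex1E) blast
    obtain t where t: "E = cone_piece u D t" "cone_piece u D t \<noteq> {}" "dim E = dim D" "E \<in> \<D>'"
      using D'[OF E(1)] by blast
    have fE: "facet C' E" using E(2) t True dimC by (simp add: facet_def)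
    obtain w where w: "w \<in> E" using t by blast
    have "(\<Sum>D'\<in>full_pieces D. incidence (Some C') (Some D'))
        = (\<Sum>D'\<in>full_pieces D. if E = D' then incidence (Some C') (Some E) else 0)"
      by (intro sum.cong refl) (use uniq in \<open>auto simp: facet_def\<close>)
    also have "\<dots> = incidence (Some C') (Some E)" using fin E(1) by simp
    also have "\<dots> = side_sign (span C') w" by (rule incidence_facet[OF dec' C'D t(4) fE w])
    also have "\<dots> = incidence (Some C) (Some D)"
      unfolding spC using w t(1) by (intro incidence_facet[OF dec CD DD True, symmetric]) (auto simp: cone_piece_def)
    finally show ?thesis .
  next
    case False
    have "\<not> facet C' D'" if D'1: "D' \<in> full_pieces D" for D'
    proof
      assume f: "facet C' D'"
      obtain t where t: "D' = cone_piece u D t" "cone_piece u D t \<noteq> {}" "dim D' = dim D"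
        using D'[OF D'1] by blast
      have "C \<subseteq> cone_closure D"
        using facet_parent[OF CD DD s(2) t(2)] f s(1) t(1) by (simp add: facet_def)
      then show False using False f t(3) dimC by (simp add: facet_def)
    qed
    then have "(\<Sum>D'\<in>full_pieces D. incidence (Some C') (Some D')) = 0"
      by (intro sum.neutral) auto
    then show ?thesis using False by simp
  qed
qed

lemma wall_cases:
  assumes C': "C' \<in> star \<D>' p" and nf: "dim C' \<noteq> dim (parent C')"
  obtains C z v where "C \<in> star \<D> p" "parent C' = C" "C' = cone_piece u C 0" "u p = 0" "C' \<in> \<D>'"
    "z \<in> C'" "z \<in> C" "u z = 0" "v \<in> C" "u v \<noteq> 0" "dim C = Suc (dim C')"
proof -
  obtain C s where C: "C \<in> star \<D> p" "C' = cone_piece u C s" "C' \<noteq> {}" "u p = 0 \<or> sgn (u p) = s"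
    using C' star_cut_iff by blast
  then have CD: "C \<in> \<D>" by (simp add: star_def)
  have par: "parent C' = C" using parent_piece[OF CD] C by blast
  have "\<not> (s \<noteq> 0 \<or> (\<forall>x\<in>C. u x = 0))" using full_iff[OF CD] nf C par by auto
  then obtain v where s: "s = 0" and v: "v \<in> C" "u v \<noteq> 0" by blast
  obtain z where z: "z \<in> C'" using C(3) by blast
  have "u p = 0" using C(4) s by (auto simp: sgn_zero_iff)
  moreover have "z \<in> C" "u z = 0" using z C(2) s by (auto simp: cone_piece_def sgn_zero_iff)
  moreover have "dim C = Suc (dim C')" using dim_piece(3)[OF CD _ s v] C(2,3) by simp
  moreover have "C' \<in> \<D>'" using C' by (simp add: star_def)
  ultimately show ?thesis using that[OF C(1) par _ _ _ z] C(2) s v by simp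
qed

lemma wall_facet:
  assumes C: "C \<in> star \<D> p" "u p = 0" and z: "z \<in> C" "u z = 0" and v: "v \<in> C" "u v \<noteq> 0"
    and s: "s = 1 \<or> s = -1"
  shows "facet (cone_piece u C 0) (cone_piece u C s)" "cone_piece u C s \<noteq> {}" "cone_piece u C s \<in> \<D>'"
    "dim (cone_piece u C s) = dim C"
proof -
  have CD: "C \<in> \<D>" using C by (simp add: star_def)
  have oC: "open_cone C" by (rule decompositionD(2)[OF dec CD])
  show ne: "cone_piece u C s \<noteq> {}" by (rule cone_piece_split[OF lin oC z span_base[OF v(1)] v(2) s])
  then show "cone_piece u C s \<in> \<D>'" by (rule pieceI[OF CD])
  have ne0: "cone_piece u C 0 \<noteq> {}" using z by (auto simp: cone_piece_def)
  show dm: "dim (cone_piece u C s) = dim C" using dim_piece(2)[OF CD ne] s by auto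
  have "cone_piece u C 0 \<subseteq> cone_closure (cone_piece u C s)"
    unfolding cone_closure_piece[OF lin oC ne] using subset_cone_closure[OF oC]
    by (auto simp: cone_piece_def sgn_zero_iff)
  then show "facet (cone_piece u C 0) (cone_piece u C s)"
    using dim_piece(3)[OF CD ne0 _ v] dm by (simp add: facet_def)
qed

text \<open>Among full pieces a wall of \<open>C\<close> is a facet only of the two halves of
  \<open>C\<close>. Points of these lie on opposite sides of its span, so the two signs cancel. For
  another cell \<open>D\<close> the dimensions agree and \<open>C\<close> would lie in the closure
  of \<open>D\<close>, forcing \<open>C = D\<close>.\<close>

lemma incidence_wall:
  assumes C': "C' \<in> star \<D>' p" and nf: "dim C' \<noteq> dim (parent C')" and D: "D \<in> star \<D> p"
  shows "(\<Sum>D'\<in>full_pieces D. incidence (Some C') (Some D')) = 0"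
proof -
  obtain C z v where w: "C \<in> star \<D> p" "parent C' = C" "C' = cone_piece u C 0" "u p = 0" "C' \<in> \<D>'"
    "z \<in> C'" "z \<in> C" "u z = 0" "v \<in> C" "u v \<noteq> 0" "dim C = Suc (dim C')"
    by (rule wall_cases[OF C' nf])
  have CD: "C \<in> \<D>" and DD: "D \<in> \<D>" using w D by (auto simp: star_def)
  have ne0: "cone_piece u C 0 \<noteq> {}" using w by auto
  show ?thesis
  proof (cases "D = C")
    case True
    let ?P = "cone_piece u C 1" and ?N = "cone_piece u C (-1)"
    note P = wall_facet[OF w(1,4,7,8,9,10), of 1, simplified]
    note N = wall_facet[OF w(1,4,7,8,9,10), of "-1", simplified]
    obtain x y where xy: "x \<in> ?P" "y \<in> ?N" using P(2) N(2) by blast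
    then have sg: "0 < u x" "u y < 0" by (auto simp: cone_piece_def sgn_if split: if_splits)
    have dist: "?P \<noteq> ?N" using xy by (auto simp: cone_piece_def)
    have fp: "facet C' ?P" and fn: "facet C' ?N" using P(1) N(1) w(3) by auto
    have "(\<Sum>D'\<in>full_pieces D. incidence (Some C') (Some D'))
      = incidence (Some C') (Some ?P) + incidence (Some C') (Some ?N)"
      using dist by (simp add: True full_pieces_split(2)[OF w(1) w(7-10) w(4)])
    also have "\<dots> = side_sign (span C') x + side_sign (span C') y"
      using incidence_facet[OF dec' w(5) P(3) fp xy(1)] incidence_facet[OF dec' w(5) N(3) fn xy(2)] by simp
    also have "side_sign (span C') y = - side_sign (span C') x"
    proof -
      have k: "u q = 0" if "q \<in> span C'" for q
      proof (rule linear_eq_0_on_span[OF lin _ that])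
        show "u r = 0" if "r \<in> C'" for r using that by (simp add: w(3) cone_piece_def sgn_zero_iff)
      qed
      have "y \<in> span C" using xy by (simp add: span_base cone_piece_def)
      also have "span C = span ?P" using dim_piece(1)[OF CD P(2)] by simp
      also have "\<dots> = span (insert x (span C'))" by (rule facet_span(2)[OF dec' w(5) P(3) fp xy(1)])
      finally obtain a where a: "y - a *\<^sub>R x \<in> span C'" by (auto simp: span_breakdown_eq span_span)
      have "u y = a * u x" using k[OF a] lin by (simp add: linear_diff linear_scale)
      then have "a < 0" using sg by (metis mult_nonneg_nonneg not_le less_imp_le)
      then show ?thesis
        using side_sign_scale_add[OF _ facet_span(1)[OF dec' w(5) P(3) fp xy(1)] a, of a] by simp
    qed
    finally show ?thesis by simp
  next
    case False
    have "\<not> facet C' D'" if D': "D' \<in> full_pieces D" for D'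
    proof
      assume f: "facet C' D'"
      obtain t where t: "D' = cone_piece u D t" "cone_piece u D t \<noteq> {}" "t \<noteq> 0 \<or> (\<forall>x\<in>D. u x = 0)"
        using D' unfolding full_pieces_eq[OF D] by blast
      then have "dim D' = dim D" using dim_piece(2)[OF DD t(2,3)] by simp
      moreover have "C \<subseteq> cone_closure D"
        using facet_parent[OF CD DD ne0 t(2)] f w(3) t(1) by (simp add: facet_def)
      ultimately show False using closure_eq_dim[OF dec CD DD] False f w(11) by (simp add: facet_def)
    qed
    then show ?thesis by (intro sum.neutral) auto
  qed
qed

definition full :: "'v set option set" where
  "full = insert None (Some ` {C' \<in> star \<D>' p. dim C' = dim (parent C')})"

definition plus_piece :: "'v set option \<Rightarrow> 'v set option" where
  "plus_piece = map_option (\<lambda>C'. cone_piece u (parent C') 1)"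

definition minus_piece :: "'v set option \<Rightarrow> 'v set option" where
  "minus_piece = map_option (\<lambda>C'. cone_piece u (parent C') (-1))"

lemma fibre_Some: "{j' \<in> full. map_option parent j' = Some C} = Some ` full_pieces C"
  by (auto simp: full_def full_pieces_def)

lemma fibre_None: "{j' \<in> full. map_option parent j' = None} = {None}"
  by (auto simp: full_def)

lemma not_full: "n \<in> star_index \<D>' p - full \<longleftrightarrow>
    (\<exists>C'. n = Some C' \<and> C' \<in> star \<D>' p \<and> dim C' \<noteq> dim (parent C'))"
  by (auto simp: star_index_def full_def)

lemma full_piecesI:
  assumes "C' \<in> star \<D>' p" "dim C' = dim (parent C')"
  shows "C' \<in> full_pieces (parent C')" "parent C' \<in> star \<D> p"
proof -
  show "C' \<in> full_pieces (parent C')" using assms by (simp add: full_pieces_def)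
  obtain C s where "C \<in> star \<D> p" "C' = cone_piece u C s" "C' \<noteq> {}" using assms star_cut_iff by blast
  then show "parent C' \<in> star \<D> p" using parent_piece[of C s] by (auto simp: star_def)
qed

lemma full_pieces_nonempty:
  assumes C: "C \<in> star \<D> p"
  shows "full_pieces C \<noteq> {}"
proof (cases "(\<forall>x\<in>C. u x = 0) \<or> (\<forall>x\<in>C. u x \<noteq> 0)")
  case True
  then show ?thesis using full_pieces_unsplit[OF C] by simp
next
  case False
  then obtain z v where "z \<in> C" "u z = 0" "v \<in> C" "u v \<noteq> 0" by blast
  then show ?thesis using full_pieces_split[OF C] by (cases "u p = 0") auto
qed

text \<open>The fibre over an unsplit cell, over a split cell with \<open>p\<close> off the
  hyperplane, and over \<open>None\<close> is a single element. Only a cell split by a hyperplane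
  through \<open>p\<close> has a fibre of two halves, and then its wall belongs to the star as
  well.\<close>

sublocale subdivision incidence "star_index \<D>' p" incidence "star_index \<D> p" full "map_option parent"
  plus_piece minus_piece
proof
  show "finite (star_index \<D>' p)" "finite (star_index \<D> p)"
    using decompositionD(1)[OF dec] decompositionD(1)[OF dec'] by (simp_all add: star_index_def star_def)
  show "full \<subseteq> star_index \<D>' p" by (auto simp: full_def star_index_def)
  show "map_option parent ` full = star_index \<D> p"
  proof (intro subset_antisym subsetI)
    fix j assume "j \<in> map_option parent ` full"
    then show "j \<in> star_index \<D> p" using full_piecesI(2) by (auto simp: full_def star_index_def)
  next
    fix j assume j: "j \<in> star_index \<D> p"
    have "{j' \<in> full. map_option parent j' = j} \<noteq> {}"
    proof (cases j)
      case None
      then show ?thesis using fibre_None by blast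
    next
      case (Some C)
      then have "C \<in> star \<D> p" using j by (auto simp: star_index_def)
      then show ?thesis using full_pieces_nonempty unfolding Some fibre_Some by blast
    qed
    then show "j \<in> map_option parent ` full" by blast
  qed
next
  fix i j assume i: "i \<in> full" and j: "j \<in> star_index \<D> p"
  show "(\<Sum>j'\<in>{j' \<in> full. map_option parent j' = j}. incidence i j') = incidence (map_option parent i) j"
  proof (cases i)
    case None
    then show ?thesis by simp
  next
    case (Some C')
    then have C': "C' \<in> star \<D>' p" "dim C' = dim (parent C')" using i by (auto simp: full_def)
    show ?thesis
    proof (cases j)
      case None
      show ?thesis unfolding None fibre_None Some using C' by simp
    next
      case (Some D)
      then have "D \<in> star \<D> p" using j by (auto simp: star_index_def)
      then show ?thesis
        using incidence_full[OF full_piecesI(2,1)[OF C']] unfolding Some \<open>i = Some C'\<close> fibre_Some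
        by (simp add: sum.reindex)
    qed
  qed
next
  fix i j assume i: "i \<in> star_index \<D>' p - full" and j: "j \<in> star_index \<D> p"
  then obtain C' where C': "i = Some C'" "C' \<in> star \<D>' p" "dim C' \<noteq> dim (parent C')" using not_full by blast
  show "(\<Sum>j'\<in>{j' \<in> full. map_option parent j' = j}. incidence i j') = 0"
  proof (cases j)
    case None
    obtain C :: "'v set" where "dim C = Suc (dim C')" by (rule wall_cases[OF C'(2,3)]) blast
    then have "dim C' \<noteq> dim (UNIV :: 'v set)" using fd.dim_subset[of C UNIV] by auto
    then show ?thesis unfolding None fibre_None C'(1) by simp
  next
    case (Some D)
    then have "D \<in> star \<D> p" using j by (auto simp: star_index_def)
    then show ?thesis using incidence_wall[OF C'(2,3)] unfolding Some C'(1) fibre_Some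
      by (simp add: sum.reindex)
  qed
next
  fix j assume j: "j \<in> star_index \<D> p"
  show "(\<exists>i. {j' \<in> full. map_option parent j' = j} = {i}) \<or>
    (\<exists>n\<in>star_index \<D>' p - full. {j' \<in> full. map_option parent j' = j} = {plus_piece n, minus_piece n} \<and>
      plus_piece n \<noteq> minus_piece n)"
  proof (cases j)
    case None
    show ?thesis unfolding None fibre_None by blast
  next
    case (Some C)
    then have C: "C \<in> star \<D> p" using j by (auto simp: star_index_def)
    then have CD: "C \<in> \<D>" by (simp add: star_def)
    show ?thesis
    proof (cases "(\<forall>x\<in>C. u x = 0) \<or> (\<forall>x\<in>C. u x \<noteq> 0)")
      case True
      then show ?thesis using full_pieces_unsplit[OF C] unfolding Some fibre_Some by simp
    next
      case False
      then obtain z v where zv: "z \<in> C" "u z = 0" "v \<in> C" "u v \<noteq> 0" by blast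
      show ?thesis
      proof (cases "u p = 0")
        case False
        then show ?thesis using full_pieces_split(1)[OF C zv] unfolding Some fibre_Some by simp
      next
        case True
        let ?n = "cone_piece u C 0"
        have ne: "?n \<noteq> {}" using zv by (auto simp: cone_piece_def)
        then have par: "parent ?n = C" by (rule parent_piece[OF CD])
        have "?n \<in> star \<D>' p" using C ne True star_cut_iff by blast
        moreover have "dim ?n \<noteq> dim (parent ?n)" using par full_iff[OF CD ne] zv by auto
        ultimately have "Some ?n \<in> star_index \<D>' p - full" using not_full by blast
        moreover have "{j' \<in> full. map_option parent j' = j} = {plus_piece (Some ?n), minus_piece (Some ?n)}"
          using full_pieces_split(2)[OF C zv True] unfolding Some fibre_Some plus_piece_def minus_piece_def
          by (simp add: par)
        moreover have "plus_piece (Some ?n) \<noteq> minus_piece (Some ?n)"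
        proof -
          obtain x where "x \<in> cone_piece u C 1" using wall_facet(2)[OF C True zv, of 1] by auto
          then have "cone_piece u C 1 \<noteq> cone_piece u C (-1)" by (auto simp: cone_piece_def)
          then show ?thesis by (simp add: plus_piece_def minus_piece_def par)
        qed
        ultimately show ?thesis by blast
      qed
    qed
  qed
next
  fix n assume "n \<in> star_index \<D>' p - full"
  then obtain C' where C': "n = Some C'" "C' \<in> star \<D>' p" "dim C' \<noteq> dim (parent C')" using not_full by blast
  obtain C z v where w: "C \<in> star \<D> p" "parent C' = C" "C' = cone_piece u C 0" "u p = 0" "C' \<in> \<D>'"
    "z \<in> C'" "z \<in> C" "u z = 0" "v \<in> C" "u v \<noteq> 0" "dim C = Suc (dim C')"
    by (rule wall_cases[OF C'(2,3)])
  note P = wall_facet[OF w(1,4,7,8,9,10), of 1, simplified]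
  have "cone_piece u C 1 \<in> full_pieces C"
    unfolding full_pieces_split(2)[OF w(1) w(7-10) w(4)] by blast
  then show "plus_piece n \<in> full"
    using C'(1) w(2) by (auto simp: plus_piece_def full_def full_pieces_def)
  obtain x where x: "x \<in> cone_piece u C 1" using P(2) by blast
  have "incidence n (plus_piece n) = side_sign (span C') x"
    using incidence_facet[OF dec' w(5) P(3) _ x] P(1) w(3) C'(1) w(2) by (simp add: plus_piece_def)
  then show "incidence n (plus_piece n) * incidence n (plus_piece n) = 1"
    using side_sign_cases[of "span C'" x] by auto
  fix n' assume n': "n' \<in> star_index \<D>' p - full" "n' \<noteq> n"
  then obtain E' where E': "n' = Some E'" "E' \<in> star \<D>' p" "dim E' \<noteq> dim (parent E')" using not_full by blast
  obtain E zE vE where e: "E \<in> star \<D> p" "parent E' = E" "E' = cone_piece u E 0" "u p = 0" "E' \<in> \<D>'"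
    "zE \<in> E'" "zE \<in> E" "u zE = 0" "vE \<in> E" "u vE \<noteq> 0" "dim E = Suc (dim E')"
    by (rule wall_cases[OF E'(2,3)])
  have CD: "C \<in> \<D>" and oC: "open_cone C" using w decompositionD(2)[OF dec] by (auto simp: star_def)
  \<comment> \<open>A wall in the closure of the positive half of \<open>C\<close> lies in the
    hyperplane, hence in the closure of the wall \<open>C'\<close>; having the same dimension it is
    \<open>C'\<close>.\<close>
  have "\<not> facet E' (cone_piece u C 1)"
  proof
    assume f: "facet E' (cone_piece u C 1)"
    have ne0: "cone_piece u C 0 \<noteq> {}" using w by auto
    have "E' \<subseteq> cone_closure (cone_piece u C 1)" using f by (simp add: facet_def)
    then have "E' \<subseteq> cone_closure C'"
      unfolding w(3) cone_closure_piece[OF lin oC P(2)] cone_closure_piece[OF lin oC ne0]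
      using e(3) by (auto simp: cone_piece_def sgn_zero_iff)
    moreover have "dim C' = dim E'" using f P(4) w(11) by (simp add: facet_def)
    ultimately have "E' = C'" using closure_eq_dim[OF dec' e(5) w(5)] by simp
    then show False using n' E'(1) C'(1) by simp
  qed
  then show "incidence n' (plus_piece n) = 0"
    using E'(1) C'(1) w(2) by (simp add: plus_piece_def)
qed

end

section \<open>Hyperplane arrangements and the square of their boundary\<close>

definition same_signs :: "('v::real_vector \<Rightarrow> real) set \<Rightarrow> 'v \<Rightarrow> 'v set" where
  "same_signs U y = {x. \<forall>u\<in>U. sgn (u x) = sgn (u y)}"

definition refinement :: "('v::real_vector \<Rightarrow> real) set \<Rightarrow> 'v set set \<Rightarrow> 'v set set" where
  "refinement U \<D> = {C \<inter> same_signs U y | C y. C \<in> \<D> \<and> y \<in> C}"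

text \<open>Simultaneous refinement equals successive cutting, so inductions over \<open>U\<close>
  treat one hyperplane at a time.\<close>

lemma refinement_insert: "refinement (insert u U) \<D> = cut u (refinement U \<D>)"
proof (intro subset_antisym subsetI)
  fix C' assume "C' \<in> refinement (insert u U) \<D>"
  then obtain C y where "C' = C \<inter> same_signs (insert u U) y" "C \<in> \<D>" "y \<in> C"
    by (auto simp: refinement_def)
  moreover from this have "C' = cone_piece u (C \<inter> same_signs U y) (sgn (u y))"
    "y \<in> C \<inter> same_signs U y" "C \<inter> same_signs U y \<in> refinement U \<D>"
    by (auto simp: cone_piece_def same_signs_def refinement_def)
  ultimately show "C' \<in> cut u (refinement U \<D>)" unfolding cut_def by blast
next
  fix C' assume "C' \<in> cut u (refinement U \<D>)"
  then obtain C y z where C: "C' = cone_piece u (C \<inter> same_signs U y) (sgn (u z))" "C \<in> \<D>"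
    "z \<in> C \<inter> same_signs U y"
    by (auto simp: cut_def refinement_def)
  then have "C' = C \<inter> same_signs (insert u U) z"
    by (auto simp: cone_piece_def same_signs_def)
  then show "C' \<in> refinement (insert u U) \<D>" using C unfolding refinement_def by blast
qed

lemma refinement_empty:
  assumes "decomposition \<D>"
  shows "refinement {} \<D> = \<D>"
proof -
  have "\<exists>y. y \<in> C" if "C \<in> \<D>" for C
    using open_cone_nonempty[OF decompositionD(2)[OF assms that]] .
  then show ?thesis by (auto simp: refinement_def same_signs_def)
qed

lemma decomposition_refinement:
  assumes "finite U" "\<forall>u\<in>U. linear u" "decomposition \<D>"
  shows "decomposition (refinement U \<D>)"
  using assms(1,2)
  by (induction U rule: finite_induct)
    (simp_all add: refinement_empty assms(3) refinement_insert decomposition_cut)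

lemma decomposition_UNIV: "decomposition {UNIV :: 'v::real_vector set}"
  by (auto simp: decomposition_def open_cone_def cone_closure_def intro: exI[of _ 1])

lemma small_perturb_signs:
  fixes U :: "('v::real_vector \<Rightarrow> real) set"
  assumes "finite U"
  shows "\<exists>e0>0. \<forall>e. 0 < e \<and> e \<le> e0 \<longrightarrow>
    (\<forall>u\<in>U. sgn (u y + e * u v) = (if u y = 0 then sgn (u v) else sgn (u y)))"
  using assms
proof (induction U rule: finite_induct)
  case empty
  then show ?case by (auto intro: exI[of _ 1])
next
  case (insert u U)
  then obtain e0 where e0: "0 < e0" "\<And>e. 0 < e \<Longrightarrow> e \<le> e0 \<Longrightarrow>
    (\<forall>u\<in>U. sgn (u y + e * u v) = (if u y = 0 then sgn (u v) else sgn (u y)))" by blast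
  have "\<exists>e1>0. \<forall>e. 0 < e \<and> e \<le> e1 \<longrightarrow> sgn (u y + e * u v) = (if u y = 0 then sgn (u v) else sgn (u y))"
  proof (cases "u y = 0")
    case True
    then show ?thesis by (auto simp: sgn_mult intro: exI[of _ 1])
  next
    case False
    \<comment> \<open>The added 1 keeps the denominator positive when \<open>u v = 0\<close> and
      makes the estimate strict.\<close>
    define e1 where "e1 = \<bar>u y\<bar> / (\<bar>u v\<bar> + 1)"
    have "sgn (u y + e * u v) = sgn (u y)" if "0 < e" "e \<le> e1" for e
    proof -
      have "e * \<bar>u v\<bar> < e * (\<bar>u v\<bar> + 1)" using that by simp
      also have "\<dots> \<le> e1 * (\<bar>u v\<bar> + 1)" using that by (intro mult_right_mono) auto
      also have "\<dots> = \<bar>u y\<bar>" unfolding e1_def by (simp add: add_nonneg_pos[THEN less_imp_neq, THEN not_sym])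
      finally have "\<bar>e * u v\<bar> < \<bar>u y\<bar>" using that by (simp add: abs_mult)
      then show ?thesis by (auto simp: sgn_if abs_if split: if_splits)
    qed
    moreover have "0 < e1" using False by (simp add: e1_def add_nonneg_pos)
    ultimately show ?thesis using False by auto
  qed
  then obtain e1 where e1: "0 < e1" "\<And>e. 0 < e \<Longrightarrow> e \<le> e1 \<Longrightarrow>
    sgn (u y + e * u v) = (if u y = 0 then sgn (u v) else sgn (u y))" by blast
  show ?case
    by (rule exI[of _ "min e0 e1"]) (use e0 e1 in auto)
qed

text \<open>Here span and closure of a cell are given by explicit sign conditions, so the cells
  between two given ones can be listed.\<close>

locale arrangement = finite_dim B for B :: "'v::real_vector set" +
  fixes U :: "('v \<Rightarrow> real) set"
  assumes finU: "finite U" and linU: "\<And>u. u \<in> U \<Longrightarrow> linear u"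
begin

abbreviation cell :: "'v \<Rightarrow> 'v set" where "cell \<equiv> same_signs U"

lemma cell_self: "y \<in> cell y" by (simp add: same_signs_def)

lemma cell_eq: "x \<in> cell y \<Longrightarrow> cell x = cell y" by (auto simp: same_signs_def)

lemma cells: "refinement U {UNIV} = range cell" by (auto simp: refinement_def)

lemma dec_cells: "decomposition (range cell)"
  using decomposition_refinement[OF finU _ decomposition_UNIV] linU by (simp add: cells)

lemma open_cell: "open_cone (cell y)"
  using decompositionD(2)[OF dec_cells] by blast

text \<open>The composition of sign vectors known from oriented matroids: a large multiple of
  \<open>t\<close> dominates wherever \<open>t\<close> has a nonzero sign, and \<open>z\<close>
  decides elsewhere. It moves a vector into the neighbourhood of the cell of
  \<open>t\<close>.\<close>

lemma local_point:
  "\<exists>c>0. \<forall>u\<in>U. sgn (u (c *\<^sub>R t + z)) = (if u t = 0 then sgn (u z) else sgn (u t))"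
proof -
  obtain e where e: "0 < e" "\<forall>u\<in>U. sgn (u t + e * u z) = (if u t = 0 then sgn (u z) else sgn (u t))"
    using small_perturb_signs[OF finU, of t z] by blast
  have "sgn (u ((1 / e) *\<^sub>R t + z)) = sgn (u t + e * u z)" if "u \<in> U" for u
  proof -
    have "u ((1 / e) *\<^sub>R t + z) = (1 / e) * (u t + e * u z)"
      using linU[OF that] e(1) by (simp add: linear_add linear_scale field_simps)
    then show ?thesis using e(1) by (simp only: sgn_mult) simp
  qed
  then show ?thesis using e by (intro exI[of _ "1 / e"]) auto
qed

lemma span_cell: "span (cell y) = {v. \<forall>u\<in>U. u y = 0 \<longrightarrow> u v = 0}"
proof
  have "subspace {v. \<forall>u\<in>U. u y = 0 \<longrightarrow> u v = 0}"
    using linU by (auto simp: subspace_def linear_0 linear_add linear_scale)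
  moreover have "cell y \<subseteq> {v. \<forall>u\<in>U. u y = 0 \<longrightarrow> u v = 0}"
    by (auto simp: same_signs_def sgn_zero_iff)
  ultimately show "span (cell y) \<subseteq> {v. \<forall>u\<in>U. u y = 0 \<longrightarrow> u v = 0}"
    by (rule span_minimal[rotated])
next
  show "{v. \<forall>u\<in>U. u y = 0 \<longrightarrow> u v = 0} \<subseteq> span (cell y)"
  proof
    fix v assume v: "v \<in> {v. \<forall>u\<in>U. u y = 0 \<longrightarrow> u v = 0}"
    obtain e where e: "0 < e" "\<forall>u\<in>U. sgn (u y + e * u v) = (if u y = 0 then sgn (u v) else sgn (u y))"
      using small_perturb_signs[OF finU, of y v] by blast
    have "y + e *\<^sub>R v \<in> cell y"
      using e v linU by (auto simp: same_signs_def linear_add linear_scale)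
    then show "v \<in> span (cell y)" using span_of_perturb[OF cell_self _ e(1)] by blast
  qed
qed

lemma closure_cell: "cone_closure (cell y) = {v. \<forall>u\<in>U. u v = 0 \<or> sgn (u v) = sgn (u y)}"
proof (intro subset_antisym subsetI)
  fix v assume v: "v \<in> cone_closure (cell y)"
  show "v \<in> {v. \<forall>u\<in>U. u v = 0 \<or> sgn (u v) = sgn (u y)}"
  proof (intro CollectI ballI disjCI)
    fix u assume u: "u \<in> U" and ne: "sgn (u v) \<noteq> sgn (u y)"
    show "u v = 0"
    proof (rule ccontr)
      assume "u v \<noteq> 0"
      from small_perturb_sgn[OF this, of 1 "u y"] obtain e where
        e: "0 < e" "sgn (u v + e * u y) = sgn (u v)" by auto
      have "v + e *\<^sub>R y \<in> cell y"
        using v open_cone_scale[OF open_cell cell_self e(1)] by (simp add: cone_closure_def)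
      then have "sgn (u (v + e *\<^sub>R y)) = sgn (u y)" using u unfolding same_signs_def by blast
      then have "sgn (u v + e * u y) = sgn (u y)"
        using linU[OF u] by (simp add: linear_add linear_scale)
      then show False using e ne by simp
    qed
  qed
next
  fix v assume v: "v \<in> {v. \<forall>u\<in>U. u v = 0 \<or> sgn (u v) = sgn (u y)}"
  have "sgn (u (v + w)) = sgn (u y)" if u: "u \<in> U" and w: "w \<in> cell y" for u w
  proof -
    have "u v = 0 \<or> sgn (u v) = sgn (u w)" "sgn (u w) = sgn (u y)"
      using v w u by (auto simp: same_signs_def)
    moreover have "u (v + w) = u v + u w" using linU[OF u] by (rule linear_add)
    ultimately show ?thesis by (auto simp: sgn_if split: if_splits)
  qed
  then show "v \<in> cone_closure (cell y)" by (simp add: cone_closure_def same_signs_def)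
qed

text \<open>The relative position of two cells \<open>T = cell t\<close> and \<open>S = cell w\<close> of codimension two is a planar
  sector: it is cut out by the forms in \<open>I\<close> and its two boundary rays are found by leaving \<open>S\<close> from
  \<open>w\<close> along \<open>y\<close> and along \<open>- y\<close>.\<close>

lemma diamond:
  assumes TS: "cell t \<subseteq> cone_closure (cell w)" and dim2: "dim (cell w) = Suc (Suc (dim (cell t)))"
  obtains \<rho>1 \<rho>2 where "\<rho>1 \<noteq> \<rho>2" "{\<rho> \<in> range cell. facet (cell t) \<rho> \<and> facet \<rho> (cell w)} = {\<rho>1, \<rho>2}"
    "incidence (Some (cell t)) (Some \<rho>1) * incidence (Some \<rho>1) (Some (cell w)) +
     incidence (Some (cell t)) (Some \<rho>2) * incidence (Some \<rho>2) (Some (cell w)) = 0"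
proof -
  \<comment> \<open>These forms cut the sector out of the plane \<open>?W\<close> modulo
    \<open>?L\<close>; after normalization by their sign at \<open>w\<close> they are the functions
    \<open>g u\<close>, and the closed sector is where all of them are nonnegative.\<close>
  define I where "I = {u \<in> U. u t = 0 \<and> u w \<noteq> 0}"
  define g where "g = (\<lambda>u v. sgn (u w) * u v :: real)"
  let ?L = "span (cell t)" and ?W = "span (cell w)"
  have finI: "finite I" using finU by (simp add: I_def)
  have tw: "u t = 0 \<or> sgn (u t) = sgn (u w)" if "u \<in> U" for u
    using TS cell_self[of t] that unfolding closure_cell by blast
  have g_add: "g u (x + y) = g u x + g u y" and g_scale: "g u (c *\<^sub>R x) = c * g u x" if "u \<in> I" for u x y c
    using that linU by (auto simp: I_def g_def linear_add linear_scale algebra_simps)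
  have gw: "0 < g u w" if "u \<in> I" for u using that by (auto simp: I_def g_def sgn_if)
  have L_iff: "x \<in> ?L \<longleftrightarrow> x \<in> ?W \<and> (\<forall>u\<in>I. g u x = 0)" for x
  proof
    assume x: "x \<in> ?L"
    have "u x = 0" if "u \<in> U" "u w = 0" for u
    proof -
      have "u t = 0" using tw[OF that(1)] that(2) by (auto simp: sgn_zero_iff)
      then show ?thesis using x that(1) unfolding span_cell by blast
    qed
    moreover have "u x = 0" if "u \<in> I" for u using x that unfolding span_cell I_def by blast
    ultimately show "x \<in> ?W \<and> (\<forall>u\<in>I. g u x = 0)" unfolding span_cell g_def by simp
  next
    assume x: "x \<in> ?W \<and> (\<forall>u\<in>I. g u x = 0)"
    have "u x = 0" if u: "u \<in> U" "u t = 0" for u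
    proof (cases "u w = 0")
      case True
      then show ?thesis using x u unfolding span_cell by blast
    next
      case False
      then have "u \<in> I" using u by (simp add: I_def)
      then have "sgn (u w) * u x = 0" using x by (simp add: g_def)
      then show ?thesis using False by (simp add: sgn_zero_iff)
    qed
    then show "x \<in> ?L" unfolding span_cell by blast
  qed
  have gL: "g u l = 0" if "u \<in> I" "l \<in> ?L" for u l using that L_iff by blast
  have LW: "?L \<subseteq> ?W" using L_iff by blast
  have wW: "w \<in> ?W" by (simp add: span_base cell_self)
  have dimLW: "dim ?W = Suc (Suc (dim ?L))" using dim2 by simp
  obtain u1 where u1: "u1 \<in> I"
  proof (cases "I = {}")
    case True
    then have "?L = ?W" using L_iff by blast
    then show ?thesis using dimLW by simp
  qed blast
  \<comment> \<open>The kernel of one form \<open>g u1\<close> on \<open>?W\<close> has codimension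
    one, whereas \<open>?L\<close> has codimension two.\<close>
  obtain y0 where y0: "y0 \<in> ?W" "g u1 y0 = 0" "y0 \<notin> ?L"
  proof (rule ccontr)
    assume "\<not> thesis"
    then have sub: "\<And>x. x \<in> ?W \<Longrightarrow> g u1 x = 0 \<Longrightarrow> x \<in> ?L" using that by blast
    have "?W \<subseteq> span (insert w ?L)"
    proof
      fix x assume x: "x \<in> ?W"
      have "x + (- (g u1 x / g u1 w)) *\<^sub>R w \<in> ?L"
      proof (rule sub)
        show "x + (- (g u1 x / g u1 w)) *\<^sub>R w \<in> ?W" using x wW by (intro span_add span_scale)
        show "g u1 (x + (- (g u1 x / g u1 w)) *\<^sub>R w) = 0"
          using gw[OF u1] by (simp only: g_add[OF u1] g_scale[OF u1]) simp
      qed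
      then show "x \<in> span (insert w ?L)"
        unfolding span_breakdown_eq by (intro exI[of _ "g u1 x / g u1 w"]) (simp add: span_span)
    qed
    then have "dim ?W \<le> dim (insert w ?L)" using fd.dim_mono by blast
    also have "\<dots> \<le> Suc (dim ?L)" by (simp add: fd.dim_insert)
    finally show False using dimLW by simp
  qed
  obtain u2 where u2: "u2 \<in> I" "g u2 y0 \<noteq> 0" using L_iff y0 by blast
  \<comment> \<open>A direction is wanted along which one form increases and another decreases, so
    that the line through \<open>w\<close> leaves the sector at both ends. Subtracting this multiple
    of \<open>w\<close> halves the value of \<open>g u2\<close> and gives \<open>g u1\<close> the
    opposite sign.\<close>
  define y where "y = y0 + (- (g u2 y0 / (2 * g u2 w))) *\<^sub>R w"
  have yW: "y \<in> ?W" unfolding y_def using y0 wW by (intro span_add span_scale)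
  have gu2y: "g u2 y = g u2 y0 / 2"
    unfolding y_def g_add[OF u2(1)] g_scale[OF u2(1)] using gw[OF u2(1)] by simp
  have gu1y: "g u1 y = - (g u2 y0 / (2 * g u2 w)) * g u1 w"
    unfolding y_def g_add[OF u1] g_scale[OF u1] using y0 by simp
  have "g u1 y * g u2 y < 0"
  proof -
    have "g u1 y * g u2 y = - ((g u2 y0 * g u2 y0) * (g u1 w / (4 * g u2 w)))"
      unfolding gu2y gu1y by simp
    moreover have "0 < (g u2 y0 * g u2 y0) * (g u1 w / (4 * g u2 w))"
    proof (rule mult_pos_pos)
      show "0 < g u2 y0 * g u2 y0" using u2(2) not_real_square_gt_zero by blast
      show "0 < g u1 w / (4 * g u2 w)" using gw[OF u1] gw[OF u2(1)] by simp
    qed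
    ultimately show ?thesis by linarith
  qed
  then have exn: "\<exists>u\<in>I. g u y < 0" and exp: "\<exists>u\<in>I. g u (- 1 *\<^sub>R y) < 0"
    using u1 u2(1) g_scale[of _ "-1" y] by (auto simp: mult_less_0_iff)
  \<comment> \<open>The first exit from the sector along \<open>d\<close>: the smallest of the
    parameters at which a decreasing form reaches zero.\<close>
  have hit: "\<exists>s>0. (\<forall>u\<in>I. 0 \<le> g u (w + s *\<^sub>R d)) \<and> (\<exists>u\<in>I. g u (w + s *\<^sub>R d) = 0 \<and> g u d < 0)"
    if ex: "\<exists>u\<in>I. g u d < 0" for d
  proof -
    define Q where "Q = (\<lambda>u. g u w / (- g u d)) ` {u \<in> I. g u d < 0}"
    have finQ: "finite Q" and neQ: "Q \<noteq> {}" using finI ex by (auto simp: Q_def)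
    have posQ: "0 < q" if "q \<in> Q" for q using that gw by (auto simp: Q_def intro!: divide_pos_neg)
    have minQ: "Min Q \<in> Q" using finQ neQ by simp
    have "0 \<le> g u (w + Min Q *\<^sub>R d)" if u: "u \<in> I" for u
    proof (cases "g u d < 0")
      case True
      then have "Min Q \<le> g u w / (- g u d)" using finQ u by (auto simp: Q_def)
      then have "Min Q * (- g u d) \<le> g u w" using True by (simp add: pos_le_divide_eq del: divide_minus_right)
      then show ?thesis using g_add[OF u] g_scale[OF u] by simp
    next
      case False
      then show ?thesis using g_add[OF u] g_scale[OF u] gw[OF u] posQ[OF minQ] by simp
    qed
    moreover obtain u where u: "u \<in> I" "g u d < 0" "Min Q = g u w / (- g u d)"
      using minQ by (auto simp: Q_def)
    have "g u (w + Min Q *\<^sub>R d) = 0" unfolding u(3) g_add[OF u(1)] g_scale[OF u(1)] using u(2) by simp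
    ultimately show ?thesis using u posQ[OF minQ] by blast
  qed
  obtain s1 a1 where s1: "0 < s1" "\<And>u. u \<in> I \<Longrightarrow> 0 \<le> g u (w + s1 *\<^sub>R y)" "a1 \<in> I"
    "g a1 (w + s1 *\<^sub>R y) = 0" "g a1 y < 0"
    using hit[OF exn] by blast
  obtain s2 a2 where s2: "0 < s2" "\<And>u. u \<in> I \<Longrightarrow> 0 \<le> g u (w + s2 *\<^sub>R (- 1 *\<^sub>R y))" "a2 \<in> I"
    "g a2 (w + s2 *\<^sub>R (- 1 *\<^sub>R y)) = 0" "g a2 (- 1 *\<^sub>R y) < 0"
    using hit[OF exp] by blast
  define z1 where "z1 = w + s1 *\<^sub>R y"
  define z2 where "z2 = w + s2 *\<^sub>R (- 1 *\<^sub>R y)"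
  \<comment> \<open>The barycentric coordinates of \<open>w\<close> on the segment between the two
    exit points.\<close>
  define \<alpha> where "\<alpha> = s1 / (s1 + s2)"
  define \<beta> where "\<beta> = s2 / (s1 + s2)"
  have ab: "0 < \<alpha>" "0 < \<beta>" "\<beta> + \<alpha> = 1" using s1 s2 by (auto simp: \<alpha>_def \<beta>_def add_divide_distrib[symmetric])
  have w_comb: "w = \<beta> *\<^sub>R z1 + \<alpha> *\<^sub>R z2"
  proof -
    have "\<beta> *\<^sub>R z1 + \<alpha> *\<^sub>R z2 = (\<beta> + \<alpha>) *\<^sub>R w + (\<beta> * s1 - \<alpha> * s2) *\<^sub>R y"
      by (simp add: z1_def z2_def algebra_simps)
    also have "\<beta> * s1 - \<alpha> * s2 = 0" by (simp add: \<alpha>_def \<beta>_def)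
    finally show ?thesis using ab by simp
  qed
  have zW: "z1 \<in> ?W" "z2 \<in> ?W" unfolding z1_def z2_def using yW wW by (simp_all add: span_add span_diff span_scale)
  have g1: "g a1 z1 = 0" "0 < g a1 z2" and g2: "g a2 z2 = 0" "0 < g a2 z1"
    and gz: "\<And>u. u \<in> I \<Longrightarrow> 0 \<le> g u z1" "\<And>u. u \<in> I \<Longrightarrow> 0 \<le> g u z2"
  proof -
    have A: "g a1 w = \<beta> * g a1 z1 + \<alpha> * g a1 z2" "g a2 w = \<beta> * g a2 z1 + \<alpha> * g a2 z2"
      using s1(3) s2(3) g_add g_scale by (subst w_comb; simp)+
    show e: "g a1 z1 = 0" "g a2 z2 = 0" using s1 s2 by (auto simp: z1_def z2_def)
    show "0 < g a1 z2" "0 < g a2 z1"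
      using A e gw[OF s1(3)] gw[OF s2(3)] ab by (auto simp: zero_less_mult_iff)
  qed (use s1 s2 in \<open>auto simp: z1_def z2_def\<close>)
  \<comment> \<open>A boundary ray of the sector, shifted close to \<open>t\<close>, determines a
    cell. Its dimension lies strictly between the two given ones: it contains \<open>z\<close>
    besides \<open>?L\<close>, while the form \<open>a\<close> vanishes on it but not at
    \<open>w\<close>.\<close>
  have mid: "\<exists>q c. q = c *\<^sub>R t + z \<and> (\<forall>u\<in>U. sgn (u q) = (if u t = 0 then sgn (u z) else sgn (u t))) \<and>
      facet (cell t) (cell q) \<and> facet (cell q) (cell w) \<and> span (cell q) = span (insert z ?L) \<and> z \<notin> ?L"
    if z: "z \<in> ?W" and nn: "\<And>u. u \<in> I \<Longrightarrow> 0 \<le> g u z" and a: "a \<in> I" "g a z = 0" and b: "b \<in> I" "0 < g b z"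
    for z a b
  proof -
    obtain c where c: "\<forall>u\<in>U. sgn (u (c *\<^sub>R t + z)) = (if u t = 0 then sgn (u z) else sgn (u t))"
      using local_point by blast
    define q where "q = c *\<^sub>R t + z"
    have q: "sgn (u q) = (if u t = 0 then sgn (u z) else sgn (u t))" if "u \<in> U" for u
      using c that by (simp add: q_def)
    have q0: "u q = 0 \<longleftrightarrow> u t = 0 \<and> u z = 0" if "u \<in> U" for u
      using q[OF that] sgn_zero_iff[of "u q"] sgn_zero_iff[of "u z"] sgn_zero_iff[of "u t"] by (simp split: if_splits)
    have zL: "z \<notin> ?L" using gL[OF b(1), of z] b(2) by auto
    have tq: "cell t \<subseteq> cone_closure (cell q)"
    proof
      fix x assume x: "x \<in> cell t"
      have "u x = 0 \<or> sgn (u x) = sgn (u q)" if u: "u \<in> U" for u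
      proof -
        have "sgn (u x) = sgn (u t)" using x u by (simp add: same_signs_def)
        then show ?thesis using q[OF u] by (cases "u t = 0") (auto simp: sgn_zero_iff)
      qed
      then show "x \<in> cone_closure (cell q)" unfolding closure_cell by blast
    qed
    have qw: "cell q \<subseteq> cone_closure (cell w)"
    proof
      fix x assume x: "x \<in> cell q"
      have "u x = 0 \<or> sgn (u x) = sgn (u w)" if u: "u \<in> U" for u
      proof -
        have sx: "sgn (u x) = sgn (u q)" using x u by (simp add: same_signs_def)
        show ?thesis
        proof (cases "u t = 0")
          case False
          then show ?thesis using sx q[OF u] tw[OF u] by simp
        next
          case True
          then have sz: "sgn (u x) = sgn (u z)" using sx q[OF u] by simp
          show ?thesis
          proof (cases "u w = 0")
            case True
            then have "u z = 0" using z u unfolding span_cell by blast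
            then show ?thesis using sz by (simp add: sgn_zero_iff)
          next
            case False
            then have "u \<in> I" using u True by (simp add: I_def)
            from nn[OF this] have "u z = 0 \<or> sgn (u z) = sgn (u w)"
              using False by (auto simp: g_def sgn_if split: if_splits)
            then show ?thesis using sz by (auto simp: sgn_zero_iff)
          qed
        qed
      qed
      then show "x \<in> cone_closure (cell w)" unfolding closure_cell by blast
    qed
    have "z \<in> span (cell q)" and Lq: "?L \<subseteq> span (cell q)" unfolding span_cell using q0 by auto
    then have sub: "span (insert z ?L) \<subseteq> span (cell q)" by (intro span_minimal) auto
    have d1: "dim (span (insert z ?L)) = Suc (dim ?L)" using zL by (simp add: fd.dim_insert span_span)
    have d2: "dim (cell q) < dim ?W"
    proof (rule ccontr)
      assume "\<not> ?thesis"
      moreover have "span (cell q) \<subseteq> ?W"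
        using qw cone_closure_subset_span[OF open_cell] by (intro span_minimal) auto
      ultimately have "span (cell q) = ?W" by (intro fd.subspace_dim_equal) auto
      then have "w \<in> span (cell q)" using wW by simp
      then have "a w = 0" unfolding span_cell using q0[of a] a by (auto simp: I_def g_def sgn_zero_iff)
      then show False using a by (simp add: I_def)
    qed
    have d3: "dim (cell q) = Suc (dim ?L)"
      using fd.dim_subset[OF sub] d1 d2 dimLW by simp
    then have "span (cell q) = span (insert z ?L)"
      using fd.subspace_dim_equal[OF _ _ sub] d1 by simp
    then show ?thesis
      using zL tq qw d3 dim2 q by (intro exI[of _ q] exI[of _ c]) (auto simp: q_def facet_def)
  qed
  obtain q1 c1 where q1: "q1 = c1 *\<^sub>R t + z1" "\<And>u. u \<in> U \<Longrightarrow> sgn (u q1) = (if u t = 0 then sgn (u z1) else sgn (u t))"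
    "facet (cell t) (cell q1)" "facet (cell q1) (cell w)" "span (cell q1) = span (insert z1 ?L)" "z1 \<notin> ?L"
    using mid[OF zW(1) gz(1) s1(3) g1(1) s2(3) g2(2)] by blast
  obtain q2 c2 where q2: "q2 = c2 *\<^sub>R t + z2" "\<And>u. u \<in> U \<Longrightarrow> sgn (u q2) = (if u t = 0 then sgn (u z2) else sgn (u t))"
    "facet (cell t) (cell q2)" "facet (cell q2) (cell w)" "span (cell q2) = span (insert z2 ?L)" "z2 \<notin> ?L"
    using mid[OF zW(2) gz(2) s2(3) g2(1) s1(3) g1(2)] by blast
  have mem: "cell x \<in> range cell" for x by blast
  have tL: "c *\<^sub>R t \<in> ?L" for c by (intro span_scale span_base cell_self)
  have w1: "w \<notin> span (insert z1 ?L)" and w2: "w \<notin> span (insert z2 ?L)"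
    using facet_span(1)[OF dec_cells mem mem q1(4) cell_self] facet_span(1)[OF dec_cells mem mem q2(4) cell_self]
      q1(5) q2(5) by auto
  have z21: "z2 \<notin> span (insert z1 ?L)"
  proof
    assume "z2 \<in> span (insert z1 ?L)"
    then have "w \<in> span (insert z1 ?L)" unfolding w_comb by (intro span_add span_scale) (auto simp: span_base)
    then show False using w1 by blast
  qed
  have z12: "z1 \<notin> span (insert z2 ?L)"
  proof
    assume "z1 \<in> span (insert z2 ?L)"
    then have "w \<in> span (insert z2 ?L)" unfolding w_comb by (intro span_add span_scale) (auto simp: span_base)
    then show False using w2 by blast
  qed
  have i1: "incidence (Some (cell t)) (Some (cell q1)) = side_sign ?L z1"
    using incidence_facet[OF dec_cells mem mem q1(3) cell_self]
      side_sign_scale_add[OF _ q1(6) tL, of 1 c1] by (simp add: q1(1) add.commute)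
  have i2: "incidence (Some (cell t)) (Some (cell q2)) = side_sign ?L z2"
    using incidence_facet[OF dec_cells mem mem q2(3) cell_self]
      side_sign_scale_add[OF _ q2(6) tL, of 1 c2] by (simp add: q2(1) add.commute)
  have j1: "incidence (Some (cell q1)) (Some (cell w)) = side_sign (span (insert z1 ?L)) z2"
  proof -
    have "\<beta> *\<^sub>R z1 \<in> span (insert z1 ?L)" by (intro span_scale span_base) simp
    then have "side_sign (span (insert z1 ?L)) (\<alpha> *\<^sub>R z2 + \<beta> *\<^sub>R z1) = side_sign (span (insert z1 ?L)) z2"
      using side_sign_scale_add[OF _ z21, of "\<beta> *\<^sub>R z1" \<alpha>] ab by simp
    then show ?thesis
      using incidence_facet[OF dec_cells mem mem q1(4) cell_self] w_comb by (simp add: q1(5) add.commute)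
  qed
  have j2: "incidence (Some (cell q2)) (Some (cell w)) = side_sign (span (insert z2 ?L)) z1"
  proof -
    have "\<alpha> *\<^sub>R z2 \<in> span (insert z2 ?L)" by (intro span_scale span_base) simp
    then have "side_sign (span (insert z2 ?L)) (\<beta> *\<^sub>R z1 + \<alpha> *\<^sub>R z2) = side_sign (span (insert z2 ?L)) z1"
      using side_sign_scale_add[OF _ z12, of "\<alpha> *\<^sub>R z2" \<beta>] ab by simp
    then show ?thesis
      using incidence_facet[OF dec_cells mem mem q2(4) cell_self] w_comb by (simp add: q2(5))
  qed
  have sgn_pos_mult: "sgn (a * x) = sgn x" if "0 < a" for a x :: real using that by (simp add: sgn_mult)
  \<comment> \<open>Modulo \<open>?L\<close> the point \<open>r\<close> of an intermediate cell is
    \<open>a *\<^sub>R z1 + b *\<^sub>R z2\<close> with nonnegative coefficients. Two positive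
    coefficients give the cell of \<open>w\<close>, two zero ones put \<open>r\<close> into
    \<open>?L\<close>, so \<open>r\<close> is on one of the two rays.\<close>
  have uniq: "\<rho> = cell q1 \<or> \<rho> = cell q2"
    if "\<rho> \<in> range cell" and f1: "facet (cell t) \<rho>" and f2: "facet \<rho> (cell w)" for \<rho>
  proof -
    obtain r where r: "\<rho> = cell r" using \<open>\<rho> \<in> range cell\<close> by blast
    have f1: "facet (cell t) (cell r)" and f2: "facet (cell r) (cell w)" using f1 f2 r by auto
    have rL: "r \<notin> ?L" by (rule facet_span(1)[OF dec_cells mem mem f1 cell_self])
    have rS: "r \<in> cone_closure (cell w)" using f2 cell_self by (auto simp: facet_def)
    have rW: "r \<in> ?W" using rS cone_closure_subset_span[OF open_cell] by blast
    have tr: "u t = 0 \<or> sgn (u t) = sgn (u r)" if "u \<in> U" for u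
      using f1 cell_self[of t] that unfolding facet_def closure_cell by blast
    have gr: "0 \<le> g u r" if "u \<in> I" for u
      using rS that unfolding closure_cell by (auto simp: I_def g_def sgn_if split: if_splits)
    have "r \<in> span (insert w (span (insert z1 ?L)))"
      using rW facet_span(2)[OF dec_cells mem mem q1(4) cell_self] q1(5) by simp
    then obtain k where "r - k *\<^sub>R w \<in> span (insert z1 ?L)" by (auto simp: span_breakdown_eq span_span)
    then obtain j where l: "r - k *\<^sub>R w - j *\<^sub>R z1 \<in> ?L" by (auto simp: span_breakdown_eq span_span)
    define l where "l = r - k *\<^sub>R w - j *\<^sub>R z1"
    define a where "a = j + k * \<beta>"
    define b where "b = k * \<alpha>"
    have lL: "l \<in> ?L" using l by (simp add: l_def)
    have r_comb: "r = l + (a *\<^sub>R z1 + b *\<^sub>R z2)"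
      unfolding l_def a_def b_def by (subst w_comb) (simp add: algebra_simps)
    have gr_eq: "g u r = a * g u z1 + b * g u z2" if "u \<in> I" for u
      using that gL[OF that lL] by (subst r_comb) (simp add: g_add g_scale)
    have a0: "0 \<le> a" using gr[OF s2(3)] gr_eq[OF s2(3)] g2 by (simp add: zero_le_mult_iff)
    have b0: "0 \<le> b" using gr[OF s1(3)] gr_eq[OF s1(3)] g1 by (simp add: zero_le_mult_iff)
    have "\<not> (0 < a \<and> 0 < b)"
    proof
      assume pos: "0 < a \<and> 0 < b"
      have "sgn (u r) = sgn (u w)" if u: "u \<in> U" for u
      proof (cases "u t = 0")
        case False
        then show ?thesis using tr[OF u] tw[OF u] by simp
      next
        case True
        show ?thesis
        proof (cases "u w = 0")
          case True
          then have "u r = 0" using rW u unfolding span_cell by blast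
          then show ?thesis using True by simp
        next
          case False
          then have uI: "u \<in> I" using u True by (simp add: I_def)
          have "0 < \<beta> * g u z1 + \<alpha> * g u z2"
            using gw[OF uI] by (subst (asm) w_comb) (simp add: g_add[OF uI] g_scale[OF uI])
          then have "g u z1 \<noteq> 0 \<or> g u z2 \<noteq> 0" by auto
          then have "0 < g u r"
            unfolding gr_eq[OF uI] using gz(1)[OF uI] gz(2)[OF uI] pos
            by (metis add_nonneg_pos add_pos_nonneg less_eq_real_def mult_nonneg_nonneg mult_pos_pos)
          then show ?thesis using False by (auto simp: g_def sgn_if split: if_splits)
        qed
      qed
      then have "cell r = cell w" by (intro cell_eq) (simp add: same_signs_def)
      then show False using f2 by (simp add: facet_def)
    qed
    moreover have "\<not> (a = 0 \<and> b = 0)" using r_comb lL rL by auto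
    ultimately consider "0 < a" "b = 0" | "a = 0" "0 < b" using a0 b0 by linarith
    then show ?thesis
    proof cases
      case 1
      have "sgn (u r) = sgn (u q1)" if u: "u \<in> U" for u
      proof (cases "u t = 0")
        case True
        then have "u l = 0" using lL u unfolding span_cell by blast
        then have "u r = a * u z1" using linU[OF u] 1 by (subst r_comb) (simp add: linear_add linear_scale linear_0)
        then show ?thesis using True q1(2)[OF u] 1 by (simp add: sgn_pos_mult)
      qed (use tr[OF u] q1(2)[OF u] in simp)
      then have "cell r = cell q1" by (intro cell_eq) (simp add: same_signs_def)
      then show ?thesis using r by simp
    next
      case 2
      have "sgn (u r) = sgn (u q2)" if u: "u \<in> U" for u
      proof (cases "u t = 0")
        case True
        then have "u l = 0" using lL u unfolding span_cell by blast
        then have "u r = b * u z2" using linU[OF u] 2 by (subst r_comb) (simp add: linear_add linear_scale linear_0)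
        then show ?thesis using True q2(2)[OF u] 2 by (simp add: sgn_pos_mult)
      qed (use tr[OF u] q2(2)[OF u] in simp)
      then have "cell r = cell q2" by (intro cell_eq) (simp add: same_signs_def)
      then show ?thesis using r by simp
    qed
  qed
  show ?thesis
  proof (rule that)
    show "cell q1 \<noteq> cell q2"
    proof
      assume "cell q1 = cell q2"
      then have "span (insert z1 ?L) = span (insert z2 ?L)" using q1(5) q2(5) by simp
      then show False using z21 span_base[of z2 "insert z2 ?L"] by simp
    qed
    show "{\<rho> \<in> range cell. facet (cell t) \<rho> \<and> facet \<rho> (cell w)} = {cell q1, cell q2}"
      using uniq q1(3,4) q2(3,4) by blast
    show "incidence (Some (cell t)) (Some (cell q1)) * incidence (Some (cell q1)) (Some (cell w)) +
      incidence (Some (cell t)) (Some (cell q2)) * incidence (Some (cell q2)) (Some (cell w)) = 0"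
      unfolding i1 i2 j1 j2 using side_sign_swap[OF _ q1(6) z21] by simp
  qed
qed

text \<open>The counterpart of \<open>diamond\<close> with the augmentation as second map: a cell of
  codimension one has two neighbours, reached from it along \<open>z\<close> and \<open>- z\<close>,
  and these have opposite signs.\<close>

lemma wall_sides:
  assumes dim1: "Suc (dim (cell t)) = dim (UNIV :: 'v set)"
  obtains \<rho>1 \<rho>2 where "\<rho>1 \<noteq> \<rho>2" "{\<rho> \<in> range cell. facet (cell t) \<rho>} = {\<rho>1, \<rho>2}"
    "incidence (Some (cell t)) (Some \<rho>1) + incidence (Some (cell t)) (Some \<rho>2) = 0"
proof -
  let ?L = "span (cell t)"
  have "?L \<noteq> UNIV"
  proof
    assume "?L = UNIV"
    then have "dim (UNIV :: 'v set) = dim (cell t)" using dim_span[of "cell t"] by metis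
    then show False using dim1 by linarith
  qed
  then obtain z where z: "z \<notin> ?L" by blast
  have mem: "cell x \<in> range cell" for x by blast
  have all: "span (insert z ?L) = UNIV"
    using z dim1 fd.dim_eq_full[of "insert z ?L"] by (simp add: fd.dim_insert span_span fd.dimension_def)
  have mid: "\<exists>q. (\<forall>u\<in>U. sgn (u q) = (if u t = 0 then sgn (u (e *\<^sub>R z)) else sgn (u t))) \<and>
      facet (cell t) (cell q) \<and> incidence (Some (cell t)) (Some (cell q)) = (if 0 < e then 1 else -1) * side_sign ?L z"
    if e: "e \<noteq> 0" for e
  proof -
    obtain c where c: "\<forall>u\<in>U. sgn (u (c *\<^sub>R t + e *\<^sub>R z)) = (if u t = 0 then sgn (u (e *\<^sub>R z)) else sgn (u t))"
      using local_point by blast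
    define q where "q = c *\<^sub>R t + e *\<^sub>R z"
    have cq: "\<forall>u\<in>U. sgn (u q) = (if u t = 0 then sgn (u (e *\<^sub>R z)) else sgn (u t))" using c by (simp add: q_def)
    have tL: "c *\<^sub>R t \<in> ?L" by (intro span_scale span_base cell_self)
    have tq: "cell t \<subseteq> cone_closure (cell q)"
    proof
      fix x assume x: "x \<in> cell t"
      have "u x = 0 \<or> sgn (u x) = sgn (u q)" if u: "u \<in> U" for u
      proof -
        have "sgn (u x) = sgn (u t)" using x u by (simp add: same_signs_def)
        then show ?thesis using cq u by (cases "u t = 0") (auto simp: sgn_zero_iff)
      qed
      then show "x \<in> cone_closure (cell q)" unfolding closure_cell by blast
    qed
    have "cell t \<noteq> cell q"
    proof
      assume "cell t = cell q"
      then have "q \<in> ?L" using cell_self[of q] by (simp add: span_base)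
      from span_scale[OF span_diff[OF this tL], of "1 / e"]
      have "(1 / e) *\<^sub>R (q - c *\<^sub>R t) \<in> ?L" .
      then show False using z e by (simp add: q_def)
    qed
    then have "\<not> dim (cell q) \<le> dim (cell t)"
      using closure_eq_dim[OF dec_cells mem mem tq] by blast
    then have f: "facet (cell t) (cell q)"
      using tq dim1 fd.dim_subset[of "cell q" UNIV] by (simp add: facet_def)
    have "side_sign ?L q = (if 0 < e then 1 else -1) * side_sign ?L z"
      unfolding q_def using side_sign_scale_add[OF _ z tL e] by (simp add: add.commute)
    then show ?thesis using incidence_facet[OF dec_cells mem mem f cell_self] f cq
      by (intro exI[of _ q]) simp
  qed
  obtain q1 where q1: "\<forall>u\<in>U. sgn (u q1) = (if u t = 0 then sgn (u (1 *\<^sub>R z)) else sgn (u t))"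
    "facet (cell t) (cell q1)"
    "incidence (Some (cell t)) (Some (cell q1)) = (if 0 < (1::real) then 1 else -1) * side_sign ?L z"
    using mid[OF one_neq_zero] by blast
  have "- 1 \<noteq> (0::real)" by simp
  from mid[OF this] obtain q2 where q2:
    "\<forall>u\<in>U. sgn (u q2) = (if u t = 0 then sgn (u (- 1 *\<^sub>R z)) else sgn (u t))"
    "facet (cell t) (cell q2)"
    "incidence (Some (cell t)) (Some (cell q2)) = (if 0 < (- 1::real) then 1 else -1) * side_sign ?L z"
    by blast
  have uniq: "\<rho> = cell q1 \<or> \<rho> = cell q2" if \<rho>: "\<rho> \<in> range cell" and f: "facet (cell t) \<rho>" for \<rho>
  proof -
    obtain r where r: "\<rho> = cell r" using \<rho> by blast
    have f1: "facet (cell t) (cell r)" using f r by simp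
    have rL: "r \<notin> ?L" by (rule facet_span(1)[OF dec_cells mem mem f1 cell_self])
    have tr: "u t = 0 \<or> sgn (u t) = sgn (u r)" if "u \<in> U" for u
      using f1 cell_self[of t] that unfolding facet_def closure_cell by blast
    have "r \<in> span (insert z ?L)" using all by simp
    then obtain a where l: "r - a *\<^sub>R z \<in> ?L" by (auto simp: span_breakdown_eq span_span)
    then have a0: "a \<noteq> 0" using rL by auto
    have ur: "u r = a * u z" if u: "u \<in> U" "u t = 0" for u
    proof -
      have "u (r - a *\<^sub>R z) = 0" using l u unfolding span_cell by blast
      then show ?thesis using linU[OF u(1)] by (simp add: linear_diff linear_scale)
    qed
    show ?thesis
    proof (cases "0 < a")
      case True
      have "sgn (u r) = sgn (u q1)" if u: "u \<in> U" for u
        using tr[OF u] bspec[OF q1(1) u] ur[OF u] True by (auto simp: sgn_mult)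
      then have "cell r = cell q1" by (intro cell_eq) (simp add: same_signs_def)
      then show ?thesis using r by simp
    next
      case False
      then have "a < 0" using a0 by simp
      have "sgn (u r) = sgn (u q2)" if u: "u \<in> U" for u
        using tr[OF u] bspec[OF q2(1) u] ur[OF u] \<open>a < 0\<close> linU[OF u]
        by (auto simp: sgn_mult linear_neg sgn_minus)
      then have "cell r = cell q2" by (intro cell_eq) (simp add: same_signs_def)
      then show ?thesis using r by simp
    qed
  qed
  show ?thesis
  proof (rule that)
    show "cell q1 \<noteq> cell q2"
    proof
      assume "cell q1 = cell q2"
      then have "side_sign ?L z = - side_sign ?L z"
        using q1(3) q2(3) by (simp del: incidence.simps)
      then show False using side_sign_cases[of ?L z] by auto
    qed
    show "{\<rho> \<in> range cell. facet (cell t) \<rho>} = {cell q1, cell q2}"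
      using uniq q1(2) q2(2) by blast
  qed (use q1(3) q2(3) in simp)
qed

lemma square_zero_cells: "square_zero incidence (star_index (range cell) p)"
proof (rule square_zeroI)
  fix i k assume i: "i \<in> star_index (range cell) p" and k: "k \<in> star_index (range cell) p"
  let ?J = "star_index (range cell) p"
  have finJ: "finite ?J" using decompositionD(1)[OF dec_cells] by (simp add: star_index_def star_def)
  show "(\<Sum>j\<in>?J. incidence i j * incidence j k) = 0"
  proof (cases i)
    case None
    then show ?thesis by simp
  next
    case (Some T)
    then obtain t where t: "T = cell t" "p \<in> cone_closure (cell t)" using i by (auto simp: star_index_def star_def)
    \<comment> \<open>A star contains, with a cell, every cell that has it as a facet, so no
      intermediate cell is lost by restricting to the star.\<close>
    have up: "Some \<rho> \<in> ?J" if "\<rho> \<in> range cell" "facet (cell t) \<rho>" for \<rho>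
      using that t(2) cone_closure_mono[OF open_cell decompositionD(2)[OF dec_cells that(1)]]
      by (auto simp: star_index_def star_def facet_def)
    show ?thesis
    proof (cases k)
      case None
      let ?M = "{\<rho> \<in> range cell. facet (cell t) \<rho> \<and> dim \<rho> = dim (UNIV :: 'v set)}"
      have "(\<Sum>j\<in>?J. incidence i j * incidence j k) = (\<Sum>j\<in>Some ` ?M. incidence i j * incidence j k)"
      proof (rule sum.mono_neutral_right[OF finJ])
        show "Some ` ?M \<subseteq> ?J" using up by blast
        show "\<forall>j\<in>?J - Some ` ?M. incidence i j * incidence j k = 0"
        proof
          fix j assume j: "j \<in> ?J - Some ` ?M"
          show "incidence i j * incidence j k = 0"
            using j unfolding Some None t(1) by (cases j) (auto simp: star_index_def star_def)
        qed
      qed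
      also have "\<dots> = (\<Sum>\<rho>\<in>?M. incidence (Some (cell t)) (Some \<rho>))"
        by (simp add: sum.reindex Some None t(1))
      also have "\<dots> = 0"
      proof (cases "Suc (dim (cell t)) = dim (UNIV :: 'v set)")
        case True
        then have "?M = {\<rho> \<in> range cell. facet (cell t) \<rho>}" by (auto simp: facet_def)
        moreover obtain \<rho>1 \<rho>2 where "\<rho>1 \<noteq> \<rho>2" "{\<rho> \<in> range cell. facet (cell t) \<rho>} = {\<rho>1, \<rho>2}"
          "incidence (Some (cell t)) (Some \<rho>1) + incidence (Some (cell t)) (Some \<rho>2) = 0"
          by (rule wall_sides[OF True])
        ultimately show ?thesis by (simp only: sum.insert sum.empty finite.intros) simp
      next
        case False
        then have "?M = {}" by (auto simp: facet_def)
        then show ?thesis by (simp only: sum.empty)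
      qed
      finally show ?thesis .
    next
      case (Some S)
      then obtain w where w: "S = cell w" using k by (auto simp: star_index_def star_def)
      let ?M = "{\<rho> \<in> range cell. facet (cell t) \<rho> \<and> facet \<rho> (cell w)}"
      have "(\<Sum>j\<in>?J. incidence i j * incidence j k) = (\<Sum>j\<in>Some ` ?M. incidence i j * incidence j k)"
      proof (rule sum.mono_neutral_right[OF finJ])
        show "Some ` ?M \<subseteq> ?J" using up by blast
        show "\<forall>j\<in>?J - Some ` ?M. incidence i j * incidence j k = 0"
        proof
          fix j assume j: "j \<in> ?J - Some ` ?M"
          show "incidence i j * incidence j k = 0"
            using j unfolding Some \<open>i = Some T\<close> t(1) w by (cases j) (auto simp: star_index_def star_def)
        qed
      qed
      also have "\<dots> = (\<Sum>\<rho>\<in>?M. incidence (Some (cell t)) (Some \<rho>) * incidence (Some \<rho>) (Some (cell w)))"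
        by (simp only: sum.reindex inj_Some o_def Some \<open>i = Some T\<close> t(1) w)
      also have "\<dots> = 0"
      proof (cases "?M = {}")
        case True
        then show ?thesis by (simp only: True sum.empty)
      next
        case False
        then obtain r where r: "facet (cell t) (cell r)" "facet (cell r) (cell w)" by blast
        have "cell t \<subseteq> cone_closure (cell w)"
          using r cone_closure_mono[OF open_cell open_cell, of r w] by (auto simp: facet_def)
        moreover have "dim (cell w) = Suc (Suc (dim (cell t)))" using r by (simp add: facet_def)
        ultimately obtain \<rho>1 \<rho>2 where "\<rho>1 \<noteq> \<rho>2" "?M = {\<rho>1, \<rho>2}"
          "incidence (Some (cell t)) (Some \<rho>1) * incidence (Some \<rho>1) (Some (cell w)) +
           incidence (Some (cell t)) (Some \<rho>2) * incidence (Some \<rho>2) (Some (cell w)) = 0"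
          by (rule diamond)
        then show ?thesis by (simp only: sum.insert sum.empty finite.intros) simp
      qed
      finally show ?thesis .
    qed
  qed
qed

end

section \<open>Acyclicity carried from the single cell to separated decompositions\<close>

context finite_dim
begin

lemma star_UNIV: "star_index {UNIV :: 'v set} p = {None, Some UNIV}"
  by (auto simp: star_index_def star_def cone_closure_def)

text \<open>The complex is the isomorphism from the only cell to \<open>None\<close>: a cycle
  vanishes on the cell, and its value at \<open>None\<close> is attained.\<close>

lemma acyclic_UNIV: "acyclic_complex incidence (star_index {UNIV :: 'v set} p)"
  unfolding acyclic_complex_def
proof (intro allI impI)
  fix x :: "'v set option \<Rightarrow> int"
  assume "\<forall>j\<in>star_index {UNIV} p. boundary incidence (star_index {UNIV} p) x j = 0"
  then have "x (Some UNIV) = 0" by (simp add: star_UNIV boundary_def)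
  then have "\<forall>j\<in>star_index {UNIV} p. boundary incidence (star_index {UNIV} p) (\<lambda>_. x None) j = x j"
    by (simp add: star_UNIV boundary_def facet_def)
  then show "\<exists>y. \<forall>j\<in>star_index {UNIV} p. boundary incidence (star_index {UNIV} p) y j = x j" by blast
qed

text \<open>Acyclicity lifts along each cut. The lift needs the finer boundary to square to zero,
  which holds because the finer complex again belongs to an arrangement.\<close>

lemma acyclic_arrangement:
  fixes U :: "('v \<Rightarrow> real) set"
  assumes "finite U" "\<forall>u\<in>U. linear u"
  shows "acyclic_complex incidence (star_index (refinement U {UNIV}) p)"
  using assms
proof (induction U rule: finite_induct)
  case empty
  then show ?case by (simp add: refinement_empty[OF decomposition_UNIV] acyclic_UNIV)
next
  case (insert u U)
  have lins: "linear u" "\<forall>v\<in>U. linear v" "\<And>v. v \<in> insert u U \<Longrightarrow> linear v" "finite (insert u U)"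
    using insert.prems insert.hyps by blast+
  have ref: "decomposition (refinement U {UNIV :: 'v set})"
    by (rule decomposition_refinement[OF insert.hyps(1) lins(2) decomposition_UNIV])
  interpret hyperplane_cut B u "refinement U {UNIV}" p
    by (intro hyperplane_cut.intro finite_dim_axioms hyperplane_cut_axioms.intro) (fact lins(1) ref)+
  interpret a: arrangement B "insert u U"
    by (intro arrangement.intro finite_dim_axioms arrangement_axioms.intro) (rule lins(4), erule lins(3))
  have "square_zero incidence (star_index (cut u (refinement U {UNIV})) p)"
    using a.square_zero_cells by (simp add: a.cells[symmetric] refinement_insert)
  from acyclic_pull[OF this insert.IH[OF lins(2)]] show ?case by (simp add: refinement_insert)
qed

text \<open>The reverse passage: both properties descend one hyperplane at a time from the finest
  refinement to \<open>\<D>\<close>.\<close>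

lemma coarsening:
  fixes U :: "('v \<Rightarrow> real) set"
  assumes "finite U" "\<forall>u\<in>U. linear u" and dec: "decomposition \<D>"
    and "square_zero incidence (star_index (refinement U \<D>) p)"
    and "acyclic_complex incidence (star_index (refinement U \<D>) p)"
  shows "square_zero incidence (star_index \<D> p) \<and> acyclic_complex incidence (star_index \<D> p)"
  using assms(1,2,4,5)
proof (induction U rule: finite_induct)
  case empty
  then show ?case by (simp add: refinement_empty[OF dec])
next
  case (insert u U)
  have lins: "linear u" "\<forall>v\<in>U. linear v" using insert.prems by blast+
  interpret hyperplane_cut B u "refinement U \<D>" p
    by (intro hyperplane_cut.intro finite_dim_axioms hyperplane_cut_axioms.intro)
      (fact lins(1) decomposition_refinement[OF insert.hyps(1) lins(2) dec])+
  show ?case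
    using insert.IH[OF lins(2)] insert.prems(2,3) square_zero_push acyclic_push
    unfolding refinement_insert by blast
qed

text \<open>When the signs of \<open>U\<close> tell the cells of \<open>\<D>\<close> apart, each
  sign cell lies inside one cell of \<open>\<D>\<close>. Hence refining \<open>\<D>\<close> by
  \<open>U\<close> yields the bare arrangement, whose star is acyclic.\<close>

lemma decomposition_star_acyclic:
  fixes U :: "('v \<Rightarrow> real) set"
  assumes U: "finite U" "\<forall>u\<in>U. linear u" and dec: "decomposition \<D>"
    and sep: "\<And>C D x y. C \<in> \<D> \<Longrightarrow> D \<in> \<D> \<Longrightarrow> C \<noteq> D \<Longrightarrow> x \<in> C \<Longrightarrow> y \<in> D \<Longrightarrow> \<exists>u\<in>U. sgn (u x) \<noteq> sgn (u y)"
  shows "square_zero incidence (star_index \<D> p)" "acyclic_complex incidence (star_index \<D> p)"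
proof -
  interpret arrangement B U
    by (intro arrangement.intro finite_dim_axioms arrangement_axioms.intro) (rule U(1), erule bspec[OF U(2)])
  have sub: "same_signs U y \<subseteq> C" if C: "C \<in> \<D>" "y \<in> C" for C y
  proof
    fix x assume x: "x \<in> same_signs U y"
    obtain D where D: "D \<in> \<D>" "x \<in> D" by (rule decomposition_cover[OF dec])
    then show "x \<in> C" using sep[OF C(1) D(1) _ C(2) D(2)] x by (cases "C = D") (auto simp: same_signs_def)
  qed
  have "refinement U \<D> = range (same_signs U)"
  proof (intro subset_antisym subsetI)
    fix E assume "E \<in> refinement U \<D>"
    then obtain C y where "E = C \<inter> same_signs U y" "C \<in> \<D>" "y \<in> C" by (auto simp: refinement_def)
    then show "E \<in> range (same_signs U)" using sub by blast
  next
    fix E assume "E \<in> range (same_signs U)"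
    then obtain y where y: "E = same_signs U y" by blast
    obtain C where C: "C \<in> \<D>" "y \<in> C" by (rule decomposition_cover[OF dec])
    then have "E = C \<inter> same_signs U y" using sub y by blast
    then show "E \<in> refinement U \<D>" using C unfolding refinement_def by blast
  qed
  then have "refinement U \<D> = refinement U {UNIV}" by (simp add: cells)
  then show "square_zero incidence (star_index \<D> p)" "acyclic_complex incidence (star_index \<D> p)"
    using coarsening[OF U dec] acyclic_arrangement[OF U] square_zero_cells
    by (simp_all add: cells)
qed

end

section \<open>Coefficients and the complex of a fan\<close>

context abelian_group
begin

lemma int_mult_add: "x \<in> carrier G \<Longrightarrow> [(m + n :: int)] \<cdot> x = [m] \<cdot> x \<oplus> [n] \<cdot> x"
  by (rule add.int_pow_mult)

lemma int_mult_zero: "[(0 :: int)] \<cdot> x = \<zero>"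
  by (simp add: add_pow_def)

lemma int_mult_one: "x \<in> carrier G \<Longrightarrow> [(1 :: int)] \<cdot> x = x"
  by (rule add.int_pow_1)

lemma int_mult_mult: "x \<in> carrier G \<Longrightarrow> [(m * n :: int)] \<cdot> x = [m] \<cdot> ([n] \<cdot> x)"
  using add.int_pow_pow[of x m n] by (simp add: mult.commute)

lemma int_mult_finsum:
  "finite I \<Longrightarrow> f \<in> I \<rightarrow> carrier G \<Longrightarrow> [(n :: int)] \<cdot> (\<Oplus>i\<in>I. f i) = (\<Oplus>i\<in>I. [n] \<cdot> f i)"
proof (induction I rule: finite_induct)
  case empty
  then show ?case using add.int_pow_distrib[of \<zero> \<zero> n] by simp
next
  case (insert i I)
  then have "f i \<in> carrier G" "f \<in> I \<rightarrow> carrier G" by auto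
  then show ?case using insert
    by (simp add: finsum_insert add.int_pow_distrib Pi_def)
qed

lemma sum_int_mult:
  "finite I \<Longrightarrow> x \<in> carrier G \<Longrightarrow> [(\<Sum>i\<in>I. c i :: int)] \<cdot> x = (\<Oplus>i\<in>I. [c i] \<cdot> x)"
proof (induction I rule: finite_induct)
  case (insert i I)
  then show ?case by (simp add: finsum_insert int_mult_add)
qed (simp add: int_mult_zero)

lemma finsum_swap:
  "finite I \<Longrightarrow> finite K \<Longrightarrow> (\<And>i k. i \<in> I \<Longrightarrow> k \<in> K \<Longrightarrow> f i k \<in> carrier G) \<Longrightarrow>
    (\<Oplus>i\<in>I. \<Oplus>k\<in>K. f i k) = (\<Oplus>k\<in>K. \<Oplus>i\<in>I. f i k)"
proof (induction I rule: finite_induct)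
  case (insert i I)
  then have "(\<Oplus>k\<in>K. f i k \<oplus> (\<Oplus>i\<in>I. f i k)) = (\<Oplus>k\<in>K. f i k) \<oplus> (\<Oplus>k\<in>K. \<Oplus>i\<in>I. f i k)"
    by (intro finsum_addf) auto
  moreover have "(\<Oplus>k\<in>K. f i k \<oplus> (\<Oplus>i\<in>I. f i k)) = (\<Oplus>k\<in>K. \<Oplus>i\<in>insert i I. f i k)"
    using insert by (intro finsum_cong' refl) (auto simp: finsum_insert Pi_def)
  ultimately show ?case using insert by (simp add: finsum_insert Pi_def)
qed simp

lemma finsum_mono_neutral:
  assumes "finite K" "I \<subseteq> K" "\<And>i. i \<in> K - I \<Longrightarrow> f i = \<zero>" "f \<in> K \<rightarrow> carrier G"
  shows "(\<Oplus>i\<in>I. f i) = (\<Oplus>i\<in>K. f i)"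
  using assms by (intro add.finprod_mono_neutral_cong_left) auto

text \<open>The integral chain map tensored with the abelian group \<open>G\<close>.\<close>

definition matrix_action :: "('i \<Rightarrow> 'i \<Rightarrow> int) \<Rightarrow> 'i set \<Rightarrow> ('i \<Rightarrow> 'a) \<Rightarrow> 'i \<Rightarrow> 'a" where
  "matrix_action m J a j = (\<Oplus>i\<in>J. [m i j] \<cdot> a i)"

lemma matrix_action_closed: "a \<in> J \<rightarrow> carrier G \<Longrightarrow> matrix_action m J a j \<in> carrier G"
  unfolding matrix_action_def by (intro finsum_closed) auto

lemma matrix_action_comp:
  assumes fin: "finite J" and a: "a \<in> J \<rightarrow> carrier G"
  shows "matrix_action h J (matrix_action m J a) j = (\<Oplus>i\<in>J. [(\<Sum>k\<in>J. m i k * h k j)] \<cdot> a i)"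
proof -
  have aC: "a i \<in> carrier G" if "i \<in> J" for i using a that by auto
  have eq: "[h k j] \<cdot> ([m i k] \<cdot> a i) = [(m i k * h k j)] \<cdot> a i" if "i \<in> J" for i k
    using int_mult_mult[OF aC[OF that], of "h k j" "m i k"] by (simp only: mult.commute)
  have "matrix_action h J (matrix_action m J a) j = (\<Oplus>k\<in>J. \<Oplus>i\<in>J. [h k j] \<cdot> ([m i k] \<cdot> a i))"
    unfolding matrix_action_def using a fin
    by (intro finsum_cong' refl int_mult_finsum) (auto intro!: finsum_closed)
  also have "\<dots> = (\<Oplus>k\<in>J. \<Oplus>i\<in>J. [(m i k * h k j)] \<cdot> a i)"
    using aC by (intro finsum_cong' refl) (auto simp: eq intro!: finsum_closed)
  also have "\<dots> = (\<Oplus>i\<in>J. \<Oplus>k\<in>J. [(m i k * h k j)] \<cdot> a i)"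
    using a fin by (intro finsum_swap) auto
  also have "\<dots> = (\<Oplus>i\<in>J. [(\<Sum>k\<in>J. m i k * h k j)] \<cdot> a i)"
    using a fin by (intro finsum_cong' refl sum_int_mult[symmetric]) auto
  finally show ?thesis .
qed

lemma matrix_action_square_zero:
  assumes fin: "finite J" and a: "a \<in> J \<rightarrow> carrier G" and j: "j \<in> J"
    and sq: "\<And>i. i \<in> J \<Longrightarrow> (\<Sum>k\<in>J. m i k * m k j) = 0"
  shows "matrix_action m J (matrix_action m J a) j = \<zero>"
proof -
  have "(\<Oplus>i\<in>J. [(\<Sum>k\<in>J. m i k * m k j)] \<cdot> a i) = (\<Oplus>i\<in>J. \<zero>)"
    using a by (intro finsum_cong' refl) (auto simp: sq int_mult_zero)
  then show ?thesis unfolding matrix_action_comp[OF fin a] by simp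
qed

text \<open>On a cycle, the half of the homotopy identity that applies \<open>m\<close> before
  \<open>h\<close> vanishes, so the other half is the identity.\<close>

lemma matrix_action_exact:
  assumes fin: "finite J" and a: "a \<in> J \<rightarrow> carrier G"
    and hom: "\<And>i j. i \<in> J \<Longrightarrow> j \<in> J \<Longrightarrow>
      (\<Sum>k\<in>J. h i k * m k j) + (\<Sum>k\<in>J. m i k * h k j) = (if i = j then 1 else 0)"
    and cyc: "\<And>j. j \<in> J \<Longrightarrow> matrix_action m J a j = \<zero>" and j: "j \<in> J"
  shows "matrix_action m J (matrix_action h J a) j = a j"
proof -
  have "matrix_action h J (matrix_action m J a) j = (\<Oplus>i\<in>J. \<zero>)"
    using j cyc unfolding matrix_action_def[of h]
    by (intro finsum_cong' refl) (auto simp: add.int_pow_distrib[of \<zero> \<zero>, simplified] intro: add.int_pow_closed)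
  then have z: "(\<Oplus>i\<in>J. [(\<Sum>k\<in>J. m i k * h k j)] \<cdot> a i) = \<zero>"
    using matrix_action_comp[OF fin a] by simp
  have "matrix_action m J (matrix_action h J a) j = (\<Oplus>i\<in>J. [(\<Sum>k\<in>J. h i k * m k j)] \<cdot> a i) \<oplus> (\<Oplus>i\<in>J. [(\<Sum>k\<in>J. m i k * h k j)] \<cdot> a i)"
    unfolding z matrix_action_comp[OF fin a] using a by (intro r_zero[symmetric] finsum_closed) auto
  also have "\<dots> = (\<Oplus>i\<in>J. [(\<Sum>k\<in>J. h i k * m k j)] \<cdot> a i \<oplus> [(\<Sum>k\<in>J. m i k * h k j)] \<cdot> a i)"
    using a by (intro finsum_addf[symmetric]) auto
  also have "\<dots> = (\<Oplus>i\<in>J. if j = i then a i else \<zero>)"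
  proof (intro finsum_cong' refl)
    fix i assume i: "i \<in> J"
    then have ai: "a i \<in> carrier G" using a by auto
    show "[(\<Sum>k\<in>J. h i k * m k j)] \<cdot> a i \<oplus> [(\<Sum>k\<in>J. m i k * h k j)] \<cdot> a i = (if j = i then a i else \<zero>)"
      unfolding int_mult_add[OF ai, symmetric] hom[OF i j] using ai
      by (simp add: int_mult_zero int_mult_one)
  qed (use a in auto)
  also have "\<dots> = a j" using a fin j by (intro add.finprod_singleton) auto
  finally show ?thesis .
qed

end

section \<open>Relative interiors of generated cones\<close>

lemma gen_cone_add_open: "x \<in> gen_cone S \<Longrightarrow> y \<in> open_gen_cone S \<Longrightarrow> x + y \<in> open_gen_cone S"
proof -
  assume x: "x \<in> gen_cone S" and y: "y \<in> open_gen_cone S"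
  obtain c where "x = (\<Sum>v\<in>S. c v *\<^sub>R v)" "\<forall>v\<in>S. 0 \<le> c v" using x unfolding gen_cone_def by blast
  moreover obtain d where "y = (\<Sum>v\<in>S. d v *\<^sub>R v)" "\<forall>v\<in>S. 0 < d v" using y unfolding open_gen_cone_def by blast
  ultimately have "x + y = (\<Sum>v\<in>S. (c v + d v) *\<^sub>R v)" "\<And>v. v \<in> S \<Longrightarrow> 0 < c v + d v"
    by (simp_all add: sum.distrib scaleR_add_left add_nonneg_pos)
  then show ?thesis using open_gen_coneI by metis
qed

lemma gen_cone_subset_span: "gen_cone S \<subseteq> span S"
  by (auto simp: gen_cone_def intro: span_sum span_scale span_base)

lemma open_gen_cone_perturb:
  assumes fin: "finite S" and x: "x \<in> open_gen_cone S" and v: "v \<in> span S"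
  shows "\<exists>e>0. x + e *\<^sub>R v \<in> open_gen_cone S"
proof -
  obtain c where c: "x = (\<Sum>s\<in>S. c s *\<^sub>R s)" "\<forall>s\<in>S. 0 < c s" using x unfolding open_gen_cone_def by blast
  obtain a where a: "v = (\<Sum>s\<in>S. a s *\<^sub>R s)" using v fin by (auto simp: span_finite)
  \<comment> \<open>Small enough to keep every coefficient \<open>c s + e * a s\<close> positive.
    The entry 1 covers empty \<open>S\<close>, the added 1 covers vanishing
    \<open>a s\<close>.\<close>
  define e where "e = Min (insert 1 ((\<lambda>s. c s / (\<bar>a s\<bar> + 1)) ` S))"
  have "0 < e" unfolding e_def using fin c(2) by (auto intro!: divide_pos_pos)
  have "0 < c s + e * a s" if s: "s \<in> S" for s
  proof -
    have "e \<le> c s / (\<bar>a s\<bar> + 1)" using fin s by (simp add: e_def)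
    then have "e * (\<bar>a s\<bar> + 1) \<le> c s" by (simp add: pos_le_divide_eq)
    then have "e * \<bar>a s\<bar> < c s" using \<open>0 < e\<close> by (simp add: distrib_left)
    moreover have "- (e * a s) \<le> e * \<bar>a s\<bar>" using \<open>0 < e\<close> by (simp add: abs_if)
    ultimately show ?thesis by linarith
  qed
  then have "(\<Sum>s\<in>S. (c s + e * a s) *\<^sub>R s) \<in> open_gen_cone S" by (rule open_gen_coneI)
  also have "(\<Sum>s\<in>S. (c s + e * a s) *\<^sub>R s) = x + e *\<^sub>R v"
    unfolding c(1) a by (simp add: scaleR_add_left sum.distrib scaleR_sum_right)
  finally show ?thesis using \<open>0 < e\<close> by blast
qed

lemma sum_in_open_gen_cone: "(\<Sum>s\<in>S. s) \<in> open_gen_cone S"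
  using open_gen_coneI[of S "\<lambda>_. 1"] by simp

lemma span_open_gen_cone:
  assumes fin: "finite S"
  shows "span (open_gen_cone S) = span S"
proof (rule subset_antisym)
  show "span (open_gen_cone S) \<subseteq> span S"
    using open_gen_cone_subset gen_cone_subset_span by (intro span_minimal) (blast, simp)
  show "span S \<subseteq> span (open_gen_cone S)"
  proof
    fix v assume "v \<in> span S"
    from open_gen_cone_perturb[OF fin sum_in_open_gen_cone this]
    show "v \<in> span (open_gen_cone S)" using span_of_perturb[OF sum_in_open_gen_cone] by blast
  qed
qed

lemma span_gen_cone: "finite S \<Longrightarrow> span (gen_cone S) = span S"
  by (metis gen_cone_subset_span gen_cone_superset span_eq span_superset subset_trans)

lemma open_cone_open_gen_cone:
  assumes fin: "finite S"
  shows "open_cone (open_gen_cone S)"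
  unfolding open_cone_def
proof (intro conjI ballI allI impI)
  show "open_gen_cone S \<noteq> {}" using sum_in_open_gen_cone by blast
next
  fix x y assume "x \<in> open_gen_cone S" "y \<in> open_gen_cone S"
  then show "x + y \<in> open_gen_cone S" using gen_cone_add_open open_gen_cone_subset by blast
next
  fix x and a :: real assume x: "x \<in> open_gen_cone S" and a: "0 < a"
  obtain c where c: "x = (\<Sum>s\<in>S. c s *\<^sub>R s)" "\<forall>s\<in>S. 0 < c s" using x unfolding open_gen_cone_def by blast
  then have "a *\<^sub>R x = (\<Sum>s\<in>S. (a * c s) *\<^sub>R s)" "\<forall>s\<in>S. 0 < a * c s"
    using a by (simp_all add: scaleR_sum_right)
  then show "a *\<^sub>R x \<in> open_gen_cone S" using open_gen_coneI by metis
next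
  fix x v assume "x \<in> open_gen_cone S" "v \<in> span (open_gen_cone S)"
  then show "\<exists>e>0. x + e *\<^sub>R v \<in> open_gen_cone S"
    using open_gen_cone_perturb[OF fin] span_open_gen_cone[OF fin] by blast
qed

text \<open>A point outside the cone has a negative value under a Farkas form, and a small step into
  the interior keeps it negative, although the result should lie in the cone.\<close>

lemma cone_closure_open_gen_cone:
  assumes fin: "finite S"
  shows "cone_closure (open_gen_cone S) = gen_cone S"
proof (intro subset_antisym subsetI)
  fix v assume "v \<in> gen_cone S"
  then show "v \<in> cone_closure (open_gen_cone S)" unfolding cone_closure_def using gen_cone_add_open by blast
next
  fix v assume v: "v \<in> cone_closure (open_gen_cone S)"
  let ?w = "\<Sum>s\<in>S. s"
  show "v \<in> gen_cone S"
  proof (rule ccontr)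
    assume "v \<notin> gen_cone S"
    then obtain f :: "'a \<Rightarrow> real" where f: "linear f" "\<forall>s\<in>S. 0 \<le> f s" "f v < 0" using farkas[OF fin] by metis
    have w: "?w \<in> gen_cone S" using sum_in_open_gen_cone open_gen_cone_subset by blast
    have fw: "0 \<le> f ?w" by (rule gen_cone_functional_nonneg[OF f(1,2) w])
    \<comment> \<open>With this choice the value of \<open>f\<close> at
      \<open>v + e *\<^sub>R ?w\<close> is exactly \<open>- e\<close>; the added 1 keeps the
      denominator positive.\<close>
    define e where "e = - f v / (f ?w + 1)"
    have "0 < f ?w + 1" using fw by linarith
    then have e: "0 < e" using f(3) unfolding e_def by (intro divide_pos_pos) simp_all
    have "v + e *\<^sub>R ?w \<in> open_gen_cone S"
      using v open_cone_scale[OF open_cone_open_gen_cone[OF fin] sum_in_open_gen_cone e]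
      unfolding cone_closure_def by blast
    then have "0 \<le> f (v + e *\<^sub>R ?w)"
      using gen_cone_functional_nonneg[OF f(1,2)] open_gen_cone_subset by blast
    then have "0 \<le> f v + e * f ?w" using f(1) by (simp add: linear_add linear_scale)
    moreover have "e * (f ?w + 1) = - f v" using \<open>0 < f ?w + 1\<close> by (simp add: e_def)
    then have "e * f ?w = - f v - e" by (simp add: distrib_left)
    ultimately show False using e by simp
  qed
qed

lemma cone_face_subset: "cone_face \<tau> \<sigma> \<Longrightarrow> \<tau> \<subseteq> \<sigma>"
  by (auto simp: cone_face_def)

lemma cone_faceE:
  assumes "cone_face \<tau> \<sigma>"
  obtains u :: "'v::real_vector \<Rightarrow> real" where "linear u" "\<forall>v\<in>\<sigma>. 0 \<le> u v" "\<tau> = {v \<in> \<sigma>. u v = 0}"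
proof -
  obtain u where "u \<in> dual_cone \<sigma>" "\<tau> = {v \<in> \<sigma>. u v = 0}" using assms unfolding cone_face_def by blast
  then show ?thesis using that[of u] by (simp add: dual_cone_def dual_space_def)
qed

text \<open>A form that is nonnegative on the generators and vanishes at a strictly positive
  combination of them vanishes on all of them.\<close>

lemma cone_face_meets_interior:
  assumes fin: "finite S" and \<sigma>: "\<sigma> = gen_cone S" and face: "cone_face \<tau> \<sigma>" and x: "x \<in> open_gen_cone S" "x \<in> \<tau>"
  shows "\<tau> = \<sigma>"
proof -
  obtain u :: "'a \<Rightarrow> real" where u: "linear u" "\<forall>v\<in>\<sigma>. 0 \<le> u v" "\<tau> = {v \<in> \<sigma>. u v = 0}"
    by (rule cone_faceE[OF face])
  have pos: "\<forall>s\<in>S. 0 \<le> u s" using u(2) gen_cone_superset[OF fin] \<sigma> by blast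
  have "u s = 0" if "s \<in> S" for s
    using open_gen_cone_functional_pos[OF u(1) pos x(1) fin that] pos that x(2) u(3) by force
  then have "u v = 0" if "v \<in> gen_cone S" for v
    using that u(1) by (auto simp: gen_cone_def linear_sum linear_scale)
  then show ?thesis using u(3) \<sigma> by blast
qed

text \<open>The alternative is applied to the vector 0 and the family of \<open>S\<close> and
  \<open>- T\<close>. A strictly positive relation would be a common point of the two interiors. The
  resulting form is nonnegative on \<open>S\<close>, nonpositive on \<open>T\<close> and nonzero at
  some generator, hence strict on one of the interiors. The sum type keeps equal members of
  \<open>S\<close> and \<open>- T\<close> apart.\<close>

lemma open_gen_cone_separation:
  fixes S T :: "'v::real_vector set"
  assumes fin: "finite S" "finite T" and disj: "open_gen_cone S \<inter> open_gen_cone T = {}"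
  shows "\<exists>f::'v \<Rightarrow> real. linear f \<and> (\<forall>x\<in>open_gen_cone S. \<forall>y\<in>open_gen_cone T. sgn (f x) \<noteq> sgn (f y))"
proof -
  define I where "I = Inl ` S \<union> Inr ` T"
  define a where "a = case_sum (\<lambda>s. s) (\<lambda>t. - t :: 'v)"
  have finI: "finite I" using fin by (simp add: I_def)
  have sumI: "(\<Sum>i\<in>I. c i *\<^sub>R a i) = (\<Sum>s\<in>S. c (Inl s) *\<^sub>R s) - (\<Sum>t\<in>T. c (Inr t) *\<^sub>R t)" for c
    unfolding I_def a_def using fin
    by (subst sum.union_disjoint) (auto simp: sum.reindex sum_negf)
  have "0 \<noteq> (\<Sum>i\<in>I. c i *\<^sub>R a i)" if c: "\<forall>i\<in>I. 0 < c i" for c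
  proof
    assume "0 = (\<Sum>i\<in>I. c i *\<^sub>R a i)"
    then have eq: "(\<Sum>s\<in>S. c (Inl s) *\<^sub>R s) = (\<Sum>t\<in>T. c (Inr t) *\<^sub>R t)" unfolding sumI by simp
    have "(\<Sum>s\<in>S. c (Inl s) *\<^sub>R s) \<in> open_gen_cone S" "(\<Sum>t\<in>T. c (Inr t) *\<^sub>R t) \<in> open_gen_cone T"
      using c by (auto simp: I_def intro!: open_gen_coneI)
    then show False using disj eq by auto
  qed
  from relint_alternative_family[OF finI _ _ this, of "\<lambda>_. 0"]
  obtain f :: "'v \<Rightarrow> real" where f: "linear f" "\<forall>i\<in>I. 0 \<le> f (a i)" "\<exists>i\<in>I. 0 < f (a i)" by auto
  define g where "g = (\<lambda>x. - f x)"
  have g: "linear g" using f(1) unfolding g_def by (rule linear_compose_neg)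
  have aI: "a (Inl s) = s" "a (Inr t) = - t" for s t by (simp_all add: a_def)
  have f2: "(\<forall>s\<in>S. 0 \<le> f (a (Inl s))) \<and> (\<forall>t\<in>T. 0 \<le> f (a (Inr t)))"
    using f(2) unfolding I_def by blast
  have f3: "(\<exists>s\<in>S. 0 < f (a (Inl s))) \<or> (\<exists>t\<in>T. 0 < f (a (Inr t)))"
    using f(3) unfolding I_def by blast
  have fS: "\<forall>s\<in>S. 0 \<le> f s" using f2 by (simp add: aI)
  have gT: "\<forall>t\<in>T. 0 \<le> g t" using f2 f(1) by (simp add: aI g_def linear_neg)
  have "sgn (f x) \<noteq> sgn (f y)" if x: "x \<in> open_gen_cone S" and y: "y \<in> open_gen_cone T" for x y
  proof -
    have x0: "0 \<le> f x" using gen_cone_functional_nonneg[OF f(1) fS] open_gen_cone_subset x by blast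
    have y0: "0 \<le> g y" using gen_cone_functional_nonneg[OF g gT] open_gen_cone_subset y by blast
    from f3 have "(\<exists>s\<in>S. 0 < f s) \<or> (\<exists>t\<in>T. 0 < g t)"
      using f(1) by (simp add: aI g_def linear_neg)
    then have "0 < f x \<or> 0 < g y"
      using open_gen_cone_functional_pos[OF f(1) fS x fin(1)] open_gen_cone_functional_pos[OF g gT y fin(2)]
      by blast
    then show ?thesis using x0 y0 by (auto simp: g_def sgn_if)
  qed
  then show ?thesis using f(1) by blast
qed

section \<open>The decomposition into relative interiors of the cones of a fan\<close>

locale complete_fan_space = finite_dim B for B :: "'v::real_vector set" +
  fixes N :: "'v set" and \<Delta> :: "'v set set"
  assumes complete: "complete_fan N \<Delta>"
begin

lemma fanD: "finite \<Delta>" "\<Union>\<Delta> = UNIV" "\<sigma> \<in> \<Delta> \<Longrightarrow> cone_face \<tau> \<sigma> \<Longrightarrow> \<tau> \<in> \<Delta>"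
  "\<sigma> \<in> \<Delta> \<Longrightarrow> \<sigma>' \<in> \<Delta> \<Longrightarrow> cone_face (\<sigma> \<inter> \<sigma>') \<sigma>"
  "\<sigma> \<in> \<Delta> \<Longrightarrow> \<sigma>' \<in> \<Delta> \<Longrightarrow> cone_face (\<sigma> \<inter> \<sigma>') \<sigma>'"
  using complete unfolding complete_fan_def fan_def by simp_all

definition gens :: "'v set \<Rightarrow> 'v set" where
  "gens \<sigma> = (SOME S. finite S \<and> S \<subseteq> N \<and> \<sigma> = gen_cone S)"

lemma gens: "\<sigma> \<in> \<Delta> \<Longrightarrow> finite (gens \<sigma>)" "\<sigma> \<in> \<Delta> \<Longrightarrow> gens \<sigma> \<subseteq> N" "\<sigma> \<in> \<Delta> \<Longrightarrow> gen_cone (gens \<sigma>) = \<sigma>"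
proof -
  assume "\<sigma> \<in> \<Delta>"
  then have "rational_polyhedral_cone N \<sigma>" using complete unfolding complete_fan_def fan_def by simp
  then have "\<exists>S. finite S \<and> S \<subseteq> N \<and> \<sigma> = gen_cone S"
    unfolding rational_polyhedral_cone_def gen_cone_def .
  from someI_ex[OF this] show "finite (gens \<sigma>)" "gens \<sigma> \<subseteq> N" "gen_cone (gens \<sigma>) = \<sigma>"
    unfolding gens_def by blast+
qed

definition relint :: "'v set \<Rightarrow> 'v set" where
  "relint \<sigma> = open_gen_cone (gens \<sigma>)"

lemma relint_subset: "\<sigma> \<in> \<Delta> \<Longrightarrow> relint \<sigma> \<subseteq> \<sigma>"
  using open_gen_cone_subset gens(3) unfolding relint_def by blast

lemma relint_face: "\<sigma> \<in> \<Delta> \<Longrightarrow> cone_face \<tau> \<sigma> \<Longrightarrow> x \<in> relint \<sigma> \<Longrightarrow> x \<in> \<tau> \<Longrightarrow> \<tau> = \<sigma>"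
  unfolding relint_def by (rule cone_face_meets_interior[OF gens(1) gens(3)[symmetric]])

text \<open>The intersection of the cones is a face of \<open>\<sigma>\<close> containing a relative
  interior point, hence all of \<open>\<sigma>\<close>.\<close>

lemma relint_subset_cone:
  assumes "\<sigma> \<in> \<Delta>" "\<sigma>' \<in> \<Delta>" "x \<in> relint \<sigma>" "x \<in> \<sigma>'"
  shows "\<sigma> \<subseteq> \<sigma>'"
  using relint_face[OF assms(1) fanD(4)[OF assms(1,2)] assms(3)] relint_subset[OF assms(1)] assms(3,4) by blast

lemma relint_inj: "\<sigma> \<in> \<Delta> \<Longrightarrow> \<sigma>' \<in> \<Delta> \<Longrightarrow> x \<in> relint \<sigma> \<Longrightarrow> x \<in> relint \<sigma>' \<Longrightarrow> \<sigma> = \<sigma>'"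
  using relint_subset_cone relint_subset by blast

lemma open_relint: "\<sigma> \<in> \<Delta> \<Longrightarrow> open_cone (relint \<sigma>)"
  unfolding relint_def by (rule open_cone_open_gen_cone[OF gens(1)])

lemma relint_nonempty: "\<exists>x. x \<in> relint \<sigma>"
  unfolding relint_def using sum_in_open_gen_cone by blast

lemma closure_relint: "\<sigma> \<in> \<Delta> \<Longrightarrow> cone_closure (relint \<sigma>) = \<sigma>"
  unfolding relint_def using cone_closure_open_gen_cone[OF gens(1)] gens(3) by simp

lemma span_relint: "\<sigma> \<in> \<Delta> \<Longrightarrow> span (relint \<sigma>) = span \<sigma>"
  unfolding relint_def using span_open_gen_cone[OF gens(1)] span_gen_cone[OF gens(1)] gens(3) by simp

lemma dim_relint: "\<sigma> \<in> \<Delta> \<Longrightarrow> dim (relint \<sigma>) = dim \<sigma>"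
  using span_relint span_eq_dim by blast

text \<open>A minimal cone of the fan containing \<open>x\<close> has \<open>x\<close> in its
  relative interior; otherwise the form from \<open>relint_alternative\<close> would cut out a
  proper face containing \<open>x\<close>, which is again a cone of the fan.\<close>

lemma relint_cover: "\<exists>\<sigma>\<in>\<Delta>. x \<in> relint \<sigma>"
proof -
  have "finite {\<sigma> \<in> \<Delta>. x \<in> \<sigma>}" "{\<sigma> \<in> \<Delta>. x \<in> \<sigma>} \<noteq> {}" using fanD(1,2) by auto
  then obtain \<sigma> where \<sigma>: "\<sigma> \<in> \<Delta>" "x \<in> \<sigma>" and min: "\<And>\<tau>. \<tau> \<in> \<Delta> \<Longrightarrow> x \<in> \<tau> \<Longrightarrow> \<tau> \<subseteq> \<sigma> \<Longrightarrow> \<tau> = \<sigma>"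
    using finite_has_minimal[of "{\<sigma> \<in> \<Delta>. x \<in> \<sigma>}"] by blast
  have "x \<in> relint \<sigma>"
  proof (rule ccontr)
    assume "x \<notin> relint \<sigma>"
    then obtain f :: "'v \<Rightarrow> real" where f: "linear f" "\<forall>s\<in>gens \<sigma>. 0 \<le> f s" "f x = 0" "\<exists>s\<in>gens \<sigma>. 0 < f s"
      using relint_alternative[OF gens(1)[OF \<sigma>(1)], of x] \<sigma> gens(3)[OF \<sigma>(1)] unfolding relint_def by blast
    have "f \<in> dual_cone \<sigma>"
      using gen_cone_functional_nonneg[OF f(1,2)] gens(3)[OF \<sigma>(1)] f(1)
      by (auto simp: dual_cone_def dual_space_def)
    then have "cone_face {v \<in> \<sigma>. f v = 0} \<sigma>" by (auto simp: cone_face_def)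
    then have "{v \<in> \<sigma>. f v = 0} = \<sigma>" using min fanD(3)[OF \<sigma>(1)] \<sigma>(2) f(3) by blast
    then show False using f(4) gen_cone_superset[OF gens(1)[OF \<sigma>(1)]] gens(3)[OF \<sigma>(1)] by force
  qed
  then show ?thesis using \<sigma>(1) by blast
qed

lemma decomposition_fan: "decomposition (relint ` \<Delta>)"
  unfolding decomposition_def
proof (intro conjI ballI impI)
  show "finite (relint ` \<Delta>)" using fanD(1) by simp
  have "x \<in> \<Union> (relint ` \<Delta>)" for x using relint_cover[of x] by auto
  then show "\<Union> (relint ` \<Delta>) = UNIV" by blast
next
  fix C assume "C \<in> relint ` \<Delta>"
  then show "open_cone C" using open_relint by blast
next
  fix C D assume "C \<in> relint ` \<Delta>" "D \<in> relint ` \<Delta>" "C \<inter> D \<noteq> {}"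
  then show "C = D" using relint_inj by blast
next
  fix C D assume C: "C \<in> relint ` \<Delta>" and D: "D \<in> relint ` \<Delta>" and ne: "C \<inter> cone_closure D \<noteq> {}"
  then obtain \<sigma> \<sigma>' x where s: "\<sigma> \<in> \<Delta>" "C = relint \<sigma>" "\<sigma>' \<in> \<Delta>" "D = relint \<sigma>'" and x: "x \<in> C" "x \<in> cone_closure D"
    by blast
  then show "C \<subseteq> cone_closure D"
    using relint_subset_cone[OF s(1,3)] relint_subset[OF s(1)] closure_relint[OF s(3)] by blast
qed

lemma relint_separated:
  obtains U :: "('v \<Rightarrow> real) set" where "finite U" "\<forall>u\<in>U. linear u"
    "\<And>C D x y. C \<in> relint ` \<Delta> \<Longrightarrow> D \<in> relint ` \<Delta> \<Longrightarrow> C \<noteq> D \<Longrightarrow> x \<in> C \<Longrightarrow> y \<in> D \<Longrightarrow>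
      \<exists>u\<in>U. sgn (u x) \<noteq> sgn (u y)"
proof -
  have "\<forall>q\<in>{(\<sigma>, \<sigma>') \<in> \<Delta> \<times> \<Delta>. \<sigma> \<noteq> \<sigma>'}. \<exists>f::'v \<Rightarrow> real. linear f \<and>
    (\<forall>x\<in>relint (fst q). \<forall>y\<in>relint (snd q). sgn (f x) \<noteq> sgn (f y))"
  proof
    fix q assume "q \<in> {(\<sigma>, \<sigma>') \<in> \<Delta> \<times> \<Delta>. \<sigma> \<noteq> \<sigma>'}"
    then have q: "fst q \<in> \<Delta>" "snd q \<in> \<Delta>" "fst q \<noteq> snd q" by auto
    then have "relint (fst q) \<inter> relint (snd q) = {}" using relint_inj by blast
    then show "\<exists>f::'v \<Rightarrow> real. linear f \<and> (\<forall>x\<in>relint (fst q). \<forall>y\<in>relint (snd q). sgn (f x) \<noteq> sgn (f y))"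
      unfolding relint_def by (rule open_gen_cone_separation[OF gens(1)[OF q(1)] gens(1)[OF q(2)]])
  qed
  from bchoice[OF this] obtain f :: "'v set \<times> 'v set \<Rightarrow> 'v \<Rightarrow> real" where
    f: "\<forall>q\<in>{(\<sigma>, \<sigma>') \<in> \<Delta> \<times> \<Delta>. \<sigma> \<noteq> \<sigma>'}. linear (f q) \<and>
      (\<forall>x\<in>relint (fst q). \<forall>y\<in>relint (snd q). sgn (f q x) \<noteq> sgn (f q y))" by (elim exE)
  show ?thesis
  proof (rule that[of "f ` {(\<sigma>, \<sigma>') \<in> \<Delta> \<times> \<Delta>. \<sigma> \<noteq> \<sigma>'}"])
    have "finite {(\<sigma>, \<sigma>') \<in> \<Delta> \<times> \<Delta>. \<sigma> \<noteq> \<sigma>'}"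
      by (rule finite_subset[of _ "\<Delta> \<times> \<Delta>"]) (use fanD(1) in auto)
    then show "finite (f ` {(\<sigma>, \<sigma>') \<in> \<Delta> \<times> \<Delta>. \<sigma> \<noteq> \<sigma>'})" by simp
    show "\<forall>u\<in>f ` {(\<sigma>, \<sigma>') \<in> \<Delta> \<times> \<Delta>. \<sigma> \<noteq> \<sigma>'}. linear u" using f by blast
  next
    fix C D x y assume "C \<in> relint ` \<Delta>" "D \<in> relint ` \<Delta>" "C \<noteq> D" and xy: "x \<in> C" "y \<in> D"
    then obtain \<sigma> \<sigma>' where s: "C = relint \<sigma>" "D = relint \<sigma>'" "(\<sigma>, \<sigma>') \<in> {(\<sigma>, \<sigma>') \<in> \<Delta> \<times> \<Delta>. \<sigma> \<noteq> \<sigma>'}" by blast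
    from bspec[OF f s(3)] xy s(1,2) have "sgn (f (\<sigma>, \<sigma>') x) \<noteq> sgn (f (\<sigma>, \<sigma>') y)" by simp
    then show "\<exists>u\<in>f ` {(\<sigma>, \<sigma>') \<in> \<Delta> \<times> \<Delta>. \<sigma> \<noteq> \<sigma>'}. sgn (u x) \<noteq> sgn (u y)" using s(3) by blast
  qed
qed

lemma fan_star_acyclic:
  "square_zero incidence (star_index (relint ` \<Delta>) p)" "acyclic_complex incidence (star_index (relint ` \<Delta>) p)"
proof -
  obtain U :: "('v \<Rightarrow> real) set" where U: "finite U" "\<forall>u\<in>U. linear u"
    "\<And>C D x y. C \<in> relint ` \<Delta> \<Longrightarrow> D \<in> relint ` \<Delta> \<Longrightarrow> C \<noteq> D \<Longrightarrow> x \<in> C \<Longrightarrow> y \<in> D \<Longrightarrow>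
      \<exists>u\<in>U. sgn (u x) \<noteq> sgn (u y)" by (rule relint_separated) blast
  show "square_zero incidence (star_index (relint ` \<Delta>) p)"
    by (rule decomposition_star_acyclic(1)[OF U(1,2) decomposition_fan]) (rule U(3))
  show "acyclic_complex incidence (star_index (relint ` \<Delta>) p)"
    by (rule decomposition_star_acyclic(2)[OF U(1,2) decomposition_fan]) (rule U(3))
qed

lemma subset_iff_face: "\<tau> \<in> \<Delta> \<Longrightarrow> \<sigma> \<in> \<Delta> \<Longrightarrow> \<tau> \<subseteq> \<sigma> \<longleftrightarrow> cone_face \<tau> \<sigma>"
  using fanD(4)[of \<sigma> \<tau>] cone_face_subset by (metis inf.absorb_iff2)

lemma facet_relint:
  assumes "\<tau> \<in> \<Delta>" "\<sigma> \<in> \<Delta>"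
  shows "facet (relint \<tau>) (relint \<sigma>) \<longleftrightarrow> cone_face \<tau> \<sigma> \<and> dim \<sigma> = Suc (dim \<tau>)"
proof -
  have "relint \<tau> \<subseteq> \<sigma> \<longleftrightarrow> \<tau> \<subseteq> \<sigma>"
    using relint_subset[OF assms(1)] relint_nonempty[of \<tau>] relint_subset_cone[OF assms] by blast
  then show ?thesis
    unfolding facet_def closure_relint[OF assms(2)] dim_relint[OF assms(1)] dim_relint[OF assms(2)]
    using subset_iff_face[OF assms] by simp
qed

lemma star_relint:
  assumes "\<tau> \<in> \<Delta>" "p \<in> relint \<tau>"
  shows "star (relint ` \<Delta>) p = relint ` {\<sigma> \<in> \<Delta>. cone_face \<tau> \<sigma>}"
proof -
  have "p \<in> \<sigma> \<longleftrightarrow> cone_face \<tau> \<sigma>" if "\<sigma> \<in> \<Delta>" for \<sigma>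
    using subset_iff_face[OF assms(1) that] relint_subset_cone[OF assms(1) that assms(2)]
      relint_subset[OF assms(1)] assms(2) by blast
  then show ?thesis unfolding star_def using closure_relint by auto
qed

text \<open>The fixed sign uses a chosen point of \<open>\<sigma>\<close> outside
  \<open>\<tau>\<close>, the canonical one a point of the relative interior. The form cutting out
  the face is positive at both, so they lie on the same side of the span of
  \<open>\<tau>\<close>.\<close>

lemma incidence_sign_relint:
  assumes ori: "fan_orientation \<Delta> ori" and \<tau>: "\<tau> \<in> \<Delta>" and \<sigma>: "\<sigma> \<in> \<Delta>"
    and f: "facet (relint \<tau>) (relint \<sigma>)"
  shows "incidence_sign ori \<tau> \<sigma> = (if canonical_basis (span \<tau>) \<in> ori \<tau> then 1 else -1) *
    (if canonical_basis (span \<sigma>) \<in> ori \<sigma> then 1 else -1) * incidence (Some (relint \<tau>)) (Some (relint \<sigma>))"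
proof -
  have face: "cone_face \<tau> \<sigma>" and dm: "dim \<sigma> = Suc (dim \<tau>)" using f facet_relint[OF \<tau> \<sigma>] by auto
  obtain g :: "'v \<Rightarrow> real" where g: "linear g" "\<forall>v\<in>\<sigma>. 0 \<le> g v" "\<tau> = {v \<in> \<sigma>. g v = 0}"
    by (rule cone_faceE[OF face])
  have gL: "g v = 0" if "v \<in> span \<tau>" for v
    using linear_eq_0_on_span[OF g(1) _ that] g(3) by blast
  have "\<tau> \<noteq> \<sigma>" using dm by auto
  then have ex: "\<exists>u. u \<in> \<sigma> - \<tau>" using cone_face_subset[OF face] by blast
  define u where "u = (SOME u. u \<in> \<sigma> - \<tau>)"
  have u: "u \<in> \<sigma>" "u \<notin> \<tau>" using someI_ex[OF ex] by (auto simp: u_def)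
  then have gu: "0 < g u" using g(2,3) by force
  then have uL: "u \<notin> span \<tau>" using gL by force
  have W: "span (insert u (span \<tau>)) = span \<sigma>"
  proof (rule fd.subspace_dim_equal)
    show "span (insert u (span \<tau>)) \<subseteq> span \<sigma>"
      using u cone_face_subset[OF face] span_mono by (intro span_minimal) (auto simp: span_base)
    show "dim (span \<sigma>) \<le> dim (span (insert u (span \<tau>)))"
      using uL dm by (simp add: fd.dim_insert span_span)
  qed auto
  obtain w where w: "w \<in> relint \<sigma>" using relint_nonempty by blast
  then have w\<sigma>: "w \<in> \<sigma>" using relint_subset[OF \<sigma>] by blast
  have "g w \<noteq> 0" using relint_face[OF \<sigma> face w] w\<sigma> g(3) \<open>\<tau> \<noteq> \<sigma>\<close> by blast
  then have gw: "0 < g w" using g(2) w\<sigma> by force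
  have "w \<in> span (insert u (span \<tau>))" using w\<sigma> W span_base by blast
  then obtain a where a: "w - a *\<^sub>R u \<in> span \<tau>" by (auto simp: span_breakdown_eq span_span)
  have "g w = a * g u" using gL[OF a] g(1) by (simp add: linear_diff linear_scale)
  then have "0 < a" using gu gw by (simp add: zero_less_mult_iff)
  then have "side_sign (span \<tau>) w = side_sign (span \<tau>) u"
    using side_sign_scale_add[OF _ uL a, of a] by simp
  moreover have "incidence (Some (relint \<tau>)) (Some (relint \<sigma>)) = side_sign (span \<tau>) w"
    using incidence_facet[OF decomposition_fan imageI[OF \<tau>] imageI[OF \<sigma>] f w] span_relint[OF \<tau>] by simp
  ultimately show ?thesis
    using incidence_sign_eq_side_sign[of \<tau> ori \<sigma> u, OF _ _ u_def uL W] ori \<tau> \<sigma>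
    by (simp add: fan_orientation_def)
qed

end

section \<open>The augmented complex of a star with the given orientations\<close>

locale oriented_fan = complete_fan_space B N \<Delta> for B N :: "'v::real_vector set" and \<Delta> +
  fixes ori :: "'v set \<Rightarrow> 'v list set"
  assumes ori: "fan_orientation \<Delta> ori"
begin

fun fan_matrix :: "'v set option \<Rightarrow> 'v set option \<Rightarrow> int" where
  "fan_matrix (Some \<rho>) (Some \<sigma>) = (if cone_face \<rho> \<sigma> \<and> dim \<sigma> = Suc (dim \<rho>) then incidence_sign ori \<rho> \<sigma> else 0)"
| "fan_matrix (Some \<sigma>) None = (if dim \<sigma> = dim (UNIV :: 'v set) then 1 else 0)"
| "fan_matrix None j = 0"

definition fan_star :: "'v set \<Rightarrow> 'v set option set" where
  "fan_star \<tau> = insert None (Some ` {\<sigma> \<in> \<Delta>. cone_face \<tau> \<sigma>})"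

text \<open>The change from the given orientations to the canonical ones.\<close>

fun twist :: "'v set option \<Rightarrow> int" where
  "twist (Some \<sigma>) = (if canonical_basis (span \<sigma>) \<in> ori \<sigma> then 1 else -1)"
| "twist None = (if canonical_basis UNIV \<in> ori (SOME \<sigma>. \<sigma> \<in> cones_codim \<Delta> 0) then 1 else -1)"

lemma twist_square: "twist i * twist i = 1"
  by (cases i) auto

text \<open>The augmentation has coefficient 1 at every full-dimensional cone. A change of signs
  respects this because the full-dimensional cones share one orientation, whose sign is also given
  to \<open>None\<close>.\<close>

lemma twist_top:
  assumes \<sigma>: "\<sigma> \<in> \<Delta>" and top: "dim \<sigma> = dim (UNIV :: 'v set)"
  shows "twist (Some \<sigma>) = twist None"
proof -
  have \<sigma>0: "\<sigma> \<in> cones_codim \<Delta> 0" using assms by (simp add: cones_codim_def)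
  then have "(SOME \<sigma>. \<sigma> \<in> cones_codim \<Delta> 0) \<in> cones_codim \<Delta> 0" by (rule someI)
  then have "ori (SOME \<sigma>. \<sigma> \<in> cones_codim \<Delta> 0) = ori \<sigma>"
    using ori \<sigma>0 unfolding fan_orientation_def by blast
  moreover have "span \<sigma> = UNIV"
    using fd.subspace_dim_equal[of "span \<sigma>" UNIV] top by simp
  ultimately show ?thesis by simp
qed

text \<open>Conjugation by the diagonal sign matrix \<open>twist\<close>, which is its own inverse;
  square zero and homotopies pass through it.\<close>

lemma fan_matrix_eq:
  assumes "i \<in> fan_star \<tau>" "j \<in> fan_star \<tau>"
  shows "fan_matrix i j = twist i * twist j * incidence (map_option relint i) (map_option relint j)"
proof (cases i)
  case None
  then show ?thesis by simp
next
  case (Some \<rho>)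
  then have \<rho>: "\<rho> \<in> \<Delta>" using assms by (auto simp: fan_star_def)
  show ?thesis
  proof (cases j)
    case None
    then show ?thesis
      using twist_top[OF \<rho>] twist_square[of None] \<open>i = Some \<rho>\<close> dim_relint[OF \<rho>]
      by (simp del: twist.simps)
  next
    case (Some \<sigma>)
    then have \<sigma>: "\<sigma> \<in> \<Delta>" using assms by (auto simp: fan_star_def)
    show ?thesis
    proof (cases "facet (relint \<rho>) (relint \<sigma>)")
      case True
      then show ?thesis
        using incidence_sign_relint[OF ori \<rho> \<sigma> True] facet_relint[OF \<rho> \<sigma>] \<open>i = Some \<rho>\<close> Some by simp
    next
      case False
      then show ?thesis using facet_relint[OF \<rho> \<sigma>] \<open>i = Some \<rho>\<close> Some by auto
    qed
  qed
qed

lemma finite_fan_star: "finite (fan_star \<tau>)"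
  using fanD(1) by (simp add: fan_star_def)

lemma fan_star_bij:
  assumes "\<tau> \<in> \<Delta>" "p \<in> relint \<tau>"
  shows "bij_betw (map_option relint) (fan_star \<tau>) (star_index (relint ` \<Delta>) p)"
proof -
  have "inj_on relint \<Delta>"
    using relint_inj relint_nonempty by (metis inj_onI)
  then have "inj_on (map_option relint) (fan_star \<tau>)"
    by (auto simp: inj_on_def fan_star_def)
  moreover have "map_option relint ` fan_star \<tau> = star_index (relint ` \<Delta>) p"
    unfolding fan_star_def star_index_def star_relint[OF assms] by (auto simp: image_image)
  ultimately show ?thesis by (simp add: bij_betw_def)
qed

lemma fan_matrix_square_zero:
  assumes \<tau>: "\<tau> \<in> \<Delta>" and i: "i \<in> fan_star \<tau>" and k: "k \<in> fan_star \<tau>"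
  shows "(\<Sum>j\<in>fan_star \<tau>. fan_matrix i j * fan_matrix j k) = 0"
proof -
  obtain p where p: "p \<in> relint \<tau>" using relint_nonempty by blast
  let ?f = "map_option relint" and ?J = "star_index (relint ` \<Delta>) p"
  note bij = fan_star_bij[OF \<tau> p]
  have "(\<Sum>j\<in>fan_star \<tau>. fan_matrix i j * fan_matrix j k)
      = (\<Sum>j\<in>fan_star \<tau>. twist i * twist k * (incidence (?f i) (?f j) * incidence (?f j) (?f k)))"
  proof (intro sum.cong refl)
    fix j assume j: "j \<in> fan_star \<tau>"
    have "fan_matrix i j * fan_matrix j k
      = twist i * twist k * (incidence (?f i) (?f j) * incidence (?f j) (?f k)) * (twist j * twist j)"
      unfolding fan_matrix_eq[OF i j] fan_matrix_eq[OF j k] by (simp only: mult_ac)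
    then show "fan_matrix i j * fan_matrix j k
      = twist i * twist k * (incidence (?f i) (?f j) * incidence (?f j) (?f k))"
      by (simp only: twist_square mult_1_right)
  qed
  also have "\<dots> = twist i * twist k * (\<Sum>j\<in>?J. incidence (?f i) j * incidence j (?f k))"
    unfolding sum_distrib_left[symmetric] sum.reindex_bij_betw[OF bij, of "\<lambda>j. incidence (?f i) j * incidence j (?f k)"] ..
  also have "\<dots> = 0"
    using square_zeroD[OF _ fan_star_acyclic(1), of p "?f i" "?f k"] bij_betw_apply[OF bij] i k
      bij_betw_finite[OF bij] finite_fan_star by simp
  finally show ?thesis .
qed

lemma fan_matrix_homotopy:
  assumes \<tau>: "\<tau> \<in> \<Delta>"
  shows "\<exists>h. \<forall>i\<in>fan_star \<tau>. \<forall>j\<in>fan_star \<tau>.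
    (\<Sum>k\<in>fan_star \<tau>. h i k * fan_matrix k j) + (\<Sum>k\<in>fan_star \<tau>. fan_matrix i k * h k j) = (if i = j then 1 else 0)"
proof -
  obtain p where p: "p \<in> relint \<tau>" using relint_nonempty by blast
  let ?f = "map_option relint" and ?J = "star_index (relint ` \<Delta>) p"
  note bij = fan_star_bij[OF \<tau> p]
  have finJ: "finite ?J" using bij_betw_finite[OF bij] finite_fan_star by simp
  \<comment> \<open>Rank is codimension plus one, leaving rank 0 for the target of the
    augmentation.\<close>
  define rk where "rk = (\<lambda>i. case i of None \<Rightarrow> 0 | Some C \<Rightarrow> Suc (dim (UNIV :: 'v set) - dim (C :: 'v set)))"
  have "rk i = Suc (rk j)" if nz: "incidence i j \<noteq> 0" for i j
  proof -
    obtain C where C: "i = Some C" using nz by (cases i) auto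
    show ?thesis
    proof (cases j)
      case None
      then have "dim C = dim (UNIV :: 'v set)" using nz C by (auto split: if_splits)
      then show ?thesis by (simp add: rk_def C None)
    next
      case (Some D)
      then have "dim D = Suc (dim C)" using nz C by (auto simp: facet_def split: if_splits)
      moreover have "dim D \<le> dim (UNIV :: 'v set)" by (rule fd.dim_subset) simp
      ultimately show ?thesis unfolding rk_def C Some by simp
    qed
  qed
  then have "\<exists>h. \<forall>i\<in>?J. \<forall>j\<in>?J. (\<Sum>k\<in>?J. h i k * incidence k j) + (\<Sum>k\<in>?J. incidence i k * h k j)
      = (if i = j then 1 else 0)"
    by (rule contracting_homotopy[OF finJ fan_star_acyclic, of rk])
  then obtain h where h: "\<And>i j. i \<in> ?J \<Longrightarrow> j \<in> ?J \<Longrightarrow>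
    (\<Sum>k\<in>?J. h i k * incidence k j) + (\<Sum>k\<in>?J. incidence i k * h k j) = (if i = j then 1 else 0)"
    by blast
  let ?h = "\<lambda>i j. twist i * twist j * h (?f i) (?f j)"
  show ?thesis
  proof (intro exI[of _ ?h] ballI)
    fix i j assume i: "i \<in> fan_star \<tau>" and j: "j \<in> fan_star \<tau>"
    have A: "?h i k * fan_matrix k j = twist i * twist j * (h (?f i) (?f k) * incidence (?f k) (?f j))"
      if k: "k \<in> fan_star \<tau>" for k
    proof -
      have "?h i k * fan_matrix k j = twist i * twist j * (h (?f i) (?f k) * incidence (?f k) (?f j)) * (twist k * twist k)"
        unfolding fan_matrix_eq[OF k j] by (simp only: mult_ac)
      then show ?thesis by (simp only: twist_square mult_1_right)
    qed
    have B: "fan_matrix i k * ?h k j = twist i * twist j * (incidence (?f i) (?f k) * h (?f k) (?f j))"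
      if k: "k \<in> fan_star \<tau>" for k
    proof -
      have "fan_matrix i k * ?h k j = twist i * twist j * (incidence (?f i) (?f k) * h (?f k) (?f j)) * (twist k * twist k)"
        unfolding fan_matrix_eq[OF i k] by (simp only: mult_ac)
      then show ?thesis by (simp only: twist_square mult_1_right)
    qed
    have "(\<Sum>k\<in>fan_star \<tau>. ?h i k * fan_matrix k j) + (\<Sum>k\<in>fan_star \<tau>. fan_matrix i k * ?h k j)
      = twist i * twist j * ((\<Sum>k\<in>fan_star \<tau>. h (?f i) (?f k) * incidence (?f k) (?f j))
        + (\<Sum>k\<in>fan_star \<tau>. incidence (?f i) (?f k) * h (?f k) (?f j)))"
      unfolding distrib_left sum_distrib_left by (intro arg_cong2[of _ _ _ _ "(+)"] sum.cong refl A B)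
    also have "\<dots> = twist i * twist j * ((\<Sum>k\<in>?J. h (?f i) k * incidence k (?f j))
        + (\<Sum>k\<in>?J. incidence (?f i) k * h k (?f j)))"
      unfolding sum.reindex_bij_betw[OF bij, of "\<lambda>k. h (?f i) k * incidence k (?f j)"]
        sum.reindex_bij_betw[OF bij, of "\<lambda>k. incidence (?f i) k * h k (?f j)"] ..
    also have "\<dots> = twist i * twist j * (if ?f i = ?f j then 1 else 0)"
      using h[OF bij_betw_apply[OF bij i] bij_betw_apply[OF bij j]] by simp
    also have "\<dots> = (if i = j then 1 else 0)"
      using bij i j twist_square[of j] by (auto simp: bij_betw_def inj_on_def)
    finally show "(\<Sum>k\<in>fan_star \<tau>. ?h i k * fan_matrix k j) + (\<Sum>k\<in>fan_star \<tau>. fan_matrix i k * ?h k j)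
      = (if i = j then 1 else 0)" .
  qed
qed

definition cone_boundary :: "('r, 'm) ring_scheme \<Rightarrow> nat \<Rightarrow> ('v set \<Rightarrow> 'r) \<Rightarrow> 'v set \<Rightarrow> 'r" where
  "cone_boundary G k a \<sigma> =
     (\<Oplus>\<^bsub>G\<^esub>\<rho>\<in>{\<rho> \<in> cones_codim \<Delta> k. cone_face \<rho> \<sigma>}. [incidence_sign ori \<rho> \<sigma>] \<cdot>\<^bsub>G\<^esub> a \<rho>)"

lemma finite_cones_codim: "finite (cones_codim \<Delta> k)"
  using fanD(1) by (simp add: cones_codim_def)

lemma cones_codim_dim:
  assumes "\<sigma> \<in> cones_codim \<Delta> k" "\<rho> \<in> \<Delta>"
  shows "dim \<sigma> = Suc (dim \<rho>) \<longleftrightarrow> \<rho> \<in> cones_codim \<Delta> (Suc k)"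
  using assms by (auto simp: cones_codim_def)

lemma cone_face_trans_fan: "\<tau> \<in> \<Delta> \<Longrightarrow> \<rho> \<in> \<Delta> \<Longrightarrow> \<sigma> \<in> \<Delta> \<Longrightarrow> cone_face \<tau> \<rho> \<Longrightarrow> cone_face \<rho> \<sigma> \<Longrightarrow> cone_face \<tau> \<sigma>"
  using subset_iff_face by (meson subset_trans)

text \<open>The form of a stalk at a point whose smallest cone is \<open>\<tau>\<close>: a family
  over all cones, in all degrees together, that vanishes off the star.\<close>

definition supported :: "('r, 'm) ring_scheme \<Rightarrow> 'v set \<Rightarrow> ('v set \<Rightarrow> 'r) \<Rightarrow> bool" where
  "supported G \<tau> a \<longleftrightarrow> a \<in> \<Delta> \<rightarrow> carrier G \<and> (\<forall>\<rho>\<in>\<Delta>. \<not> cone_face \<tau> \<rho> \<longrightarrow> a \<rho> = \<zero>\<^bsub>G\<^esub>)"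

definition restrict_star :: "('r, 'm) ring_scheme \<Rightarrow> 'v set \<Rightarrow> ('v set option \<Rightarrow> 'r) \<Rightarrow> 'v set \<Rightarrow> 'r" where
  "restrict_star G \<tau> A \<rho> = (if cone_face \<tau> \<rho> then A (Some \<rho>) else \<zero>\<^bsub>G\<^esub>)"

context
  fixes G :: "('r, 'm) ring_scheme" (structure) and \<tau> :: "'v set"
  assumes G: "abelian_group G" and \<tau>: "\<tau> \<in> \<Delta>"
begin

interpretation abelian_group G by (rule G)

lemma fan_star_closed: "A \<in> fan_star \<tau> \<rightarrow> carrier G \<Longrightarrow> \<rho> \<in> \<Delta> \<Longrightarrow> cone_face \<tau> \<rho> \<Longrightarrow> A (Some \<rho>) \<in> carrier G"
  by (rule funcset_mem) (auto simp: fan_star_def)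

lemma supported_restrict_star: "A \<in> fan_star \<tau> \<rightarrow> carrier G \<Longrightarrow> supported G \<tau> (restrict_star G \<tau> A)"
  using fan_star_closed by (auto simp: supported_def restrict_star_def)

text \<open>The differential of sheaves sums over all faces of codimension one, the integral matrix
  only over those in the star; the additional terms are zero.\<close>

lemma matrix_action_Some:
  assumes A: "A \<in> fan_star \<tau> \<rightarrow> carrier G" and \<sigma>: "\<sigma> \<in> cones_codim \<Delta> k" "cone_face \<tau> \<sigma>"
  shows "matrix_action fan_matrix (fan_star \<tau>) A (Some \<sigma>) = cone_boundary G (Suc k) (restrict_star G \<tau> A) \<sigma>"
proof -
  let ?I = "{\<rho> \<in> cones_codim \<Delta> (Suc k). cone_face \<rho> \<sigma> \<and> cone_face \<tau> \<rho>}"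
  have rA: "restrict_star G \<tau> A \<rho> \<in> carrier G" if "\<rho> \<in> \<Delta>" for \<rho>
    using supported_restrict_star[OF A] that by (auto simp: supported_def)
  have "matrix_action fan_matrix (fan_star \<tau>) A (Some \<sigma>) = (\<Oplus>i\<in>Some ` ?I. [fan_matrix i (Some \<sigma>)] \<cdot> A i)"
    unfolding matrix_action_def
  proof (rule finsum_mono_neutral[symmetric, OF finite_fan_star])
    show "Some ` ?I \<subseteq> fan_star \<tau>" by (auto simp: fan_star_def cones_codim_def)
    show "(\<lambda>i. [fan_matrix i (Some \<sigma>)] \<cdot> A i) \<in> fan_star \<tau> \<rightarrow> carrier G"
      using A by (auto intro!: add.int_pow_closed)
    fix i assume i: "i \<in> fan_star \<tau> - Some ` ?I"
    have "fan_matrix i (Some \<sigma>) = 0"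
    proof (cases i)
      case (Some \<rho>)
      then have "\<rho> \<in> \<Delta>" "cone_face \<tau> \<rho>" "\<rho> \<notin> ?I" using i by (auto simp: fan_star_def)
      then have "\<not> (cone_face \<rho> \<sigma> \<and> dim \<sigma> = Suc (dim \<rho>))" using cones_codim_dim[OF \<sigma>(1)] by blast
      then show ?thesis using Some by auto
    qed simp
    then show "[fan_matrix i (Some \<sigma>)] \<cdot> A i = \<zero>" by (simp only: int_mult_zero)
  qed
  also have "\<dots> = (\<Oplus>\<rho>\<in>?I. [fan_matrix (Some \<rho>) (Some \<sigma>)] \<cdot> A (Some \<rho>))"
    using fan_star_closed[OF A] by (subst add.finprod_reindex) (auto simp: cones_codim_def intro!: add.int_pow_closed)
  also have "\<dots> = (\<Oplus>\<rho>\<in>?I. [incidence_sign ori \<rho> \<sigma>] \<cdot> restrict_star G \<tau> A \<rho>)"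
    using cones_codim_dim[OF \<sigma>(1)] rA
    by (intro finsum_cong' refl) (auto simp: restrict_star_def cones_codim_def intro!: add.int_pow_closed)
  also have "\<dots> = cone_boundary G (Suc k) (restrict_star G \<tau> A) \<sigma>"
    unfolding cone_boundary_def
  proof (rule finsum_mono_neutral)
    show "finite {\<rho> \<in> cones_codim \<Delta> (Suc k). cone_face \<rho> \<sigma>}" using finite_cones_codim by simp
    show "(\<lambda>\<rho>. [incidence_sign ori \<rho> \<sigma>] \<cdot> restrict_star G \<tau> A \<rho>) \<in> {\<rho> \<in> cones_codim \<Delta> (Suc k). cone_face \<rho> \<sigma>} \<rightarrow> carrier G"
      using rA by (auto simp: cones_codim_def intro!: add.int_pow_closed)
    fix \<rho> assume "\<rho> \<in> {\<rho> \<in> cones_codim \<Delta> (Suc k). cone_face \<rho> \<sigma>} - ?I"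
    then have "restrict_star G \<tau> A \<rho> = \<zero>" by (auto simp: restrict_star_def)
    then show "[incidence_sign ori \<rho> \<sigma>] \<cdot> restrict_star G \<tau> A \<rho> = \<zero>"
      using add.int_pow_one by simp
  qed auto
  finally show ?thesis .
qed

lemma matrix_action_None:
  assumes A: "A \<in> fan_star \<tau> \<rightarrow> carrier G"
  shows "matrix_action fan_matrix (fan_star \<tau>) A None = (\<Oplus>\<sigma>\<in>cones_codim \<Delta> 0. restrict_star G \<tau> A \<sigma>)"
proof -
  let ?I = "{\<sigma> \<in> cones_codim \<Delta> 0. cone_face \<tau> \<sigma>}"
  have rA: "restrict_star G \<tau> A \<rho> \<in> carrier G" if "\<rho> \<in> \<Delta>" for \<rho>
    using supported_restrict_star[OF A] that by (auto simp: supported_def)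
  have "matrix_action fan_matrix (fan_star \<tau>) A None = (\<Oplus>i\<in>Some ` ?I. [fan_matrix i None] \<cdot> A i)"
    unfolding matrix_action_def
  proof (rule finsum_mono_neutral[symmetric, OF finite_fan_star])
    show "Some ` ?I \<subseteq> fan_star \<tau>" by (auto simp: fan_star_def cones_codim_def)
    show "(\<lambda>i. [fan_matrix i None] \<cdot> A i) \<in> fan_star \<tau> \<rightarrow> carrier G"
      using A by (auto intro!: add.int_pow_closed)
    fix i assume i: "i \<in> fan_star \<tau> - Some ` ?I"
    have "fan_matrix i None = 0"
      using i by (cases i) (auto simp: fan_star_def cones_codim_def)
    then show "[fan_matrix i None] \<cdot> A i = \<zero>" by (simp only: int_mult_zero)
  qed
  also have "\<dots> = (\<Oplus>\<sigma>\<in>?I. [fan_matrix (Some \<sigma>) None] \<cdot> A (Some \<sigma>))"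
    using fan_star_closed[OF A] by (subst add.finprod_reindex) (auto simp: cones_codim_def intro!: add.int_pow_closed)
  also have "\<dots> = (\<Oplus>\<sigma>\<in>?I. restrict_star G \<tau> A \<sigma>)"
  proof (intro finsum_cong' refl)
    fix \<sigma> assume s: "\<sigma> \<in> ?I"
    then have "A (Some \<sigma>) \<in> carrier G" using fan_star_closed[OF A] by (simp add: cones_codim_def)
    moreover have "fan_matrix (Some \<sigma>) None = 1" using s by (simp add: cones_codim_def)
    ultimately show "[fan_matrix (Some \<sigma>) None] \<cdot> A (Some \<sigma>) = restrict_star G \<tau> A \<sigma>"
      using s by (simp only: int_mult_one restrict_star_def) simp
  qed (use rA in \<open>auto simp: cones_codim_def\<close>)
  also have "\<dots> = (\<Oplus>\<sigma>\<in>cones_codim \<Delta> 0. restrict_star G \<tau> A \<sigma>)"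
  proof (rule finsum_mono_neutral[OF finite_cones_codim])
    show "restrict_star G \<tau> A \<in> cones_codim \<Delta> 0 \<rightarrow> carrier G" using rA by (auto simp: cones_codim_def)
  qed (auto simp: restrict_star_def)
  finally show ?thesis .
qed

text \<open>Applying the homotopy to \<open>A\<close> treats all degrees at once. The value of the
  lift at \<open>None\<close> may be forgotten, since \<open>None\<close> has boundary zero.\<close>

lemma star_cycle_lift:
  assumes A: "A \<in> fan_star \<tau> \<rightarrow> carrier G"
    and cyc: "\<And>j. j \<in> fan_star \<tau> \<Longrightarrow> matrix_action fan_matrix (fan_star \<tau>) A j = \<zero>"
  shows "\<exists>b. supported G \<tau> b \<and> (\<forall>k. \<forall>\<sigma>\<in>cones_codim \<Delta> k. cone_face \<tau> \<sigma> \<longrightarrow> cone_boundary G (Suc k) b \<sigma> = A (Some \<sigma>)) \<and>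
    (\<Oplus>\<sigma>\<in>cones_codim \<Delta> 0. b \<sigma>) = A None"
proof -
  obtain h where h: "\<And>i j. i \<in> fan_star \<tau> \<Longrightarrow> j \<in> fan_star \<tau> \<Longrightarrow>
    (\<Sum>k\<in>fan_star \<tau>. h i k * fan_matrix k j) + (\<Sum>k\<in>fan_star \<tau>. fan_matrix i k * h k j) = (if i = j then 1 else 0)"
    using fan_matrix_homotopy[OF \<tau>] by blast
  let ?H = "matrix_action h (fan_star \<tau>) A"
  have H: "?H \<in> fan_star \<tau> \<rightarrow> carrier G" using matrix_action_closed[OF A] by auto
  have ex: "matrix_action fan_matrix (fan_star \<tau>) ?H j = A j" if "j \<in> fan_star \<tau>" for j
    by (rule matrix_action_exact[OF finite_fan_star A h cyc that])
  show ?thesis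
  proof (intro exI[of _ "restrict_star G \<tau> ?H"] conjI allI ballI impI supported_restrict_star H)
    fix k \<sigma> assume s: "\<sigma> \<in> cones_codim \<Delta> k" "cone_face \<tau> \<sigma>"
    then have "Some \<sigma> \<in> fan_star \<tau>" by (auto simp: fan_star_def cones_codim_def)
    then show "cone_boundary G (Suc k) (restrict_star G \<tau> ?H) \<sigma> = A (Some \<sigma>)"
      using ex matrix_action_Some[OF H s] by simp
  next
    show "(\<Oplus>\<sigma>\<in>cones_codim \<Delta> 0. restrict_star G \<tau> ?H \<sigma>) = A None"
      using ex[of None] matrix_action_None[OF H] by (simp add: fan_star_def)
  qed
qed

lemma cone_boundary_zero:
  "(\<And>\<rho>. \<rho> \<in> cones_codim \<Delta> k \<Longrightarrow> cone_face \<rho> \<sigma> \<Longrightarrow> a \<rho> = \<zero>) \<Longrightarrow> cone_boundary G k a \<sigma> = \<zero>"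
  unfolding cone_boundary_def using add.int_pow_one by (intro add.finprod_one_eqI) auto

lemma cone_boundary_cong:
  "(\<And>\<rho>. \<rho> \<in> cones_codim \<Delta> k \<Longrightarrow> a \<rho> = b \<rho> \<and> b \<rho> \<in> carrier G) \<Longrightarrow> cone_boundary G k a \<sigma> = cone_boundary G k b \<sigma>"
  unfolding cone_boundary_def by (intro finsum_cong' refl) (auto intro!: add.int_pow_closed)

lemma cones_codim_unique: "\<sigma> \<in> cones_codim \<Delta> k \<Longrightarrow> \<sigma> \<in> cones_codim \<Delta> l \<Longrightarrow> k = l"
  by (auto simp: cones_codim_def)

lemma codim_exists:
  assumes "\<sigma> \<in> \<Delta>"
  shows "\<exists>k. \<sigma> \<in> cones_codim \<Delta> k"
  using assms fd.dim_subset[of "span \<sigma>" UNIV] unfolding cones_codim_def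
  by (auto intro: exI[of _ "dim (UNIV :: 'v set) - dim (span \<sigma>)"])

text \<open>A family mixes degrees, and only its part of codimension \<open>k\<close> is assumed to
  be a cycle. Extended by zero this part is a cycle of the ungraded complex, since its boundary
  lives in codimension \<open>k - 1\<close>, or at \<open>None\<close> when
  \<open>k = 0\<close>.\<close>

lemma degree_cycle:
  assumes a: "supported G \<tau> a" and A: "A = (\<lambda>i. case i of None \<Rightarrow> \<zero> | Some \<rho> \<Rightarrow> if \<rho> \<in> cones_codim \<Delta> k then a \<rho> else \<zero>)"
    and cyc: "\<And>l \<sigma>. Suc l = k \<Longrightarrow> \<sigma> \<in> cones_codim \<Delta> l \<Longrightarrow> cone_face \<tau> \<sigma> \<Longrightarrow> cone_boundary G k a \<sigma> = \<zero>"
    and aug: "k = 0 \<Longrightarrow> (\<Oplus>\<sigma>\<in>cones_codim \<Delta> 0. a \<sigma>) = \<zero>" and j: "j \<in> fan_star \<tau>"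
  shows "A \<in> fan_star \<tau> \<rightarrow> carrier G" "matrix_action fan_matrix (fan_star \<tau>) A j = \<zero>"
proof -
  have aC: "a \<rho> \<in> carrier G" if "\<rho> \<in> cones_codim \<Delta> l" for \<rho> l
    using a that by (auto simp: supported_def cones_codim_def)
  show AC: "A \<in> fan_star \<tau> \<rightarrow> carrier G"
    using aC by (auto simp: A split: option.splits)
  have rk: "restrict_star G \<tau> A \<rho> = a \<rho>" if "\<rho> \<in> cones_codim \<Delta> k" for \<rho>
    using that a by (auto simp: restrict_star_def A supported_def cones_codim_def)
  have rl: "restrict_star G \<tau> A \<rho> = \<zero>" if "\<rho> \<in> cones_codim \<Delta> l" "l \<noteq> k" for \<rho> l
    using that cones_codim_unique[of \<rho> k l] by (auto simp: restrict_star_def A)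
  show "matrix_action fan_matrix (fan_star \<tau>) A j = \<zero>"
  proof (cases j)
    case None
    show ?thesis
    proof (cases "k = 0")
      case True
      then have "(\<Oplus>\<sigma>\<in>cones_codim \<Delta> 0. restrict_star G \<tau> A \<sigma>) = (\<Oplus>\<sigma>\<in>cones_codim \<Delta> 0. a \<sigma>)"
        using rk aC by (intro finsum_cong' refl) auto
      then show ?thesis using aug[OF True] matrix_action_None[OF AC] None by simp
    next
      case False
      then have "(\<Oplus>\<sigma>\<in>cones_codim \<Delta> 0. restrict_star G \<tau> A \<sigma>) = \<zero>"
        using rl by (intro add.finprod_one_eqI) auto
      then show ?thesis using matrix_action_None[OF AC] None by simp
    qed
  next
    case (Some \<sigma>)
    then have s: "\<sigma> \<in> \<Delta>" "cone_face \<tau> \<sigma>" using j by (auto simp: fan_star_def)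
    then obtain l where l: "\<sigma> \<in> cones_codim \<Delta> l" using codim_exists by blast
    have "cone_boundary G (Suc l) (restrict_star G \<tau> A) \<sigma> = \<zero>"
    proof (cases "Suc l = k")
      case True
      then have "cone_boundary G (Suc l) (restrict_star G \<tau> A) \<sigma> = cone_boundary G k a \<sigma>"
        using rk aC by (auto intro: cone_boundary_cong)
      then show ?thesis using cyc[OF True l s(2)] by simp
    next
      case False
      then show ?thesis using rl by (intro cone_boundary_zero) auto
    qed
    then show ?thesis using matrix_action_Some[OF AC l s(2)] Some by simp
  qed
qed

lemma cone_boundary_exact:
  assumes a: "supported G \<tau> a"
    and cyc: "\<And>l \<sigma>. Suc l = k \<Longrightarrow> \<sigma> \<in> cones_codim \<Delta> l \<Longrightarrow> cone_face \<tau> \<sigma> \<Longrightarrow> cone_boundary G k a \<sigma> = \<zero>"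
    and aug: "k = 0 \<Longrightarrow> (\<Oplus>\<sigma>\<in>cones_codim \<Delta> 0. a \<sigma>) = \<zero>"
  shows "\<exists>b. supported G \<tau> b \<and> (\<forall>\<sigma>\<in>cones_codim \<Delta> k. cone_face \<tau> \<sigma> \<longrightarrow> cone_boundary G (Suc k) b \<sigma> = a \<sigma>)"
proof -
  let ?A = "\<lambda>i. case i of None \<Rightarrow> \<zero> | Some \<rho> \<Rightarrow> if \<rho> \<in> cones_codim \<Delta> k then a \<rho> else \<zero>"
  have A: "?A \<in> fan_star \<tau> \<rightarrow> carrier G"
    using a by (auto simp: supported_def cones_codim_def split: option.splits)
  have "matrix_action fan_matrix (fan_star \<tau>) ?A j = \<zero>" if "j \<in> fan_star \<tau>" for j
    by (rule degree_cycle(2)[OF a refl _ _ that]) (erule (2) cyc, erule aug)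
  from star_cycle_lift[OF A this] obtain b where b: "supported G \<tau> b"
    "\<forall>k. \<forall>\<sigma>\<in>cones_codim \<Delta> k. cone_face \<tau> \<sigma> \<longrightarrow> cone_boundary G (Suc k) b \<sigma> = ?A (Some \<sigma>)" by blast
  then show ?thesis by (intro exI[of _ b]) auto
qed

text \<open>The chain with the single value \<open>r\<close> at \<open>None\<close> is a cycle,
  because nothing leaves \<open>None\<close>; exactness lifts it.\<close>

lemma augmentation_surjective:
  assumes "r \<in> carrier G"
  shows "\<exists>b. supported G \<tau> b \<and> (\<Oplus>\<sigma>\<in>cones_codim \<Delta> 0. b \<sigma>) = r"
proof -
  let ?A = "\<lambda>i. case i of None \<Rightarrow> r | Some \<rho> \<Rightarrow> \<zero>"
  have A: "?A \<in> fan_star \<tau> \<rightarrow> carrier G" using assms by (auto split: option.splits)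
  have "matrix_action fan_matrix (fan_star \<tau>) ?A j = \<zero>" for j
    unfolding matrix_action_def
  proof (rule add.finprod_one_eqI)
    fix i
    show "[fan_matrix i j] \<cdot> ?A i = \<zero>"
      using add.int_pow_one by (cases i) (auto simp: int_mult_zero)
  qed
  from star_cycle_lift[OF A this] show ?thesis by auto
qed

lemma cone_boundary_closed: "supported G \<tau> a \<Longrightarrow> cone_boundary G k a \<sigma> \<in> carrier G"
  unfolding cone_boundary_def supported_def
  by (intro finsum_closed) (auto simp: cones_codim_def intro!: add.int_pow_closed)

text \<open>The truncation to cones with face \<open>\<tau>\<close> matches the stalk of a
  differential, which is zero at the cones whose chart misses the point.\<close>

lemma cone_boundary_square_zero:
  assumes a: "supported G \<tau> a"
  shows "\<sigma> \<in> cones_codim \<Delta> k \<Longrightarrow> cone_face \<tau> \<sigma> \<Longrightarrow>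
      cone_boundary G (Suc k) (\<lambda>\<rho>. if cone_face \<tau> \<rho> then cone_boundary G (Suc (Suc k)) a \<rho> else \<zero>) \<sigma> = \<zero>"
    and "(\<Oplus>\<rho>\<in>cones_codim \<Delta> 0. if cone_face \<tau> \<rho> then cone_boundary G (Suc 0) a \<rho> else \<zero>) = \<zero>"
proof -
  let ?A = "\<lambda>i. case i of None \<Rightarrow> \<zero> | Some \<rho> \<Rightarrow> a \<rho>"
  have A: "?A \<in> fan_star \<tau> \<rightarrow> carrier G" using a by (auto simp: supported_def fan_star_def)
  let ?D = "matrix_action fan_matrix (fan_star \<tau>) ?A"
  have D: "?D \<in> fan_star \<tau> \<rightarrow> carrier G" using matrix_action_closed[OF A] by auto
  have rA: "restrict_star G \<tau> ?A \<rho> = a \<rho>" if "\<rho> \<in> \<Delta>" for \<rho>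
    using a that by (auto simp: restrict_star_def supported_def)
  have rD: "restrict_star G \<tau> ?D \<rho> = (if cone_face \<tau> \<rho> then cone_boundary G (Suc l) a \<rho> else \<zero>)"
    if "\<rho> \<in> cones_codim \<Delta> l" for \<rho> l
  proof -
    have "cone_boundary G (Suc l) (restrict_star G \<tau> ?A) \<rho> = cone_boundary G (Suc l) a \<rho>"
      using rA a by (intro cone_boundary_cong) (auto simp: cones_codim_def supported_def)
    then show ?thesis using matrix_action_Some[OF A that] by (simp add: restrict_star_def)
  qed
  have zero: "matrix_action fan_matrix (fan_star \<tau>) ?D j = \<zero>" if "j \<in> fan_star \<tau>" for j
    by (rule matrix_action_square_zero[OF finite_fan_star A that]) (rule fan_matrix_square_zero[OF \<tau> _ that])
  show "cone_boundary G (Suc k) (\<lambda>\<rho>. if cone_face \<tau> \<rho> then cone_boundary G (Suc (Suc k)) a \<rho> else \<zero>) \<sigma> = \<zero>"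
    if \<sigma>: "\<sigma> \<in> cones_codim \<Delta> k" "cone_face \<tau> \<sigma>"
  proof -
    have "Some \<sigma> \<in> fan_star \<tau>" using \<sigma> by (auto simp: fan_star_def cones_codim_def)
    then have "cone_boundary G (Suc k) (restrict_star G \<tau> ?D) \<sigma> = \<zero>"
      using zero matrix_action_Some[OF D \<sigma>] by simp
    moreover have "cone_boundary G (Suc k) (restrict_star G \<tau> ?D) \<sigma> = cone_boundary G (Suc k)
      (\<lambda>\<rho>. if cone_face \<tau> \<rho> then cone_boundary G (Suc (Suc k)) a \<rho> else \<zero>) \<sigma>"
      using rD cone_boundary_closed[OF a] by (intro cone_boundary_cong) auto
    ultimately show ?thesis by simp
  qed
  show "(\<Oplus>\<rho>\<in>cones_codim \<Delta> 0. if cone_face \<tau> \<rho> then cone_boundary G (Suc 0) a \<rho> else \<zero>) = \<zero>"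
  proof -
    have "(\<Oplus>\<sigma>\<in>cones_codim \<Delta> 0. restrict_star G \<tau> ?D \<sigma>) = \<zero>"
      using zero[of None] matrix_action_None[OF D] by (simp add: fan_star_def)
    moreover have "(\<Oplus>\<sigma>\<in>cones_codim \<Delta> 0. restrict_star G \<tau> ?D \<sigma>)
      = (\<Oplus>\<rho>\<in>cones_codim \<Delta> 0. if cone_face \<tau> \<rho> then cone_boundary G (Suc 0) a \<rho> else \<zero>)"
      using rD cone_boundary_closed[OF a] by (intro finsum_cong' refl) auto
    ultimately show ?thesis by simp
  qed
qed

end

end

section \<open>Points of the toric variety\<close>

text \<open>Composed with a real functional that cuts out a face of a rational cone, such a \<open>\<rat>\<close>-linear \<open>\<phi>\<close>
  makes the functional rational without moving its zeros among the generators.  It moves a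
  \<open>\<rat>\<close>-basis of the span of \<open>X\<close> slightly.\<close>

lemma rational_sign_preserving_map:
  fixes X :: "real set"
  assumes fin: "finite X"
  shows "\<exists>\<phi>::real \<Rightarrow> real. (\<forall>x y. \<phi> (x + y) = \<phi> x + \<phi> y) \<and> (\<forall>q x. \<phi> (of_rat q * x) = of_rat q * \<phi> x) \<and>
    (\<forall>x\<in>X. \<phi> x \<in> \<rat> \<and> sgn (\<phi> x) = sgn x)"
proof -
  interpret Q: vector_space "\<lambda>(q::rat) (x::real). of_rat q * x"
    by unfold_locales (auto simp: algebra_simps of_rat_add of_rat_mult)
  interpret QQ: vector_space_pair "\<lambda>(q::rat) (x::real). of_rat q * x" "\<lambda>(q::rat) (x::real). of_rat q * x"
    by unfold_locales
  obtain T where T: "T \<subseteq> X" "Q.independent T" "X \<subseteq> Q.span T"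
    by (rule Q.maximal_independent_subset)
  have finT: "finite T" using T(1) fin by (rule finite_subset)
  define c where "c = (\<lambda>x. \<Sum>t\<in>T. \<bar>of_rat (Q.representation T x t)\<bar> :: real)"
  \<comment> \<open>Moving the basis elements by less than \<open>\<delta>\<close> moves
    \<open>x\<close> by at most \<open>c x * \<delta>\<close>, which is less than
    \<open>\<bar>x\<bar>\<close> for every nonzero \<open>x\<close> in \<open>X\<close>.\<close>
  define \<delta> where "\<delta> = Min (insert 1 ((\<lambda>x. \<bar>x\<bar> / (c x + 1)) ` (X - {0})))"
  have c0: "0 \<le> c x" for x by (simp add: c_def sum_nonneg)
  have "0 < \<delta>" unfolding \<delta>_def using fin c0 by (auto intro!: divide_pos_pos add_nonneg_pos)
  have "\<exists>r. \<bar>of_rat r - t\<bar> < \<delta>" for t :: real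
  proof -
    obtain r where "t < of_rat r" "of_rat r < t + \<delta>" using of_rat_dense[of t "t + \<delta>"] \<open>0 < \<delta>\<close> by auto
    then show ?thesis by (intro exI[of _ r]) auto
  qed
  then obtain r where r: "\<And>t::real. \<bar>of_rat (r t) - t\<bar> < \<delta>" by metis
  obtain \<phi> where lin: "Vector_Spaces.linear (\<lambda>(q::rat) (x::real). of_rat q * x) (\<lambda>(q::rat) (x::real). of_rat q * x) \<phi>"
    and \<phi>T: "\<forall>t\<in>T. \<phi> t = of_rat (r t)"
    using QQ.linear_independent_extend[OF T(2), of "\<lambda>t. of_rat (r t)"] by blast
  have add: "\<phi> (x + y) = \<phi> x + \<phi> y" and scale: "\<phi> (of_rat q * x) = of_rat q * \<phi> x" for x y q
    using lin QQ.linear_add QQ.linear_scale by blast+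
  have "\<phi> x \<in> \<rat> \<and> sgn (\<phi> x) = sgn x" if x: "x \<in> X" for x
  proof -
    have x_eq: "x = (\<Sum>t\<in>T. of_rat (Q.representation T x t) * t)"
      using Q.sum_representation_eq[OF T(2) _ finT order_refl, of x] x T(3) by auto
    have "\<phi> x = (\<Sum>t\<in>T. \<phi> (of_rat (Q.representation T x t) * t))"
      by (subst x_eq) (rule QQ.linear_sum[OF lin])
    then have \<phi>x: "\<phi> x = (\<Sum>t\<in>T. of_rat (Q.representation T x t) * of_rat (r t))"
      using \<phi>T by (simp add: scale)
    then have rat: "\<phi> x \<in> \<rat>" by (auto intro!: Rats_sum Rats_mult)
    have "sgn (\<phi> x) = sgn x"
    proof (cases "x = 0")
      case True
      then show ?thesis using scale[of 0 0] by simp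
    next
      case False
      have "\<phi> x - x = (\<Sum>t\<in>T. of_rat (Q.representation T x t) * (of_rat (r t) - t))"
        unfolding \<phi>x by (subst (2) x_eq) (simp add: sum_subtractf right_diff_distrib)
      then have "\<bar>\<phi> x - x\<bar> \<le> (\<Sum>t\<in>T. \<bar>of_rat (Q.representation T x t) * (of_rat (r t) - t)\<bar>)"
        by (simp only: sum_abs)
      also have "\<dots> \<le> (\<Sum>t\<in>T. \<bar>of_rat (Q.representation T x t)\<bar> * \<delta>)"
        unfolding abs_mult by (intro sum_mono mult_left_mono less_imp_le[OF r] abs_ge_zero)
      also have "\<dots> = c x * \<delta>" by (simp add: c_def sum_distrib_right)
      also have "\<dots> < (c x + 1) * \<delta>" using \<open>0 < \<delta>\<close> by simp
      also have "\<dots> \<le> (c x + 1) * (\<bar>x\<bar> / (c x + 1))"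
        using fin x False c0[of x] by (intro mult_left_mono) (auto simp: \<delta>_def)
      also have "\<dots> = \<bar>x\<bar>" using c0[of x] by simp
      finally show ?thesis by (auto simp: sgn_if abs_if split: if_splits)
    qed
    then show ?thesis using rat by blast
  qed
  then show ?thesis using add scale by blast
qed

lemma common_denominator:
  assumes "finite A" "\<forall>a\<in>A. f a \<in> (\<rat> :: real set)"
  shows "\<exists>d::nat. 0 < d \<and> (\<forall>a\<in>A. of_nat d * f a \<in> \<int>)"
  using assms
proof (induction A rule: finite_induct)
  case empty
  then show ?case by (auto intro: exI[of _ 1])
next
  case (insert a A)
  then obtain d where d: "0 < d" "\<forall>a\<in>A. of_nat d * f a \<in> \<int>" by auto
  obtain m n :: int where mn: "0 < n" "f a = of_int m / of_int n"
    using insert.prems by (auto elim!: Rats_cases')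
  have A: "of_nat (nat n * d) * f b \<in> \<int>" if "b \<in> A" for b
  proof -
    have "of_nat (nat n * d) * f b = of_int n * (of_nat d * f b)" using mn by simp
    then show ?thesis using d(2) that by (metis Ints_mult Ints_of_int)
  qed
  have "of_nat (nat n * d) * f a = of_int (int d * m)" using mn by simp
  then have "of_nat (nat n * d) * f a \<in> \<int>" by (metis Ints_of_int)
  then show ?case using A d mn by (intro exI[of _ "nat n * d"]) auto
qed

lemma gen_cone_zero_iff:
  fixes f :: "'v::real_vector \<Rightarrow> real"
  assumes fin: "finite S" and f: "linear f" "\<forall>s\<in>S. 0 \<le> f s" and c: "\<forall>s\<in>S. 0 \<le> c s"
  shows "f (\<Sum>s\<in>S. c s *\<^sub>R s) = 0 \<longleftrightarrow> (\<forall>s\<in>S. c s = 0 \<or> f s = 0)"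
proof -
  have "f (\<Sum>s\<in>S. c s *\<^sub>R s) = (\<Sum>s\<in>S. c s * f s)"
    using f(1) by (simp add: linear_sum linear_scale)
  then show ?thesis using fin f(2) c by (simp add: sum_nonneg_eq_0_iff)
qed

lemma gen_cone_zero_mono:
  fixes f g :: "'v::real_vector \<Rightarrow> real"
  assumes fin: "finite S" and f: "linear f" "\<forall>s\<in>S. 0 \<le> f s" and g: "linear g" "\<forall>s\<in>S. 0 \<le> g s"
    and le: "\<And>s. s \<in> S \<Longrightarrow> f s = 0 \<Longrightarrow> g s = 0" and v: "v \<in> gen_cone S" "f v = 0"
  shows "g v = 0"
proof -
  obtain c where c: "v = (\<Sum>s\<in>S. c s *\<^sub>R s)" "\<forall>s\<in>S. 0 \<le> c s" using v(1) unfolding gen_cone_def by blast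
  have "\<forall>s\<in>S. c s = 0 \<or> f s = 0" using v(2) gen_cone_zero_iff[OF fin f c(2)] c(1) by simp
  then show ?thesis using gen_cone_zero_iff[OF fin g c(2)] c(1) le by auto
qed

definition nat_multiple :: "nat \<Rightarrow> ('v \<Rightarrow> real) \<Rightarrow> 'v \<Rightarrow> real" where
  "nat_multiple k u = (\<lambda>v. real k * u v)"

definition character :: "('v \<Rightarrow> real) \<Rightarrow> (('v \<Rightarrow> real) \<Rightarrow>\<^sub>0 complex)" where
  "character m = Poly_Mapping.single m 1"

lemma character_add: "character (m + n) = character m * character n"
  by (simp add: character_def mult_single)

lemma character_zero: "character 0 = 1"
  by (simp add: character_def)

lemma keys_character: "Poly_Mapping.keys (character m) = {m}"
  by (simp add: character_def)

lemma nat_multiple_0: "nat_multiple 0 u = 0"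
  by (auto simp: nat_multiple_def)

lemma nat_multiple_add: "nat_multiple (k + l) u = nat_multiple k u + nat_multiple l u"
  by (auto simp: nat_multiple_def distrib_right)

lemma nat_multiple_Suc: "nat_multiple (Suc k) u = nat_multiple k u + u"
  by (auto simp: nat_multiple_def distrib_right)

definition exponents :: "'v::real_vector set \<Rightarrow> 'v set \<Rightarrow> ('v \<Rightarrow> real) set" where
  "exponents N \<sigma> = dual_cone \<sigma> \<inter> dual_lattice N"

lemma exponents_iff: "u \<in> exponents N \<sigma> \<longleftrightarrow> linear u \<and> (\<forall>v\<in>\<sigma>. 0 \<le> u v) \<and> (\<forall>v\<in>N. u v \<in> \<int>)"
  by (auto simp: exponents_def dual_cone_def dual_lattice_def dual_space_def)

lemma exponents_zero: "0 \<in> exponents N \<sigma>"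
  by (auto simp: exponents_iff zero_fun_def intro: linearI)

lemma exponents_add: "u \<in> exponents N \<sigma> \<Longrightarrow> w \<in> exponents N \<sigma> \<Longrightarrow> u + w \<in> exponents N \<sigma>"
  by (auto simp: exponents_iff plus_fun_def intro: linear_compose_add)

lemma exponents_nat_multiple: "u \<in> exponents N \<sigma> \<Longrightarrow> nat_multiple k u \<in> exponents N \<sigma>"
  by (induction k) (simp_all add: nat_multiple_0 exponents_zero exponents_add nat_multiple_Suc)

lemma exponents_mono: "\<tau> \<subseteq> \<sigma> \<Longrightarrow> exponents N \<sigma> \<subseteq> exponents N \<tau>"
  by (simp add: subset_iff exponents_iff)

lemma cone_ring_simps:
  "carrier (cone_ring N \<sigma>) = {f. Poly_Mapping.keys f \<subseteq> exponents N \<sigma>}"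
  "f \<otimes>\<^bsub>cone_ring N \<sigma>\<^esub> g = f * g" "\<one>\<^bsub>cone_ring N \<sigma>\<^esub> = 1" "\<zero>\<^bsub>cone_ring N \<sigma>\<^esub> = 0" "f \<oplus>\<^bsub>cone_ring N \<sigma>\<^esub> g = f + g"
  by (auto simp: cone_ring_def exponents_def)

abbreviation cone_algebra :: "'v::real_vector set \<Rightarrow> 'v set \<Rightarrow> (('v \<Rightarrow> real) \<Rightarrow>\<^sub>0 complex) set" where
  "cone_algebra N \<sigma> \<equiv> carrier (cone_ring N \<sigma>)"

lemma character_in_cone_algebra: "character m \<in> cone_algebra N \<sigma> \<longleftrightarrow> m \<in> exponents N \<sigma>"
  by (simp add: cone_ring_simps keys_character)

lemma cone_algebra_mono: "\<tau> \<subseteq> \<sigma> \<Longrightarrow> cone_algebra N \<sigma> \<subseteq> cone_algebra N \<tau>"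
  using exponents_mono[of \<tau> \<sigma> N] by (auto simp: cone_ring_simps)

lemma cone_algebra_closed:
  "f \<in> cone_algebra N \<sigma> \<Longrightarrow> g \<in> cone_algebra N \<sigma> \<Longrightarrow> f * g \<in> cone_algebra N \<sigma>"
  "f \<in> cone_algebra N \<sigma> \<Longrightarrow> g \<in> cone_algebra N \<sigma> \<Longrightarrow> f + g \<in> cone_algebra N \<sigma>"
  "1 \<in> cone_algebra N \<sigma>" "0 \<in> cone_algebra N \<sigma>"
proof -
  interpret cring "cone_ring N \<sigma>" by (rule cring_cone_ring)
  show "f \<in> cone_algebra N \<sigma> \<Longrightarrow> g \<in> cone_algebra N \<sigma> \<Longrightarrow> f * g \<in> cone_algebra N \<sigma>"
    using m_closed[of f g] by (simp add: cone_ring_simps(2))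
  show "f \<in> cone_algebra N \<sigma> \<Longrightarrow> g \<in> cone_algebra N \<sigma> \<Longrightarrow> f + g \<in> cone_algebra N \<sigma>"
    using a_closed[of f g] by (simp add: cone_ring_simps(5))
  show "1 \<in> cone_algebra N \<sigma>" "0 \<in> cone_algebra N \<sigma>"
    using one_closed zero_closed by (simp_all add: cone_ring_simps(3,4))
qed

lemma cone_algebra_minus_one: "- 1 \<in> cone_algebra N \<sigma>"
  using cone_algebra_closed(3)[of N \<sigma>] by (simp add: cone_ring_simps)

text \<open>Primality is phrased with the operations on formal sums, which are the same for all
  cones. Ideals of the rings of different cones can then be compared as plain sets.\<close>

lemma spec_cone_ringI:
  assumes sub: "P \<subseteq> cone_algebra N \<sigma>" and zero: "0 \<in> P"
    and add: "\<And>f g. f \<in> P \<Longrightarrow> g \<in> P \<Longrightarrow> f + g \<in> P"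
    and mult: "\<And>f g. f \<in> P \<Longrightarrow> g \<in> cone_algebra N \<sigma> \<Longrightarrow> g * f \<in> P"
    and one: "1 \<notin> P"
    and prime: "\<And>f g. f \<in> cone_algebra N \<sigma> \<Longrightarrow> g \<in> cone_algebra N \<sigma> \<Longrightarrow> f * g \<in> P \<Longrightarrow> f \<in> P \<or> g \<in> P"
  shows "P \<in> spec (cone_ring N \<sigma>)"
proof -
  interpret cring "cone_ring N \<sigma>" by (rule cring_cone_ring)
  have uminus: "- f \<in> P" if "f \<in> P" for f using mult[OF that cone_algebra_minus_one] by simp
  have inv: "\<ominus>\<^bsub>cone_ring N \<sigma>\<^esub> f = - f" if "f \<in> P" for f
    using that uminus sub by (intro minus_equality) (auto simp: cone_ring_simps(4,5))
  have "subgroup P (add_monoid (cone_ring N \<sigma>))"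
    using sub zero add uminus inv
    by (intro add.subgroupI) (auto simp: cone_ring_simps(5))
  then have "ideal P (cone_ring N \<sigma>)"
    using mult by (intro idealI ring_axioms) (auto simp: cone_ring_simps(2) mult.commute)
  then have "primeideal P (cone_ring N \<sigma>)"
    using prime one cone_algebra_closed(3)[of N \<sigma>]
    by (intro primeidealI is_cring) (auto simp: cone_ring_simps(2))
  then show ?thesis by (simp add: spec_def)
qed

lemma spec_cone_ringD:
  assumes "P \<in> spec (cone_ring N \<sigma>)"
  shows "P \<subseteq> cone_algebra N \<sigma>" "0 \<in> P" "\<And>f g. f \<in> P \<Longrightarrow> g \<in> P \<Longrightarrow> f + g \<in> P"
    "\<And>f g. f \<in> P \<Longrightarrow> g \<in> cone_algebra N \<sigma> \<Longrightarrow> g * f \<in> P" "1 \<notin> P"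
    "\<And>f g. f \<in> cone_algebra N \<sigma> \<Longrightarrow> g \<in> cone_algebra N \<sigma> \<Longrightarrow> f * g \<in> P \<Longrightarrow> f \<in> P \<or> g \<in> P"
proof -
  interpret primeideal P "cone_ring N \<sigma>" using assms by (simp add: spec_def)
  show "P \<subseteq> cone_algebra N \<sigma>" by (rule a_subset)
  show "0 \<in> P" using additive_subgroup.zero_closed[OF additive_subgroup_axioms] by (simp add: cone_ring_simps(4))
  show "\<And>f g. f \<in> P \<Longrightarrow> g \<in> P \<Longrightarrow> f + g \<in> P"
    using additive_subgroup.a_closed[OF additive_subgroup_axioms] by (simp add: cone_ring_simps(5))
  show "\<And>f g. f \<in> P \<Longrightarrow> g \<in> cone_algebra N \<sigma> \<Longrightarrow> g * f \<in> P"
    using I_l_closed by (simp add: cone_ring_simps(2))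
  show "1 \<notin> P" using one_imp_carrier I_notcarr by (auto simp: cone_ring_simps(3))
  show "\<And>f g. f \<in> cone_algebra N \<sigma> \<Longrightarrow> g \<in> cone_algebra N \<sigma> \<Longrightarrow> f * g \<in> P \<Longrightarrow> f \<in> P \<or> g \<in> P"
    using I_prime by (simp add: cone_ring_simps(2))
qed

lemma character_prime_add:
  assumes P: "P \<in> spec (cone_ring N \<sigma>)" and m: "m \<in> exponents N \<sigma>" and n: "n \<in> exponents N \<sigma>"
  shows "character (m + n) \<in> P \<longleftrightarrow> character m \<in> P \<or> character n \<in> P"
  using spec_cone_ringD(4,6)[OF P] character_in_cone_algebra m n
  by (metis character_add mult.commute)

lemma character_nat_multiple:
  assumes P: "P \<in> spec (cone_ring N \<sigma>)" and m: "m \<in> exponents N \<sigma>" "character m \<notin> P"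
  shows "character (nat_multiple k m) \<notin> P"
proof (induction k)
  case 0
  show ?case unfolding nat_multiple_0 character_zero by (rule spec_cone_ringD(5)[OF P])
next
  case (Suc k)
  then show ?case
    using character_prime_add[OF P exponents_nat_multiple[OF m(1), of k] m(1)] m(2)
    unfolding nat_multiple_Suc by blast
qed

lemma prime_contraction:
  assumes P: "P \<in> spec (cone_ring N \<tau>)" and sub: "\<tau> \<subseteq> \<sigma>"
  shows "P \<inter> cone_algebra N \<sigma> \<in> spec (cone_ring N \<sigma>)"
proof (rule spec_cone_ringI)
  note PD = spec_cone_ringD[OF P]
  note mono = subsetD[OF cone_algebra_mono[OF sub, of N]]
  show "0 \<in> P \<inter> cone_algebra N \<sigma>" using PD(2) cone_algebra_closed(4) by blast
  show "1 \<notin> P \<inter> cone_algebra N \<sigma>" using PD(5) by blast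
  show "f + g \<in> P \<inter> cone_algebra N \<sigma>" if "f \<in> P \<inter> cone_algebra N \<sigma>" "g \<in> P \<inter> cone_algebra N \<sigma>" for f g
    using that PD(3) cone_algebra_closed(2) by blast
  show "g * f \<in> P \<inter> cone_algebra N \<sigma>" if "f \<in> P \<inter> cone_algebra N \<sigma>" "g \<in> cone_algebra N \<sigma>" for f g
    using that PD(4)[OF _ mono] cone_algebra_closed(1) by blast
  show "f \<in> P \<inter> cone_algebra N \<sigma> \<or> g \<in> P \<inter> cone_algebra N \<sigma>"
    if "f \<in> cone_algebra N \<sigma>" "g \<in> cone_algebra N \<sigma>" "f * g \<in> P \<inter> cone_algebra N \<sigma>" for f g
    using that PD(6)[OF mono mono, of f g] by blast
qed blast

text \<open>The smallest face of \<open>\<sigma>\<close> whose chart contains the point \<open>P\<close> of the chart of \<open>\<sigma>\<close>.\<close>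

definition orbit_cone :: "'v::real_vector set \<Rightarrow> 'v set \<Rightarrow> (('v \<Rightarrow> real) \<Rightarrow>\<^sub>0 complex) set \<Rightarrow> 'v set" where
  "orbit_cone N \<sigma> P = {v \<in> \<sigma>. \<forall>u\<in>exponents N \<sigma>. character u \<notin> P \<longrightarrow> u v = 0}"

lemma equiv_toric_equiv: "equiv UNIV (toric_equiv N \<Delta>)"
  unfolding toric_equiv_def
  by (intro equivI refl_rtrancl trans_rtrancl sym_rtrancl) (auto simp: sym_def)

section \<open>Faces cut out by lattice forms, orbit cones and charts\<close>

locale toric_fan = oriented_fan B N \<Delta> ori for B N :: "'v::real_vector set" and \<Delta> ori +
  assumes lattice: "N = {\<Sum>b\<in>B. of_int (c b) *\<^sub>R b | c :: 'v \<Rightarrow> int. True}"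
begin

text \<open>The map \<open>\<phi>\<close> composed with \<open>u0\<close> is only additive over the
  rationals, so the real form \<open>u1\<close> is defined by its values on \<open>B\<close>. Both
  agree on the lattice, hence on the generators, where signs are preserved; the common denominator
  \<open>d\<close> makes the values on \<open>N\<close> integral.\<close>

lemma face_exponent:
  assumes \<sigma>: "\<sigma> \<in> \<Delta>" and face: "cone_face \<tau> \<sigma>"
  obtains u where "u \<in> exponents N \<sigma>" "\<tau> = {v \<in> \<sigma>. u v = 0}"
proof -
  let ?S = "gens \<sigma>"
  note S = gens[OF \<sigma>]
  obtain u0 :: "'v \<Rightarrow> real" where u0: "linear u0" "\<forall>v\<in>\<sigma>. 0 \<le> u0 v" "\<tau> = {v \<in> \<sigma>. u0 v = 0}"
    by (rule cone_faceE[OF face])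
  have u0S: "\<forall>s\<in>?S. 0 \<le> u0 s" using u0(2) gen_cone_superset[OF S(1)] S(3) by blast
  have fX: "finite (u0 ` B \<union> u0 ` ?S)" using finite_B S(1) by simp
  from rational_sign_preserving_map[OF fX] obtain \<phi> :: "real \<Rightarrow> real" where
    \<phi>': "\<forall>x y. \<phi> (x + y) = \<phi> x + \<phi> y" "\<forall>q x. \<phi> (of_rat q * x) = of_rat q * \<phi> x"
      "\<forall>x\<in>u0 ` B \<union> u0 ` ?S. \<phi> x \<in> \<rat> \<and> sgn (\<phi> x) = sgn x"
    by (elim exE conjE)
  note \<phi> = \<phi>'(1,2)[rule_format] bspec[OF \<phi>'(3)]
  obtain u1 :: "'v \<Rightarrow> real" where u1: "linear u1" "\<forall>b\<in>B. u1 b = \<phi> (u0 b)"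
    using linear_independent_extend[OF independent_B, of "\<lambda>b. \<phi> (u0 b)"] by blast
  obtain d :: nat where d: "0 < d" "\<forall>b\<in>B. of_nat d * \<phi> (u0 b) \<in> \<int>"
    using common_denominator[OF finite_B, of "\<lambda>b. \<phi> (u0 b)"] \<phi>(3) by blast
  have \<phi>_sum: "\<phi> (\<Sum>b\<in>A. f b) = (\<Sum>b\<in>A. \<phi> (f b))" if "finite A" for A and f :: "'v \<Rightarrow> real"
    using that \<phi>(2)[of 0 0] by (induction A rule: finite_induct) (auto simp: \<phi>(1))
  have u1N: "u1 v = \<phi> (u0 v)" and intN: "of_nat d * u1 v \<in> \<int>" if "v \<in> N" for v
  proof -
    obtain c :: "'v \<Rightarrow> int" where c: "v = (\<Sum>b\<in>B. of_int (c b) *\<^sub>R b)" using \<open>v \<in> N\<close> lattice by blast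
    have eq: "u1 v = (\<Sum>b\<in>B. of_int (c b) * \<phi> (u0 b))"
      using u1 by (simp add: c linear_sum linear_scale)
    have "\<phi> (u0 v) = (\<Sum>b\<in>B. \<phi> (of_rat (of_int (c b)) * u0 b))"
      using u0(1) finite_B by (simp add: c linear_sum linear_scale \<phi>_sum)
    then show "u1 v = \<phi> (u0 v)" unfolding \<phi>(2) eq by simp
    have "of_nat d * u1 v = (\<Sum>b\<in>B. of_int (c b) * (of_nat d * \<phi> (u0 b)))"
      unfolding eq by (simp add: sum_distrib_left mult_ac)
    moreover have "(\<Sum>b\<in>B. of_int (c b) * (of_nat d * \<phi> (u0 b))) \<in> \<int>"
      by (intro Ints_sum Ints_mult[OF Ints_of_int]) (rule bspec[OF d(2)])
    ultimately show "of_nat d * u1 v \<in> \<int>" by metis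
  qed
  define u where "u = nat_multiple d u1"
  have lin: "linear u" unfolding u_def nat_multiple_def
    using linear_compose_scale_right[OF u1(1), of "real d"] by simp
  have sgnS: "sgn (u s) = sgn (u0 s)" if "s \<in> ?S" for s
    using that \<phi>(3)[of "u0 s"] u1N[of s] S(2) d(1) by (auto simp: u_def nat_multiple_def sgn_mult)
  have uS: "\<forall>s\<in>?S. 0 \<le> u s"
  proof
    fix s assume s: "s \<in> ?S"
    then have "sgn (u s) = sgn (u0 s)" "0 \<le> u0 s" using sgnS u0S by blast+
    then show "0 \<le> u s" by (auto simp: sgn_if split: if_splits)
  qed
  have "u \<in> exponents N \<sigma>"
    unfolding exponents_iff using lin gen_cone_functional_nonneg[OF lin uS] S(3) intN
    by (auto simp: u_def nat_multiple_def)
  moreover have "u v = 0 \<longleftrightarrow> u0 v = 0" if "v \<in> \<sigma>" for v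
    using gen_cone_zero_mono[OF S(1) lin uS u0(1) u0S, of v] gen_cone_zero_mono[OF S(1) u0(1) u0S lin uS, of v]
      sgnS sgn_zero_iff that S(3) by metis
  then have "\<tau> = {v \<in> \<sigma>. u v = 0}" using u0(3) by blast
  ultimately show ?thesis using that by blast
qed

text \<open>On a generator in the face \<open>m\<close> is already nonnegative; on any other
  \<open>u\<close> is positive and a large multiple of it wins. The statement for all large
  \<open>k\<close> allows finitely many exponents to be treated with one \<open>k\<close>.\<close>

lemma face_absorbs:
  assumes \<sigma>: "\<sigma> \<in> \<Delta>" and u: "u \<in> exponents N \<sigma>" and m: "m \<in> dual_lattice N" "\<forall>v\<in>{v \<in> \<sigma>. u v = 0}. 0 \<le> m v"
  shows "\<exists>k0. \<forall>k\<ge>k0. m + nat_multiple k u \<in> exponents N \<sigma>"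
proof -
  let ?S = "gens \<sigma>"
  note S = gens[OF \<sigma>]
  have lin: "linear m" "linear u" using m(1) u by (auto simp: dual_lattice_def dual_space_def exponents_iff)
  have "\<forall>s\<in>?S. \<exists>k0::nat. \<forall>k\<ge>k0. 0 \<le> m s + real k * u s"
  proof
    fix s assume s: "s \<in> ?S"
    then have s\<sigma>: "s \<in> \<sigma>" using gen_cone_superset[OF S(1)] S(3) by blast
    show "\<exists>k0::nat. \<forall>k\<ge>k0. 0 \<le> m s + real k * u s"
    proof (cases "u s = 0")
      case True
      then show ?thesis using m(2) s\<sigma> by auto
    next
      case False
      then have us: "0 < u s" using u s\<sigma> by (force simp: exponents_iff)
      obtain k0 :: nat where k0: "- m s / u s \<le> real k0" using real_arch_simple by blast
      have "0 \<le> m s + real k * u s" if "k0 \<le> k" for k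
      proof -
        have "- m s / u s \<le> real k" using k0 that by linarith
        then have "- m s \<le> real k * u s" using pos_divide_le_eq[OF us, of "- m s" "real k"] by blast
        then show ?thesis by linarith
      qed
      then show ?thesis by blast
    qed
  qed
  from bchoice[OF this] obtain K :: "'v \<Rightarrow> nat" where
    K: "\<forall>s\<in>?S. \<forall>k\<ge>K s. 0 \<le> m s + real k * u s" by blast
  have "m + nat_multiple k u \<in> exponents N \<sigma>" if k: "(\<Sum>s\<in>?S. K s) \<le> k" for k
  proof -
    have Ks: "K s \<le> k" if "s \<in> ?S" for s
      using member_le_sum[OF that _ S(1), of K] k by simp
    have lin': "linear (m + nat_multiple k u)"
      unfolding plus_fun_def nat_multiple_def
      using linear_compose_add[OF lin(1) linear_compose_scale_right[OF lin(2), of "real k"]] by simp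
    have "\<forall>s\<in>?S. 0 \<le> (m + nat_multiple k u) s"
      using K Ks by (simp add: nat_multiple_def plus_fun_def)
    then have "\<forall>v\<in>\<sigma>. 0 \<le> (m + nat_multiple k u) v"
      using gen_cone_functional_nonneg[OF lin'] S(3) by blast
    moreover have "(m + nat_multiple k u) v \<in> \<int>" if "v \<in> N" for v
      using that m(1) u by (auto simp: dual_lattice_def exponents_iff nat_multiple_def plus_fun_def)
    ultimately show ?thesis using lin' by (simp add: exponents_iff)
  qed
  then show ?thesis by blast
qed

text \<open>One exponent replaces all those occurring in \<open>orbit_cone\<close>: take an
  admissible one with the fewest generators among its zeros. By primality its sum with another
  admissible exponent \<open>w\<close> is admissible, and by minimality has no fewer zeros, so
  \<open>w\<close> vanishes wherever \<open>u\<close> does.\<close>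

lemma orbit_cone_exponent:
  assumes \<sigma>: "\<sigma> \<in> \<Delta>" and P: "P \<in> spec (cone_ring N \<sigma>)"
  obtains u where "u \<in> exponents N \<sigma>" "character u \<notin> P" "orbit_cone N \<sigma> P = {v \<in> \<sigma>. u v = 0}"
proof -
  let ?S = "gens \<sigma>"
  note S = gens[OF \<sigma>]
  let ?ok = "\<lambda>u. u \<in> exponents N \<sigma> \<and> character u \<notin> P"
  let ?Z = "\<lambda>u. {s \<in> ?S. u s = (0::real)}"
  have "?ok 0" using exponents_zero spec_cone_ringD(5)[OF P] by (simp add: character_zero)
  then obtain u where u: "?ok u" and least: "\<And>w. ?ok w \<Longrightarrow> card (?Z u) \<le> card (?Z w)"
    using ex_has_least_nat[of ?ok 0 "\<lambda>u. card (?Z u)"] by blast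
  have nonneg: "\<forall>s\<in>?S. 0 \<le> w s" if "w \<in> exponents N \<sigma>" for w
    using that gen_cone_superset[OF S(1)] S(3) by (auto simp: exponents_iff)
  have "w v = 0" if w: "?ok w" and v: "v \<in> \<sigma>" "u v = 0" for w v
  proof -
    have ok: "?ok (u + w)"
      using u w exponents_add character_prime_add[OF P] by blast
    have sub: "?Z (u + w) \<subseteq> ?Z u"
    proof
      fix s assume "s \<in> ?Z (u + w)"
      then have s: "s \<in> ?S" "u s + w s = 0" by (simp_all add: plus_fun_def)
      moreover have "0 \<le> u s" "0 \<le> w s" using nonneg u w s(1) by blast+
      ultimately show "s \<in> ?Z u" by simp
    qed
    have eq: "?Z (u + w) = ?Z u"
      using card_subset_eq[OF _ sub] least[OF ok] card_mono[OF _ sub] S(1) by fastforce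
    have "w s = 0" if "s \<in> ?S" "u s = 0" for s
    proof -
      have "s \<in> ?Z (u + w)" unfolding eq using that by blast
      then show ?thesis using that(2) by (simp add: plus_fun_def)
    qed
    then show ?thesis
      using gen_cone_zero_mono[OF S(1) _ nonneg _ nonneg, of u w v] u w v S(3) by (auto simp: exponents_iff)
  qed
  then have "orbit_cone N \<sigma> P = {v \<in> \<sigma>. u v = 0}"
    using u by (auto simp: orbit_cone_def)
  then show ?thesis using that u by blast
qed

lemma orbit_cone_face:
  assumes "\<sigma> \<in> \<Delta>" "P \<in> spec (cone_ring N \<sigma>)"
  shows "cone_face (orbit_cone N \<sigma> P) \<sigma>"
  using orbit_cone_exponent[OF assms] unfolding cone_face_def exponents_def by blast

text \<open>The form \<open>w\<close> cutting out \<open>\<tau>\<close> vanishes on it, so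
  \<open>character w\<close> is invertible over \<open>\<tau>\<close> and avoids \<open>P\<close>.
  An exponent of \<open>\<tau>\<close> becomes one of \<open>\<sigma>\<close> after adding a
  multiple of \<open>w\<close>, without changing its values on \<open>\<tau>\<close>.\<close>

lemma orbit_cone_contraction:
  assumes \<tau>: "\<tau> \<in> \<Delta>" and \<sigma>: "\<sigma> \<in> \<Delta>" and face: "cone_face \<tau> \<sigma>" and P: "P \<in> spec (cone_ring N \<tau>)"
  shows "orbit_cone N \<sigma> (P \<inter> cone_algebra N \<sigma>) = orbit_cone N \<tau> P"
proof -
  note sub = cone_face_subset[OF face]
  obtain w where w: "w \<in> exponents N \<sigma>" "\<tau> = {v \<in> \<sigma>. w v = 0}" by (rule face_exponent[OF \<sigma> face])
  have w\<tau>: "w \<in> exponents N \<tau>" using w(1) exponents_mono[OF sub] by blast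
  have "(\<lambda>v. - w v) \<in> exponents N \<tau>"
    using w by (auto simp: exponents_iff intro: linear_compose_neg)
  moreover have "character (w + (\<lambda>v. - w v)) = 1"
    using character_zero by (simp add: plus_fun_def zero_fun_def)
  ultimately have wP: "character w \<notin> P"
    using character_prime_add[OF P w\<tau>] spec_cone_ringD(5)[OF P] by metis
  show ?thesis
  proof (intro subset_antisym subsetI)
    fix v assume v: "v \<in> orbit_cone N \<tau> P"
    then show "v \<in> orbit_cone N \<sigma> (P \<inter> cone_algebra N \<sigma>)"
      using sub exponents_mono[OF sub, of N] by (auto simp: orbit_cone_def character_in_cone_algebra)
  next
    fix v assume v: "v \<in> orbit_cone N \<sigma> (P \<inter> cone_algebra N \<sigma>)"
    then have wv: "w v = 0" using w(1) wP by (auto simp: orbit_cone_def)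
    then have v\<tau>: "v \<in> \<tau>" using v w(2) by (auto simp: orbit_cone_def)
    have "m v = 0" if m: "m \<in> exponents N \<tau>" "character m \<notin> P" for m
    proof -
      obtain k where k: "m + nat_multiple k w \<in> exponents N \<sigma>"
        using face_absorbs[OF \<sigma> w(1), of m] m(1) w(2) by (auto simp: exponents_def dual_cone_def)
      have "character (m + nat_multiple k w) \<notin> P"
        using character_prime_add[OF P m(1) exponents_nat_multiple[OF w\<tau>]]
          character_nat_multiple[OF P w\<tau> wP] m(2) by blast
      then have "(m + nat_multiple k w) v = 0" using v k by (auto simp: orbit_cone_def)
      then show ?thesis using wv by (simp add: plus_fun_def nat_multiple_def)
    qed
    then show "v \<in> orbit_cone N \<tau> P" using v\<tau> by (simp add: orbit_cone_def)
  qed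
qed

lemma orbit_cone_toric_equiv:
  assumes "((\<sigma>, P), (\<sigma>', P')) \<in> toric_equiv N \<Delta>"
  shows "orbit_cone N \<sigma> P = orbit_cone N \<sigma>' P'"
proof -
  have "case_prod (orbit_cone N) x = case_prod (orbit_cone N) y" if "(x, y) \<in> toric_equiv N \<Delta>" for x y
    using that unfolding toric_equiv_def
  proof (induction rule: rtrancl_induct)
    case (step y z)
    have glue: "case_prod (orbit_cone N) a = case_prod (orbit_cone N) b" if "(a, b) \<in> toric_glue N \<Delta>" for a b
      using that orbit_cone_contraction by (auto simp: toric_glue_def)
    from step.hyps(2) have "case_prod (orbit_cone N) y = case_prod (orbit_cone N) z"
      using glue[of y z] glue[of z y] by auto
    then show ?case using step.IH by simp
  qed simp
  from this[OF assms] show ?thesis by simp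
qed

lemma cone_algebra_absorbs:
  assumes \<sigma>: "\<sigma> \<in> \<Delta>" and u: "u \<in> exponents N \<sigma>" and \<tau>: "\<tau> = {v \<in> \<sigma>. u v = 0}" and f: "f \<in> cone_algebra N \<tau>"
  shows "\<exists>k. character (nat_multiple k u) * f \<in> cone_algebra N \<sigma>"
proof -
  have "\<forall>m\<in>Poly_Mapping.keys f. \<exists>k0. \<forall>k\<ge>k0. m + nat_multiple k u \<in> exponents N \<sigma>"
  proof
    fix m assume "m \<in> Poly_Mapping.keys f"
    then have "m \<in> exponents N \<tau>" using f by (auto simp: cone_ring_simps(1))
    then show "\<exists>k0. \<forall>k\<ge>k0. m + nat_multiple k u \<in> exponents N \<sigma>"
      using face_absorbs[OF \<sigma> u, of m] \<tau> by (auto simp: exponents_def dual_cone_def)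
  qed
  from bchoice[OF this] obtain K where
    K: "\<forall>m\<in>Poly_Mapping.keys f. \<forall>k\<ge>K m. m + nat_multiple k u \<in> exponents N \<sigma>" by blast
  define k where "k = (\<Sum>m\<in>Poly_Mapping.keys f. K m)"
  have Kk: "K m \<le> k" if "m \<in> Poly_Mapping.keys f" for m
    unfolding k_def by (rule member_le_sum[OF that]) auto
  have "Poly_Mapping.keys (character (nat_multiple k u) * f) \<subseteq> exponents N \<sigma>"
  proof
    fix e assume "e \<in> Poly_Mapping.keys (character (nat_multiple k u) * f)"
    then obtain m where "m \<in> Poly_Mapping.keys f" "e = nat_multiple k u + m"
      using keys_mult[of "character (nat_multiple k u)" f] by (auto simp: keys_character)
    then show "e \<in> exponents N \<sigma>" using K Kk by (simp add: add.commute)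
  qed
  then show ?thesis by (auto simp: cone_ring_simps(1))
qed

text \<open>The chart of \<open>\<tau>\<close> is the principal open subset on which
  \<open>character u\<close> is invertible. The ideal \<open>Q\<close> is the extension of
  \<open>P\<close> to this localization, described by clearing denominators.\<close>

lemma prime_localization:
  assumes \<sigma>: "\<sigma> \<in> \<Delta>" and P: "P \<in> spec (cone_ring N \<sigma>)" and u: "u \<in> exponents N \<sigma>" "character u \<notin> P"
    and \<tau>: "\<tau> = {v \<in> \<sigma>. u v = 0}"
  obtains Q where "Q \<in> spec (cone_ring N \<tau>)" "Q \<inter> cone_algebra N \<sigma> = P"
proof -
  define \<chi> where "\<chi> = (\<lambda>k. character (nat_multiple k u))"
  define Q where "Q = {f \<in> cone_algebra N \<tau>. \<exists>k. \<chi> k * f \<in> P}"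
  note PD = spec_cone_ringD[OF P]
  have sub: "\<tau> \<subseteq> \<sigma>" using \<tau> by blast
  have \<chi>P: "\<chi> k \<notin> P" for k unfolding \<chi>_def by (rule character_nat_multiple[OF P u])
  have \<chi>C: "\<chi> k \<in> cone_algebra N \<sigma>" for k
    unfolding \<chi>_def character_in_cone_algebra by (rule exponents_nat_multiple[OF u(1)])
  have \<chi>_add: "\<chi> (k + l) = \<chi> k * \<chi> l" for k l by (simp add: \<chi>_def nat_multiple_add character_add)
  have \<chi>0: "\<chi> 0 = 1" by (simp add: \<chi>_def nat_multiple_0 character_zero)
  have abs: "\<exists>k. \<chi> k * f \<in> cone_algebra N \<sigma>" if "f \<in> cone_algebra N \<tau>" for f
    unfolding \<chi>_def by (rule cone_algebra_absorbs[OF \<sigma> u(1) \<tau> that])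
  have "Q \<in> spec (cone_ring N \<tau>)"
  proof (rule spec_cone_ringI)
    show "Q \<subseteq> cone_algebra N \<tau>" by (auto simp: Q_def)
    show "0 \<in> Q" using PD(2) cone_algebra_closed(4) by (auto simp: Q_def)
    show "1 \<notin> Q" using \<chi>P by (simp add: Q_def)
  next
    fix f g assume "f \<in> Q" "g \<in> Q"
    then obtain k l where kl: "\<chi> k * f \<in> P" "\<chi> l * g \<in> P" "f \<in> cone_algebra N \<tau>" "g \<in> cone_algebra N \<tau>"
      by (auto simp: Q_def)
    have "\<chi> l * (\<chi> k * f) + \<chi> k * (\<chi> l * g) \<in> P" using kl PD(3,4) \<chi>C by blast
    also have "\<chi> l * (\<chi> k * f) + \<chi> k * (\<chi> l * g) = \<chi> (k + l) * (f + g)"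
      by (simp add: \<chi>_add algebra_simps)
    finally show "f + g \<in> Q" using kl cone_algebra_closed(2) by (auto simp: Q_def)
  next
    fix f g assume f: "f \<in> Q" and g: "g \<in> cone_algebra N \<tau>"
    obtain k where k: "\<chi> k * f \<in> P" "f \<in> cone_algebra N \<tau>" using f by (auto simp: Q_def)
    obtain l where l: "\<chi> l * g \<in> cone_algebra N \<sigma>" using abs[OF g] by blast
    have "(\<chi> l * g) * (\<chi> k * f) \<in> P" using k l PD(4) by blast
    also have "(\<chi> l * g) * (\<chi> k * f) = \<chi> (l + k) * (g * f)" by (simp add: \<chi>_add algebra_simps)
    finally show "g * f \<in> Q" using k g cone_algebra_closed(1) by (auto simp: Q_def)
  next
    fix f g assume f: "f \<in> cone_algebra N \<tau>" and g: "g \<in> cone_algebra N \<tau>" and fg: "f * g \<in> Q"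
    obtain k where k: "\<chi> k * (f * g) \<in> P" using fg by (auto simp: Q_def)
    obtain a b where ab: "\<chi> a * f \<in> cone_algebra N \<sigma>" "\<chi> b * g \<in> cone_algebra N \<sigma>" using abs f g by blast
    have "\<chi> (a + b) * (\<chi> k * (f * g)) \<in> P" using k PD(4) \<chi>C by blast
    also have "\<chi> (a + b) * (\<chi> k * (f * g)) = \<chi> k * ((\<chi> a * f) * (\<chi> b * g))" by (simp add: \<chi>_add algebra_simps)
    finally have "(\<chi> a * f) * (\<chi> b * g) \<in> P"
      using PD(6)[OF \<chi>C[of k] cone_algebra_closed(1)[OF ab]] \<chi>P by blast
    then have "\<chi> a * f \<in> P \<or> \<chi> b * g \<in> P" using PD(6)[OF ab] by blast
    then show "f \<in> Q \<or> g \<in> Q" using f g by (auto simp: Q_def)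
  qed
  moreover have "Q \<inter> cone_algebra N \<sigma> = P"
  proof (intro subset_antisym subsetI)
    fix f assume "f \<in> Q \<inter> cone_algebra N \<sigma>"
    then obtain k where k: "\<chi> k * f \<in> P" "f \<in> cone_algebra N \<sigma>" by (auto simp: Q_def)
    then show "f \<in> P" using PD(6)[OF \<chi>C k(2) k(1)] \<chi>P by blast
  next
    fix f assume f: "f \<in> P"
    then have "\<chi> 0 * f \<in> P" by (simp add: \<chi>0)
    then show "f \<in> Q \<inter> cone_algebra N \<sigma>"
      using f PD(1) cone_algebra_mono[OF sub, of N] unfolding Q_def by blast
  qed
  ultimately show ?thesis using that by blast
qed

text \<open>The orbit cone is constant on gluing classes and is a face of each cone whose chart
  contains the point. Conversely the point comes from the chart of its orbit cone by localization,
  and contraction takes it to the chart of any cone of which that is a face.\<close>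

lemma chart_map_in_chart_iff:
  assumes \<sigma>0: "\<sigma>0 \<in> \<Delta>" and P: "P \<in> spec (cone_ring N \<sigma>0)" and \<sigma>: "\<sigma> \<in> \<Delta>"
  shows "chart_map N \<Delta> \<sigma>0 P \<in> chart N \<Delta> \<sigma> \<longleftrightarrow> cone_face (orbit_cone N \<sigma>0 P) \<sigma>"
proof
  assume "chart_map N \<Delta> \<sigma>0 P \<in> chart N \<Delta> \<sigma>"
  then obtain P' where P': "P' \<in> spec (cone_ring N \<sigma>)" "chart_map N \<Delta> \<sigma>0 P = chart_map N \<Delta> \<sigma> P'"
    by (auto simp: chart_def)
  have "(\<sigma>, P') \<in> chart_map N \<Delta> \<sigma> P'" by (simp add: chart_map_def toric_equiv_def)
  then have "((\<sigma>0, P), (\<sigma>, P')) \<in> toric_equiv N \<Delta>" unfolding P'(2)[symmetric] by (simp add: chart_map_def)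
  then show "cone_face (orbit_cone N \<sigma>0 P) \<sigma>"
    using orbit_cone_toric_equiv orbit_cone_face[OF \<sigma> P'(1)] by simp
next
  let ?\<tau> = "orbit_cone N \<sigma>0 P"
  assume face: "cone_face ?\<tau> \<sigma>"
  obtain u where u: "u \<in> exponents N \<sigma>0" "character u \<notin> P" "?\<tau> = {v \<in> \<sigma>0. u v = 0}"
    by (rule orbit_cone_exponent[OF \<sigma>0 P])
  have face0: "cone_face ?\<tau> \<sigma>0" by (rule orbit_cone_face[OF \<sigma>0 P])
  obtain Q where Q: "Q \<in> spec (cone_ring N ?\<tau>)" "Q \<inter> cone_algebra N \<sigma>0 = P"
    by (rule prime_localization[OF \<sigma>0 P u])
  have \<tau>: "?\<tau> \<in> \<Delta>" by (rule fanD(3)[OF \<sigma>0 face0])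
  let ?P' = "Q \<inter> cone_algebra N \<sigma>"
  have g0: "((?\<tau>, Q), (\<sigma>0, P)) \<in> toric_glue N \<Delta>"
    using \<tau> \<sigma>0 face0 Q unfolding toric_glue_def by blast
  have g: "((?\<tau>, Q), (\<sigma>, ?P')) \<in> toric_glue N \<Delta>"
    using \<tau> \<sigma> face Q(1) unfolding toric_glue_def by blast
  have "((\<sigma>0, P), (\<sigma>, ?P')) \<in> toric_equiv N \<Delta>"
    unfolding toric_equiv_def using g0 g
    by (meson UnI1 UnI2 converseI r_into_rtrancl rtrancl_trans)
  then have "chart_map N \<Delta> \<sigma>0 P = chart_map N \<Delta> \<sigma> ?P'"
    unfolding chart_map_def by (rule equiv_class_eq[OF equiv_toric_equiv])
  then show "chart_map N \<Delta> \<sigma>0 P \<in> chart N \<Delta> \<sigma>"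
    using prime_contraction[OF Q(1) cone_face_subset[OF face]] by (auto simp: chart_def)
qed

lemma chart_map_in_toric_points:
  "\<sigma> \<in> \<Delta> \<Longrightarrow> P \<in> spec (cone_ring N \<sigma>) \<Longrightarrow> chart_map N \<Delta> \<sigma> P \<in> toric_points N \<Delta>"
  unfolding chart_map_def toric_points_def toric_charts_def by (intro quotientI) auto

lemma chart_subset: "\<sigma> \<in> \<Delta> \<Longrightarrow> chart N \<Delta> \<sigma> \<subseteq> toric_points N \<Delta>"
  using chart_map_in_toric_points by (auto simp: chart_def)

lemma toric_point_cone:
  assumes "x \<in> toric_points N \<Delta>"
  shows "\<exists>\<tau>\<in>\<Delta>. \<forall>\<sigma>\<in>\<Delta>. x \<in> chart N \<Delta> \<sigma> \<longleftrightarrow> cone_face \<tau> \<sigma>"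
proof -
  obtain \<sigma>0 P where x: "x = chart_map N \<Delta> \<sigma>0 P" and \<sigma>0: "\<sigma>0 \<in> \<Delta>" and P: "P \<in> spec (cone_ring N \<sigma>0)"
    using assms by (auto simp: toric_points_def toric_charts_def chart_map_def elim!: quotientE)
  have "orbit_cone N \<sigma>0 P \<in> \<Delta>" by (rule fanD(3)[OF \<sigma>0 orbit_cone_face[OF \<sigma>0 P]])
  then show ?thesis using chart_map_in_chart_iff[OF \<sigma>0 P] x by blast
qed

text \<open>Inside the chart of \<open>\<sigma>'\<close>, the chart of \<open>\<sigma>\<close> is
  the principal open set of \<open>character w\<close>, where \<open>w\<close> cuts out the common
  face.\<close>

lemma openin_chart:
  assumes \<sigma>: "\<sigma> \<in> \<Delta>"
  shows "openin (toric_variety N \<Delta>) (chart N \<Delta> \<sigma>)"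
  unfolding openin_toric_variety
proof (intro conjI ballI chart_subset[OF \<sigma>])
  fix \<sigma>' assume \<sigma>': "\<sigma>' \<in> \<Delta>"
  have face: "cone_face (\<sigma> \<inter> \<sigma>') \<sigma>'" by (rule fanD(5)[OF \<sigma> \<sigma>'])
  obtain w where w: "w \<in> exponents N \<sigma>'" "\<sigma> \<inter> \<sigma>' = {v \<in> \<sigma>'. w v = 0}" by (rule face_exponent[OF \<sigma>' face])
  have "chart_map N \<Delta> \<sigma>' P \<in> chart N \<Delta> \<sigma> \<longleftrightarrow> \<not> {character w} \<subseteq> P" if P: "P \<in> spec (cone_ring N \<sigma>')" for P
  proof -
    let ?F = "orbit_cone N \<sigma>' P"
    have F: "cone_face ?F \<sigma>'" by (rule orbit_cone_face[OF \<sigma>' P])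
    have "chart_map N \<Delta> \<sigma>' P \<in> chart N \<Delta> \<sigma> \<longleftrightarrow> ?F \<subseteq> \<sigma>"
      using chart_map_in_chart_iff[OF \<sigma>' P \<sigma>] subset_iff_face[OF fanD(3)[OF \<sigma>' F] \<sigma>] by simp
    also have "\<dots> \<longleftrightarrow> character w \<notin> P"
    proof
      assume "character w \<notin> P"
      then show "?F \<subseteq> \<sigma>" using w by (auto simp: orbit_cone_def)
    next
      assume sub: "?F \<subseteq> \<sigma>"
      obtain u where u: "u \<in> exponents N \<sigma>'" "character u \<notin> P" "?F = {v \<in> \<sigma>'. u v = 0}"
        by (rule orbit_cone_exponent[OF \<sigma>' P])
      \<comment> \<open>The form \<open>w\<close> vanishes on the orbit cone, which \<open>u\<close>
        cuts out. Hence \<open>character w\<close> divides the character of a multiple of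
        \<open>u\<close>, and the latter is not in \<open>P\<close>.\<close>
      have "(\<lambda>v. - w v) \<in> dual_lattice N"
        using w(1) by (auto simp: dual_lattice_def dual_space_def exponents_iff intro: linear_compose_neg)
      moreover have "\<forall>v\<in>{v \<in> \<sigma>'. u v = 0}. 0 \<le> - w v" using sub u(3) w(2) by fastforce
      ultimately obtain k where k: "(\<lambda>v. - w v) + nat_multiple k u \<in> exponents N \<sigma>'"
        using face_absorbs[OF \<sigma>' u(1)] by blast
      have "w + ((\<lambda>v. - w v) + nat_multiple k u) = nat_multiple k u" by (auto simp: plus_fun_def)
      then show "character w \<notin> P"
        using character_prime_add[OF P w(1) k] character_nat_multiple[OF P u(1,2)] by metis
    qed
    finally show ?thesis by simp
  qed
  then have "{P \<in> spec (cone_ring N \<sigma>'). chart_map N \<Delta> \<sigma>' P \<in> chart N \<Delta> \<sigma>}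
      = {P \<in> spec (cone_ring N \<sigma>'). \<not> {character w} \<subseteq> P}" by blast
  moreover have "{character w} \<subseteq> cone_algebra N \<sigma>'" using w(1) character_in_cone_algebra by blast
  ultimately show "openin (zariski (cone_ring N \<sigma>')) {P \<in> spec (cone_ring N \<sigma>'). chart_map N \<Delta> \<sigma>' P \<in> chart N \<Delta> \<sigma>}"
    unfolding openin_zariski by blast
qed

lemma topspace_toric_variety: "topspace (toric_variety N \<Delta>) = toric_points N \<Delta>"
proof (rule subset_antisym)
  show "topspace (toric_variety N \<Delta>) \<subseteq> toric_points N \<Delta>"
    using openin_topspace[of "toric_variety N \<Delta>"] openin_toric_variety by blast
  show "toric_points N \<Delta> \<subseteq> topspace (toric_variety N \<Delta>)"
  proof
    fix x assume x: "x \<in> toric_points N \<Delta>"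
    then obtain \<tau> where \<tau>: "\<tau> \<in> \<Delta>" "\<forall>\<sigma>\<in>\<Delta>. x \<in> chart N \<Delta> \<sigma> \<longleftrightarrow> cone_face \<tau> \<sigma>" using toric_point_cone by blast
    then have "x \<in> chart N \<Delta> \<tau>" using subset_iff_face[of \<tau> \<tau>] by blast
    then show "x \<in> topspace (toric_variety N \<Delta>)" using openin_chart[OF \<tau>(1)] openin_subset by blast
  qed
qed

end

section \<open>Sheaves\<close>

text \<open>The product module, with the record fields of \<open>finite_direct_sum\<close>; sections
  of the constant sheaf are an instance with a smaller carrier.\<close>

definition function_module :: "'i set \<Rightarrow> ('i \<Rightarrow> ('r, 's) module) \<Rightarrow> ('r, 'i \<Rightarrow> 's) module" where
  "function_module I M = \<lparr>carrier = (\<Pi>\<^sub>E i\<in>I. carrier (M i)),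
     monoid.mult = (\<lambda>s t. \<lambda>i\<in>I. s i \<otimes>\<^bsub>M i\<^esub> t i), one = (\<lambda>i\<in>I. \<one>\<^bsub>M i\<^esub>),
     zero = (\<lambda>i\<in>I. \<zero>\<^bsub>M i\<^esub>), add = (\<lambda>s t. \<lambda>i\<in>I. s i \<oplus>\<^bsub>M i\<^esub> t i),
     module.smult = (\<lambda>a s. \<lambda>i\<in>I. a \<odot>\<^bsub>M i\<^esub> s i)\<rparr>"

lemma module_function_module:
  assumes R: "cring R" and M: "\<And>i. i \<in> I \<Longrightarrow> module R (M i)"
  shows "module R (function_module I M)"
proof (rule moduleI[OF R])
  have ab: "abelian_group (M i)" if "i \<in> I" for i using M[OF that] by (simp add: module_def)
  note cl = abelian_monoid.a_closed[OF abelian_group.axioms(1)[OF ab]]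
    abelian_monoid.zero_closed[OF abelian_group.axioms(1)[OF ab]]
  show "abelian_group (function_module I M)"
  proof (rule abelian_groupI)
    fix x assume "x \<in> carrier (function_module I M)"
    then have x: "x i \<in> carrier (M i)" if "i \<in> I" for i using that by (auto simp: function_module_def)
    show "\<exists>y\<in>carrier (function_module I M). y \<oplus>\<^bsub>function_module I M\<^esub> x = \<zero>\<^bsub>function_module I M\<^esub>"
    proof (rule bexI[of _ "\<lambda>i\<in>I. \<ominus>\<^bsub>M i\<^esub> x i"])
      show "(\<lambda>i\<in>I. \<ominus>\<^bsub>M i\<^esub> x i) \<oplus>\<^bsub>function_module I M\<^esub> x = \<zero>\<^bsub>function_module I M\<^esub>"
        unfolding function_module_def using abelian_group.l_neg[OF ab x] by (auto intro: restrict_ext)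
      show "(\<lambda>i\<in>I. \<ominus>\<^bsub>M i\<^esub> x i) \<in> carrier (function_module I M)"
        unfolding function_module_def using abelian_group.a_inv_closed[OF ab x] by auto
    qed
  next
    fix x y z assume xyz: "x \<in> carrier (function_module I M)" "y \<in> carrier (function_module I M)"
      "z \<in> carrier (function_module I M)"
    then have c: "x i \<in> carrier (M i)" "y i \<in> carrier (M i)" "z i \<in> carrier (M i)" if "i \<in> I" for i
      using that by (auto simp: function_module_def)
    show "x \<oplus>\<^bsub>function_module I M\<^esub> y \<oplus>\<^bsub>function_module I M\<^esub> z
        = x \<oplus>\<^bsub>function_module I M\<^esub> (y \<oplus>\<^bsub>function_module I M\<^esub> z)"
      unfolding function_module_def
      using abelian_monoid.a_assoc[OF abelian_group.axioms(1)[OF ab] c(1) c(2) c(3)] by (auto intro: restrict_ext)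
  next
    fix x y assume xy: "x \<in> carrier (function_module I M)" "y \<in> carrier (function_module I M)"
    then have c: "x i \<in> carrier (M i)" "y i \<in> carrier (M i)" if "i \<in> I" for i
      using that by (auto simp: function_module_def)
    show "x \<oplus>\<^bsub>function_module I M\<^esub> y = y \<oplus>\<^bsub>function_module I M\<^esub> x"
      unfolding function_module_def
      using abelian_monoid.a_comm[OF abelian_group.axioms(1)[OF ab] c(1) c(2)] by (auto intro: restrict_ext)
    show "x \<oplus>\<^bsub>function_module I M\<^esub> y \<in> carrier (function_module I M)"
      unfolding function_module_def using cl(1)[OF _ c(1) c(2)] by auto
  next
    fix x assume x: "x \<in> carrier (function_module I M)"
    then have c: "x i \<in> carrier (M i)" if "i \<in> I" for i using that by (auto simp: function_module_def)
    have "(\<lambda>i\<in>I. \<zero>\<^bsub>M i\<^esub> \<oplus>\<^bsub>M i\<^esub> x i) = (\<lambda>i\<in>I. x i)"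
      using abelian_monoid.l_zero[OF abelian_group.axioms(1)[OF ab] c] by (intro restrict_ext) auto
    also have "\<dots> = x" using x by (auto simp: function_module_def PiE_restrict)
    finally show "\<zero>\<^bsub>function_module I M\<^esub> \<oplus>\<^bsub>function_module I M\<^esub> x = x"
      unfolding function_module_def by (simp cong: restrict_cong)
  qed (use cl(2) in \<open>auto simp: function_module_def\<close>)
next
  fix a b x y
  assume a: "a \<in> carrier R" and b: "b \<in> carrier R" and xm: "x \<in> carrier (function_module I M)"
    and ym: "y \<in> carrier (function_module I M)"
  then have x: "x i \<in> carrier (M i)" and y: "y i \<in> carrier (M i)" if "i \<in> I" for i
    using that by (auto simp: function_module_def)
  show "a \<odot>\<^bsub>function_module I M\<^esub> x \<in> carrier (function_module I M)"
    unfolding function_module_def using module.smult_closed[OF M a x] by auto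
  show "(a \<oplus>\<^bsub>R\<^esub> b) \<odot>\<^bsub>function_module I M\<^esub> x
      = a \<odot>\<^bsub>function_module I M\<^esub> x \<oplus>\<^bsub>function_module I M\<^esub> b \<odot>\<^bsub>function_module I M\<^esub> x"
    unfolding function_module_def using module.smult_l_distr[OF M a b x] by (auto intro: restrict_ext)
  show "a \<odot>\<^bsub>function_module I M\<^esub> (x \<oplus>\<^bsub>function_module I M\<^esub> y)
      = a \<odot>\<^bsub>function_module I M\<^esub> x \<oplus>\<^bsub>function_module I M\<^esub> a \<odot>\<^bsub>function_module I M\<^esub> y"
    unfolding function_module_def using module.smult_r_distr[OF M a x y] by (auto intro: restrict_ext)
  show "(a \<otimes>\<^bsub>R\<^esub> b) \<odot>\<^bsub>function_module I M\<^esub> x = a \<odot>\<^bsub>function_module I M\<^esub> (b \<odot>\<^bsub>function_module I M\<^esub> x)"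
    unfolding function_module_def using module.smult_assoc1[OF M a b x] by (auto intro: restrict_ext)
next
  fix x assume xm: "x \<in> carrier (function_module I M)"
  then have x: "x i \<in> carrier (M i)" if "i \<in> I" for i using that by (auto simp: function_module_def)
  have "(\<lambda>i\<in>I. \<one>\<^bsub>R\<^esub> \<odot>\<^bsub>M i\<^esub> x i) = (\<lambda>i\<in>I. x i)"
    using module.smult_one[OF M x] by (intro restrict_ext) auto
  also have "\<dots> = x" using xm by (auto simp: function_module_def PiE_restrict)
  finally show "\<one>\<^bsub>R\<^esub> \<odot>\<^bsub>function_module I M\<^esub> x = x" unfolding function_module_def by simp
qed

lemma module_restrict_carrier:
  assumes M: "module R M" and sub: "A \<subseteq> carrier M" and zero: "\<zero>\<^bsub>M\<^esub> \<in> A"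
    and add: "\<And>x y. x \<in> A \<Longrightarrow> y \<in> A \<Longrightarrow> x \<oplus>\<^bsub>M\<^esub> y \<in> A"
    and smult: "\<And>a x. a \<in> carrier R \<Longrightarrow> x \<in> A \<Longrightarrow> a \<odot>\<^bsub>M\<^esub> x \<in> A"
  shows "module R (M\<lparr>carrier := A\<rparr>)"
proof -
  interpret module R M by (rule M)
  have "\<ominus>\<^bsub>M\<^esub> x \<in> A" if x: "x \<in> A" for x
  proof -
    have xM: "x \<in> carrier M" using x sub by blast
    have mx: "(\<ominus>\<^bsub>R\<^esub> \<one>\<^bsub>R\<^esub>) \<odot>\<^bsub>M\<^esub> x \<in> carrier M" using xM by (intro smult_closed) auto
    have "(\<ominus>\<^bsub>R\<^esub> \<one>\<^bsub>R\<^esub>) \<odot>\<^bsub>M\<^esub> x \<oplus>\<^bsub>M\<^esub> x = (\<ominus>\<^bsub>R\<^esub> \<one>\<^bsub>R\<^esub>) \<odot>\<^bsub>M\<^esub> x \<oplus>\<^bsub>M\<^esub> \<one>\<^bsub>R\<^esub> \<odot>\<^bsub>M\<^esub> x"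
      using xM by simp
    also have "\<dots> = (\<ominus>\<^bsub>R\<^esub> \<one>\<^bsub>R\<^esub> \<oplus>\<^bsub>R\<^esub> \<one>\<^bsub>R\<^esub>) \<odot>\<^bsub>M\<^esub> x"
      using xM by (intro smult_l_distr[symmetric]) auto
    also have "\<dots> = \<zero>\<^bsub>M\<^esub>" using xM by (simp add: R.l_neg)
    finally have "\<ominus>\<^bsub>M\<^esub> x = (\<ominus>\<^bsub>R\<^esub> \<one>\<^bsub>R\<^esub>) \<odot>\<^bsub>M\<^esub> x" using xM mx by (intro M.minus_equality)
    then show ?thesis using smult[OF _ x] by simp
  qed
  then have "submodule A R M" using assms by (intro submoduleI) auto
  then show ?thesis by (rule submodule.submodule_is_module[OF _ M])
qed

text \<open>Applied to evaluation at a point, which turns sums and integral multiples of sections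
  into those of \<open>R\<close>.\<close>

lemma hom_finsum_int_mult:
  assumes M: "abelian_group M" and G: "abelian_group G" and h: "\<And>x. x \<in> carrier M \<Longrightarrow> h x \<in> carrier G"
    and add: "\<And>x y. x \<in> carrier M \<Longrightarrow> y \<in> carrier M \<Longrightarrow> h (x \<oplus>\<^bsub>M\<^esub> y) = h x \<oplus>\<^bsub>G\<^esub> h y"
  shows "x \<in> carrier M \<Longrightarrow> h ([(n::int)] \<cdot>\<^bsub>M\<^esub> x) = [n] \<cdot>\<^bsub>G\<^esub> h x"
    and "finite I \<Longrightarrow> f \<in> I \<rightarrow> carrier M \<Longrightarrow> h (\<Oplus>\<^bsub>M\<^esub>i\<in>I. f i) = (\<Oplus>\<^bsub>G\<^esub>i\<in>I. h (f i))"
proof -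
  interpret M: abelian_group M by (rule M)
  interpret G: abelian_group G by (rule G)
  have hom: "h \<in> hom (add_monoid M) (add_monoid G)" using h add by (auto simp: hom_def)
  show "h ([(n::int)] \<cdot>\<^bsub>M\<^esub> x) = [n] \<cdot>\<^bsub>G\<^esub> h x" if "x \<in> carrier M" for x
    using hom_int_pow[OF hom _ M.a_group G.a_group, of x n] that by (simp add: add_pow_def)
  interpret group_hom "add_monoid M" "add_monoid G" h
    using hom M.a_group G.a_group by (simp add: group_hom_def group_hom_axioms_def)
  show "h (\<Oplus>\<^bsub>M\<^esub>i\<in>I. f i) = (\<Oplus>\<^bsub>G\<^esub>i\<in>I. h (f i))" if "finite I" "f \<in> I \<rightarrow> carrier M" for I f
    using that
  proof (induction I rule: finite_induct)
    case empty
    then show ?case using hom_one by simp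
  next
    case (insert i I)
    then have "f i \<in> carrier M" "f \<in> I \<rightarrow> carrier M" by auto
    then show ?case using insert h by (simp add: add M.finsum_insert G.finsum_insert Pi_def)
  qed
qed

lemma continuous_map_discrete_iff:
  assumes "openin X U"
  shows "continuous_map (subtopology X U) (discrete_topology A) s \<longleftrightarrow>
    s \<in> U \<rightarrow> A \<and> (\<forall>x\<in>U. \<exists>V. openin X V \<and> x \<in> V \<and> V \<subseteq> U \<and> (\<forall>y\<in>V. s y = s x))"
proof -
  have top: "topspace (subtopology X U) = U" using openin_subset[OF assms] by auto
  have op: "openin (subtopology X U) W \<longleftrightarrow> openin X W \<and> W \<subseteq> U" for W
    by (rule openin_open_subtopology[OF assms])
  show ?thesis
  proof
    assume c: "continuous_map (subtopology X U) (discrete_topology A) s"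
    then have sA: "s \<in> U \<rightarrow> A" unfolding continuous_map_def top by simp
    have "\<exists>V. openin X V \<and> x \<in> V \<and> V \<subseteq> U \<and> (\<forall>y\<in>V. s y = s x)" if x: "x \<in> U" for x
    proof (intro exI conjI)
      have "openin (discrete_topology A) {s x}" using sA x by (auto simp: openin_discrete_topology)
      then have "openin (subtopology X U) {y \<in> U. s y \<in> {s x}}"
        using c unfolding continuous_map_def top by blast
      then show "openin X {y \<in> U. s y \<in> {s x}}" by (simp add: op)
    qed (use x in auto)
    then show "s \<in> U \<rightarrow> A \<and> (\<forall>x\<in>U. \<exists>V. openin X V \<and> x \<in> V \<and> V \<subseteq> U \<and> (\<forall>y\<in>V. s y = s x))" using sA by blast
  next
    assume r: "s \<in> U \<rightarrow> A \<and> (\<forall>x\<in>U. \<exists>V. openin X V \<and> x \<in> V \<and> V \<subseteq> U \<and> (\<forall>y\<in>V. s y = s x))"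
    have "openin X {x \<in> U. s x \<in> W}" for W
    proof (subst openin_subopen, intro ballI)
      fix x assume x: "x \<in> {x \<in> U. s x \<in> W}"
      then have xU: "x \<in> U" by simp
      from bspec[OF conjunct2[OF r] xU] obtain V where
        V: "openin X V" "x \<in> V" "V \<subseteq> U" "\<forall>y\<in>V. s y = s x" by (elim exE conjE)
      have "V \<subseteq> {x \<in> U. s x \<in> W}"
      proof
        fix y assume y: "y \<in> V"
        then have "s y = s x" using V(4) by blast
        then show "y \<in> {x \<in> U. s x \<in> W}" using x y V(3) by auto
      qed
      then show "\<exists>T. openin X T \<and> x \<in> T \<and> T \<subseteq> {x \<in> U. s x \<in> W}" using V(1,2) by blast
    qed
    then show "continuous_map (subtopology X U) (discrete_topology A) s"
      using r unfolding continuous_map_def top by (auto simp: op)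
  qed
qed

section \<open>The constant sheaf and its extensions by zero\<close>

locale constant_coefficients = cring R for R :: "'r ring" (structure) +
  fixes X :: "'p topology"
begin

abbreviation "K \<equiv> constant_sheaf X R"

definition locally_constant :: "'p set \<Rightarrow> ('p \<Rightarrow> 'r) \<Rightarrow> bool" where
  "locally_constant U s \<longleftrightarrow> s \<in> (U \<rightarrow>\<^sub>E carrier R) \<and>
     (\<forall>x\<in>U. \<exists>V. openin X V \<and> x \<in> V \<and> V \<subseteq> U \<and> (\<forall>y\<in>V. s y = s x))"

lemma locally_constantI:
  "s \<in> (U \<rightarrow>\<^sub>E carrier R) \<Longrightarrow> (\<And>x. x \<in> U \<Longrightarrow> \<exists>V. openin X V \<and> x \<in> V \<and> V \<subseteq> U \<and> (\<forall>y\<in>V. s y = s x)) \<Longrightarrow>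
    locally_constant U s"
  by (simp add: locally_constant_def)

lemma locally_constant_closed: "locally_constant U s \<Longrightarrow> x \<in> U \<Longrightarrow> s x \<in> carrier R"
  by (auto simp: locally_constant_def)

lemma locally_constant_nbhd:
  "locally_constant U s \<Longrightarrow> x \<in> U \<Longrightarrow> \<exists>V. openin X V \<and> x \<in> V \<and> V \<subseteq> U \<and> (\<forall>y\<in>V. s y = s x)"
  by (simp add: locally_constant_def)

lemma locally_constant_ext:
  "locally_constant U s \<Longrightarrow> locally_constant U t \<Longrightarrow> (\<And>x. x \<in> U \<Longrightarrow> s x = t x) \<Longrightarrow> s = t"
  unfolding locally_constant_def by (blast intro: PiE_ext)

lemma K_simps:
  "base K = X" "res K U V s = restrict s V" "\<zero>\<^bsub>sect K U\<^esub> = (\<lambda>x\<in>U. \<zero>)"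
  "s \<oplus>\<^bsub>sect K U\<^esub> t = (\<lambda>x\<in>U. s x \<oplus> t x)" "a \<odot>\<^bsub>sect K U\<^esub> s = (\<lambda>x\<in>U. a \<otimes> s x)"
  by (simp_all add: constant_sheaf_def)

lemma carrier_K: "openin X U \<Longrightarrow> carrier (sect K U) = {s. locally_constant U s}"
  by (auto simp: constant_sheaf_def continuous_map_discrete_iff locally_constant_def PiE_iff)

lemma locally_constant_restrict:
  assumes V: "openin X V" "V \<subseteq> U" and s: "locally_constant U s"
  shows "locally_constant V (restrict s V)"
proof (rule locally_constantI)
  show "restrict s V \<in> V \<rightarrow>\<^sub>E carrier R" using locally_constant_closed[OF s] V by auto
  fix x assume x: "x \<in> V"
  then have "x \<in> U" using V by blast
  from locally_constant_nbhd[OF s this] obtain W where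
    W: "openin X W" "x \<in> W" "W \<subseteq> U" "\<forall>y\<in>W. s y = s x" by (elim exE conjE)
  show "\<exists>W. openin X W \<and> x \<in> W \<and> W \<subseteq> V \<and> (\<forall>y\<in>W. restrict s V y = restrict s V x)"
  proof (intro exI conjI ballI)
    show "openin X (V \<inter> W)" using V(1) W(1) by blast
    show "restrict s V y = restrict s V x" if "y \<in> V \<inter> W" for y
      using bspec[OF W(4), of y] that x by simp
  qed (use x W(2) in auto)
qed

lemma locally_constant_const: "openin X U \<Longrightarrow> c \<in> carrier R \<Longrightarrow> locally_constant U (\<lambda>x\<in>U. c)"
  by (intro locally_constantI) auto

lemma locally_constant_op:
  assumes s: "locally_constant U s" and t: "locally_constant U t"
    and f: "\<And>a b. a \<in> carrier R \<Longrightarrow> b \<in> carrier R \<Longrightarrow> f a b \<in> carrier R"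
  shows "locally_constant U (\<lambda>x\<in>U. f (s x) (t x))"
proof (rule locally_constantI)
  show "(\<lambda>x\<in>U. f (s x) (t x)) \<in> U \<rightarrow>\<^sub>E carrier R"
    using locally_constant_closed[OF s] locally_constant_closed[OF t] f by auto
  fix x assume x: "x \<in> U"
  from locally_constant_nbhd[OF s x] obtain V where
    V: "openin X V" "x \<in> V" "V \<subseteq> U" "\<forall>y\<in>V. s y = s x" by (elim exE conjE)
  from locally_constant_nbhd[OF t x] obtain W where
    W: "openin X W" "x \<in> W" "W \<subseteq> U" "\<forall>y\<in>W. t y = t x" by (elim exE conjE)
  show "\<exists>V. openin X V \<and> x \<in> V \<and> V \<subseteq> U \<and> (\<forall>y\<in>V. (\<lambda>x\<in>U. f (s x) (t x)) y = (\<lambda>x\<in>U. f (s x) (t x)) x)"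
  proof (intro exI conjI ballI)
    show "openin X (V \<inter> W)" using V(1) W(1) by blast
    show "(\<lambda>x\<in>U. f (s x) (t x)) y = (\<lambda>x\<in>U. f (s x) (t x)) x" if y: "y \<in> V \<inter> W" for y
    proof -
      have "y \<in> U" "s y = s x" "t y = t x" using y V(3) bspec[OF V(4), of y] bspec[OF W(4), of y] by blast+
      then show ?thesis using x by simp
    qed
  qed (use V(2,3) W(2) in auto)
qed

lemma module_K:
  assumes U: "openin X U"
  shows "module R (sect K U)"
proof -
  let ?reg = "\<lparr>carrier = carrier R, monoid.mult = (\<otimes>), one = \<one>, zero = \<zero>, add = (\<oplus>), module.smult = (\<otimes>)\<rparr>"
  have "abelian_group ?reg"
    by (rule abelian_groupI) (auto simp: a_ac intro: bexI[of _ "\<ominus> _"] l_neg)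
  then have reg: "module R ?reg"
    by (intro moduleI is_cring) (auto simp: l_distr r_distr m_assoc)
  let ?M = "function_module U (\<lambda>_. ?reg)"
  have eq: "sect K U = ?M\<lparr>carrier := carrier (sect K U)\<rparr>"
    by (simp add: constant_sheaf_def function_module_def)
  show ?thesis
  proof (subst eq, rule module_restrict_carrier)
    show "module R ?M" using reg is_cring by (intro module_function_module)
    show "carrier (sect K U) \<subseteq> carrier ?M"
      unfolding carrier_K[OF U] by (auto simp: function_module_def locally_constant_def)
    show "\<zero>\<^bsub>?M\<^esub> \<in> carrier (sect K U)"
      unfolding carrier_K[OF U] using locally_constant_const[OF U zero_closed] by (simp add: function_module_def)
    show "x \<oplus>\<^bsub>?M\<^esub> y \<in> carrier (sect K U)" if "x \<in> carrier (sect K U)" "y \<in> carrier (sect K U)" for x y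
      using that locally_constant_op[of U x y "(\<oplus>)"] unfolding carrier_K[OF U] by (simp add: function_module_def)
    show "a \<odot>\<^bsub>?M\<^esub> x \<in> carrier (sect K U)" if "a \<in> carrier R" "x \<in> carrier (sect K U)" for a x
      using that locally_constant_op[of U x x "\<lambda>c _. a \<otimes> c"] unfolding carrier_K[OF U] by (simp add: function_module_def)
  qed
qed

lemma locally_constant_glue:
  assumes W: "\<And>i. i \<in> I \<Longrightarrow> openin X (W i)" and s: "\<And>i. i \<in> I \<Longrightarrow> locally_constant (W i) (s i)"
    and agree: "\<And>i j x. i \<in> I \<Longrightarrow> j \<in> I \<Longrightarrow> x \<in> W i \<Longrightarrow> x \<in> W j \<Longrightarrow> s i x = s j x"
  shows "\<exists>t. locally_constant (\<Union>i\<in>I. W i) t \<and> (\<forall>i\<in>I. restrict t (W i) = s i)"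
proof -
  define t where "t = (\<lambda>x\<in>(\<Union>i\<in>I. W i). s (SOME i. i \<in> I \<and> x \<in> W i) x)"
  have t: "t x = s i x" if i: "i \<in> I" "x \<in> W i" for i x
  proof -
    let ?k = "SOME i. i \<in> I \<and> x \<in> W i"
    have k: "?k \<in> I \<and> x \<in> W ?k" by (rule someI[of _ i]) (use i in simp)
    have "t x = s ?k x" unfolding t_def by (rule restrict_apply') (use i in blast)
    also have "\<dots> = s i x" using k i by (intro agree) simp_all
    finally show ?thesis .
  qed
  have "locally_constant (\<Union>i\<in>I. W i) t"
  proof (rule locally_constantI)
    have "t \<in> extensional (\<Union>i\<in>I. W i)" by (simp add: t_def)
    moreover have "t x \<in> carrier R" if x: "x \<in> (\<Union>i\<in>I. W i)" for x
    proof -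
      obtain i where "i \<in> I" "x \<in> W i" using x by blast
      then show ?thesis using t locally_constant_closed[OF s] by simp
    qed
    ultimately show "t \<in> (\<Union>i\<in>I. W i) \<rightarrow>\<^sub>E carrier R" by (auto simp: PiE_iff)
    fix x assume "x \<in> (\<Union>i\<in>I. W i)"
    then obtain i where i: "i \<in> I" "x \<in> W i" by blast
    from locally_constant_nbhd[OF s[OF i(1)] i(2)] obtain V where
      V: "openin X V" "x \<in> V" "V \<subseteq> W i" "\<forall>y\<in>V. s i y = s i x" by (elim exE conjE)
    have "\<forall>y\<in>V. t y = t x"
    proof
      fix y assume y: "y \<in> V"
      then have "t y = s i y" using t i(1) V(3) by blast
      also have "\<dots> = s i x" using V(4) y by blast
      finally show "t y = t x" using t[OF i] by simp
    qed
    then show "\<exists>V. openin X V \<and> x \<in> V \<and> V \<subseteq> (\<Union>i\<in>I. W i) \<and> (\<forall>y\<in>V. t y = t x)" using V i by blast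
  qed
  moreover have "restrict t (W i) = s i" if i: "i \<in> I" for i
  proof -
    have "restrict t (W i) = restrict (s i) (W i)" using t[OF i] by (intro restrict_ext) auto
    also have "\<dots> = s i" using s[OF i] by (auto simp: locally_constant_def PiE_restrict)
    finally show ?thesis .
  qed
  ultimately show ?thesis by blast
qed

lemma restrict_eqD: "restrict s A = restrict t A \<Longrightarrow> x \<in> A \<Longrightarrow> s x = t x"
  by (metis restrict_apply')

lemma glue_unique:
  assumes t: "locally_constant (\<Union>i\<in>I. W i) t" and t': "locally_constant (\<Union>i\<in>I. W i) t'"
    and eq: "\<And>i. i \<in> I \<Longrightarrow> restrict t (W i) = restrict t' (W i)"
  shows "t = t'"
proof (rule locally_constant_ext[OF t t'])
  fix x assume "x \<in> (\<Union>i\<in>I. W i)"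
  then obtain i where "i \<in> I" "x \<in> W i" by blast
  then show "t x = t' x" using restrict_eqD[OF eq] by blast
qed

lemma sheaf_K: "sheaf R K"
  unfolding sheaf_def K_simps
proof (intro conjI allI impI ballI, goal_cases)
  case (1 U)
  then show ?case by (rule module_K)
next
  case (2 U V)
  then have U: "openin X U" and V: "openin X V" "V \<subseteq> U" by auto
  show ?case
    unfolding linear_maps_def carrier_K[OF U] carrier_K[OF V(1)] K_simps
    using locally_constant_restrict[OF V] V(2) by (auto simp: restrict_def fun_eq_iff)
next
  case (3 U s)
  then show ?case by (auto simp: carrier_K locally_constant_def PiE_restrict)
next
  case (4 U V W s)
  then show ?case by (auto simp: restrict_def fun_eq_iff)
next
  case (5 \<U> s)
  then have U: "\<And>U. U \<in> \<U> \<Longrightarrow> openin X U" by blast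
  have s: "locally_constant U (s U)" if "U \<in> \<U>" for U
    using 5 that carrier_K[OF U[OF that]] by blast
  have agree: "s U x = s V x" if "U \<in> \<U>" "V \<in> \<U>" "x \<in> U" "x \<in> V" for U V x
  proof -
    have "restrict (s U) (U \<inter> V) = restrict (s V) (U \<inter> V)" using 5 that(1,2) by blast
    then show ?thesis by (rule restrict_eqD) (use that in blast)
  qed
  have op: "openin X (\<Union>\<U>)" using U by blast
  obtain t where t: "locally_constant (\<Union>\<U>) t" "\<forall>U\<in>\<U>. restrict t U = s U"
    using locally_constant_glue[of \<U> "\<lambda>U. U" s, OF U s agree] by auto
  show ?case
    unfolding carrier_K[OF op]
  proof (rule ex1I[of _ t])
    fix t' assume "t' \<in> {t. locally_constant (\<Union>\<U>) t} \<and> (\<forall>U\<in>\<U>. restrict t' U = s U)"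
    then show "t' = t" using glue_unique[where I = \<U> and W = "\<lambda>U. U", of t' t] t by simp
  qed (use t in simp)
qed

definition zero_extension :: "'p set \<Rightarrow> 'p set \<Rightarrow> ('p \<Rightarrow> 'r) \<Rightarrow> 'p \<Rightarrow> 'r" where
  "zero_extension W W' s = (\<lambda>x\<in>W'. if x \<in> W then s x else \<zero>)"

lemma locally_constant_zero_extension:
  assumes W: "openin X W" "W \<subseteq> W'" and s: "locally_constant W s"
    and supp: "openin X (W' - {x \<in> W. s x \<noteq> \<zero>})"
  shows "locally_constant W' (zero_extension W W' s)"
proof (rule locally_constantI)
  show "zero_extension W W' s \<in> W' \<rightarrow>\<^sub>E carrier R"
    using locally_constant_closed[OF s] by (auto simp: zero_extension_def)
  fix x assume x: "x \<in> W'"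
  show "\<exists>V. openin X V \<and> x \<in> V \<and> V \<subseteq> W' \<and> (\<forall>y\<in>V. zero_extension W W' s y = zero_extension W W' s x)"
  proof (cases "x \<in> W")
    case True
    from locally_constant_nbhd[OF s this] obtain V where
      V: "openin X V" "x \<in> V" "V \<subseteq> W" "\<forall>y\<in>V. s y = s x" by (elim exE conjE)
    have "zero_extension W W' s y = zero_extension W W' s x" if y: "y \<in> V" for y
    proof -
      have "y \<in> W" "y \<in> W'" "s y = s x" using y V(3) W(2) bspec[OF V(4) y] by blast+
      then show ?thesis using True x by (simp add: zero_extension_def)
    qed
    then show ?thesis using V W(2) by blast
  next
    case False
    have "zero_extension W W' s y = \<zero>" if "y \<in> W' - {x \<in> W. s x \<noteq> \<zero>}" for y
      using that by (auto simp: zero_extension_def)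
    then show ?thesis using supp x False by (intro exI[of _ "W' - {x \<in> W. s x \<noteq> \<zero>}"]) auto
  qed
qed

text \<open>Near a zero a locally constant section vanishes identically. The sheaf \<open>F\<close>
  is kept general to cover both \<open>K\<close> and its restriction to an open set.\<close>

lemma support_eq:
  assumes W: "openin X W" and s: "locally_constant W s"
    and F: "\<And>V. V \<subseteq> W \<Longrightarrow> openin (base F) V \<longleftrightarrow> openin X V" "\<And>V. res F W V s = restrict s V"
      "\<And>V. \<zero>\<^bsub>sect F V\<^esub> = (\<lambda>x\<in>V. \<zero>)"
  shows "section_support F W s = {x \<in> W. s x \<noteq> \<zero>}"
proof -
  have "(\<forall>V. openin (base F) V \<and> x \<in> V \<and> V \<subseteq> W \<longrightarrow> restrict s V \<noteq> (\<lambda>x\<in>V. \<zero>)) \<longleftrightarrow> s x \<noteq> \<zero>" if x: "x \<in> W" for x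
  proof
    assume a: "\<forall>V. openin (base F) V \<and> x \<in> V \<and> V \<subseteq> W \<longrightarrow> restrict s V \<noteq> (\<lambda>x\<in>V. \<zero>)"
    from locally_constant_nbhd[OF s x] obtain V where
      V: "openin X V" "x \<in> V" "V \<subseteq> W" "\<forall>y\<in>V. s y = s x" by (elim exE conjE)
    show "s x \<noteq> \<zero>"
    proof
      assume "s x = \<zero>"
      then have "restrict s V = (\<lambda>x\<in>V. \<zero>)" using bspec[OF V(4)] by (intro restrict_ext) metis
      then show False using a V(1-3) F(1)[OF V(3)] by blast
    qed
  next
    assume nz: "s x \<noteq> \<zero>"
    show "\<forall>V. openin (base F) V \<and> x \<in> V \<and> V \<subseteq> W \<longrightarrow> restrict s V \<noteq> (\<lambda>x\<in>V. \<zero>)"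
    proof (intro allI impI notI)
      fix V assume V: "openin (base F) V \<and> x \<in> V \<and> V \<subseteq> W" and eq: "restrict s V = (\<lambda>x\<in>V. \<zero>)"
      have "x \<in> V" using V by blast
      then have "s x = \<zero>" using fun_cong[OF eq, of x] by simp
      then show False using nz by blast
    qed
  qed
  then show ?thesis unfolding section_support_def F by blast
qed

text \<open>The definite description is resolved here: \<open>W\<close> and the complement of the
  support cover \<open>W'\<close>, so the extension is determined pointwise, and openness of that
  complement makes it locally constant.\<close>

lemma extend_section_eq:
  assumes W: "openin X W" "openin X W'" "W \<subseteq> W'" and s: "locally_constant W s"
    and supp: "openin X (W' - {x \<in> W. s x \<noteq> \<zero>})"
  shows "extend_section K W W' s = zero_extension W W' s"
proof -
  let ?S = "{x \<in> W. s x \<noteq> \<zero>}"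
  let ?z = "zero_extension W W' s"
  have S: "section_support K W s = ?S" by (rule support_eq[OF W(1) s]) (simp_all add: K_simps)
  show ?thesis
    unfolding extend_section_def S Let_def K_simps carrier_K[OF W(2)]
  proof (rule the_equality)
    have "restrict ?z W = restrict s W" using W(3) by (intro restrict_ext) (auto simp: zero_extension_def)
    moreover have "restrict s W = s" using s by (auto simp: locally_constant_def PiE_restrict)
    moreover have "restrict ?z (W' - ?S) = (\<lambda>x\<in>W' - ?S. \<zero>)" by (intro restrict_ext) (auto simp: zero_extension_def)
    ultimately show "?z \<in> {s. locally_constant W' s} \<and> restrict ?z W = s \<and> restrict ?z (W' - ?S) = (\<lambda>x\<in>W' - ?S. \<zero>)"
      using locally_constant_zero_extension[OF W(1,3) s supp] by simp
  next
    fix t assume t: "t \<in> {s. locally_constant W' s} \<and> restrict t W = s \<and> restrict t (W' - ?S) = (\<lambda>x\<in>W' - ?S. \<zero>)"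
    show "t = ?z"
    proof (rule locally_constant_ext)
      show "locally_constant W' t" using t by simp
      show "locally_constant W' ?z" by (rule locally_constant_zero_extension[OF W(1,3) s supp])
      fix x assume x: "x \<in> W'"
      have tW: "restrict t W = s" and t0: "restrict t (W' - ?S) = (\<lambda>x\<in>W' - ?S. \<zero>)" using t by auto
      show "t x = ?z x"
      proof (cases "x \<in> W")
        case True
        then show ?thesis using fun_cong[OF tW, of x] x by (simp add: zero_extension_def)
      next
        case False
        then show ?thesis using fun_cong[OF t0, of x] x by (simp add: zero_extension_def)
      qed
    qed
  qed
qed

abbreviation summand :: "'p set \<Rightarrow> ('p, 'r, 'p \<Rightarrow> 'r) module_sheaf" where
  "summand P \<equiv> extension_by_zero X (open_restriction K P)"

definition supported_section :: "'p set \<Rightarrow> 'p set \<Rightarrow> ('p \<Rightarrow> 'r) \<Rightarrow> bool" where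
  "supported_section P V s \<longleftrightarrow> locally_constant (P \<inter> V) s \<and> openin X (V - {x \<in> P \<inter> V. s x \<noteq> \<zero>})"

context
  fixes P :: "'p set"
  assumes P: "openin X P"
begin

lemma summand_simps:
  "base (summand P) = X" "res (summand P) V W s = restrict s (P \<inter> W)"
  "\<zero>\<^bsub>sect (summand P) V\<^esub> = (\<lambda>x\<in>P \<inter> V. \<zero>)"
  "s \<oplus>\<^bsub>sect (summand P) V\<^esub> t = (\<lambda>x\<in>P \<inter> V. s x \<oplus> t x)" "a \<odot>\<^bsub>sect (summand P) V\<^esub> s = (\<lambda>x\<in>P \<inter> V. a \<otimes> s x)"
proof -
  have "topspace (subtopology X P) = P" using openin_subset[OF P] by auto
  then show "base (summand P) = X" "res (summand P) V W s = restrict s (P \<inter> W)"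
    "\<zero>\<^bsub>sect (summand P) V\<^esub> = (\<lambda>x\<in>P \<inter> V. \<zero>)"
    "s \<oplus>\<^bsub>sect (summand P) V\<^esub> t = (\<lambda>x\<in>P \<inter> V. s x \<oplus> t x)" "a \<odot>\<^bsub>sect (summand P) V\<^esub> s = (\<lambda>x\<in>P \<inter> V. a \<otimes> s x)"
    by (simp_all add: extension_by_zero_def open_restriction_def Let_def K_simps)
qed

lemma sect_summand:
  assumes V: "openin X V"
  shows "sect (summand P) V = (sect K (P \<inter> V))\<lparr>carrier := {s. supported_section P V s}\<rparr>"
proof -
  have top: "topspace X \<inter> P = P" using openin_subset[OF P] by auto
  have PV: "openin X (P \<inter> V)" using P V by blast
  have Vt: "V \<subseteq> topspace X" using V by (rule openin_subset)
  have "s \<in> carrier (sect K (P \<inter> V)) \<and>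
      closedin (subtopology X V) (section_support (open_restriction K P) (P \<inter> V) s) \<longleftrightarrow> supported_section P V s" for s
  proof -
    have "closedin (subtopology X V) {x \<in> P \<inter> V. s x \<noteq> \<zero>} \<longleftrightarrow> openin X (V - {x \<in> P \<inter> V. s x \<noteq> \<zero>})"
    proof -
      have "topspace (subtopology X V) = V" using Vt by auto
      then show ?thesis unfolding closedin_def openin_open_subtopology[OF V] by auto
    qed
    moreover have "section_support (open_restriction K P) (P \<inter> V) s = {x \<in> P \<inter> V. s x \<noteq> \<zero>}"
      if "locally_constant (P \<inter> V) s"
      by (rule support_eq[OF PV that])
        (auto simp: open_restriction_def K_simps openin_open_subtopology[OF P])
    ultimately show ?thesis unfolding carrier_K[OF PV] supported_section_def by auto
  qed
  then show ?thesis
    unfolding extension_by_zero_def Let_def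
    by (simp add: open_restriction_def K_simps top)
qed

lemma carrier_summand: "openin X V \<Longrightarrow> carrier (sect (summand P) V) = {s. supported_section P V s}"
  by (simp add: sect_summand)

lemma supported_section_zero: "openin X V \<Longrightarrow> supported_section P V (\<lambda>x\<in>P \<inter> V. \<zero>)"
proof -
  assume V: "openin X V"
  have "{x \<in> P \<inter> V. (\<lambda>x\<in>P \<inter> V. \<zero>) x \<noteq> \<zero>} = {}" by auto
  then show ?thesis
    using V locally_constant_const[OF openin_Int[OF P V] zero_closed]
    by (simp only: supported_section_def Diff_empty simp_thms)
qed

text \<open>Near a zero in \<open>P\<close> local constancy gives a neighbourhood of zeros. Near a
  point outside \<open>P\<close> only the closed supports of \<open>s\<close> and \<open>t\<close>
  help, and there \<open>f \<zero> \<zero> = \<zero>\<close> enters.\<close>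

lemma supported_section_op:
  assumes V: "openin X V" and s: "supported_section P V s" and t: "supported_section P V t"
    and f: "\<And>a b. a \<in> carrier R \<Longrightarrow> b \<in> carrier R \<Longrightarrow> f a b \<in> carrier R" "f \<zero> \<zero> = \<zero>"
  shows "supported_section P V (\<lambda>x\<in>P \<inter> V. f (s x) (t x))"
proof -
  let ?h = "\<lambda>x\<in>P \<inter> V. f (s x) (t x)"
  have h: "locally_constant (P \<inter> V) ?h"
    using s t f(1) by (intro locally_constant_op) (auto simp: supported_section_def)
  have "openin X (V - {x \<in> P \<inter> V. ?h x \<noteq> \<zero>})"
  proof (subst openin_subopen, intro ballI)
    fix x assume x: "x \<in> V - {x \<in> P \<inter> V. ?h x \<noteq> \<zero>}"
    show "\<exists>T. openin X T \<and> x \<in> T \<and> T \<subseteq> V - {x \<in> P \<inter> V. ?h x \<noteq> \<zero>}"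
    proof (cases "x \<in> P")
      case True
      then have "x \<in> P \<inter> V" using x by blast
      from locally_constant_nbhd[OF h this] obtain T where
        T: "openin X T" "x \<in> T" "T \<subseteq> P \<inter> V" "\<forall>y\<in>T. ?h y = ?h x" by (elim exE conjE)
      have "?h x = \<zero>" using x True by blast
      then have "?h y = \<zero>" if "y \<in> T" for y using bspec[OF T(4) that] by (rule trans[rotated])
      then have "T \<subseteq> V - {x \<in> P \<inter> V. ?h x \<noteq> \<zero>}" using T(3) by blast
      then show ?thesis using T(1,2) by blast
    next
      case False
      let ?T = "(V - {x \<in> P \<inter> V. s x \<noteq> \<zero>}) \<inter> (V - {x \<in> P \<inter> V. t x \<noteq> \<zero>})"
      have "openin X ?T" using s t unfolding supported_section_def by blast
      moreover have "x \<in> ?T" using x False by blast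
      moreover have "?T \<subseteq> V - {x \<in> P \<inter> V. ?h x \<noteq> \<zero>}" using f(2) by auto
      ultimately show ?thesis by blast
    qed
  qed
  then show ?thesis using h by (simp add: supported_section_def)
qed

lemma supported_section_restrict:
  assumes V: "openin X V" and W: "openin X W" "W \<subseteq> V" and s: "supported_section P V s"
  shows "supported_section P W (restrict s (P \<inter> W))"
proof -
  have "W - {x \<in> P \<inter> W. restrict s (P \<inter> W) x \<noteq> \<zero>} = W \<inter> (V - {x \<in> P \<inter> V. s x \<noteq> \<zero>})"
    using W(2) by auto
  moreover have "openin X (W \<inter> (V - {x \<in> P \<inter> V. s x \<noteq> \<zero>}))"
    using W s unfolding supported_section_def by blast
  moreover have "locally_constant (P \<inter> W) (restrict s (P \<inter> W))"
    using P W s by (intro locally_constant_restrict[of _ "P \<inter> V"]) (auto simp: supported_section_def)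
  ultimately show ?thesis by (simp add: supported_section_def)
qed

lemma module_summand:
  assumes V: "openin X V"
  shows "module R (sect (summand P) V)"
proof -
  have PV: "openin X (P \<inter> V)" using P V by blast
  show ?thesis
    unfolding sect_summand[OF V]
  proof (rule module_restrict_carrier[OF module_K[OF PV]], unfold K_simps)
    show "{s. supported_section P V s} \<subseteq> carrier (sect K (P \<inter> V))"
      unfolding carrier_K[OF PV] by (auto simp: supported_section_def)
    show "(\<lambda>x\<in>P \<inter> V. \<zero>) \<in> {s. supported_section P V s}" using supported_section_zero[OF V] by simp
    show "(\<lambda>z\<in>P \<inter> V. x z \<oplus> y z) \<in> {s. supported_section P V s}"
      if "x \<in> {s. supported_section P V s}" "y \<in> {s. supported_section P V s}" for x y
      using that supported_section_op[OF V, of x y "(\<oplus>)"] by simp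
    show "(\<lambda>z\<in>P \<inter> V. a \<otimes> x z) \<in> {s. supported_section P V s}"
      if "a \<in> carrier R" "x \<in> {s. supported_section P V s}" for a x
      using that supported_section_op[OF V, of x x "\<lambda>c _. a \<otimes> c"] by simp
  qed
qed

text \<open>Sections glue as in the constant sheaf over \<open>P\<close>. The support stays closed
  because the complement of the glued support is the union of the complements over the
  cover.\<close>

lemma sheaf_summand: "sheaf R (summand P)"
  unfolding sheaf_def summand_simps
proof (intro conjI allI impI ballI, goal_cases)
  case (1 U)
  then show ?case by (rule module_summand)
next
  case (2 U V)
  then have U: "openin X U" and V: "openin X V" "V \<subseteq> U" by auto
  show ?case
    unfolding linear_maps_def carrier_summand[OF U] carrier_summand[OF V(1)] summand_simps
    using supported_section_restrict[OF U V] V(2) by (auto simp: restrict_def fun_eq_iff)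
next
  case (3 U s)
  then show ?case
    by (auto simp: carrier_summand supported_section_def locally_constant_def PiE_restrict)
next
  case (4 U V W s)
  then show ?case by (auto simp: restrict_def fun_eq_iff)
next
  case (5 \<U> s)
  then have U: "\<And>U. U \<in> \<U> \<Longrightarrow> openin X U" by blast
  have s: "supported_section P U (s U)" if "U \<in> \<U>" for U
    using 5 that carrier_summand[OF U[OF that]] by blast
  have agree: "s U x = s V x" if "U \<in> \<U>" "V \<in> \<U>" "x \<in> P \<inter> U" "x \<in> P \<inter> V" for U V x
  proof -
    have "restrict (s U) (P \<inter> (U \<inter> V)) = restrict (s V) (P \<inter> (U \<inter> V))" using 5 that(1,2) by blast
    then show ?thesis by (rule restrict_eqD) (use that in blast)
  qed
  have op: "openin X (\<Union>\<U>)" using U by blast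
  have PU: "P \<inter> \<Union>\<U> = (\<Union>U\<in>\<U>. P \<inter> U)" by blast
  have lc: "locally_constant (P \<inter> U) (s U)" if "U \<in> \<U>" for U using s[OF that] by (simp add: supported_section_def)
  obtain t where t: "locally_constant (P \<inter> \<Union>\<U>) t" "\<forall>U\<in>\<U>. restrict t (P \<inter> U) = s U"
    using locally_constant_glue[of \<U> "\<lambda>U. P \<inter> U" s, OF openin_Int[OF P U] lc agree] unfolding PU by auto
  have "\<Union>\<U> - {x \<in> P \<inter> \<Union>\<U>. t x \<noteq> \<zero>} = (\<Union>U\<in>\<U>. U - {x \<in> P \<inter> U. s U x \<noteq> \<zero>})"
  proof -
    have "t x = s U x" if "U \<in> \<U>" "x \<in> P \<inter> U" for U x
    proof -
      have "restrict t (P \<inter> U) = s U" using t(2) that(1) by blast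
      from fun_cong[OF this, of x] show ?thesis using that(2) by simp
    qed
    then show ?thesis by auto
  qed
  moreover have "openin X (\<Union>U\<in>\<U>. U - {x \<in> P \<inter> U. s U x \<noteq> \<zero>})"
    using s by (intro openin_Union) (auto simp: supported_section_def)
  ultimately have ts: "supported_section P (\<Union>\<U>) t" using t(1) by (simp add: supported_section_def)
  show ?case
    unfolding carrier_summand[OF op]
  proof (rule ex1I[of _ t])
    fix t' assume t': "t' \<in> {t. supported_section P (\<Union>\<U>) t} \<and> (\<forall>U\<in>\<U>. restrict t' (P \<inter> U) = s U)"
    show "t' = t"
    proof (rule glue_unique[where I = \<U> and W = "\<lambda>U. P \<inter> U"])
      show "locally_constant (\<Union>U\<in>\<U>. P \<inter> U) t'" "locally_constant (\<Union>U\<in>\<U>. P \<inter> U) t"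
        using t' t(1) unfolding supported_section_def PU by blast+
      show "restrict t' (P \<inter> U) = restrict t (P \<inter> U)" if "U \<in> \<U>" for U
        using bspec[OF t(2) that] t' that by metis
    qed
  qed (use ts t in simp)
qed

end

lemma sheaf_finite_direct_sum:
  assumes F: "\<And>i. i \<in> I \<Longrightarrow> sheaf R (F i)" and b: "\<And>i. i \<in> I \<Longrightarrow> base (F i) = X"
  shows "sheaf R (finite_direct_sum X I F)"
proof -
  let ?D = "finite_direct_sum X I F"
  have sD: "sect ?D U = function_module I (\<lambda>i. sect (F i) U)" for U
    by (simp add: finite_direct_sum_def function_module_def)
  have bD: "base ?D = X" and rD: "res ?D U V s = (\<lambda>i\<in>I. res (F i) U V (s i))" for U V s
    by (simp_all add: finite_direct_sum_def)
  have cD: "carrier (sect ?D U) = (\<Pi>\<^sub>E i\<in>I. carrier (sect (F i) U))" for U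
    by (simp add: sD function_module_def)
  note F' = F[unfolded sheaf_def]
  have mod: "module R (sect (F i) U)" if "i \<in> I" "openin X U" for i U
    using F'[OF that(1)] b[OF that(1)] that(2) by simp
  have lin: "res (F i) U V \<in> linear_maps R (sect (F i) U) (sect (F i) V)"
    if "i \<in> I" "openin X U" "openin X V" "V \<subseteq> U" for i U V
    using F'[OF that(1)] b[OF that(1)] that by simp
  have ident: "res (F i) U U s = s" if "i \<in> I" "openin X U" "s \<in> carrier (sect (F i) U)" for i U s
    using F'[OF that(1)] b[OF that(1)] that by simp
  have comp: "res (F i) V W (res (F i) U V s) = res (F i) U W s"
    if "i \<in> I" "openin X U" "openin X V" "openin X W" "W \<subseteq> V" "V \<subseteq> U" "s \<in> carrier (sect (F i) U)" for i U V W s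
    using F'[OF that(1)] b[OF that(1)] that by simp
  have glue: "\<exists>!t. t \<in> carrier (sect (F i) (\<Union>\<U>)) \<and> (\<forall>U\<in>\<U>. res (F i) (\<Union>\<U>) U t = s U)"
    if "i \<in> I" "\<forall>U\<in>\<U>. openin X U \<and> s U \<in> carrier (sect (F i) U)"
      "\<forall>U\<in>\<U>. \<forall>V\<in>\<U>. res (F i) U (U \<inter> V) (s U) = res (F i) V (U \<inter> V) (s V)" for i \<U> s
    using F'[OF that(1)] b[OF that(1)] that(2,3) by simp
  show ?thesis
    unfolding sheaf_def bD
  proof (intro conjI allI impI ballI, goal_cases)
    case (1 U)
    then show ?case unfolding sD using mod is_cring by (intro module_function_module)
  next
    case (2 U V)
    then have UV: "openin X U" "openin X V" "V \<subseteq> U" by auto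
    note l = lin[OF _ UV, unfolded linear_maps_def]
    show ?case
      unfolding linear_maps_def
    proof (intro CollectI conjI ballI)
      show "res ?D U V \<in> carrier (sect ?D U) \<rightarrow> carrier (sect ?D V)"
        unfolding cD rD
      proof
        fix s assume "s \<in> (\<Pi>\<^sub>E i\<in>I. carrier (sect (F i) U))"
        then have "s i \<in> carrier (sect (F i) U)" if "i \<in> I" for i using that by (rule PiE_mem)
        then have "res (F i) U V (s i) \<in> carrier (sect (F i) V)" if "i \<in> I" for i using l[OF that] that by blast
        then show "(\<lambda>i\<in>I. res (F i) U V (s i)) \<in> (\<Pi>\<^sub>E i\<in>I. carrier (sect (F i) V))" by (intro restrict_PiE_iff[THEN iffD2] ballI)
      qed
      show "res ?D U V (x \<oplus>\<^bsub>sect ?D U\<^esub> y) = res ?D U V x \<oplus>\<^bsub>sect ?D V\<^esub> res ?D U V y"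
        if "x \<in> carrier (sect ?D U)" "y \<in> carrier (sect ?D U)" for x y
      proof -
        have "x i \<in> carrier (sect (F i) U)" "y i \<in> carrier (sect (F i) U)" if "i \<in> I" for i
          using \<open>x \<in> _\<close> \<open>y \<in> _\<close> that unfolding cD by auto
        then show ?thesis unfolding rD sD function_module_def using l by (auto intro!: restrict_ext)
      qed
      show "res ?D U V (a \<odot>\<^bsub>sect ?D U\<^esub> x) = a \<odot>\<^bsub>sect ?D V\<^esub> res ?D U V x"
        if "a \<in> carrier R" "x \<in> carrier (sect ?D U)" for a x
      proof -
        have "x i \<in> carrier (sect (F i) U)" if "i \<in> I" for i
          using \<open>x \<in> _\<close> that unfolding cD by auto
        then show ?thesis unfolding rD sD function_module_def using l that(1) by (auto intro!: restrict_ext)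
      qed
    qed
  next
    case (3 U s)
    then have "(\<lambda>i\<in>I. res (F i) U U (s i)) = (\<lambda>i\<in>I. s i)"
      unfolding cD by (intro restrict_ext ident) auto
    then show ?case using 3 unfolding cD rD by (simp add: PiE_restrict)
  next
    case (4 U V W s)
    then have "s i \<in> carrier (sect (F i) U)" if "i \<in> I" for i using that unfolding cD by auto
    then show ?case using 4 unfolding rD by (auto intro!: restrict_ext comp)
  next
    case (5 \<U> s)
    have sU: "openin X U" "s U \<in> (\<Pi>\<^sub>E i\<in>I. carrier (sect (F i) U))" if "U \<in> \<U>" for U
      using 5 that unfolding cD by auto
    have ag: "res (F i) U (U \<inter> V) (s U i) = res (F i) V (U \<inter> V) (s V i)" if "U \<in> \<U>" "V \<in> \<U>" "i \<in> I" for U V i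
    proof -
      have "(\<lambda>i\<in>I. res (F i) U (U \<inter> V) (s U i)) = (\<lambda>i\<in>I. res (F i) V (U \<inter> V) (s V i))"
        using 5 that unfolding rD by blast
      from fun_cong[OF this, of i] show ?thesis using that by simp
    qed
    have ex: "\<exists>!t. t \<in> carrier (sect (F i) (\<Union>\<U>)) \<and> (\<forall>U\<in>\<U>. res (F i) (\<Union>\<U>) U t = s U i)" if "i \<in> I" for i
      using sU ag that by (intro glue) auto
    define t where "t = (\<lambda>i\<in>I. THE t. t \<in> carrier (sect (F i) (\<Union>\<U>)) \<and> (\<forall>U\<in>\<U>. res (F i) (\<Union>\<U>) U t = s U i))"
    have t: "t i \<in> carrier (sect (F i) (\<Union>\<U>)) \<and> (\<forall>U\<in>\<U>. res (F i) (\<Union>\<U>) U (t i) = s U i)" if "i \<in> I" for i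
      using theI'[OF ex[OF that]] that by (simp add: t_def)
    show ?case
      unfolding cD rD
    proof (rule ex1I[of _ t], intro conjI ballI)
      show "t \<in> (\<Pi>\<^sub>E i\<in>I. carrier (sect (F i) (\<Union>\<U>)))" using t by (auto simp: t_def)
      show "(\<lambda>i\<in>I. res (F i) (\<Union>\<U>) U (t i)) = s U" if U: "U \<in> \<U>" for U
      proof -
        have "(\<lambda>i\<in>I. res (F i) (\<Union>\<U>) U (t i)) = (\<lambda>i\<in>I. s U i)" using t U by (intro restrict_ext) auto
        then show ?thesis using sU(2)[OF U] by (simp add: PiE_restrict)
      qed
    next
      fix t' assume t': "t' \<in> (\<Pi>\<^sub>E i\<in>I. carrier (sect (F i) (\<Union>\<U>))) \<and>
        (\<forall>U\<in>\<U>. (\<lambda>i\<in>I. res (F i) (\<Union>\<U>) U (t' i)) = s U)"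
      show "t' = t"
      proof (rule PiE_ext)
        show "t' \<in> (\<Pi>\<^sub>E i\<in>I. carrier (sect (F i) (\<Union>\<U>)))" using t' by blast
        show "t \<in> (\<Pi>\<^sub>E i\<in>I. carrier (sect (F i) (\<Union>\<U>)))" using t by (auto simp: t_def)
        fix i assume i: "i \<in> I"
        have "res (F i) (\<Union>\<U>) U (t' i) = s U i" if "U \<in> \<U>" for U
        proof -
          have "(\<lambda>i\<in>I. res (F i) (\<Union>\<U>) U (t' i)) = s U" using t' that by blast
          from fun_cong[OF this, of i] show ?thesis using i by simp
        qed
        moreover have "t' i \<in> carrier (sect (F i) (\<Union>\<U>))" using t' i by auto
        ultimately show "t' i = t i" using ex[OF i] t[OF i] by blast
      qed
    qed
  qed
qed

end

section \<open>Stalks of the complex of sheaves and local lifting\<close>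

locale toric_sheaf = toric_fan B N \<Delta> ori + constant_coefficients R "toric_variety N \<Delta>"
  for B N :: "'v::real_vector set" and \<Delta> ori and R :: "'r ring" (structure)
begin

abbreviation "X \<equiv> toric_variety N \<Delta>"

abbreviation "C k \<equiv> cech_sheaf N \<Delta> K k"

lemma R_group: "abelian_group R" by (rule is_abelian_group)

text \<open>The cone is recovered from the charts containing \<open>x\<close>; prime ideals do not
  appear from here on.\<close>

definition point_cone :: "'v chart_point set \<Rightarrow> 'v set" where
  "point_cone x = (SOME \<tau>. \<tau> \<in> \<Delta> \<and> (\<forall>\<sigma>\<in>\<Delta>. x \<in> chart N \<Delta> \<sigma> \<longleftrightarrow> cone_face \<tau> \<sigma>))"

lemma point_cone:
  assumes "openin X U" "x \<in> U"
  shows "point_cone x \<in> \<Delta>" "\<sigma> \<in> \<Delta> \<Longrightarrow> x \<in> chart N \<Delta> \<sigma> \<longleftrightarrow> cone_face (point_cone x) \<sigma>"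
proof -
  have "x \<in> toric_points N \<Delta>"
    using assms openin_subset[OF assms(1)] topspace_toric_variety by blast
  then have "\<exists>\<tau>. \<tau> \<in> \<Delta> \<and> (\<forall>\<sigma>\<in>\<Delta>. x \<in> chart N \<Delta> \<sigma> \<longleftrightarrow> cone_face \<tau> \<sigma>)"
    using toric_point_cone by blast
  from someI_ex[OF this] show "point_cone x \<in> \<Delta>" "\<sigma> \<in> \<Delta> \<Longrightarrow> x \<in> chart N \<Delta> \<sigma> \<longleftrightarrow> cone_face (point_cone x) \<sigma>"
    unfolding point_cone_def by blast+
qed

lemma codim_in: "\<sigma> \<in> cones_codim \<Delta> k \<Longrightarrow> \<sigma> \<in> \<Delta>"
  by (simp add: cones_codim_def)

lemma chart_mono:
  assumes "\<tau> \<in> \<Delta>" "\<sigma> \<in> \<Delta>" "cone_face \<tau> \<sigma>"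
  shows "chart N \<Delta> \<tau> \<subseteq> chart N \<Delta> \<sigma>"
proof
  fix x assume x: "x \<in> chart N \<Delta> \<tau>"
  note pc = point_cone[OF openin_chart[OF assms(1)] x]
  show "x \<in> chart N \<Delta> \<sigma>"
    using x pc(2)[OF assms(1)] pc(2)[OF assms(2)] cone_face_trans_fan[OF pc(1) assms(1,2) _ assms(3)] by blast
qed

lemma C_simps:
  "base (C k) = X" "res (C k) U V s = (\<lambda>\<sigma>\<in>cones_codim \<Delta> k. restrict (s \<sigma>) (chart N \<Delta> \<sigma> \<inter> V))"
  "\<zero>\<^bsub>sect (C k) U\<^esub> = (\<lambda>\<sigma>\<in>cones_codim \<Delta> k. \<lambda>x\<in>chart N \<Delta> \<sigma> \<inter> U. \<zero>)"
  "s \<oplus>\<^bsub>sect (C k) U\<^esub> t = (\<lambda>\<sigma>\<in>cones_codim \<Delta> k. \<lambda>x\<in>chart N \<Delta> \<sigma> \<inter> U. s \<sigma> x \<oplus> t \<sigma> x)"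
  "a \<odot>\<^bsub>sect (C k) U\<^esub> s = (\<lambda>\<sigma>\<in>cones_codim \<Delta> k. \<lambda>x\<in>chart N \<Delta> \<sigma> \<inter> U. a \<otimes> s \<sigma> x)"
  using summand_simps[OF openin_chart[OF codim_in]]
  by (auto simp: cech_sheaf_def finite_direct_sum_def cech_summand_def intro!: restrict_ext)

lemma carrier_C:
  assumes U: "openin X U"
  shows "carrier (sect (C k) U) = (\<Pi>\<^sub>E \<sigma>\<in>cones_codim \<Delta> k. {s. supported_section (chart N \<Delta> \<sigma>) U s})"
  using carrier_summand[OF openin_chart[OF codim_in] U]
  by (auto simp: cech_sheaf_def finite_direct_sum_def cech_summand_def intro!: PiE_cong)

lemma sheaf_C: "sheaf R (C k)"
  unfolding cech_sheaf_def
proof (rule sheaf_finite_direct_sum)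
  fix \<sigma> assume "\<sigma> \<in> cones_codim \<Delta> k"
  then have "openin X (chart N \<Delta> \<sigma>)" by (intro openin_chart codim_in)
  then show "sheaf R (cech_summand N \<Delta> K \<sigma>)" "base (cech_summand N \<Delta> K \<sigma>) = X"
    unfolding cech_summand_def by (rule sheaf_summand, rule summand_simps)
qed

lemma C_component:
  "openin X U \<Longrightarrow> s \<in> carrier (sect (C k) U) \<Longrightarrow> \<sigma> \<in> cones_codim \<Delta> k \<Longrightarrow>
    supported_section (chart N \<Delta> \<sigma>) U (s \<sigma>)"
  using carrier_C by (auto dest: PiE_mem)

text \<open>The stalk at \<open>x\<close> of a section of the degree \<open>k\<close> term, with the value \<open>\<zero>\<close> at the cones whose
  chart does not contain \<open>x\<close>.\<close>

definition stalk_value :: "nat \<Rightarrow> ('v set \<Rightarrow> 'v chart_point set \<Rightarrow> 'r) \<Rightarrow> 'v chart_point set \<Rightarrow> 'v set \<Rightarrow> 'r" where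
  "stalk_value k s x \<sigma> = (if \<sigma> \<in> cones_codim \<Delta> k \<and> x \<in> chart N \<Delta> \<sigma> then s \<sigma> x else \<zero>)"

lemma stalk_value_closed:
  assumes "openin X U" "s \<in> carrier (sect (C k) U)" "x \<in> U"
  shows "stalk_value k s x \<sigma> \<in> carrier R"
  using C_component[OF assms(1,2), of \<sigma>] assms(3) locally_constant_closed
  by (auto simp: stalk_value_def supported_section_def)

lemma supported_stalk_value:
  assumes "openin X U" "s \<in> carrier (sect (C k) U)" "x \<in> U"
  shows "supported R (point_cone x) (stalk_value k s x)"
  unfolding supported_def
proof (intro conjI ballI impI Pi_I stalk_value_closed[OF assms])
  fix \<rho> assume "\<rho> \<in> \<Delta>" "\<not> cone_face (point_cone x) \<rho>"
  then show "stalk_value k s x \<rho> = \<zero>" using point_cone(2)[OF assms(1,3)] by (simp add: stalk_value_def)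
qed

lemma C_ext:
  assumes U: "openin X U" and s: "s \<in> carrier (sect (C k) U)" and t: "t \<in> carrier (sect (C k) U)"
    and eq: "\<And>\<sigma> x. \<sigma> \<in> cones_codim \<Delta> k \<Longrightarrow> x \<in> chart N \<Delta> \<sigma> \<Longrightarrow> x \<in> U \<Longrightarrow> s \<sigma> x = t \<sigma> x"
  shows "s = t"
proof (rule PiE_ext)
  show "s \<in> (\<Pi>\<^sub>E \<sigma>\<in>cones_codim \<Delta> k. {s. supported_section (chart N \<Delta> \<sigma>) U s})"
    "t \<in> (\<Pi>\<^sub>E \<sigma>\<in>cones_codim \<Delta> k. {s. supported_section (chart N \<Delta> \<sigma>) U s})"
    using s t by (simp_all add: carrier_C[OF U])
  fix \<sigma> assume \<sigma>: "\<sigma> \<in> cones_codim \<Delta> k"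
  have "locally_constant (chart N \<Delta> \<sigma> \<inter> U) (s \<sigma>)" "locally_constant (chart N \<Delta> \<sigma> \<inter> U) (t \<sigma>)"
    using C_component[OF U s \<sigma>] C_component[OF U t \<sigma>] by (simp_all add: supported_section_def)
  then show "s \<sigma> = t \<sigma>" by (rule locally_constant_ext) (use eq[OF \<sigma>] in blast)
qed

text \<open>The support does not change under extension, and it is closed in all of
  \<open>V\<close>, hence also in \<open>Q \<inter> V\<close>.\<close>

lemma zero_extension_supported:
  assumes P: "openin X P" and Q: "openin X Q" and PQ: "P \<subseteq> Q" and V: "openin X V" and s: "supported_section P V s"
  shows "extend_section K (P \<inter> V) (Q \<inter> V) s = zero_extension (P \<inter> V) (Q \<inter> V) s"
    and "supported_section Q V (zero_extension (P \<inter> V) (Q \<inter> V) s)"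
proof -
  have lc: "locally_constant (P \<inter> V) s" and supp: "openin X (V - {x \<in> P \<inter> V. s x \<noteq> \<zero>})"
    using s by (simp_all add: supported_section_def)
  have op: "openin X (P \<inter> V)" "openin X (Q \<inter> V)" "P \<inter> V \<subseteq> Q \<inter> V" using P Q V PQ by auto
  have "Q \<inter> V - {x \<in> P \<inter> V. s x \<noteq> \<zero>} = Q \<inter> (V - {x \<in> P \<inter> V. s x \<noteq> \<zero>})" by blast
  then have supp': "openin X (Q \<inter> V - {x \<in> P \<inter> V. s x \<noteq> \<zero>})" using openin_Int[OF Q supp] by simp
  show "extend_section K (P \<inter> V) (Q \<inter> V) s = zero_extension (P \<inter> V) (Q \<inter> V) s"
    by (rule extend_section_eq[OF op lc supp'])
  have "{x \<in> Q \<inter> V. zero_extension (P \<inter> V) (Q \<inter> V) s x \<noteq> \<zero>} = {x \<in> P \<inter> V. s x \<noteq> \<zero>}"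
    using PQ by (auto simp: zero_extension_def)
  then show "supported_section Q V (zero_extension (P \<inter> V) (Q \<inter> V) s)"
    using locally_constant_zero_extension[OF op(1,3) lc supp'] supp by (simp add: supported_section_def)
qed

text \<open>Evaluation at \<open>x\<close> is additive, and an extension by zero evaluates to the
  stalk value, so the differential at \<open>x\<close> becomes the combinatorial boundary.\<close>

lemma differential_component:
  assumes V: "openin X V" and s: "s \<in> carrier (sect (C (Suc k)) V)" and \<sigma>: "\<sigma> \<in> cones_codim \<Delta> k"
  shows "supported_section (chart N \<Delta> \<sigma>) V (cech_differential N \<Delta> ori K (Suc k) V s \<sigma>)"
    and "x \<in> chart N \<Delta> \<sigma> \<Longrightarrow> x \<in> V \<Longrightarrow>
      cech_differential N \<Delta> ori K (Suc k) V s \<sigma> x = cone_boundary R (Suc k) (stalk_value (Suc k) s x) \<sigma>"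
proof -
  let ?Q = "chart N \<Delta> \<sigma>" and ?I = "{\<tau> \<in> cones_codim \<Delta> (Suc k). cone_face \<tau> \<sigma>}"
  let ?M = "sect (summand ?Q) V"
  let ?e = "\<lambda>\<tau>. zero_extension (chart N \<Delta> \<tau> \<inter> V) (?Q \<inter> V) (s \<tau>)"
  have Q: "openin X ?Q" by (rule openin_chart[OF codim_in[OF \<sigma>]])
  have M: "module R ?M" by (rule module_summand[OF Q V])
  interpret M: module R ?M by (rule M)
  have carM: "carrier ?M = {s. supported_section ?Q V s}" by (rule carrier_summand[OF Q V])
  have fin: "finite ?I" using finite_cones_codim by simp
  have ext: "extension_inclusion K (chart N \<Delta> \<tau>) ?Q V (s \<tau>) = ?e \<tau>" "?e \<tau> \<in> carrier ?M" if "\<tau> \<in> ?I" for \<tau>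
    using zero_extension_supported[OF openin_chart[OF codim_in] Q chart_mono[OF codim_in codim_in[OF \<sigma>]] V
        C_component[OF V s]] that
    by (auto simp: extension_inclusion_def carM)
  let ?t = "\<lambda>\<tau>. [incidence_sign ori \<tau> \<sigma>] \<cdot>\<^bsub>?M\<^esub> ?e \<tau>"
  have tM: "?t \<tau> \<in> carrier ?M" if "\<tau> \<in> ?I" for \<tau> using ext(2)[OF that] by (rule M.M.add.int_pow_closed)
  have d: "cech_differential N \<Delta> ori K (Suc k) V s \<sigma> = (\<Oplus>\<^bsub>?M\<^esub>\<tau>\<in>?I. ?t \<tau>)"
    unfolding cech_differential_def cech_summand_def using \<sigma> ext(1) tM
    by (simp, intro M.M.finsum_cong' refl) auto
  have "(\<Oplus>\<^bsub>?M\<^esub>\<tau>\<in>?I. ?t \<tau>) \<in> carrier ?M" using tM by (intro M.M.finsum_closed) auto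
  then show "supported_section ?Q V (cech_differential N \<Delta> ori K (Suc k) V s \<sigma>)" by (simp add: d carM)
  assume x: "x \<in> ?Q" "x \<in> V"
  have hc: "f x \<in> carrier R" if "f \<in> carrier ?M" for f
    using that x locally_constant_closed by (auto simp: carM supported_section_def)
  have ha: "(f \<oplus>\<^bsub>?M\<^esub> g) x = f x \<oplus> g x" for f g using x by (simp add: summand_simps[OF Q])
  have ev: "f \<in> carrier ?M \<Longrightarrow> ([(n::int)] \<cdot>\<^bsub>?M\<^esub> f) x = [n] \<cdot> f x" for n f
    by (rule hom_finsum_int_mult(1)[OF M.abelian_group_axioms R_group, of "\<lambda>f. f x"]; (erule hc | rule ha | assumption))
  have ev2: "finite I \<Longrightarrow> g \<in> I \<rightarrow> carrier ?M \<Longrightarrow> (\<Oplus>\<^bsub>?M\<^esub>i\<in>I. g i) x = (\<Oplus>i\<in>I. g i x)" for g I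
    by (rule hom_finsum_int_mult(2)[OF M.abelian_group_axioms R_group, of "\<lambda>f. f x"]; (erule hc | rule ha | assumption))
  have "(\<Oplus>\<^bsub>?M\<^esub>\<tau>\<in>?I. ?t \<tau>) x = (\<Oplus>\<tau>\<in>?I. (?t \<tau>) x)" using tM by (intro ev2[OF fin]) auto
  also have "\<dots> = (\<Oplus>\<tau>\<in>?I. [incidence_sign ori \<tau> \<sigma>] \<cdot> stalk_value (Suc k) s x \<tau>)"
  proof (intro finsum_cong' refl)
    fix \<tau> assume \<tau>: "\<tau> \<in> ?I"
    have "?e \<tau> x = stalk_value (Suc k) s x \<tau>" using \<tau> x by (simp add: zero_extension_def stalk_value_def)
    then show "(?t \<tau>) x = [incidence_sign ori \<tau> \<sigma>] \<cdot> stalk_value (Suc k) s x \<tau>" using ev[OF ext(2)[OF \<tau>]] by simp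
  qed (use stalk_value_closed[OF V s x(2)] in \<open>auto intro!: add.int_pow_closed\<close>)
  finally show "cech_differential N \<Delta> ori K (Suc k) V s \<sigma> x = cone_boundary R (Suc k) (stalk_value (Suc k) s x) \<sigma>"
    unfolding d cone_boundary_def .
qed

lemma augmentation_value:
  assumes V: "openin X V" and s: "s \<in> carrier (sect (C 0) V)"
  shows "locally_constant V (cech_augmentation N \<Delta> K V s)"
    and "x \<in> V \<Longrightarrow> cech_augmentation N \<Delta> K V s x = (\<Oplus>\<sigma>\<in>cones_codim \<Delta> 0. stalk_value 0 s x \<sigma>)"
proof -
  let ?I = "cones_codim \<Delta> 0" and ?M = "sect K V"
  let ?e = "\<lambda>\<sigma>. zero_extension (chart N \<Delta> \<sigma> \<inter> V) V (s \<sigma>)"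
  interpret M: module R ?M by (rule module_K[OF V])
  \<comment> \<open>The counit is treated as the inclusion into the extension from the whole
    space.\<close>
  have top: "openin X (topspace X)" "topspace X \<inter> V = V" using openin_subset[OF V] by auto
  have ext: "extension_counit K (chart N \<Delta> \<sigma>) V (s \<sigma>) = ?e \<sigma>" "?e \<sigma> \<in> carrier ?M" if "\<sigma> \<in> ?I" for \<sigma>
  proof -
    have P: "openin X (chart N \<Delta> \<sigma>)" by (rule openin_chart[OF codim_in[OF that]])
    note z = zero_extension_supported[OF P top(1) openin_subset[OF P] V C_component[OF V s that], unfolded top(2)]
    show "extension_counit K (chart N \<Delta> \<sigma>) V (s \<sigma>) = ?e \<sigma>" using z(1) by (simp add: extension_counit_def)
    show "?e \<sigma> \<in> carrier ?M" using z(2) unfolding carrier_K[OF V] supported_section_def top(2) by simp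
  qed
  have d: "cech_augmentation N \<Delta> K V s = (\<Oplus>\<^bsub>?M\<^esub>\<sigma>\<in>?I. ?e \<sigma>)"
    unfolding cech_augmentation_def using ext by (intro M.M.finsum_cong' refl) auto
  have "(\<Oplus>\<^bsub>?M\<^esub>\<sigma>\<in>?I. ?e \<sigma>) \<in> carrier ?M" using ext(2) by (intro M.M.finsum_closed) auto
  then show "locally_constant V (cech_augmentation N \<Delta> K V s)" by (simp add: d carrier_K[OF V])
  assume x: "x \<in> V"
  have hc: "f x \<in> carrier R" if "f \<in> carrier ?M" for f
    using that x locally_constant_closed by (auto simp: carrier_K[OF V])
  have ha: "(f \<oplus>\<^bsub>?M\<^esub> g) x = f x \<oplus> g x" for f g using x by (simp add: K_simps)
  have ev: "finite I \<Longrightarrow> g \<in> I \<rightarrow> carrier ?M \<Longrightarrow> (\<Oplus>\<^bsub>?M\<^esub>i\<in>I. g i) x = (\<Oplus>i\<in>I. g i x)" for g I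
    by (rule hom_finsum_int_mult(2)[OF M.abelian_group_axioms R_group, of "\<lambda>f. f x"]; (erule hc | rule ha | assumption))
  have "(\<Oplus>\<^bsub>?M\<^esub>\<sigma>\<in>?I. ?e \<sigma>) x = (\<Oplus>\<sigma>\<in>?I. (?e \<sigma>) x)"
    using ext(2) by (intro ev[OF finite_cones_codim]) auto
  also have "\<dots> = (\<Oplus>\<sigma>\<in>?I. stalk_value 0 s x \<sigma>)"
    using x stalk_value_closed[OF V s x] by (intro finsum_cong' refl) (auto simp: zero_extension_def stalk_value_def)
  finally show "cech_augmentation N \<Delta> K V s x = (\<Oplus>\<sigma>\<in>?I. stalk_value 0 s x \<sigma>)" unfolding d .
qed

lemma differential_closed:
  assumes "openin X V" "s \<in> carrier (sect (C (Suc k)) V)"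
  shows "cech_differential N \<Delta> ori K (Suc k) V s \<in> carrier (sect (C k) V)"
  unfolding carrier_C[OF assms(1)]
  using differential_component(1)[OF assms] by (auto simp: PiE_iff cech_differential_def)

lemma C_closed:
  assumes U: "openin X U"
  shows "s \<in> carrier (sect (C k) U) \<Longrightarrow> t \<in> carrier (sect (C k) U) \<Longrightarrow> s \<oplus>\<^bsub>sect (C k) U\<^esub> t \<in> carrier (sect (C k) U)"
    and "a \<in> carrier R \<Longrightarrow> s \<in> carrier (sect (C k) U) \<Longrightarrow> a \<odot>\<^bsub>sect (C k) U\<^esub> s \<in> carrier (sect (C k) U)"
    and "openin X V \<Longrightarrow> V \<subseteq> U \<Longrightarrow> s \<in> carrier (sect (C k) U) \<Longrightarrow> res (C k) U V s \<in> carrier (sect (C k) V)"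
    and "\<zero>\<^bsub>sect (C k) U\<^esub> \<in> carrier (sect (C k) U)"
proof -
  note sh = sheaf_C[of k, unfolded sheaf_def C_simps(1)]
  interpret S: module R "sect (C k) U" by (rule conjunct1[OF sh, rule_format, OF U])
  show "s \<in> carrier (sect (C k) U) \<Longrightarrow> t \<in> carrier (sect (C k) U) \<Longrightarrow> s \<oplus>\<^bsub>sect (C k) U\<^esub> t \<in> carrier (sect (C k) U)"
    by (rule S.M.a_closed)
  show "a \<in> carrier R \<Longrightarrow> s \<in> carrier (sect (C k) U) \<Longrightarrow> a \<odot>\<^bsub>sect (C k) U\<^esub> s \<in> carrier (sect (C k) U)"
    by (rule S.smult_closed)
  show "\<zero>\<^bsub>sect (C k) U\<^esub> \<in> carrier (sect (C k) U)" by (rule S.M.zero_closed)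
  show "res (C k) U V s \<in> carrier (sect (C k) V)" if "openin X V" "V \<subseteq> U" "s \<in> carrier (sect (C k) U)"
  proof -
    have "res (C k) U V \<in> linear_maps R (sect (C k) U) (sect (C k) V)"
      by (rule conjunct1[OF conjunct2[OF sh], rule_format]) (use U that in simp)
    then show ?thesis using that(3) unfolding linear_maps_def by (elim CollectE conjE funcset_mem)
  qed
qed

lemma stalk_value_add:
  "x \<in> U \<Longrightarrow> \<rho> \<in> cones_codim \<Delta> k \<Longrightarrow>
    stalk_value k (s \<oplus>\<^bsub>sect (C k) U\<^esub> t) x \<rho> = stalk_value k s x \<rho> \<oplus> stalk_value k t x \<rho>"
  by (simp add: stalk_value_def C_simps)

lemma stalk_value_smult:
  "x \<in> U \<Longrightarrow> \<rho> \<in> cones_codim \<Delta> k \<Longrightarrow> a \<in> carrier R \<Longrightarrow>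
    stalk_value k (a \<odot>\<^bsub>sect (C k) U\<^esub> s) x \<rho> = a \<otimes> stalk_value k s x \<rho>"
  by (simp add: stalk_value_def C_simps)

lemma stalk_value_res:
  "x \<in> V \<Longrightarrow> stalk_value k (res (C k) U V s) x = stalk_value k s x"
  by (auto simp: stalk_value_def C_simps)

lemma cone_boundary_add:
  assumes "\<And>\<rho>. a \<rho> \<in> carrier R" "\<And>\<rho>. b \<rho> \<in> carrier R" "\<And>\<rho>. \<rho> \<in> cones_codim \<Delta> k \<Longrightarrow> c \<rho> = a \<rho> \<oplus> b \<rho>"
  shows "cone_boundary R k c \<sigma> = cone_boundary R k a \<sigma> \<oplus> cone_boundary R k b \<sigma>"
proof -
  let ?I = "{\<rho> \<in> cones_codim \<Delta> k. cone_face \<rho> \<sigma>}"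
  have "cone_boundary R k c \<sigma> = (\<Oplus>\<rho>\<in>?I. [incidence_sign ori \<rho> \<sigma>] \<cdot> a \<rho> \<oplus> [incidence_sign ori \<rho> \<sigma>] \<cdot> b \<rho>)"
    unfolding cone_boundary_def using assms
    by (intro finsum_cong' refl) (auto simp: add.int_pow_distrib intro!: add.int_pow_closed)
  also have "\<dots> = cone_boundary R k a \<sigma> \<oplus> cone_boundary R k b \<sigma>"
    unfolding cone_boundary_def using assms by (intro finsum_addf) (auto intro!: add.int_pow_closed)
  finally show ?thesis .
qed

lemma cone_boundary_smult:
  assumes "\<And>\<rho>. a \<rho> \<in> carrier R" "r \<in> carrier R" "\<And>\<rho>. \<rho> \<in> cones_codim \<Delta> k \<Longrightarrow> c \<rho> = r \<otimes> a \<rho>"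
  shows "cone_boundary R k c \<sigma> = r \<otimes> cone_boundary R k a \<sigma>"
  unfolding cone_boundary_def using assms finite_cones_codim
  by (subst finsum_rdistr)
    (auto simp: add_pow_rdistr_int intro!: finsum_cong' add.int_pow_closed)

lemma morphism_differential:
  "sheaf_morphism R (C (Suc k)) (C k) (cech_differential N \<Delta> ori K (Suc k))"
  unfolding sheaf_morphism_def C_simps(1)
proof (intro conjI allI impI ballI refl)
  fix U assume U: "openin X U"
  note cl = C_closed(1,2)[OF U, where k = "Suc k"] and cl' = C_closed(1,2)[OF U, where k = k] and dcl = differential_closed[OF U]
  show "cech_differential N \<Delta> ori K (Suc k) U \<in> linear_maps R (sect (C (Suc k)) U) (sect (C k) U)"
    unfolding linear_maps_def
  proof (intro CollectI conjI ballI)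
    show "cech_differential N \<Delta> ori K (Suc k) U \<in> carrier (sect (C (Suc k)) U) \<rightarrow> carrier (sect (C k) U)"
      using dcl by blast
  next
    fix s t assume s: "s \<in> carrier (sect (C (Suc k)) U)" and t: "t \<in> carrier (sect (C (Suc k)) U)"
    note st = cl(1)[OF s t]
    show "cech_differential N \<Delta> ori K (Suc k) U (s \<oplus>\<^bsub>sect (C (Suc k)) U\<^esub> t) =
      cech_differential N \<Delta> ori K (Suc k) U s \<oplus>\<^bsub>sect (C k) U\<^esub> cech_differential N \<Delta> ori K (Suc k) U t"
    proof (rule C_ext[OF U dcl[OF st] cl'(1)[OF dcl[OF s] dcl[OF t]]])
      fix \<sigma> x assume \<sigma>: "\<sigma> \<in> cones_codim \<Delta> k" and x: "x \<in> chart N \<Delta> \<sigma>" "x \<in> U"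
      have "cone_boundary R (Suc k) (stalk_value (Suc k) (s \<oplus>\<^bsub>sect (C (Suc k)) U\<^esub> t) x) \<sigma> =
        cone_boundary R (Suc k) (stalk_value (Suc k) s x) \<sigma> \<oplus> cone_boundary R (Suc k) (stalk_value (Suc k) t x) \<sigma>"
        by (intro cone_boundary_add stalk_value_add stalk_value_closed[OF U s] stalk_value_closed[OF U t] x(2))
      then show "cech_differential N \<Delta> ori K (Suc k) U (s \<oplus>\<^bsub>sect (C (Suc k)) U\<^esub> t) \<sigma> x =
        (cech_differential N \<Delta> ori K (Suc k) U s \<oplus>\<^bsub>sect (C k) U\<^esub> cech_differential N \<Delta> ori K (Suc k) U t) \<sigma> x"
        using differential_component(2)[OF U st \<sigma> x] differential_component(2)[OF U s \<sigma> x]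
          differential_component(2)[OF U t \<sigma> x] \<sigma> x
        by (simp add: C_simps(4))
    qed
  next
    fix a s assume a: "a \<in> carrier R" and s: "s \<in> carrier (sect (C (Suc k)) U)"
    note as = cl(2)[OF a s]
    show "cech_differential N \<Delta> ori K (Suc k) U (a \<odot>\<^bsub>sect (C (Suc k)) U\<^esub> s) =
      a \<odot>\<^bsub>sect (C k) U\<^esub> cech_differential N \<Delta> ori K (Suc k) U s"
    proof (rule C_ext[OF U dcl[OF as] cl'(2)[OF a dcl[OF s]]])
      fix \<sigma> x assume \<sigma>: "\<sigma> \<in> cones_codim \<Delta> k" and x: "x \<in> chart N \<Delta> \<sigma>" "x \<in> U"
      have "cone_boundary R (Suc k) (stalk_value (Suc k) (a \<odot>\<^bsub>sect (C (Suc k)) U\<^esub> s) x) \<sigma> =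
        a \<otimes> cone_boundary R (Suc k) (stalk_value (Suc k) s x) \<sigma>"
        by (intro cone_boundary_smult stalk_value_smult stalk_value_closed[OF U s] x(2) a)
      then show "cech_differential N \<Delta> ori K (Suc k) U (a \<odot>\<^bsub>sect (C (Suc k)) U\<^esub> s) \<sigma> x =
        (a \<odot>\<^bsub>sect (C k) U\<^esub> cech_differential N \<Delta> ori K (Suc k) U s) \<sigma> x"
        using differential_component(2)[OF U as \<sigma> x] differential_component(2)[OF U s \<sigma> x] \<sigma> x
        by (simp add: C_simps(5))
    qed
  qed
next
  fix U V s assume UV: "openin X U \<and> openin X V \<and> V \<subseteq> U" and s: "s \<in> carrier (sect (C (Suc k)) U)"
  then have U: "openin X U" and V: "openin X V" "V \<subseteq> U" by auto
  have rs: "res (C (Suc k)) U V s \<in> carrier (sect (C (Suc k)) V)" by (rule C_closed(3)[OF U V s])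
  show "cech_differential N \<Delta> ori K (Suc k) V (res (C (Suc k)) U V s) =
    res (C k) U V (cech_differential N \<Delta> ori K (Suc k) U s)"
  proof (rule C_ext[OF V(1) differential_closed[OF V(1) rs] C_closed(3)[OF U V differential_closed[OF U s]]])
    fix \<sigma> x assume \<sigma>: "\<sigma> \<in> cones_codim \<Delta> k" and x: "x \<in> chart N \<Delta> \<sigma>" "x \<in> V"
    have xU: "x \<in> U" using x V by blast
    show "cech_differential N \<Delta> ori K (Suc k) V (res (C (Suc k)) U V s) \<sigma> x =
      res (C k) U V (cech_differential N \<Delta> ori K (Suc k) U s) \<sigma> x"
      using differential_component(2)[OF V(1) rs \<sigma> x] differential_component(2)[OF U s \<sigma> x(1) xU]
        stalk_value_res[OF x(2), of "Suc k" U s] \<sigma> x by (simp add: C_simps(2))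
  qed
qed

lemma morphism_augmentation: "sheaf_morphism R (C 0) K (cech_augmentation N \<Delta> K)"
  unfolding sheaf_morphism_def C_simps(1) K_simps(1,2)
proof (intro conjI allI impI ballI refl)
  fix U assume U: "openin X U"
  note cl = C_closed(1,2)[OF U, where k = 0] and lc = augmentation_value(1)[OF U] and ev = augmentation_value(2)[OF U]
  show "cech_augmentation N \<Delta> K U \<in> linear_maps R (sect (C 0) U) (sect K U)"
    unfolding linear_maps_def carrier_K[OF U]
  proof (intro CollectI conjI ballI)
    show "cech_augmentation N \<Delta> K U \<in> carrier (sect (C 0) U) \<rightarrow> {s. locally_constant U s}" using lc by blast
  next
    fix s t assume s: "s \<in> carrier (sect (C 0) U)" and t: "t \<in> carrier (sect (C 0) U)"
    show "cech_augmentation N \<Delta> K U (s \<oplus>\<^bsub>sect (C 0) U\<^esub> t) =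
      cech_augmentation N \<Delta> K U s \<oplus>\<^bsub>sect K U\<^esub> cech_augmentation N \<Delta> K U t"
      unfolding K_simps
    proof (rule locally_constant_ext[OF lc[OF cl(1)[OF s t]] locally_constant_op[OF lc[OF s] lc[OF t] a_closed]])
      fix x assume x: "x \<in> U"
      have "(\<Oplus>\<sigma>\<in>cones_codim \<Delta> 0. stalk_value 0 (s \<oplus>\<^bsub>sect (C 0) U\<^esub> t) x \<sigma>)
        = (\<Oplus>\<sigma>\<in>cones_codim \<Delta> 0. stalk_value 0 s x \<sigma> \<oplus> stalk_value 0 t x \<sigma>)"
        using stalk_value_closed[OF U s x] stalk_value_closed[OF U t x]
        by (intro finsum_cong' refl) (auto simp: stalk_value_add[OF x])
      also have "\<dots> = (\<Oplus>\<sigma>\<in>cones_codim \<Delta> 0. stalk_value 0 s x \<sigma>) \<oplus> (\<Oplus>\<sigma>\<in>cones_codim \<Delta> 0. stalk_value 0 t x \<sigma>)"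
        using stalk_value_closed[OF U s x] stalk_value_closed[OF U t x] by (intro finsum_addf) auto
      finally show "cech_augmentation N \<Delta> K U (s \<oplus>\<^bsub>sect (C 0) U\<^esub> t) x =
        (\<lambda>x\<in>U. cech_augmentation N \<Delta> K U s x \<oplus> cech_augmentation N \<Delta> K U t x) x"
        using ev[OF cl(1)[OF s t] x] ev[OF s x] ev[OF t x] x by simp
    qed
  next
    fix a s assume a: "a \<in> carrier R" and s: "s \<in> carrier (sect (C 0) U)"
    show "cech_augmentation N \<Delta> K U (a \<odot>\<^bsub>sect (C 0) U\<^esub> s) = a \<odot>\<^bsub>sect K U\<^esub> cech_augmentation N \<Delta> K U s"
      unfolding K_simps
    proof (rule locally_constant_ext[OF lc[OF cl(2)[OF a s]]])
      show "locally_constant U (\<lambda>x\<in>U. a \<otimes> cech_augmentation N \<Delta> K U s x)"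
        using locally_constant_op[OF lc[OF s] lc[OF s], of "\<lambda>c _. a \<otimes> c"] a by simp
      fix x assume x: "x \<in> U"
      have "(\<Oplus>\<sigma>\<in>cones_codim \<Delta> 0. stalk_value 0 (a \<odot>\<^bsub>sect (C 0) U\<^esub> s) x \<sigma>)
        = (\<Oplus>\<sigma>\<in>cones_codim \<Delta> 0. a \<otimes> stalk_value 0 s x \<sigma>)"
        using stalk_value_closed[OF U s x] a
        by (intro finsum_cong' refl) (auto simp: stalk_value_smult[OF x])
      also have "\<dots> = a \<otimes> (\<Oplus>\<sigma>\<in>cones_codim \<Delta> 0. stalk_value 0 s x \<sigma>)"
        using stalk_value_closed[OF U s x] a finite_cones_codim by (intro finsum_rdistr[symmetric]) auto
      finally show "cech_augmentation N \<Delta> K U (a \<odot>\<^bsub>sect (C 0) U\<^esub> s) x =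
        (\<lambda>x\<in>U. a \<otimes> cech_augmentation N \<Delta> K U s x) x"
        using ev[OF cl(2)[OF a s] x] ev[OF s x] x by simp
    qed
  qed
next
  fix U V s assume UV: "openin X U \<and> openin X V \<and> V \<subseteq> U" and s: "s \<in> carrier (sect (C 0) U)"
  then have U: "openin X U" and V: "openin X V" "V \<subseteq> U" by auto
  have rs: "res (C 0) U V s \<in> carrier (sect (C 0) V)" by (rule C_closed(3)[OF U V s])
  show "cech_augmentation N \<Delta> K V (res (C 0) U V s) = restrict (cech_augmentation N \<Delta> K U s) V"
  proof (rule locally_constant_ext[OF augmentation_value(1)[OF V(1) rs]
        locally_constant_restrict[OF V augmentation_value(1)[OF U s]]])
    fix x assume x: "x \<in> V"
    then have xU: "x \<in> U" using V by blast
    show "cech_augmentation N \<Delta> K V (res (C 0) U V s) x = restrict (cech_augmentation N \<Delta> K U s) V x"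
      using augmentation_value(2)[OF V(1) rs x] augmentation_value(2)[OF U s xU] stalk_value_res[OF x, of 0 U s] x
      by simp
  qed
qed

text \<open>At a cone whose chart contains \<open>x\<close> local constancy suffices. At the others
  closedness of the support provides a neighbourhood of \<open>x\<close> on which the component is
  zero. Finitely many cones allow an intersection, which is also shrunk into the chart of
  \<open>point_cone x\<close>.\<close>

lemma stalk_value_nbhd:
  assumes U: "openin X U" and t: "t \<in> carrier (sect (C k) U)" and x: "x \<in> U"
  shows "\<exists>V. openin X V \<and> x \<in> V \<and> V \<subseteq> U \<and> V \<subseteq> chart N \<Delta> (point_cone x) \<and>
    (\<forall>y\<in>V. \<forall>\<sigma>\<in>cones_codim \<Delta> k. stalk_value k t y \<sigma> = stalk_value k t x \<sigma>)"
proof -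
  have one: "\<exists>V. openin X V \<and> x \<in> V \<and> V \<subseteq> U \<and> (\<forall>y\<in>V. stalk_value k t y \<sigma> = stalk_value k t x \<sigma>)"
    if \<sigma>: "\<sigma> \<in> cones_codim \<Delta> k" for \<sigma>
  proof -
    have lc: "locally_constant (chart N \<Delta> \<sigma> \<inter> U) (t \<sigma>)"
      and supp: "openin X (U - {x \<in> chart N \<Delta> \<sigma> \<inter> U. t \<sigma> x \<noteq> \<zero>})"
      using C_component[OF U t \<sigma>] by (simp_all add: supported_section_def)
    show ?thesis
    proof (cases "x \<in> chart N \<Delta> \<sigma>")
      case True
      then have "x \<in> chart N \<Delta> \<sigma> \<inter> U" using x by blast
      from locally_constant_nbhd[OF lc this] obtain V where
        V: "openin X V" "x \<in> V" "V \<subseteq> chart N \<Delta> \<sigma> \<inter> U" "\<forall>y\<in>V. t \<sigma> y = t \<sigma> x" by (elim exE conjE)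
      have "stalk_value k t y \<sigma> = stalk_value k t x \<sigma>" if y: "y \<in> V" for y
      proof -
        have "y \<in> chart N \<Delta> \<sigma>" "t \<sigma> y = t \<sigma> x" using y V(3) bspec[OF V(4) y] by blast+
        then show ?thesis using True by (simp add: stalk_value_def)
      qed
      then show ?thesis using V(1-3) by blast
    next
      case False
      let ?V = "U - {x \<in> chart N \<Delta> \<sigma> \<inter> U. t \<sigma> x \<noteq> \<zero>}"
      have "stalk_value k t y \<sigma> = stalk_value k t x \<sigma>" if "y \<in> ?V" for y
        using that False by (auto simp: stalk_value_def)
      moreover have "x \<in> ?V" using False x by blast
      ultimately show ?thesis using supp by blast
    qed
  qed
  note pc = point_cone[OF U x]
  have xc: "x \<in> chart N \<Delta> (point_cone x)" using pc subset_iff_face[OF pc(1) pc(1)] by blast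
  have "\<exists>V. openin X V \<and> x \<in> V \<and> V \<subseteq> U \<and> V \<subseteq> chart N \<Delta> (point_cone x) \<and>
    (\<forall>y\<in>V. \<forall>\<sigma>\<in>S. stalk_value k t y \<sigma> = stalk_value k t x \<sigma>)"
    if "finite S" "S \<subseteq> cones_codim \<Delta> k" for S
    using that
  proof (induction S rule: finite_induct)
    case empty
    have "openin X (U \<inter> chart N \<Delta> (point_cone x))" using U openin_chart[OF pc(1)] by blast
    then show ?case using x xc by blast
  next
    case (insert \<sigma> S)
    then have \<sigma>: "\<sigma> \<in> cones_codim \<Delta> k" and "S \<subseteq> cones_codim \<Delta> k" by blast+
    from insert.IH[OF this(2)] obtain V where V: "openin X V" "x \<in> V" "V \<subseteq> U" "V \<subseteq> chart N \<Delta> (point_cone x)"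
      "\<forall>y\<in>V. \<forall>\<sigma>\<in>S. stalk_value k t y \<sigma> = stalk_value k t x \<sigma>" by (elim exE conjE)
    from one[OF \<sigma>] obtain W where W: "openin X W" "x \<in> W" "\<forall>y\<in>W. stalk_value k t y \<sigma> = stalk_value k t x \<sigma>"
      by (elim exE conjE)
    have "openin X (V \<inter> W)" using V(1) W(1) by blast
    then show ?case using V(2-5) W(2,3) by (intro exI[of _ "V \<inter> W"]) blast
  qed
  from this[OF finite_cones_codim order_refl] show ?thesis .
qed

text \<open>For a cone of the star the chart contains \<open>V\<close>, so a constant has support
  \<open>V\<close> or empty, both closed in \<open>V\<close>; off the star the value is zero. Thus a
  family supported on the star spreads from a stalk to \<open>V\<close>.\<close>

lemma constant_section:
  fixes k :: nat
  assumes V: "openin X V" "V \<subseteq> chart N \<Delta> \<tau>" and \<tau>: "\<tau> \<in> \<Delta>" and b: "supported R \<tau> b"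
  defines "s \<equiv> \<lambda>\<rho>\<in>cones_codim \<Delta> k. \<lambda>y\<in>chart N \<Delta> \<rho> \<inter> V. b \<rho>"
  shows "s \<in> carrier (sect (C k) V)" "y \<in> V \<Longrightarrow> \<rho> \<in> cones_codim \<Delta> k \<Longrightarrow> stalk_value k s y \<rho> = b \<rho>"
proof -
  have bC: "b \<rho> \<in> carrier R" and b0: "\<not> cone_face \<tau> \<rho> \<Longrightarrow> b \<rho> = \<zero>" if "\<rho> \<in> cones_codim \<Delta> k" for \<rho>
    using b codim_in[OF that] by (auto simp: supported_def)
  have full: "chart N \<Delta> \<rho> \<inter> V = V" if "\<rho> \<in> cones_codim \<Delta> k" "cone_face \<tau> \<rho>" for \<rho>
    using chart_mono[OF \<tau> codim_in[OF that(1)] that(2)] V(2) by blast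
  show "s \<in> carrier (sect (C k) V)"
    unfolding carrier_C[OF V(1)]
  proof (rule PiE_I)
    fix \<rho> assume \<rho>: "\<rho> \<in> cones_codim \<Delta> k"
    have op: "openin X (chart N \<Delta> \<rho> \<inter> V)" using openin_chart[OF codim_in[OF \<rho>]] V(1) by blast
    have "V - {x \<in> chart N \<Delta> \<rho> \<inter> V. s \<rho> x \<noteq> \<zero>} = (if b \<rho> = \<zero> then V else {})"
    proof (cases "b \<rho> = \<zero>")
      case True
      then show ?thesis using \<rho> by (auto simp: s_def)
    next
      case False
      then have "V \<subseteq> chart N \<Delta> \<rho>" using full[OF \<rho>] b0[OF \<rho>] by blast
      then show ?thesis using False \<rho> by (auto simp: s_def)
    qed
    then have "openin X (V - {x \<in> chart N \<Delta> \<rho> \<inter> V. s \<rho> x \<noteq> \<zero>})" using V(1) by simp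
    moreover have "locally_constant (chart N \<Delta> \<rho> \<inter> V) (s \<rho>)"
      using locally_constant_const[OF op bC[OF \<rho>]] \<rho> by (simp add: s_def)
    ultimately show "s \<rho> \<in> {s. supported_section (chart N \<Delta> \<rho>) V s}" by (simp add: supported_section_def)
  qed (simp add: s_def)
  assume y: "y \<in> V" and \<rho>: "\<rho> \<in> cones_codim \<Delta> k"
  show "stalk_value k s y \<rho> = b \<rho>"
  proof (cases "cone_face \<tau> \<rho>")
    case True
    then have "y \<in> chart N \<Delta> \<rho>" using full[OF \<rho>] y by blast
    then show ?thesis using y \<rho> by (simp add: stalk_value_def s_def)
  next
    case False
    then show ?thesis using y \<rho> b0[OF \<rho>] by (simp add: stalk_value_def s_def)
  qed
qed

lemma local_lift:
  assumes U: "openin X U" and t: "t \<in> carrier (sect (C k) U)" and x: "x \<in> U"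
    and b: "supported R (point_cone x) b"
    and lift: "\<forall>\<sigma>\<in>cones_codim \<Delta> k. cone_face (point_cone x) \<sigma> \<longrightarrow> cone_boundary R (Suc k) b \<sigma> = stalk_value k t x \<sigma>"
  shows "\<exists>V. openin X V \<and> x \<in> V \<and> V \<subseteq> U \<and>
    res (C k) U V t \<in> cech_differential N \<Delta> ori K (Suc k) V ` carrier (sect (C (Suc k)) V)"
proof -
  let ?\<tau> = "point_cone x"
  note pc = point_cone[OF U x]
  obtain V where V: "openin X V" "x \<in> V" "V \<subseteq> U" "V \<subseteq> chart N \<Delta> ?\<tau>"
    "\<forall>y\<in>V. \<forall>\<sigma>\<in>cones_codim \<Delta> k. stalk_value k t y \<sigma> = stalk_value k t x \<sigma>"
    using stalk_value_nbhd[OF U t x] by (elim exE conjE)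
  define s where "s = (\<lambda>\<rho>\<in>cones_codim \<Delta> (Suc k). \<lambda>y\<in>chart N \<Delta> \<rho> \<inter> V. b \<rho>)"
  have s: "s \<in> carrier (sect (C (Suc k)) V)"
    and sv: "\<And>y \<rho>. y \<in> V \<Longrightarrow> \<rho> \<in> cones_codim \<Delta> (Suc k) \<Longrightarrow> stalk_value (Suc k) s y \<rho> = b \<rho>"
    unfolding s_def by (fact constant_section[OF V(1,4) pc(1) b])+
  have bC: "b \<rho> \<in> carrier R" and b0: "\<not> cone_face ?\<tau> \<rho> \<Longrightarrow> b \<rho> = \<zero>" if "\<rho> \<in> cones_codim \<Delta> (Suc k)" for \<rho>
    using b codim_in[OF that] by (auto simp: supported_def)
  have "res (C k) U V t = cech_differential N \<Delta> ori K (Suc k) V s"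
  proof (rule C_ext[OF V(1) C_closed(3)[OF U V(1,3) t] differential_closed[OF V(1) s]])
    fix \<sigma> y assume \<sigma>: "\<sigma> \<in> cones_codim \<Delta> k" and y: "y \<in> chart N \<Delta> \<sigma>" "y \<in> V"
    have "res (C k) U V t \<sigma> y = stalk_value k t y \<sigma>" using \<sigma> y by (simp add: C_simps(2) stalk_value_def)
    also have "\<dots> = stalk_value k t x \<sigma>" using V(5) y(2) \<sigma> by blast
    also have "\<dots> = cone_boundary R (Suc k) b \<sigma>"
    proof (cases "cone_face ?\<tau> \<sigma>")
      case True
      then show ?thesis using lift \<sigma> by simp
    next
      \<comment> \<open>A point \<open>y\<close> of \<open>V\<close> may lie in charts that miss
        \<open>x\<close>. There both sides vanish: \<open>t\<close> near \<open>x\<close> by the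
        choice of \<open>V\<close>, and the boundary because no face of \<open>\<sigma>\<close> has
        \<open>point_cone x\<close> as a face.\<close>
      case False
      then have "x \<notin> chart N \<Delta> \<sigma>" using pc(2)[OF codim_in[OF \<sigma>]] by simp
      moreover have "cone_boundary R (Suc k) b \<sigma> = \<zero>"
      proof (rule cone_boundary_zero[OF R_group pc(1)])
        fix \<rho> assume \<rho>: "\<rho> \<in> cones_codim \<Delta> (Suc k)" "cone_face \<rho> \<sigma>"
        then have "\<not> cone_face ?\<tau> \<rho>"
          using False cone_face_trans_fan[OF pc(1) codim_in codim_in[OF \<sigma>]] by blast
        then show "b \<rho> = \<zero>" by (rule b0[OF \<rho>(1)])
      qed
      ultimately show ?thesis by (simp add: stalk_value_def)
    qed
    also have "\<dots> = cone_boundary R (Suc k) (stalk_value (Suc k) s y) \<sigma>"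
      by (rule cone_boundary_cong[OF R_group pc(1)]) (use sv[OF y(2)] bC in auto)
    also have "\<dots> = cech_differential N \<Delta> ori K (Suc k) V s \<sigma> y"
      by (rule differential_component(2)[OF V(1) s \<sigma> y, symmetric])
    finally show "res (C k) U V t \<sigma> y = cech_differential N \<Delta> ori K (Suc k) V s \<sigma> y" .
  qed
  then show ?thesis using V(1-3) s by blast
qed

lemma stalk_value_differential:
  assumes U: "openin X U" and t: "t \<in> carrier (sect (C k) U)" and V: "openin X V" "x \<in> V" "V \<subseteq> U"
    and s: "s \<in> carrier (sect (C (Suc k)) V)" and eq: "res (C k) U V t = cech_differential N \<Delta> ori K (Suc k) V s"
    and \<rho>: "\<rho> \<in> cones_codim \<Delta> k"
  shows "stalk_value k t x \<rho> =
    (if cone_face (point_cone x) \<rho> then cone_boundary R (Suc k) (stalk_value (Suc k) s x) \<rho> else \<zero>)"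
proof (cases "x \<in> chart N \<Delta> \<rho>")
  case True
  have "stalk_value k t x \<rho> = res (C k) U V t \<rho> x" using True V(2) \<rho> by (simp add: stalk_value_def C_simps(2))
  also have "\<dots> = cone_boundary R (Suc k) (stalk_value (Suc k) s x) \<rho>"
    unfolding eq by (rule differential_component(2)[OF V(1) s \<rho> True V(2)])
  finally show ?thesis using True point_cone(2)[OF V(1,2) codim_in[OF \<rho>]] by simp
next
  case False
  then show ?thesis using point_cone(2)[OF V(1,2) codim_in[OF \<rho>]] by (simp add: stalk_value_def)
qed

lemma kernel_differential:
  assumes U: "openin X U" and t: "t \<in> carrier (sect (C (Suc k)) U)"
  shows "cech_differential N \<Delta> ori K (Suc k) U t = \<zero>\<^bsub>sect (C k) U\<^esub> \<longleftrightarrow>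
    (\<forall>x\<in>U. \<forall>\<sigma>\<in>cones_codim \<Delta> k. cone_face (point_cone x) \<sigma> \<longrightarrow>
      cone_boundary R (Suc k) (stalk_value (Suc k) t x) \<sigma> = \<zero>)"
proof
  assume eq: "cech_differential N \<Delta> ori K (Suc k) U t = \<zero>\<^bsub>sect (C k) U\<^esub>"
  show "\<forall>x\<in>U. \<forall>\<sigma>\<in>cones_codim \<Delta> k. cone_face (point_cone x) \<sigma> \<longrightarrow>
      cone_boundary R (Suc k) (stalk_value (Suc k) t x) \<sigma> = \<zero>"
  proof (intro ballI impI)
    fix x \<sigma> assume x: "x \<in> U" and \<sigma>: "\<sigma> \<in> cones_codim \<Delta> k" and f: "cone_face (point_cone x) \<sigma>"
    have xc: "x \<in> chart N \<Delta> \<sigma>" using point_cone(2)[OF U x codim_in[OF \<sigma>]] f by simp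
    show "cone_boundary R (Suc k) (stalk_value (Suc k) t x) \<sigma> = \<zero>"
      using differential_component(2)[OF U t \<sigma> xc x] xc x \<sigma> by (simp add: eq C_simps(3))
  qed
next
  assume z: "\<forall>x\<in>U. \<forall>\<sigma>\<in>cones_codim \<Delta> k. cone_face (point_cone x) \<sigma> \<longrightarrow>
      cone_boundary R (Suc k) (stalk_value (Suc k) t x) \<sigma> = \<zero>"
  show "cech_differential N \<Delta> ori K (Suc k) U t = \<zero>\<^bsub>sect (C k) U\<^esub>"
  proof (rule C_ext[OF U differential_closed[OF U t] C_closed(4)[OF U]])
    fix \<sigma> x assume \<sigma>: "\<sigma> \<in> cones_codim \<Delta> k" and x: "x \<in> chart N \<Delta> \<sigma>" "x \<in> U"
    have "cone_face (point_cone x) \<sigma>" using point_cone(2)[OF U x(2) codim_in[OF \<sigma>]] x(1) by simp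
    then have "cone_boundary R (Suc k) (stalk_value (Suc k) t x) \<sigma> = \<zero>" using z x(2) \<sigma> by blast
    then show "cech_differential N \<Delta> ori K (Suc k) U t \<sigma> x = \<zero>\<^bsub>sect (C k) U\<^esub> \<sigma> x"
      using differential_component(2)[OF U t \<sigma> x] \<sigma> x by (simp add: C_simps(3))
  qed
qed

text \<open>Vanishing of the differential is a condition on stalks at each point of
  \<open>U\<close>, whereas the image only asks for a lift near each point. So both inclusions
  reduce to one stalk and the neighbourhood given by \<open>local_lift\<close>.\<close>

lemma exact_at_degree:
  assumes U: "openin X U"
  shows "image_sections (C (Suc (Suc k))) (C (Suc k)) (cech_differential N \<Delta> ori K (Suc (Suc k))) U =
    kernel_sections (C (Suc k)) (C k) (cech_differential N \<Delta> ori K (Suc k)) U"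
proof (intro subset_antisym subsetI)
  fix t assume "t \<in> image_sections (C (Suc (Suc k))) (C (Suc k)) (cech_differential N \<Delta> ori K (Suc (Suc k))) U"
  then have t: "t \<in> carrier (sect (C (Suc k)) U)"
    and loc: "\<forall>x\<in>U. \<exists>V. openin X V \<and> x \<in> V \<and> V \<subseteq> U \<and>
      res (C (Suc k)) U V t \<in> cech_differential N \<Delta> ori K (Suc (Suc k)) V ` carrier (sect (C (Suc (Suc k))) V)"
    by (simp_all add: image_sections_def C_simps(1))
  have "cone_boundary R (Suc k) (stalk_value (Suc k) t x) \<sigma> = \<zero>"
    if x: "x \<in> U" and \<sigma>: "\<sigma> \<in> cones_codim \<Delta> k" "cone_face (point_cone x) \<sigma>" for x \<sigma>
  proof -
    from bspec[OF loc x] obtain V where V: "openin X V" "x \<in> V" "V \<subseteq> U" and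
      im: "res (C (Suc k)) U V t \<in> cech_differential N \<Delta> ori K (Suc (Suc k)) V ` carrier (sect (C (Suc (Suc k))) V)"
      by (elim exE conjE)
    from im obtain s where eq: "res (C (Suc k)) U V t = cech_differential N \<Delta> ori K (Suc (Suc k)) V s"
      and s: "s \<in> carrier (sect (C (Suc (Suc k))) V)" by (rule imageE)
    note pc = point_cone[OF U x] and sup = supported_stalk_value[OF V(1) s V(2)]
    have "cone_boundary R (Suc k) (stalk_value (Suc k) t x) \<sigma> = cone_boundary R (Suc k)
      (\<lambda>\<rho>. if cone_face (point_cone x) \<rho> then cone_boundary R (Suc (Suc k)) (stalk_value (Suc (Suc k)) s x) \<rho> else \<zero>) \<sigma>"
      by (rule cone_boundary_cong[OF R_group pc(1)])
        (use stalk_value_differential[OF U t V s eq] cone_boundary_closed[OF R_group pc(1) sup] in auto)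
    also have "\<dots> = \<zero>" by (rule cone_boundary_square_zero(1)[OF R_group pc(1) sup \<sigma>])
    finally show ?thesis .
  qed
  then show "t \<in> kernel_sections (C (Suc k)) (C k) (cech_differential N \<Delta> ori K (Suc k)) U"
    unfolding kernel_sections_def using t kernel_differential[OF U t] by blast
next
  fix t assume "t \<in> kernel_sections (C (Suc k)) (C k) (cech_differential N \<Delta> ori K (Suc k)) U"
  then have t: "t \<in> carrier (sect (C (Suc k)) U)"
    and z: "\<forall>x\<in>U. \<forall>\<sigma>\<in>cones_codim \<Delta> k. cone_face (point_cone x) \<sigma> \<longrightarrow>
      cone_boundary R (Suc k) (stalk_value (Suc k) t x) \<sigma> = \<zero>"
    using kernel_differential[OF U] by (auto simp: kernel_sections_def)
  have "\<exists>V. openin X V \<and> x \<in> V \<and> V \<subseteq> U \<and>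
      res (C (Suc k)) U V t \<in> cech_differential N \<Delta> ori K (Suc (Suc k)) V ` carrier (sect (C (Suc (Suc k))) V)"
    if x: "x \<in> U" for x
  proof -
    have "\<exists>b. supported R (point_cone x) b \<and> (\<forall>\<sigma>\<in>cones_codim \<Delta> (Suc k). cone_face (point_cone x) \<sigma> \<longrightarrow>
        cone_boundary R (Suc (Suc k)) b \<sigma> = stalk_value (Suc k) t x \<sigma>)"
      by (rule cone_boundary_exact[OF R_group point_cone(1)[OF U x] supported_stalk_value[OF U t x]])
        (use z x in auto)
    then obtain b where b: "supported R (point_cone x) b" "\<forall>\<sigma>\<in>cones_codim \<Delta> (Suc k). cone_face (point_cone x) \<sigma> \<longrightarrow>
        cone_boundary R (Suc (Suc k)) b \<sigma> = stalk_value (Suc k) t x \<sigma>" by (elim exE conjE)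
    show ?thesis by (rule local_lift[OF U t x b])
  qed
  then show "t \<in> image_sections (C (Suc (Suc k))) (C (Suc k)) (cech_differential N \<Delta> ori K (Suc (Suc k))) U"
    using t by (simp add: image_sections_def C_simps(1))
qed

lemma exact_at_zero:
  assumes U: "openin X U"
  shows "image_sections (C (Suc 0)) (C 0) (cech_differential N \<Delta> ori K (Suc 0)) U =
    kernel_sections (C 0) K (cech_augmentation N \<Delta> K) U"
proof -
  have ker: "cech_augmentation N \<Delta> K U t = \<zero>\<^bsub>sect K U\<^esub> \<longleftrightarrow>
    (\<forall>x\<in>U. (\<Oplus>\<sigma>\<in>cones_codim \<Delta> 0. stalk_value 0 t x \<sigma>) = \<zero>)" if t: "t \<in> carrier (sect (C 0) U)" for t
  proof
    assume eq: "cech_augmentation N \<Delta> K U t = \<zero>\<^bsub>sect K U\<^esub>"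
    show "\<forall>x\<in>U. (\<Oplus>\<sigma>\<in>cones_codim \<Delta> 0. stalk_value 0 t x \<sigma>) = \<zero>"
      using augmentation_value(2)[OF U t] by (simp add: eq K_simps)
  next
    assume z: "\<forall>x\<in>U. (\<Oplus>\<sigma>\<in>cones_codim \<Delta> 0. stalk_value 0 t x \<sigma>) = \<zero>"
    show "cech_augmentation N \<Delta> K U t = \<zero>\<^bsub>sect K U\<^esub>"
      unfolding K_simps
      by (rule locally_constant_ext[OF augmentation_value(1)[OF U t] locally_constant_const[OF U zero_closed]])
        (use augmentation_value(2)[OF U t] z in simp)
  qed
  show ?thesis
  proof (intro subset_antisym subsetI)
    fix t assume "t \<in> image_sections (C (Suc 0)) (C 0) (cech_differential N \<Delta> ori K (Suc 0)) U"
    then have t: "t \<in> carrier (sect (C 0) U)"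
      and loc: "\<forall>x\<in>U. \<exists>V. openin X V \<and> x \<in> V \<and> V \<subseteq> U \<and>
        res (C 0) U V t \<in> cech_differential N \<Delta> ori K (Suc 0) V ` carrier (sect (C (Suc 0)) V)"
      by (simp_all add: image_sections_def C_simps(1))
    have "(\<Oplus>\<sigma>\<in>cones_codim \<Delta> 0. stalk_value 0 t x \<sigma>) = \<zero>" if x: "x \<in> U" for x
    proof -
      from bspec[OF loc x] obtain V where V: "openin X V" "x \<in> V" "V \<subseteq> U" and
        im: "res (C 0) U V t \<in> cech_differential N \<Delta> ori K (Suc 0) V ` carrier (sect (C (Suc 0)) V)"
        by (elim exE conjE)
      from im obtain s where eq: "res (C 0) U V t = cech_differential N \<Delta> ori K (Suc 0) V s"
        and s: "s \<in> carrier (sect (C (Suc 0)) V)" by (rule imageE)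
      note pc = point_cone[OF U x] and sup = supported_stalk_value[OF V(1) s V(2)]
      have "(\<Oplus>\<sigma>\<in>cones_codim \<Delta> 0. stalk_value 0 t x \<sigma>) = (\<Oplus>\<rho>\<in>cones_codim \<Delta> 0.
        if cone_face (point_cone x) \<rho> then cone_boundary R (Suc 0) (stalk_value (Suc 0) s x) \<rho> else \<zero>)"
        by (intro finsum_cong' refl stalk_value_differential[OF U t V s eq])
          (use cone_boundary_closed[OF R_group pc(1) sup] in auto)
      also have "\<dots> = \<zero>" by (rule cone_boundary_square_zero(2)[OF R_group pc(1) sup])
      finally show ?thesis .
    qed
    then show "t \<in> kernel_sections (C 0) K (cech_augmentation N \<Delta> K) U"
      unfolding kernel_sections_def using t ker[OF t] by blast
  next
    fix t assume "t \<in> kernel_sections (C 0) K (cech_augmentation N \<Delta> K) U"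
    then have t: "t \<in> carrier (sect (C 0) U)" and z: "\<forall>x\<in>U. (\<Oplus>\<sigma>\<in>cones_codim \<Delta> 0. stalk_value 0 t x \<sigma>) = \<zero>"
      using ker by (auto simp: kernel_sections_def)
    have "\<exists>V. openin X V \<and> x \<in> V \<and> V \<subseteq> U \<and>
        res (C 0) U V t \<in> cech_differential N \<Delta> ori K (Suc 0) V ` carrier (sect (C (Suc 0)) V)"
      if x: "x \<in> U" for x
    proof -
      have "\<exists>b. supported R (point_cone x) b \<and> (\<forall>\<sigma>\<in>cones_codim \<Delta> 0. cone_face (point_cone x) \<sigma> \<longrightarrow>
          cone_boundary R (Suc 0) b \<sigma> = stalk_value 0 t x \<sigma>)"
        by (rule cone_boundary_exact[OF R_group point_cone(1)[OF U x] supported_stalk_value[OF U t x]])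
          (use z x in auto)
      then obtain b where b: "supported R (point_cone x) b" "\<forall>\<sigma>\<in>cones_codim \<Delta> 0. cone_face (point_cone x) \<sigma> \<longrightarrow>
          cone_boundary R (Suc 0) b \<sigma> = stalk_value 0 t x \<sigma>" by (elim exE conjE)
      show ?thesis by (rule local_lift[OF U t x b])
    qed
    then show "t \<in> image_sections (C (Suc 0)) (C 0) (cech_differential N \<Delta> ori K (Suc 0)) U"
      using t by (simp add: image_sections_def C_simps(1))
  qed
qed

text \<open>On a neighbourhood inside the chart of \<open>point_cone x\<close> the section
  \<open>r\<close> has one value, which is distributed over the full-dimensional cones of the star
  by constant sections.\<close>

lemma augmentation_onto:
  assumes U: "openin X U"
  shows "image_sections (C 0) K (cech_augmentation N \<Delta> K) U = carrier (sect K U)"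
proof (rule subset_antisym)
  show "image_sections (C 0) K (cech_augmentation N \<Delta> K) U \<subseteq> carrier (sect K U)"
    by (auto simp: image_sections_def)
  show "carrier (sect K U) \<subseteq> image_sections (C 0) K (cech_augmentation N \<Delta> K) U"
  proof
    fix r assume r: "r \<in> carrier (sect K U)"
    then have lc: "locally_constant U r" by (simp add: carrier_K[OF U])
    have "\<exists>V. openin X V \<and> x \<in> V \<and> V \<subseteq> U \<and> res K U V r \<in> cech_augmentation N \<Delta> K V ` carrier (sect (C 0) V)"
      if x: "x \<in> U" for x
    proof -
      let ?\<tau> = "point_cone x"
      note pc = point_cone[OF U x]
      have xc: "x \<in> chart N \<Delta> ?\<tau>" using pc subset_iff_face[OF pc(1) pc(1)] by blast
      from locally_constant_nbhd[OF lc x] obtain W where W: "openin X W" "x \<in> W" "W \<subseteq> U" "\<forall>y\<in>W. r y = r x"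
        by (elim exE conjE)
      let ?V = "W \<inter> chart N \<Delta> ?\<tau>"
      have V: "openin X ?V" "?V \<subseteq> chart N \<Delta> ?\<tau>" "?V \<subseteq> U" using W openin_chart[OF pc(1)] by auto
      obtain b where b: "supported R ?\<tau> b" "(\<Oplus>\<sigma>\<in>cones_codim \<Delta> 0. b \<sigma>) = r x"
        using augmentation_surjective[OF R_group pc(1) locally_constant_closed[OF lc x]] by (elim exE conjE)
      define s where "s = (\<lambda>\<rho>\<in>cones_codim \<Delta> 0. \<lambda>y\<in>chart N \<Delta> \<rho> \<inter> ?V. b \<rho>)"
      have s: "s \<in> carrier (sect (C 0) ?V)"
        and sv: "\<And>y \<rho>. y \<in> ?V \<Longrightarrow> \<rho> \<in> cones_codim \<Delta> 0 \<Longrightarrow> stalk_value 0 s y \<rho> = b \<rho>"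
        unfolding s_def by (fact constant_section[OF V(1,2) pc(1) b(1)])+
      have bC: "b \<rho> \<in> carrier R" if "\<rho> \<in> cones_codim \<Delta> 0" for \<rho>
        using b(1) codim_in[OF that] by (auto simp: supported_def)
      have "restrict r ?V = cech_augmentation N \<Delta> K ?V s"
      proof (rule locally_constant_ext[OF locally_constant_restrict[OF V(1,3) lc] augmentation_value(1)[OF V(1) s]])
        fix y assume y: "y \<in> ?V"
        have "cech_augmentation N \<Delta> K ?V s y = (\<Oplus>\<sigma>\<in>cones_codim \<Delta> 0. stalk_value 0 s y \<sigma>)"
          by (rule augmentation_value(2)[OF V(1) s y])
        also have "\<dots> = (\<Oplus>\<sigma>\<in>cones_codim \<Delta> 0. b \<sigma>)"
          using bC by (intro finsum_cong' refl sv[OF y]) auto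
        also have "\<dots> = r y" using b(2) bspec[OF W(4), of y] y by simp
        finally show "restrict r ?V y = cech_augmentation N \<Delta> K ?V s y" using y by simp
      qed
      then show ?thesis using V(1,3) W(2) xc s unfolding K_simps by blast
    qed
    then show "r \<in> image_sections (C 0) K (cech_augmentation N \<Delta> K) U"
      using r by (simp add: image_sections_def K_simps(1))
  qed
qed

theorem cech_resolution:
  "sheaf_resolution R (cech_sheaf N \<Delta> K) (cech_differential N \<Delta> ori K) K (cech_augmentation N \<Delta> K)"
  unfolding sheaf_resolution_def K_simps(1)
proof (intro conjI allI impI sheaf_K sheaf_C morphism_augmentation augmentation_onto)
  fix k :: nat assume "1 \<le> k"
  then obtain l where "k = Suc l" by (cases k) auto
  then show "sheaf_morphism R (C k) (C (k - 1)) (cech_differential N \<Delta> ori K k)"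
    using morphism_differential by simp
next
  fix U assume U: "openin X U"
  show "image_sections (C 1) (C 0) (cech_differential N \<Delta> ori K 1) U =
    kernel_sections (C 0) K (cech_augmentation N \<Delta> K) U"
    using exact_at_zero[OF U] by simp
  fix k :: nat assume "1 \<le> k"
  then obtain l where "k = Suc l" by (cases k) auto
  then show "image_sections (C (k + 1)) (C k) (cech_differential N \<Delta> ori K (k + 1)) U =
    kernel_sections (C k) (C (k - 1)) (cech_differential N \<Delta> ori K k) U"
    using exact_at_degree[OF U, of l] by simp
qed

end

theorem corollary4p18:
  fixes N :: "'v::real_vector set"
    and \<Delta> :: "'v set set"
    and ori :: "'v set \<Rightarrow> 'v list set"
    and R :: "'r ring"
  assumes "full_rank_lattice N"
    and "complete_fan N \<Delta>"
    and "fan_orientation \<Delta> ori"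
    and "cring R"
  defines "R_X \<equiv> constant_sheaf (toric_variety N \<Delta>) R"
  shows "sheaf_resolution R (cech_sheaf N \<Delta> R_X) (cech_differential N \<Delta> ori R_X)
           R_X (cech_augmentation N \<Delta> R_X)"
proof -
  obtain B where B: "finite B" "independent B" "span B = UNIV"
    "N = {\<Sum>b\<in>B. of_int (c b) *\<^sub>R b | c :: 'v \<Rightarrow> int. True}"
    using assms(1) unfolding full_rank_lattice_def by blast
  interpret toric_sheaf B N \<Delta> ori R
    by (intro toric_sheaf.intro toric_fan.intro oriented_fan.intro complete_fan_space.intro finite_dim.intro
        constant_coefficients.intro complete_fan_space_axioms.intro oriented_fan_axioms.intro toric_fan_axioms.intro)
      (fact B assms)+
  show ?thesis unfolding R_X_def by (rule cech_resolution)
qed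

end
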